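(* Let $\Gamma$ be a compact quantum graph with a distinguished vertex $v$, with arbitrary self-adjoint conditions fixed at all vertices other than $v$. For $z$ in the unit circle $S^1=\{z\in\mathbb{C}:|z|=1\}$, let $\mathcal{H}(z)$ be the operator with these conditions at the vertices other than $v$ and with the following condition at $v$: $f$ is continuous at $v$ and $$(z+1)\sum_{e\in\mathcal{E}_v}\frac{df}{dx_e}(v)=-\mathrm{i}\,(z-1)f(v).$$ Then there exist a bounded from below discrete set $\Delta\subset\mathbb{R}$ and a multiple-valued function $\Lambda(z)$ ("dispersion relation"), analytic in a neighborhood of the unit circle $S^1$ and real on $S^1$, such that: (1) For any $z\in S^1$, one has $\sigma(\mathcal{H}(z))=\Lambda(z)\cup\Delta$, where $\sigma(\cdot)$ denotes the spectrum and $\Lambda(z)$ the set of values at $z$. (2) The function $\Lambda$ is irreducible, i.e. any of its branches determines by analytic continuation the whole function $\Lambda$. (3) Each analytic branch of $\Lambda$ is monotonically increasing in the counter-clockwise direction of $S^1$.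
   Context: A compact quantum graph is a metric graph with finitely many vertices and edges, each edge $e$ being a segment of finite positive length, equipped with the operator acting as $-d^2/dx^2+V(x)$ on each edge, where $V\in L_2(\Gamma)$ is real-valued, on functions that belong to $H^2(e)$ on each edge $e$ and satisfy local self-adjoint vertex conditions. Self-adjoint conditions at a vertex $w$ of degree $d_w$ are conditions $A_wF(w)+B_wF'(w)=0$, where $F(w)$ and $F'(w)$ are the column vectors of values and of derivatives of $f$ at $w$ along the incident edges, $A_w,B_w$ are $d_w\times d_w$ complex matrices, $(A_w\ B_w)$ has rank $d_w$ and $A_wB_w^*$ is self-adjoint. $\mathcal{E}_v$ is the set of edges incident to $v$; derivatives $\frac{df}{dx_e}(v)$ are taken away from the vertex and into the edge. The condition at $v$ is the $\delta$-type condition ($f$ continuous at $v$, $\sum_{e\in\mathcal{E}_v}\frac{df}{dx_e}(v)=\alpha f(v)$ with real $\alpha$) extended to include the Dirichlet condition $f(v)=0$ along all incident edges ($\alpha=\infty$): $z=-1$ corresponds to the Dirichlet condition and $z=1$ to the Neumann–Kirchhoff condition $\alpha=0$. *)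

theory Defs
  imports
    "HOL-Analysis.Analysis"
    "Graph_Theory.Digraph"
    "Jordan_Normal_Form.DL_Rank"
    "Jordan_Normal_Form.Schur_Decomposition"
begin

section \<open>Compact metric graphs\<close>

text \<open>
  The underlying graph is a finite directed multigraph; loops and parallel edges are allowed.
  The direction of an arc \<open>e\<close> only fixes the coordinate on the corresponding edge: the edge is the
  segment \<open>[0, len e]\<close>, with \<open>0\<close> at \<open>tail G e\<close> and \<open>len e\<close> at \<open>head G e\<close>.
  A function on the graph is a family of functions indexed by the arcs, of which only the values on
  these segments matter.
\<close>

definition compact_metric_graph :: "('v, 'e) pre_digraph \<Rightarrow> ('e \<Rightarrow> real) \<Rightarrow> bool" where
  "compact_metric_graph G len \<longleftrightarrow> fin_digraph G \<and> (\<forall>e\<in>arcs G. 0 < len e)"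

text \<open>
  Edge ends: \<open>(e, False)\<close> is the end of \<open>e\<close> at its tail, \<open>(e, True)\<close> the end at its head. A loop
  contributes two ends to its vertex, in accordance with the usual convention for the degree.
\<close>

definition ends_at :: "('v, 'e) pre_digraph \<Rightarrow> 'v \<Rightarrow> ('e \<times> bool) set" where
  "ends_at G w = {(e, b). e \<in> arcs G \<and> (if b then head G e else tail G e) = w}"

definition end_value :: "('e \<Rightarrow> real) \<Rightarrow> ('e \<Rightarrow> real \<Rightarrow> complex) \<Rightarrow> 'e \<times> bool \<Rightarrow> complex" where
  "end_value len f p = (case p of (e, b) \<Rightarrow> f e (if b then len e else 0))"

text \<open>Derivative at an edge end, taken away from the vertex and into the edge.\<close>

definition end_deriv :: "('e \<Rightarrow> real) \<Rightarrow> ('e \<Rightarrow> real \<Rightarrow> complex) \<Rightarrow> 'e \<times> bool \<Rightarrow> complex" where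
  "end_deriv len f p = (case p of (e, b) \<Rightarrow>
     if b then - vector_derivative (f e) (at (len e) within {0..len e})
     else vector_derivative (f e) (at 0 within {0..len e}))"

section \<open>Square-integrable functions and the Sobolev space $H^2$\<close>

definition L2_on :: "real \<Rightarrow> (real \<Rightarrow> 'a::real_normed_vector) \<Rightarrow> bool" where
  "L2_on L f \<longleftrightarrow> f \<in> borel_measurable (lebesgue_on {0..L}) \<and>
     integrable (lebesgue_on {0..L}) (\<lambda>x. (norm (f x))\<^sup>2)"

text \<open>
  \<open>H2_derivs L f f1 f2\<close>: \<open>f\<close> is (the \<open>C\<^sup>1\<close> representative of) an element of the Sobolev space
  \<open>H\<^sup>2(0,L)\<close>, \<open>f1\<close> is its first derivative and \<open>f2\<close> is (a representative of) its second
  derivative: \<open>f1\<close> is absolutely continuous with almost everywhere derivative \<open>f2\<close>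
  in \<open>L\<^sub>2(0,L)\<close>.
\<close>

definition H2_derivs ::
  "real \<Rightarrow> (real \<Rightarrow> complex) \<Rightarrow> (real \<Rightarrow> complex) \<Rightarrow> (real \<Rightarrow> complex) \<Rightarrow> bool" where
  "H2_derivs L f f1 f2 \<longleftrightarrow> L2_on L f2 \<and>
     (\<forall>x\<in>{0..L}. (f has_vector_derivative f1 x) (at x within {0..L}) \<and>
                 (f2 has_integral (f1 x - f1 0)) {0..x})"

section \<open>Vertex conditions\<close>

text \<open>
  The list \<open>ps\<close> enumerates the edge ends at \<open>w\<close> and thereby fixes the order of the entries of the
  column vectors \<open>F(w)\<close> and \<open>F'(w)\<close>. The appended columns form the \<open>d \<times> 2d\<close> matrix \<open>(A B)\<close>.
\<close>

definition selfadjoint_condition ::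
  "('v, 'e) pre_digraph \<Rightarrow> 'v \<Rightarrow> ('e \<times> bool) list \<Rightarrow> complex mat \<Rightarrow> complex mat \<Rightarrow> bool" where
  "selfadjoint_condition G w ps A B \<longleftrightarrow>
     distinct ps \<and> set ps = ends_at G w \<and>
     (let d = length ps in
        A \<in> carrier_mat d d \<and> B \<in> carrier_mat d d \<and>
        vec_space.rank d (mat_of_cols d (cols A @ cols B)) = d \<and>
        mat_adjoint (A * mat_adjoint B) = A * mat_adjoint B)"

definition matrix_condition ::
  "('e \<Rightarrow> real) \<Rightarrow> ('e \<times> bool) list \<Rightarrow> complex mat \<Rightarrow> complex mat \<Rightarrow> ('e \<Rightarrow> real \<Rightarrow> complex) \<Rightarrow> bool" where
  "matrix_condition len ps A B f \<longleftrightarrow>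
     A *\<^sub>v vec_of_list (map (end_value len f) ps) + B *\<^sub>v vec_of_list (map (end_deriv len f) ps)
       = 0\<^sub>v (length ps)"

text \<open>In the condition at the distinguished vertex, \<open>c\<close> is the common value \<open>f(v)\<close>.\<close>

definition delta_condition ::
  "('v, 'e) pre_digraph \<Rightarrow> ('e \<Rightarrow> real) \<Rightarrow> 'v \<Rightarrow> complex \<Rightarrow> ('e \<Rightarrow> real \<Rightarrow> complex) \<Rightarrow> bool" where
  "delta_condition G len v z f \<longleftrightarrow>
     (\<exists>c. (\<forall>p\<in>ends_at G v. end_value len f p = c) \<and>
          (z + 1) * (\<Sum>p\<in>ends_at G v. end_deriv len f p) = - \<i> * (z - 1) * c)"

section \<open>The operator and its spectrum\<close>

definition graph_L2 :: "('v, 'e) pre_digraph \<Rightarrow> ('e \<Rightarrow> real) \<Rightarrow> ('e \<Rightarrow> real \<Rightarrow> complex) set" where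
  "graph_L2 G len = {f. \<forall>e\<in>arcs G. L2_on (len e) (f e)}"

definition graph_L2_norm ::
  "('v, 'e) pre_digraph \<Rightarrow> ('e \<Rightarrow> real) \<Rightarrow> ('e \<Rightarrow> real \<Rightarrow> complex) \<Rightarrow> real" where
  "graph_L2_norm G len f =
     sqrt (\<Sum>e\<in>arcs G. LINT x|lebesgue_on {0..len e}. (norm (f e x))\<^sup>2)"

text \<open>
  An unbounded operator in \<open>L\<^sub>2\<close> of the graph is represented by its graph: the set of pairs of a
  function in the domain and a representative of its image. The operator below acts as
  \<open>-d\<^sup>2/dx\<^sup>2 + V\<close> on the functions that are \<open>H\<^sup>2\<close> on every edge and satisfy the vertex
  conditions \<open>bc\<close>.
\<close>

definition schroedinger ::
  "('v, 'e) pre_digraph \<Rightarrow> ('e \<Rightarrow> real) \<Rightarrow> ('e \<Rightarrow> real \<Rightarrow> real) \<Rightarrow> (('e \<Rightarrow> real \<Rightarrow> complex) \<Rightarrow> bool) \<Rightarrow>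
     (('e \<Rightarrow> real \<Rightarrow> complex) \<times> ('e \<Rightarrow> real \<Rightarrow> complex)) set" where
  "schroedinger G len V bc = {(f, u). bc f \<and>
     (\<forall>e\<in>arcs G. \<exists>f1 f2. H2_derivs (len e) (f e) f1 f2 \<and>
        (AE x in lebesgue_on {0..len e}. u e x = - f2 x + complex_of_real (V e x) * f e x))}"

text \<open>
  The resolvent set: those \<open>\<mu>\<close> for which \<open>T - \<mu>\<close> is injective, maps its domain
  onto \<open>L\<^sub>2\<close>, and has a bounded inverse.
\<close>

definition resolvent_set ::
  "('v, 'e) pre_digraph \<Rightarrow> ('e \<Rightarrow> real) \<Rightarrow>
     (('e \<Rightarrow> real \<Rightarrow> complex) \<times> ('e \<Rightarrow> real \<Rightarrow> complex)) set \<Rightarrow> complex set" where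
  "resolvent_set G len T = {\<mu>.
     (\<forall>f. (f, \<lambda>e x. \<mu> * f e x) \<in> T \<longrightarrow>
        (\<forall>e\<in>arcs G. AE x in lebesgue_on {0..len e}. f e x = 0)) \<and>
     (\<forall>g\<in>graph_L2 G len. \<exists>f. (f, \<lambda>e x. \<mu> * f e x + g e x) \<in> T) \<and>
     (\<exists>C. \<forall>(f, u)\<in>T. graph_L2_norm G len f \<le> C * graph_L2_norm G len (\<lambda>e x. u e x - \<mu> * f e x))}"

definition op_spectrum ::
  "('v, 'e) pre_digraph \<Rightarrow> ('e \<Rightarrow> real) \<Rightarrow>
     (('e \<Rightarrow> real \<Rightarrow> complex) \<times> ('e \<Rightarrow> real \<Rightarrow> complex)) set \<Rightarrow> complex set" where
  "op_spectrum G len T = - resolvent_set G len T"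

text \<open>The operator \<open>\<H>(z)\<close>.\<close>

definition hamiltonian ::
  "('v, 'e) pre_digraph \<Rightarrow> ('e \<Rightarrow> real) \<Rightarrow> ('e \<Rightarrow> real \<Rightarrow> real) \<Rightarrow>
     ('v \<Rightarrow> ('e \<times> bool) list) \<Rightarrow> ('v \<Rightarrow> complex mat) \<Rightarrow> ('v \<Rightarrow> complex mat) \<Rightarrow> 'v \<Rightarrow> complex \<Rightarrow>
     (('e \<Rightarrow> real \<Rightarrow> complex) \<times> ('e \<Rightarrow> real \<Rightarrow> complex)) set" where
  "hamiltonian G len V inc A B v z = schroedinger G len V
     (\<lambda>f. delta_condition G len v z f \<and>
          (\<forall>w\<in>verts G - {v}. matrix_condition len (inc w) (A w) (B w) f))"

section \<open>Multiple-valued analytic functions\<close>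

text \<open>
  A multiple-valued function is given by the set of its germs. A germ at \<open>z\<close> is represented by
  pairs \<open>(z, f)\<close> with \<open>f\<close> analytic at \<open>z\<close>; the set contains all representatives of each
  of its germs. The condition on nearby points says that a branch at \<open>z\<close> is also a branch at all
  points close to \<open>z\<close>; how close may depend on the branch.
\<close>

type_synonym mvfun = "(complex \<times> (complex \<Rightarrow> complex)) set"

definition mv_analytic_on :: "complex set \<Rightarrow> mvfun \<Rightarrow> bool" where
  "mv_analytic_on U E \<longleftrightarrow> open U \<and> fst ` E = U \<and>
     (\<forall>(z, f)\<in>E. f analytic_on {z} \<and>
        (\<forall>\<^sub>F w in nhds z. (w, f) \<in> E) \<and>
        (\<forall>g. (\<forall>\<^sub>F w in nhds z. g w = f w) \<longrightarrow> (z, g) \<in> E))"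

definition mv_values :: "mvfun \<Rightarrow> complex \<Rightarrow> complex set" where
  "mv_values E z = {f z |f. (z, f) \<in> E}"

text \<open>\<open>(w, g)\<close> arises from \<open>(z, f)\<close> by analytic continuation along a path in \<open>U\<close>.\<close>

definition analytic_continuation_in ::
  "complex set \<Rightarrow> complex \<Rightarrow> (complex \<Rightarrow> complex) \<Rightarrow> complex \<Rightarrow> (complex \<Rightarrow> complex) \<Rightarrow> bool" where
  "analytic_continuation_in U z f w g \<longleftrightarrow>
     (\<exists>\<gamma> F. path \<gamma> \<and> path_image \<gamma> \<subseteq> U \<and> pathstart \<gamma> = z \<and> pathfinish \<gamma> = w \<and>
        F 0 = f \<and> F 1 = g \<and>
        (\<forall>t\<in>{0..1}. F t analytic_on {\<gamma> t}) \<and>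
        (\<forall>t\<in>{0..1}. \<forall>\<^sub>F s in at t within {0..1}. \<forall>\<^sub>F \<zeta> in nhds (\<gamma> s). F s \<zeta> = F t \<zeta>))"

text \<open>Any germ determines the whole function: continuing it in \<open>U\<close> produces exactly \<open>E\<close>.\<close>

definition mv_irreducible_on :: "complex set \<Rightarrow> mvfun \<Rightarrow> bool" where
  "mv_irreducible_on U E \<longleftrightarrow>
     (\<forall>(z, f)\<in>E. E = {(w, g). analytic_continuation_in U z f w g})"

text \<open>
  \<open>\<phi>\<close> is an analytic branch over the arc \<open>{cis \<theta> | a < \<theta> < b}\<close> of the unit circle, as a function
  of the angle. The arc may wind around the circle more than once.
\<close>

definition circle_branch :: "mvfun \<Rightarrow> real \<Rightarrow> real \<Rightarrow> (real \<Rightarrow> complex) \<Rightarrow> bool" where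
  "circle_branch E a b \<phi> \<longleftrightarrow>
     (\<forall>\<theta>\<in>{a<..<b}. \<exists>f. (cis \<theta>, f) \<in> E \<and> (\<forall>\<^sub>F t in nhds \<theta>. \<phi> t = f (cis t)))"

end

theory Submission
  imports Defs "HOL-Complex_Analysis.Complex_Analysis"
begin

text \<open>
  The solutions on the edges that satisfy all conditions at the vertices \<open>w \<noteq> v\<close> and are continuous at \<open>v\<close>
  depend on \<open>\<mu>\<close> through finitely many entire functions, so that \<open>\<mu> \<in> \<sigma>(\<H>(z))\<close> is equivalent to
  \<open>(z + 1) S \<mu> + \<i> (z - 1) C \<mu> = 0\<close> with entire \<open>S\<close> and \<open>C\<close>, where \<open>S / C\<close> is the Dirichlet-to-Neumann
  function \<open>\<Sum> f' / f\<close> at \<open>v\<close>. Green's formula shows that \<open>S / C\<close> maps the upper and the lower half plane to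
  themselves, and the sesquilinear form of the operator shows that, as \<open>\<mu> \<rightarrow> -\<infinity>\<close>, it is large but \<open>o(\<mu>)\<close>.

  The set \<open>\<Delta>\<close> consists of the common zeros of \<open>S\<close> and \<open>C\<close>; they are real. After dividing these out, the
  equation reads \<open>z = Z \<mu>\<close> with \<open>Z = (\<i> C - S) / (\<i> C + S)\<close>, a Cayley transform of \<open>S / C\<close>. It is unimodular
  exactly on the real line, has nonzero derivative there, and \<open>x \<mapsto> Z x\<close> runs counter-clockwise. Hence \<open>\<Lambda>\<close> is the
  inverse of the single function \<open>Z\<close> on a connected neighbourhood of the real line, which makes it irreducible.
  Every \<open>z\<close> on the circle is attained: otherwise an entire function of Herglotz type would exist; it would
  be linear, which the behaviour of \<open>S / C\<close> at \<open>-\<infinity>\<close> excludes.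
\<close>

section \<open>Sturm--Liouville equations with integrable coefficients\<close>

text \<open>The potential is only square integrable, so first derivatives are merely absolutely
  continuous. The differential equation is therefore kept in integrated form, and integration by
  parts is proved from increments instead of pointwise second derivatives. \<open>S\<close> and
  \<open>C\<close> come from one determinant: only the row of a single edge end at \<open>v\<close>
  depends on the condition at \<open>v\<close>, and expansion along it is linear in the two
  coefficients of that condition. Nothing prevents this determinant from vanishing for every
  \<open>z\<close> at some \<open>\<mu>\<close>, which is the reason for dividing out a common
  entire factor first. Division loses the sign information at real zeros of the factor; it is
  regained by continuity from the two half planes. Two growth statements are needed because the
  omitted value plays two roles: for -1 the Cayley transform is \<open>S / C\<close> itself, so
  sublinearity is required, while for any other value it is a Moebius image of \<open>S / C\<close>
  that stays bounded once \<open>S / C\<close> is large. Largeness comes from a trace inequality at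
  \<open>v\<close>, sublinearity from test functions concentrated at one end of an edge.\<close>

lemma absolutely_integrable_mult_continuous:
  fixes q f :: "real \<Rightarrow> complex"
  assumes "q absolutely_integrable_on {a..b}" "continuous_on {a..b} f"
  shows "(\<lambda>t. q t * f t) absolutely_integrable_on {a..b}"
proof -
  have "(\<lambda>t. f t * q t) absolutely_integrable_on {a..b}"
  proof (rule absolutely_integrable_bounded_measurable_product[OF bilinear_times _ _ _ assms(1)])
    show "f \<in> borel_measurable (lebesgue_on {a..b})"
      using assms(2) by (intro continuous_imp_measurable_on_sets_lebesgue) auto
    show "bounded (f ` {a..b})"
      using assms(2) compact_continuous_image compact_imp_bounded by blast
  qed auto
  then show ?thesis by (simp add: mult.commute)
qed

lemma continuous_on_indefinite_integral:
  fixes h :: "real \<Rightarrow> complex"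
  assumes "h absolutely_integrable_on {0..L}"
  shows "continuous_on {0..L} (\<lambda>x. integral {0..x} h)"
  using assms by (intro indefinite_integral_continuous_1) (auto simp: absolutely_integrable_on_def)

lemma norm_indefinite_integral_le:
  fixes h :: "real \<Rightarrow> complex"
  assumes "h absolutely_integrable_on {0..L}" "x \<in> {0..L}"
  shows "norm (integral {0..x} h) \<le> integral {0..L} (\<lambda>t. norm (h t))"
proof -
  have ab: "h absolutely_integrable_on {0..x}"
    using assms set_integrable_subset[of lebesgue "{0..L}" h "{0..x}"] by auto
  have "norm (integral {0..x} h) \<le> integral {0..x} (\<lambda>t. norm (h t))"
    using ab by (intro integral_norm_bound_integral) (auto simp: absolutely_integrable_on_def)
  also have "\<dots> \<le> integral {0..L} (\<lambda>t. norm (h t))"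
    using assms ab by (intro integral_subset_le) (auto simp: absolutely_integrable_on_def)
  finally show ?thesis .
qed

lemma absolutely_integrable_subset0:
  fixes h :: "real \<Rightarrow> complex"
  assumes "h absolutely_integrable_on {0..L}" "x \<in> {0..L}"
  shows "h absolutely_integrable_on {0..x}"
  using assms set_integrable_subset[of lebesgue "{0..L}" h "{0..x}"] by auto

text \<open>The equation \<open>f'' = q f + k\<close> with data at 0, integrated twice, reads
  \<open>f = f0 + volterra q f\<close>. It contains no derivative, so \<open>q\<close> may be merely
  integrable.\<close>

definition volterra :: "(real \<Rightarrow> complex) \<Rightarrow> (real \<Rightarrow> complex) \<Rightarrow> real \<Rightarrow> complex" where
  "volterra q f x = integral {0..x} (\<lambda>t. integral {0..t} (\<lambda>s. q s * f s))"

lemma continuous_volterra_inner: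
  fixes q f :: "real \<Rightarrow> complex"
  assumes "q absolutely_integrable_on {0..L}" "continuous_on {0..L} f"
  shows "continuous_on {0..L} (\<lambda>t. integral {0..t} (\<lambda>s. q s * f s))"
  by (rule continuous_on_indefinite_integral[OF absolutely_integrable_mult_continuous[OF assms]])

lemma continuous_volterra:
  assumes "q absolutely_integrable_on {0..L}" "continuous_on {0..L} f"
  shows "continuous_on {0..L} (volterra q f)"
  unfolding volterra_def
  by (rule indefinite_integral_continuous_1[OF integrable_continuous_interval[OF continuous_volterra_inner[OF assms]]])

lemma volterra_diff:
  assumes q: "q absolutely_integrable_on {0..L}" and fg: "continuous_on {0..L} f" "continuous_on {0..L} g"
    and x: "x \<in> {0..L}"
  shows "volterra q (\<lambda>t. f t - g t) x = volterra q f x - volterra q g x"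
proof -
  have i: "(\<lambda>s. q s * h s) integrable_on {0..t}" if "t \<in> {0..L}" "continuous_on {0..L} h" for t h
    using absolutely_integrable_subset0[OF absolutely_integrable_mult_continuous[OF q that(2)] that(1)]
    by (simp add: absolutely_integrable_on_def)
  have "volterra q (\<lambda>t. f t - g t) x
      = integral {0..x} (\<lambda>t. integral {0..t} (\<lambda>s. q s * f s) - integral {0..t} (\<lambda>s. q s * g s))"
    unfolding volterra_def using x fg
    by (intro integral_cong) (simp add: right_diff_distrib integral_diff i)
  also have "\<dots> = volterra q f x - volterra q g x"
    unfolding volterra_def using x continuous_volterra_inner[OF q fg(1)] continuous_volterra_inner[OF q fg(2)]
    by (intro integral_diff integrable_continuous_interval) (auto elim: continuous_on_subset)
  finally show ?thesis .
qed

text \<open>The exponential weight makes the Volterra operator a contraction.\<close>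

lemma volterra_weighted_bound:
  assumes q: "q absolutely_integrable_on {0..L}" and f: "continuous_on {0..L} f"
    and M: "integral {0..L} (\<lambda>t. norm (q t)) \<le> M" "0 < M"
    and c: "0 \<le> c" "\<And>t. t \<in> {0..L} \<Longrightarrow> norm (f t) \<le> c * exp (2 * M * t)"
    and x: "x \<in> {0..L}"
  shows "norm (volterra q f x) \<le> c / 2 * exp (2 * M * x)"
proof -
  have qn: "(\<lambda>t. norm (q t)) integrable_on {0..t}" if "t \<in> {0..L}" for t
    using absolutely_integrable_subset0[OF q that] by (simp add: absolutely_integrable_on_def)
  have inner: "norm (integral {0..t} (\<lambda>s. q s * f s)) \<le> M * c * exp (2 * M * t)" if t: "t \<in> {0..L}" for t
  proof -
    have "norm (integral {0..t} (\<lambda>s. q s * f s)) \<le> integral {0..t} (\<lambda>s. norm (q s) * (c * exp (2 * M * t)))"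
    proof (rule integral_norm_bound_integral)
      show "(\<lambda>s. q s * f s) integrable_on {0..t}"
        using absolutely_integrable_subset0[OF absolutely_integrable_mult_continuous[OF q f] t]
        by (simp add: absolutely_integrable_on_def)
      show "(\<lambda>s. norm (q s) * (c * exp (2 * M * t))) integrable_on {0..t}"
        using qn[OF t] by (rule integrable_on_mult_left)
      fix s assume s: "s \<in> {0..t}"
      have "norm (f s) \<le> c * exp (2 * M * s)" using s t c by auto
      also have "\<dots> \<le> c * exp (2 * M * t)" using s c M by (intro mult_left_mono) auto
      finally show "norm (q s * f s) \<le> norm (q s) * (c * exp (2 * M * t))"
        by (simp add: norm_mult mult_left_mono)
    qed
    also have "\<dots> = integral {0..t} (\<lambda>s. norm (q s)) * (c * exp (2 * M * t))" by simp
    also have "\<dots> \<le> M * (c * exp (2 * M * t))"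
    proof (rule mult_right_mono)
      have "integral {0..t} (\<lambda>s. norm (q s)) \<le> integral {0..L} (\<lambda>s. norm (q s))"
        using t qn[of t] qn[of L] by (intro integral_subset_le) auto
      then show "integral {0..t} (\<lambda>s. norm (q s)) \<le> M" using M by simp
    qed (use c in auto)
    finally show ?thesis by (simp add: mult.assoc)
  qed
  \<comment> \<open>The rate \<open>2 * M\<close> of the weight against the factor \<open>M\<close>
    from the inner integral is what gives the contraction factor 1/2.\<close>
  have hi: "((\<lambda>t. M * c * exp (2 * M * t)) has_integral (c / 2 * exp (2 * M * x) - c / 2 * exp (2 * M * 0))) {0..x}"
    using x M by (intro fundamental_theorem_of_calculus)
      (auto intro!: derivative_eq_intros simp flip: has_real_derivative_iff_has_vector_derivative)
  have "norm (volterra q f x) \<le> integral {0..x} (\<lambda>t. M * c * exp (2 * M * t))"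
    unfolding volterra_def
    using x inner continuous_volterra_inner[OF q f]
    by (intro integral_norm_bound_integral integrable_continuous_interval)
      (auto elim: continuous_on_subset intro!: continuous_intros)
  also have "\<dots> = c / 2 * exp (2 * M * x) - c / 2" using integral_unique[OF hi] by simp
  also have "\<dots> \<le> c / 2 * exp (2 * M * x)" using c by simp
  finally show ?thesis .
qed

text \<open>Let \<open>c\<close> be the maximum of the weighted norm of \<open>f\<close>. The
  contraction gives \<open>c \<le> m + c / 2\<close>, so \<open>c \<le> 2 * m\<close>; removing the
  weight costs at most \<open>exp (2 * M * L)\<close>.\<close>

lemma volterra_equation_bound:
  assumes q: "q absolutely_integrable_on {0..L}" and f: "continuous_on {0..L} f" and L: "0 \<le> L"
    and M: "integral {0..L} (\<lambda>t. norm (q t)) \<le> M" "0 < M"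
    and eq: "\<And>x. x \<in> {0..L} \<Longrightarrow> f x = f0 x + volterra q f x"
    and m: "\<And>x. x \<in> {0..L} \<Longrightarrow> norm (f0 x) \<le> m"
    and x: "x \<in> {0..L}"
  shows "norm (f x) \<le> 2 * m * exp (2 * M * L)"
proof -
  have "\<exists>t\<in>{0..L}. \<forall>s\<in>{0..L}. norm (f s) * exp (- (2 * M * s)) \<le> norm (f t) * exp (- (2 * M * t))"
    using L f by (intro continuous_attains_sup) (auto intro!: continuous_intros)
  then obtain t where t: "t \<in> {0..L}"
    "\<And>s. s \<in> {0..L} \<Longrightarrow> norm (f s) * exp (- (2 * M * s)) \<le> norm (f t) * exp (- (2 * M * t))" by blast
  define c where "c = norm (f t) * exp (- (2 * M * t))"
  have c: "norm (f s) \<le> c * exp (2 * M * s)" if "s \<in> {0..L}" for s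
    using t(2)[OF that] by (simp add: c_def exp_minus field_simps)
  have "norm (f t) \<le> norm (f0 t) + norm (volterra q f t)" using eq[OF t(1)] norm_triangle_ineq by metis
  also have "\<dots> \<le> m + c / 2 * exp (2 * M * t)"
    using m[OF t(1)] volterra_weighted_bound[OF q f M _ c t(1)] by (simp add: c_def)
  finally have "norm (f t) * exp (- (2 * M * t)) \<le> (m + c / 2 * exp (2 * M * t)) * exp (- (2 * M * t))"
    by (rule mult_right_mono) simp
  then have "c \<le> m * exp (- (2 * M * t)) + c / 2" by (simp add: c_def algebra_simps exp_minus field_simps)
  moreover have "0 \<le> m" using m[OF t(1)] norm_ge_zero order_trans by blast
  then have "m * exp (- (2 * M * t)) \<le> m" using t M by (intro mult_left_le) auto
  ultimately have "c \<le> 2 * m" by simp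
  have "norm (f x) \<le> c * exp (2 * M * x)" using c x by simp
  also have "\<dots> \<le> 2 * m * exp (2 * M * L)"
    using \<open>c \<le> 2 * m\<close> x M \<open>0 \<le> m\<close> by (intro mult_mono) auto
  finally show ?thesis .
qed

lemma volterra_equation_solvable:
  assumes q: "q absolutely_integrable_on {0..L}" and f0: "continuous_on {0..L} f0" and L: "0 \<le> L"
  obtains f where "continuous_on {0..L} f" "\<And>x. x \<in> {0..L} \<Longrightarrow> f x = f0 x + volterra q f x"
proof -
  define M where "M = integral {0..L} (\<lambda>t. norm (q t)) + 1"
  have M: "integral {0..L} (\<lambda>t. norm (q t)) \<le> M" "0 < M"
    using integral_nonneg[of "\<lambda>t. norm (q t)" "{0..L}"] q by (auto simp: M_def absolutely_integrable_on_def)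
  obtain m where m: "\<And>x. x \<in> {0..L} \<Longrightarrow> norm (f0 x) \<le> m"
    using compact_imp_bounded[OF compact_continuous_image[OF f0 compact_Icc]] unfolding bounded_iff by blast
  have m0: "0 \<le> m" using m[of 0] L norm_ge_zero order_trans by (metis atLeastAtMost_iff order_refl)
  \<comment> \<open>Picard iteration from 0: the first iterate is \<open>f0\<close>, and each
    further difference is halved in the weighted norm. The limit is therefore uniform, and the
    Volterra term passes to the limit by the same weighted estimate.\<close>
  define u where "u = (\<lambda>n. ((\<lambda>f x. f0 x + volterra q f x) ^^ n) (\<lambda>_. 0))"
  have u_Suc: "u (Suc n) x = f0 x + volterra q (u n) x" for n x by (simp add: u_def)
  have cu: "continuous_on {0..L} (u n)" for n
  proof (induction n)
    case (Suc n)
    have "u (Suc n) = (\<lambda>x. f0 x + volterra q (u n) x)" using u_Suc by auto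
    then show ?case using Suc by (auto intro!: continuous_intros f0 continuous_volterra[OF q])
  qed (simp add: u_def)
  have d: "norm (u (Suc n) x - u n x) \<le> m / 2 ^ n * exp (2 * M * x)" if "x \<in> {0..L}" for n x
    using that
  proof (induction n arbitrary: x)
    case 0
    have "volterra q (\<lambda>_. 0) x = 0" by (simp add: volterra_def)
    then have "norm (u (Suc 0) x - u 0 x) = norm (f0 x)" by (simp add: u_def)
    also have "\<dots> \<le> m * 1" using m 0 by simp
    also have "\<dots> \<le> m * exp (2 * M * x)" using m0 M 0 by (intro mult_left_mono) auto
    finally show ?case by simp
  next
    case (Suc n)
    have "u (Suc (Suc n)) x - u (Suc n) x = volterra q (\<lambda>t. u (Suc n) t - u n t) x"
      using volterra_diff[OF q cu[of "Suc n"] cu[of n] Suc.prems] u_Suc by simp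
    also have "norm \<dots> \<le> m / 2 ^ n / 2 * exp (2 * M * x)"
      using Suc m0 by (intro volterra_weighted_bound[OF q _ M]) (auto intro!: continuous_intros cu)
    finally show ?case by (simp add: field_simps)
  qed
  define f where "f = (\<lambda>x. \<Sum>n. u (Suc n) x - u n x)"
  have "uniform_limit {0..L} (\<lambda>n x. \<Sum>i<n. u (Suc i) x - u i x) f sequentially"
    unfolding f_def
  proof (rule Weierstrass_m_test)
    show "norm (u (Suc n) x - u n x) \<le> m * exp (2 * M * L) * (1 / 2) ^ n" if "x \<in> {0..L}" for n x
    proof -
      have "m / 2 ^ n * exp (2 * M * x) \<le> m / 2 ^ n * exp (2 * M * L)"
        using that m0 M by (intro mult_left_mono) auto
      then show ?thesis using d[OF that, of n] by (simp add: field_simps power_one_over)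
    qed
    show "summable (\<lambda>n. m * exp (2 * M * L) * (1 / 2) ^ n)"
      by (intro summable_mult summable_geometric) simp
  qed
  moreover have "(\<lambda>n x. \<Sum>i<n. u (Suc i) x - u i x) = u"
  proof (intro ext)
    fix n x show "(\<Sum>i<n. u (Suc i) x - u i x) = u n x"
      using sum_lessThan_telescope[of "\<lambda>i. u i x" n] by (simp add: u_def)
  qed
  ultimately have ul: "uniform_limit {0..L} u f sequentially" by simp
  have cf: "continuous_on {0..L} f"
    using uniform_limit_theorem[OF _ ul] cu by simp
  show thesis
  proof (rule that[OF cf])
    fix x assume x: "x \<in> {0..L}"
    have "(\<lambda>n. volterra q (u n) x) \<longlonglongrightarrow> volterra q f x"
    proof (rule LIMSEQ_I)
      fix r :: real assume r: "0 < r"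
      define e where "e = r / exp (2 * M * L)"
      have e: "0 < e" using r by (simp add: e_def)
      obtain N where N: "\<And>n t. n \<ge> N \<Longrightarrow> t \<in> {0..L} \<Longrightarrow> norm (u n t - f t) < e"
        using uniform_limitD[OF ul e] unfolding eventually_sequentially dist_norm by blast
      have "norm (volterra q (u n) x - volterra q f x) < r" if n: "n \<ge> N" for n
      proof -
        have "norm (u n t - f t) \<le> e * exp (2 * M * t)" if t: "t \<in> {0..L}" for t
        proof -
          have "e * 1 \<le> e * exp (2 * M * t)" using e t M by (intro mult_left_mono) auto
          then show ?thesis using N[OF n t] by simp
        qed
        then have "norm (volterra q (\<lambda>t. u n t - f t) x) \<le> e / 2 * exp (2 * M * x)"
          using e x by (intro volterra_weighted_bound[OF q _ M]) (auto intro!: continuous_intros cu cf)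
        also have "\<dots> \<le> e / 2 * exp (2 * M * L)" using e M x by (intro mult_left_mono) auto
        also have "\<dots> < r" using r by (simp add: e_def)
        finally show ?thesis using volterra_diff[OF q cu cf x] by simp
      qed
      then show "\<exists>no. \<forall>n\<ge>no. norm (volterra q (u n) x - volterra q f x) < r" by blast
    qed
    then have "(\<lambda>n. u (Suc n) x) \<longlonglongrightarrow> f0 x + volterra q f x"
      unfolding u_Suc by (intro tendsto_intros)
    moreover have "(\<lambda>n. u (Suc n) x) \<longlonglongrightarrow> f x"
      using tendsto_uniform_limitI[OF ul x] by (rule LIMSEQ_Suc)
    ultimately show "f x = f0 x + volterra q f x" by (rule LIMSEQ_unique[symmetric])
  qed
qed

text \<open>The equation \<open>f'' = q f + k\<close> in Caratheodory form: \<open>f1\<close> is the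
  derivative of \<open>f\<close> at every point, one-sided at the two ends, but the equation for
  \<open>f1\<close> is only required after integration, since \<open>q\<close> and \<open>k\<close>
  are only integrable.\<close>

definition solves ::
  "(real \<Rightarrow> complex) \<Rightarrow> (real \<Rightarrow> complex) \<Rightarrow> real \<Rightarrow> (real \<Rightarrow> complex) \<Rightarrow> (real \<Rightarrow> complex) \<Rightarrow> bool" where
  "solves q k L f f1 \<longleftrightarrow>
     (\<forall>x\<in>{0..L}. (f has_vector_derivative f1 x) (at x within {0..L}) \<and>
                 ((\<lambda>t. q t * f t + k t) has_integral (f1 x - f1 0)) {0..x})"

lemma solves_continuous:
  assumes "solves q k L f f1"
  shows "continuous_on {0..L} f"
  using assms unfolding solves_def continuous_on_eq_continuous_within
  using has_vector_derivative_continuous by blast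

lemma solves_continuous_deriv:
  assumes "solves q k L f f1" "0 \<le> L"
  shows "continuous_on {0..L} f1"
proof -
  have h: "((\<lambda>t. q t * f t + k t) has_integral (f1 x - f1 0)) {0..x}" if "x \<in> {0..L}" for x
    using assms that by (simp add: solves_def)
  have "continuous_on {0..L} (\<lambda>x. f1 0 + integral {0..x} (\<lambda>t. q t * f t + k t))"
    using h[of L] assms(2) by (intro continuous_intros indefinite_integral_continuous_1) (auto simp: has_integral_integrable)
  then show ?thesis
    by (rule continuous_on_eq) (simp add: integral_unique[OF h])
qed

lemma solves_deriv_cong:
  assumes "solves q k L f f1" "0 \<le> L" "\<And>t. t \<in> {0..L} \<Longrightarrow> f1 t = h t"
  shows "solves q k L f h"
proof -
  have "f1 0 = h 0" using assms(2,3) by simp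
  then show ?thesis using assms(1,3) unfolding solves_def by metis
qed

lemma solves_linear:
  assumes "solves q k L f f1" "solves q l L g g1"
  shows "solves q (\<lambda>t. a * k t + b * l t) L (\<lambda>x. a * f x + b * g x) (\<lambda>x. a * f1 x + b * g1 x)"
  unfolding solves_def
proof (intro ballI conjI)
  fix x assume x: "x \<in> {0..L}"
  show "((\<lambda>x. a * f x + b * g x) has_vector_derivative a * f1 x + b * g1 x) (at x within {0..L})"
    using assms x unfolding solves_def
    by (intro has_vector_derivative_add has_vector_derivative_mult_right) auto
  have "((\<lambda>t. a * (q t * f t + k t) + b * (q t * g t + l t)) has_integral
      (a * (f1 x - f1 0) + b * (g1 x - g1 0))) {0..x}"
    using assms x unfolding solves_def
    by (intro has_integral_add has_integral_mult_right) auto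
  then show "((\<lambda>t. q t * (a * f t + b * g t) + (a * k t + b * l t)) has_integral
      (a * f1 x + b * g1 x - (a * f1 0 + b * g1 0))) {0..x}"
    by (simp add: algebra_simps)
qed

lemma solves_exists:
  assumes q: "q absolutely_integrable_on {0..L}" and k: "k absolutely_integrable_on {0..L}" and L: "0 \<le> L"
  obtains f f1 where "solves q k L f f1" "f 0 = a" "f1 0 = b"
proof -
  \<comment> \<open>The solution for \<open>q = 0\<close> with the same initial data; it is the
    inhomogeneous term of the Volterra equation.\<close>
  define f0 where "f0 = (\<lambda>x. a + integral {0..x} (\<lambda>t. b + integral {0..t} k))"
  have ck: "continuous_on {0..L} (\<lambda>t. b + integral {0..t} k)"
    by (intro continuous_intros continuous_on_indefinite_integral k)
  have "continuous_on {0..L} f0"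
    unfolding f0_def by (intro continuous_intros indefinite_integral_continuous_1 integrable_continuous_interval ck)
  then obtain f where f: "continuous_on {0..L} f" "\<And>x. x \<in> {0..L} \<Longrightarrow> f x = f0 x + volterra q f x"
    using volterra_equation_solvable[OF q _ L] by blast
  define f1 where "f1 = (\<lambda>x. b + integral {0..x} k + integral {0..x} (\<lambda>s. q s * f s))"
  have c1: "continuous_on {0..L} f1"
    unfolding f1_def by (intro continuous_on_add ck continuous_volterra_inner q f)
  have fx: "f x = a + integral {0..x} f1" if x: "x \<in> {0..L}" for x
  proof -
    have sub: "{0..x} \<subseteq> {0..L}" using x by auto
    have "integral {0..x} f1 = integral {0..x} (\<lambda>t. b + integral {0..t} k) + volterra q f x"
      unfolding f1_def volterra_def
      by (intro integral_add integrable_continuous_interval continuous_on_subset[OF ck sub]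
          continuous_on_subset[OF continuous_volterra_inner[OF q f(1)] sub])
    then show ?thesis using f(2)[OF x] by (simp add: f0_def)
  qed
  show thesis
  proof (rule that)
    show "f 0 = a" using fx[of 0] L by simp
    show "f1 0 = b" by (simp add: f1_def)
    show "solves q k L f f1"
      unfolding solves_def
    proof (intro ballI conjI)
      fix x assume x: "x \<in> {0..L}"
      have "((\<lambda>x. a + integral {0..x} f1) has_vector_derivative (0 + f1 x)) (at x within {0..L})"
        by (intro has_vector_derivative_add has_vector_derivative_const integral_has_vector_derivative c1 x)
      then show "(f has_vector_derivative f1 x) (at x within {0..L})"
        using has_vector_derivative_transform[OF x, of f "\<lambda>x. a + integral {0..x} f1" "f1 x"] fx by simp
      have i: "(\<lambda>t. q t * f t) integrable_on {0..x}" "k integrable_on {0..x}"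
        using absolutely_integrable_subset0[OF absolutely_integrable_mult_continuous[OF q f(1)] x]
          absolutely_integrable_subset0[OF k x] by (simp_all add: absolutely_integrable_on_def)
      show "((\<lambda>t. q t * f t + k t) has_integral (f1 x - f1 0)) {0..x}"
        using has_integral_add[OF integrable_integral[OF i(1)] integrable_integral[OF i(2)]]
        by (simp add: f1_def add.commute)
    qed
  qed
qed

text \<open>The order of the quantifiers is the point: \<open>K\<close> depends on \<open>q\<close>
  and \<open>L\<close> only, so it is uniform in the initial data and in \<open>k\<close>. This
  yields uniqueness, differentiability in the parameter (where \<open>k\<close> varies with
  \<open>\<mu>\<close>) and the bound on the resolvent. For \<open>f\<close> it is the Volterra
  bound with inhomogeneous term at most \<open>(1 + L) * N\<close>; for \<open>f1\<close> the
  equation is integrated once more.\<close>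

lemma solves_bound:
  assumes q: "q absolutely_integrable_on {0..L}" and L: "0 \<le> L"
  shows "\<exists>K\<ge>0. \<forall>k f f1 x. k absolutely_integrable_on {0..L} \<longrightarrow> solves q k L f f1 \<longrightarrow> x \<in> {0..L} \<longrightarrow>
       norm (f x) \<le> K * (norm (f 0) + norm (f1 0) + integral {0..L} (\<lambda>t. norm (k t))) \<and>
       norm (f1 x) \<le> K * (norm (f 0) + norm (f1 0) + integral {0..L} (\<lambda>t. norm (k t)))"
proof -
  define M where "M = integral {0..L} (\<lambda>t. norm (q t)) + 1"
  have M: "integral {0..L} (\<lambda>t. norm (q t)) \<le> M" "0 < M"
    using integral_nonneg[of "\<lambda>t. norm (q t)" "{0..L}"] q by (auto simp: M_def absolutely_integrable_on_def)
  define K1 where "K1 = 2 * (1 + L) * exp (2 * M * L)"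
  define K where "K = K1 + (1 + M * K1)"
  have K1: "0 \<le> K1" using L by (simp add: K1_def)
  have 0: "0 \<le> K" "K1 \<le> K" "1 + M * K1 \<le> K" using K1 M by (auto simp: K_def)
  have main: "norm (f x) \<le> K1 * (norm (f 0) + norm (f1 0) + integral {0..L} (\<lambda>t. norm (k t))) \<and>
     norm (f1 x) \<le> (1 + M * K1) * (norm (f 0) + norm (f1 0) + integral {0..L} (\<lambda>t. norm (k t)))"
    if k: "k absolutely_integrable_on {0..L}" and s: "solves q k L f f1" and x: "x \<in> {0..L}" for k f f1 x
  proof -
    define N where "N = norm (f 0) + norm (f1 0) + integral {0..L} (\<lambda>t. norm (k t))"
    have kn: "0 \<le> integral {0..L} (\<lambda>t. norm (k t))"
      using k by (intro integral_nonneg) (auto simp: absolutely_integrable_on_def)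
    have cf: "continuous_on {0..L} f" using solves_continuous[OF s] .
    have qf: "(\<lambda>t. q t * f t) absolutely_integrable_on {0..L}"
      by (rule absolutely_integrable_mult_continuous[OF q cf])
    define g where "g = (\<lambda>t. f1 0 + integral {0..t} k)"
    have cg: "continuous_on {0..L} g" unfolding g_def
      by (intro continuous_intros continuous_on_indefinite_integral k)
    have f1: "f1 t = g t + integral {0..t} (\<lambda>s. q s * f s)" if t: "t \<in> {0..L}" for t
    proof -
      have i: "(\<lambda>t. q t * f t) integrable_on {0..t}" "k integrable_on {0..t}"
        using absolutely_integrable_subset0[OF qf t]
          absolutely_integrable_subset0[OF k t] by (simp_all add: absolutely_integrable_on_def)
      have "f1 t - f1 0 = integral {0..t} (\<lambda>t. q t * f t + k t)"
        using s t unfolding solves_def by (metis integral_unique)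
      then show ?thesis unfolding integral_add[OF i] g_def by (simp add: diff_eq_eq add_ac)
    qed
    have fx: "f t = (f 0 + integral {0..t} g) + volterra q f t" if t: "t \<in> {0..L}" for t
    proof -
      have sub: "{0..t} \<subseteq> {0..L}" using t by auto
      have "(f1 has_integral (f t - f 0)) {0..t}"
        using t s sub unfolding solves_def
        by (intro fundamental_theorem_of_calculus) (auto intro: has_vector_derivative_within_subset[of _ _ _ "{0..L}"])
      then have "f t - f 0 = integral {0..t} f1" by (simp add: integral_unique)
      also have "\<dots> = integral {0..t} (\<lambda>t. g t + integral {0..t} (\<lambda>s. q s * f s))"
        using sub f1 by (intro integral_cong) auto
      also have "\<dots> = integral {0..t} g + volterra q f t"
        unfolding volterra_def
        by (intro integral_add integrable_continuous_interval continuous_on_subset[OF cg sub]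
            continuous_on_subset[OF continuous_volterra_inner[OF q cf] sub])
      finally show ?thesis by (simp add: diff_eq_eq add_ac)
    qed
    have gb: "norm (g t) \<le> N" if "t \<in> {0..L}" for t
      using norm_triangle_ineq[of "f1 0" "integral {0..t} k"] norm_indefinite_integral_le[OF k that] norm_ge_zero[of "f 0"]
      unfolding g_def N_def by linarith
    have bnd: "norm (f 0 + integral {0..t} g) \<le> (1 + L) * N" if t: "t \<in> {0..L}" for t
    proof -
      have "norm (integral {0..t} g) \<le> integral {0..t} (\<lambda>_. N)"
        using t gb by (intro integral_norm_bound_integral integrable_continuous_interval)
          (auto intro: continuous_on_subset[OF cg])
      also have "\<dots> \<le> L * N" using t kn by (auto intro!: mult_right_mono simp: N_def)
      finally have "norm (integral {0..t} g) \<le> L * N" .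
      moreover have "norm (f 0) \<le> N" using kn by (simp add: N_def)
      ultimately show ?thesis using norm_triangle_ineq[of "f 0" "integral {0..t} g"] by (simp add: algebra_simps)
    qed
    have fb: "norm (f t) \<le> K1 * N" if "t \<in> {0..L}" for t
      using volterra_equation_bound[OF q cf L M fx bnd that] by (simp add: K1_def mult_ac)
    have "norm (integral {0..x} (\<lambda>s. q s * f s)) \<le> integral {0..L} (\<lambda>s. norm (q s * f s))"
      by (rule norm_indefinite_integral_le[OF qf x])
    also have "\<dots> \<le> integral {0..L} (\<lambda>s. norm (q s) * (K1 * N))"
      using qf q fb by (intro integral_le integrable_on_mult_left)
        (auto simp: absolutely_integrable_on_def norm_mult mult_left_mono)
    also have "\<dots> = integral {0..L} (\<lambda>s. norm (q s)) * (K1 * N)" by simp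
    also have "\<dots> \<le> M * (K1 * N)" using M K1 kn by (intro mult_right_mono) (auto simp: N_def)
    finally have "norm (f1 x) \<le> N + M * (K1 * N)"
      using f1[OF x] gb[OF x] norm_triangle_ineq[of "g x" "integral {0..x} (\<lambda>s. q s * f s)"] by simp
    then show ?thesis using fb[OF x] by (simp add: N_def algebra_simps)
  qed
  have nn: "0 \<le> norm (f 0) + norm (f1 0) + integral {0..L} (\<lambda>t. norm (k t))"
    if "k absolutely_integrable_on {0..L}" for k f f1 :: "real \<Rightarrow> complex"
    using that integral_nonneg[of "\<lambda>t. norm (k t)" "{0..L}"] by (auto simp: absolutely_integrable_on_def)
  show ?thesis
  proof (intro exI[of _ K] conjI 0(1) allI impI)
    fix k f f1 x assume a: "k absolutely_integrable_on {0..L}" "solves q k L f f1" "x \<in> {0..L}"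
    show "norm (f x) \<le> K * (norm (f 0) + norm (f1 0) + integral {0..L} (\<lambda>t. norm (k t)))"
      using main[OF a] mult_right_mono[OF 0(2) nn[OF a(1), of f f1]] by linarith
    show "norm (f1 x) \<le> K * (norm (f 0) + norm (f1 0) + integral {0..L} (\<lambda>t. norm (k t)))"
      using main[OF a] mult_right_mono[OF 0(3) nn[OF a(1), of f f1]] by linarith
  qed
qed

lemma solves_unique:
  assumes q: "q absolutely_integrable_on {0..L}" and k: "k absolutely_integrable_on {0..L}" and L: "0 \<le> L"
    and fg: "solves q k L f f1" "solves q k L g g1" "f 0 = g 0" "f1 0 = g1 0" and x: "x \<in> {0..L}"
  shows "f x = g x" "f1 x = g1 x"
proof -
  obtain K where K: "\<forall>k f f1 x. k absolutely_integrable_on {0..L} \<longrightarrow> solves q k L f f1 \<longrightarrow> x \<in> {0..L} \<longrightarrow>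
       norm (f x) \<le> K * (norm (f 0) + norm (f1 0) + integral {0..L} (\<lambda>t. norm (k t))) \<and>
       norm (f1 x) \<le> K * (norm (f 0) + norm (f1 0) + integral {0..L} (\<lambda>t. norm (k t)))"
    using solves_bound[OF q L] by blast
  have s: "solves q (\<lambda>_. 0) L (\<lambda>x. f x - g x) (\<lambda>x. f1 x - g1 x)"
    using solves_linear[OF fg(1,2), of 1 "-1"] by simp
  have z: "(\<lambda>_. 0::complex) absolutely_integrable_on {0..L}" by simp
  show "f x = g x" "f1 x = g1 x" using K[rule_format, OF z s x] fg(3,4) by simp_all
qed

text \<open>The solution with fixed initial data is holomorphic in \<open>\<mu>\<close>: the difference quotient minus the
  solution of the formally differentiated equation solves an initial value problem with right-hand side
  \<open>f\<^sub>\<mu>\<^sub>0 - f\<^sub>\<mu>\<close>, which is \<open>O(\<mu> - \<mu>\<^sub>0)\<close> by the a priori bound.\<close>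

lemma solves_holomorphic:
  fixes Q :: "real \<Rightarrow> complex"
  assumes Q: "Q absolutely_integrable_on {0..L}" and L: "0 \<le> L"
    and s: "\<And>\<mu>. solves (\<lambda>t. Q t - \<mu>) (\<lambda>_. 0) L (f \<mu>) (f1 \<mu>)"
    and init: "\<And>\<mu>. f \<mu> 0 = a" "\<And>\<mu>. f1 \<mu> 0 = b"
    and x: "x \<in> {0..L}"
  shows "(\<lambda>\<mu>. f \<mu> x) holomorphic_on UNIV" "(\<lambda>\<mu>. f1 \<mu> x) holomorphic_on UNIV"
proof -
  have "(\<lambda>\<mu>. f \<mu> x) field_differentiable (at \<mu>0) \<and> (\<lambda>\<mu>. f1 \<mu> x) field_differentiable (at \<mu>0)" for \<mu>0
  proof -
    have q: "(\<lambda>t. Q t - \<mu>0) absolutely_integrable_on {0..L}"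
      using Q by (intro set_integral_diff) (auto intro!: absolutely_integrable_continuous_real)
    obtain K where K0: "0 \<le> K" and K: "\<forall>k f f1 x. k absolutely_integrable_on {0..L} \<longrightarrow> solves (\<lambda>t. Q t - \<mu>0) k L f f1 \<longrightarrow> x \<in> {0..L} \<longrightarrow>
       norm (f x) \<le> K * (norm (f 0) + norm (f1 0) + integral {0..L} (\<lambda>t. norm (k t))) \<and>
       norm (f1 x) \<le> K * (norm (f 0) + norm (f1 0) + integral {0..L} (\<lambda>t. norm (k t)))"
      using solves_bound[OF q L] by blast
    have cf: "continuous_on {0..L} (f \<mu>)" for \<mu> using solves_continuous[OF s] .
    have af: "f \<mu> absolutely_integrable_on {0..L}" for \<mu> using absolutely_integrable_continuous_real[OF cf] .
    obtain m where m: "\<And>x. x \<in> {0..L} \<Longrightarrow> norm (f \<mu>0 x) \<le> m"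
      using compact_imp_bounded[OF compact_continuous_image[OF cf compact_Icc]] unfolding bounded_iff by blast
    have m0: "0 \<le> m" using m[of 0] L norm_ge_zero order_trans by (metis atLeastAtMost_iff order_refl)
    \<comment> \<open>\<open>w\<close> solves the equation differentiated in \<open>\<mu>\<close> at
      \<open>\<mu>0\<close>. Its data are zero because the initial data do not depend on
      \<open>\<mu>\<close>. It is the candidate for the derivative.\<close>
    obtain w w1 where w: "solves (\<lambda>t. Q t - \<mu>0) (\<lambda>t. - f \<mu>0 t) L w w1" "w 0 = 0" "w1 0 = 0"
      using solves_exists[OF q absolutely_integrable_continuous_real[OF continuous_on_minus[OF cf]] L]
      by blast
    have intb: "integral {0..L} (\<lambda>t. norm (h t)) \<le> L * c" 
      if "continuous_on {0..L} h" "\<And>t. t \<in> {0..L} \<Longrightarrow> norm (h t) \<le> c" for h :: "real \<Rightarrow> complex" and c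
    proof -
      have "integral {0..L} (\<lambda>t. norm (h t)) \<le> integral {0..L} (\<lambda>_. c)"
        using that by (intro integral_le integrable_continuous_interval) (auto intro: continuous_intros)
      then show ?thesis using L by simp
    qed
    have d: "solves (\<lambda>t. Q t - \<mu>0) (\<lambda>t. (\<mu>0 - \<mu>) * f \<mu> t) L (\<lambda>t. f \<mu> t - f \<mu>0 t) (\<lambda>t. f1 \<mu> t - f1 \<mu>0 t)" for \<mu>
    proof -
      have "solves (\<lambda>t. Q t - \<mu>0) (\<lambda>t. (\<mu>0 - \<mu>) * f \<mu> t) L (f \<mu>) (f1 \<mu>)"
        using s[of \<mu>] unfolding solves_def by (simp add: algebra_simps)
      from solves_linear[OF this s[of \<mu>0], of 1 "-1"] show ?thesis by simp
    qed
    have ad: "(\<lambda>t. (\<mu>0 - \<mu>) * f \<mu> t) absolutely_integrable_on {0..L}" for \<mu>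
      by (intro absolutely_integrable_continuous_real continuous_intros cf)
    \<comment> \<open>\<open>f \<mu>\<close> occurs on both sides of the estimate for
      \<open>f \<mu> - f \<mu>0\<close>. At a maximum point \<open>r\<close> of its norm, the
      restriction on \<open>\<mu>\<close> makes its contribution at most half of that norm, so it
      can be absorbed.\<close>
    have fmu: "norm (f \<mu> t) \<le> 2 * m" if mu: "norm (\<mu> - \<mu>0) * (K * L) \<le> 1 / 2" and t: "t \<in> {0..L}" for \<mu> t
    proof -
      obtain r where r: "r \<in> {0..L}" "\<And>t. t \<in> {0..L} \<Longrightarrow> norm (f \<mu> t) \<le> norm (f \<mu> r)"
        using continuous_attains_sup[of "{0..L}" "\<lambda>t. norm (f \<mu> t)"] L continuous_on_norm[OF cf[of \<mu>]]
        by auto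
      have "norm (f \<mu> r - f \<mu>0 r) \<le> K * integral {0..L} (\<lambda>t. norm ((\<mu>0 - \<mu>) * f \<mu> t))"
        using K[rule_format, OF ad d r(1), of \<mu>] init by simp
      also have "\<dots> \<le> K * (L * (norm (\<mu> - \<mu>0) * norm (f \<mu> r)))"
        using K0 r by (intro mult_left_mono intb continuous_intros cf)
          (auto simp: norm_mult norm_minus_commute intro: mult_left_mono)
      also have "\<dots> = norm (\<mu> - \<mu>0) * (K * L) * norm (f \<mu> r)" by (simp add: mult_ac)
      also have "\<dots> \<le> 1 / 2 * norm (f \<mu> r)" using mu by (intro mult_right_mono) auto
      finally have "norm (f \<mu> r) \<le> 2 * m"
        using m[OF r(1)] norm_triangle_ineq2[of "f \<mu> r" "f \<mu>0 r"] by simp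
      then show ?thesis using r(2)[OF t] by simp
    qed
    have dmu: "norm (f \<mu> t - f \<mu>0 t) \<le> K * L * 2 * m * norm (\<mu> - \<mu>0)"
      if mu: "norm (\<mu> - \<mu>0) * (K * L) \<le> 1 / 2" and t: "t \<in> {0..L}" for \<mu> t
    proof -
      have "norm (f \<mu> t - f \<mu>0 t) \<le> K * integral {0..L} (\<lambda>t. norm ((\<mu>0 - \<mu>) * f \<mu> t))"
        using K[rule_format, OF ad d t, of \<mu>] init by simp
      also have "\<dots> \<le> K * (L * (norm (\<mu> - \<mu>0) * (2 * m)))"
        using K0 fmu[OF mu] by (intro mult_left_mono intb continuous_intros cf)
          (auto simp: norm_mult norm_minus_commute intro: mult_left_mono)
      finally show ?thesis by (simp add: mult_ac)
    qed
    have r: "solves (\<lambda>t. Q t - \<mu>0) (\<lambda>t. f \<mu>0 t - f \<mu> t) L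
         (\<lambda>t. (f \<mu> t - f \<mu>0 t) / (\<mu> - \<mu>0) - w t) (\<lambda>t. (f1 \<mu> t - f1 \<mu>0 t) / (\<mu> - \<mu>0) - w1 t)"
      if "\<mu> \<noteq> \<mu>0" for \<mu>
    proof -
      have "1 / (\<mu> - \<mu>0) * ((\<mu>0 - \<mu>) * y) = - y" for y
      proof -
        have "\<mu> - \<mu>0 \<noteq> 0" using that by simp
        moreover have "(\<mu>0 - \<mu>) * y = (\<mu> - \<mu>0) * (- y)" by (simp add: algebra_simps)
        ultimately show ?thesis by simp
      qed
      with solves_linear[OF d[of \<mu>] w(1), of "1 / (\<mu> - \<mu>0)" "-1"]
      show ?thesis by (simp only: mult_minus1 minus_minus uminus_add_conv_diff add_uminus_conv_diff mult_1 times_divide_eq_left)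
    qed
    have ar: "(\<lambda>t. f \<mu>0 t - f \<mu> t) absolutely_integrable_on {0..L}" for \<mu>
      by (intro absolutely_integrable_continuous_real continuous_intros cf)
    define c where "c = K * (L * (K * L * 2 * m))"
    have est: "norm ((f \<mu> x - f \<mu>0 x) / (\<mu> - \<mu>0) - w x) \<le> c * norm (\<mu> - \<mu>0) \<and>
               norm ((f1 \<mu> x - f1 \<mu>0 x) / (\<mu> - \<mu>0) - w1 x) \<le> c * norm (\<mu> - \<mu>0)"
      if mu: "norm (\<mu> - \<mu>0) * (K * L) \<le> 1 / 2" "\<mu> \<noteq> \<mu>0" for \<mu>
    proof -
      have "K * integral {0..L} (\<lambda>t. norm (f \<mu>0 t - f \<mu> t)) \<le> K * (L * (K * L * 2 * m * norm (\<mu> - \<mu>0)))"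
        using K0 dmu[OF mu(1)] by (intro mult_left_mono intb continuous_intros cf) (auto simp: norm_minus_commute)
      also have "\<dots> = c * norm (\<mu> - \<mu>0)" by (simp add: c_def)
      finally have le: "K * integral {0..L} (\<lambda>t. norm (f \<mu>0 t - f \<mu> t)) \<le> c * norm (\<mu> - \<mu>0)" .
      have "norm ((f \<mu> x - f \<mu>0 x) / (\<mu> - \<mu>0) - w x) \<le> K * integral {0..L} (\<lambda>t. norm (f \<mu>0 t - f \<mu> t))"
        using K[rule_format, OF ar r[OF mu(2)] x] by (simp only: w init diff_self div_0 norm_zero add_0)
      moreover have "norm ((f1 \<mu> x - f1 \<mu>0 x) / (\<mu> - \<mu>0) - w1 x) \<le> K * integral {0..L} (\<lambda>t. norm (f \<mu>0 t - f \<mu> t))"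
        using K[rule_format, OF ar r[OF mu(2)] x] by (simp only: w init diff_self div_0 norm_zero add_0)
      ultimately show ?thesis by (intro conjI order_trans[OF _ le])
    qed
    have ev: "\<forall>\<^sub>F \<mu> in at \<mu>0. norm (\<mu> - \<mu>0) * (K * L) \<le> 1 / 2"
    proof -
      have "((\<lambda>\<mu>. norm (\<mu> - \<mu>0) * (K * L)) \<longlongrightarrow> norm (\<mu>0 - \<mu>0) * (K * L)) (at \<mu>0)"
        by (rule isContD) (intro continuous_intros)
      then have "\<forall>\<^sub>F \<mu> in at \<mu>0. norm (\<mu> - \<mu>0) * (K * L) < 1 / 2" by (rule order_tendstoD) simp
      then show ?thesis by eventually_elim simp
    qed
    have lim: "((\<lambda>\<mu>. c * norm (\<mu> - \<mu>0)) \<longlongrightarrow> 0) (at \<mu>0)"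
    proof -
      have "((\<lambda>\<mu>. c * norm (\<mu> - \<mu>0)) \<longlongrightarrow> c * norm (\<mu>0 - \<mu>0)) (at \<mu>0)"
        by (rule isContD) (intro continuous_intros)
      then show ?thesis by simp
    qed
    have ev': "\<forall>\<^sub>F \<mu> in at \<mu>0. norm (\<mu> - \<mu>0) * (K * L) \<le> 1 / 2 \<and> \<mu> \<noteq> \<mu>0"
      using ev by (intro eventually_conj eventually_neq_at_within)
    have "\<forall>\<^sub>F \<mu> in at \<mu>0. norm ((f \<mu> x - f \<mu>0 x) / (\<mu> - \<mu>0) - w x) \<le> c * norm (\<mu> - \<mu>0)"
      using ev' by (rule eventually_mono) (rule conjunct1[OF est], auto)
    from Lim_null_comparison[OF this lim]
    have "((\<lambda>\<mu>. (f \<mu> x - f \<mu>0 x) / (\<mu> - \<mu>0)) \<longlongrightarrow> w x) (at \<mu>0)" by (rule iffD2[OF Lim_null])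
    moreover have "\<forall>\<^sub>F \<mu> in at \<mu>0. norm ((f1 \<mu> x - f1 \<mu>0 x) / (\<mu> - \<mu>0) - w1 x) \<le> c * norm (\<mu> - \<mu>0)"
      using ev' by (rule eventually_mono) (rule conjunct2[OF est], auto)
    from Lim_null_comparison[OF this lim]
    have "((\<lambda>\<mu>. (f1 \<mu> x - f1 \<mu>0 x) / (\<mu> - \<mu>0)) \<longlongrightarrow> w1 x) (at \<mu>0)" by (rule iffD2[OF Lim_null])
    ultimately show ?thesis
      unfolding field_differentiable_def has_field_derivative_iff by blast
  qed
  then show "(\<lambda>\<mu>. f \<mu> x) holomorphic_on UNIV" "(\<lambda>\<mu>. f1 \<mu> x) holomorphic_on UNIV"
    unfolding holomorphic_on_def by auto
qed

section \<open>Integration by parts and a trace inequality on a segment\<close>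

lemma eq_if_small_increments:
  fixes F :: "real \<Rightarrow> complex" and m :: "real \<Rightarrow> real"
  assumes L: "0 \<le> L"
    and inc: "\<forall>e>0. \<exists>d>0. \<forall>x y. 0 \<le> x \<longrightarrow> x \<le> y \<longrightarrow> y \<le> L \<longrightarrow> y - x < d \<longrightarrow>
      norm (F y - F x) \<le> e * (m y - m x)"
  shows "F L = F 0"
proof -
  \<comment> \<open>Over a partition of mesh below \<open>d\<close> both sides telescope. The
    resulting bound is linear in \<open>e\<close>, which may tend to 0. This replaces the
    almost-everywhere derivative of an absolutely continuous function.\<close>
  have bound: "norm (F L - F 0) \<le> e * (m L - m 0)" if e: "0 < e" for e
  proof -
    obtain d where d: "0 < d" "\<And>x y. 0 \<le> x \<Longrightarrow> x \<le> y \<Longrightarrow> y \<le> L \<Longrightarrow> y - x < d \<Longrightarrow>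
      norm (F y - F x) \<le> e * (m y - m x)" using inc e by blast
    obtain n :: nat where n: "L / d < real n" using reals_Archimedean2 by blast
    have n0: "0 < real n" using n L d by (metis divide_nonneg_pos le_less_trans)
    define p where "p = (\<lambda>i::nat. real i * (L / real n))"
    have p: "0 \<le> p i" "p i \<le> p (Suc i)" "p (Suc i) \<le> L" "p (Suc i) - p i < d" if "i < n" for i
    proof -
      have step: "p (Suc i) = p i + L / real n" by (simp add: p_def algebra_simps add_divide_distrib)
      show "0 \<le> p i" "p i \<le> p (Suc i)" using L unfolding step by (auto simp: p_def)
      have "real (Suc i) * (L / real n) \<le> real n * (L / real n)"
        using that L by (intro mult_right_mono) auto
      then show "p (Suc i) \<le> L" using n0 by (simp add: p_def)
      have "L / real n < d" using n d n0 by (simp add: field_simps)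
      then show "p (Suc i) - p i < d" by (simp add: step)
    qed
    have "F L - F 0 = (\<Sum>i<n. F (p (Suc i)) - F (p i))"
      using n0 sum_lessThan_telescope[of "\<lambda>i. F (p i)" n] by (simp add: p_def)
    also have "norm \<dots> \<le> (\<Sum>i<n. e * (m (p (Suc i)) - m (p i)))"
      by (rule sum_norm_le) (use d(2) p in auto)
    also have "\<dots> = e * (m (p n) - m (p 0))"
      using sum_lessThan_telescope[of "\<lambda>i. m (p i)" n] by (simp flip: sum_distrib_left)
    also have "\<dots> = e * (m L - m 0)" using n0 by (simp add: p_def)
    finally show ?thesis .
  qed
  have "((\<lambda>e. e * (m L - m 0)) \<longlongrightarrow> 0 * (m L - m 0)) (at_right 0)" by (intro tendsto_intros)
  then have "norm (F L - F 0) \<le> 0 * (m L - m 0)"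
    by (rule tendsto_lowerbound) (auto simp: eventually_at_right_less bound intro!: eventually_mono[OF eventually_at_right_less])
  then show ?thesis by simp
qed

lemma integral_split:
  fixes h :: "real \<Rightarrow> 'a::banach"
  assumes "h integrable_on {0..L}" "0 \<le> x" "x \<le> y" "y \<le> L"
  shows "integral {0..y} h - integral {0..x} h = integral {x..y} h" "h integrable_on {x..y}"
proof -
  have "h integrable_on {0..y}" using assms integrable_on_subinterval[of h "{0..L}" 0 y] by auto
  then show "integral {0..y} h - integral {0..x} h = integral {x..y} h"
    using Henstock_Kurzweil_Integration.integral_combine[of 0 x y h] assms by (metis add_diff_cancel_left')
  show "h integrable_on {x..y}" using assms integrable_on_subinterval[of h "{0..L}" x y] by auto
qed

text \<open>\<open>F\<close> is only absolutely continuous, so no pointwise product rule is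
  available. Instead the defect \<open>P\<close> of the formula is shown to have small increments
  compared with those of \<open>m\<close>, the integrals of \<open>norm h\<close> and
  \<open>norm g1\<close> up to the point.\<close>

lemma has_integral_by_parts:
  fixes h F g g1 :: "real \<Rightarrow> complex"
  assumes L: "0 \<le> L" and h: "h absolutely_integrable_on {0..L}"
    and F: "\<And>x. x \<in> {0..L} \<Longrightarrow> (h has_integral (F x - F 0)) {0..x}"
    and g: "\<And>x. x \<in> {0..L} \<Longrightarrow> (g has_vector_derivative g1 x) (at x within {0..L})"
    and g1: "continuous_on {0..L} g1"
  shows "((\<lambda>t. h t * g t) has_integral (F L * g L - F 0 * g 0 - integral {0..L} (\<lambda>t. F t * g1 t))) {0..L}"
proof -
  have Fint: "F x = F 0 + integral {0..x} h" if "x \<in> {0..L}" for x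
    using integral_unique[OF F[OF that]] by simp
  have cF: "continuous_on {0..L} F"
  proof -
    have "continuous_on {0..L} (\<lambda>x. F 0 + integral {0..x} h)"
      by (intro continuous_intros continuous_on_indefinite_integral h)
    then show ?thesis by (rule continuous_on_eq) (simp add: Fint[symmetric])
  qed
  have cg: "continuous_on {0..L} g"
    unfolding continuous_on_eq_continuous_within using g has_vector_derivative_continuous by blast
  have ihg: "(\<lambda>t. h t * g t) integrable_on {0..L}"
    using absolutely_integrable_mult_continuous[OF h cg] by (simp add: absolutely_integrable_on_def)
  have iFg: "(\<lambda>t. F t * g1 t) integrable_on {0..L}"
    by (intro integrable_continuous_interval continuous_intros cF g1)
  have ih: "h integrable_on {0..L}" "(\<lambda>t. norm (h t)) integrable_on {0..L}"
    using h by (auto simp: absolutely_integrable_on_def)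
  have ig: "(\<lambda>t. norm (g1 t)) integrable_on {0..L}"
    by (intro integrable_continuous_interval continuous_intros g1)
  define m where "m = (\<lambda>x. integral {0..x} (\<lambda>t. norm (h t)) + integral {0..x} (\<lambda>t. norm (g1 t)))"
  define P where "P = (\<lambda>x. F x * g x - integral {0..x} (\<lambda>t. F t * g1 t) - integral {0..x} (\<lambda>t. h t * g t))"
  have "P L = P 0"
  proof (rule eq_if_small_increments[OF L, of _ m], intro allI impI)
    fix e :: real assume e: "0 < e"
    have "uniformly_continuous_on {0..L} F" by (rule compact_uniformly_continuous[OF cF compact_Icc])
    then obtain d1 where d1: "0 < d1" "\<And>x y. x \<in> {0..L} \<Longrightarrow> y \<in> {0..L} \<Longrightarrow> dist y x < d1 \<Longrightarrow> dist (F y) (F x) < e"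
      by (rule uniformly_continuous_onE[OF _ e]) blast
    have "uniformly_continuous_on {0..L} g" by (rule compact_uniformly_continuous[OF cg compact_Icc])
    then obtain d2 where d2: "0 < d2" "\<And>x y. x \<in> {0..L} \<Longrightarrow> y \<in> {0..L} \<Longrightarrow> dist y x < d2 \<Longrightarrow> dist (g y) (g x) < e"
      by (rule uniformly_continuous_onE[OF _ e]) blast
    show "\<exists>d>0. \<forall>x y. 0 \<le> x \<longrightarrow> x \<le> y \<longrightarrow> y \<le> L \<longrightarrow> y - x < d \<longrightarrow> norm (P y - P x) \<le> e * (m y - m x)"
    proof (intro exI[of _ "min d1 d2"] conjI allI impI)
      show "0 < min d1 d2" using d1 d2 by simp
      fix x y assume xy: "0 \<le> x" "x \<le> y" "y \<le> L" "y - x < min d1 d2"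
      have sub: "{x..y} \<subseteq> {0..L}" using xy by auto
      have fxy: "integral {x..y} h = F y - F x"
      proof -
        have "F x = F 0 + integral {0..x} h" "F y = F 0 + integral {0..y} h" using xy by (auto intro: Fint)
        then show ?thesis using integral_split(1)[OF ih(1) xy(1-3)] by simp
      qed
      have "(g1 has_integral (g y - g x)) {x..y}"
        using xy sub g by (intro fundamental_theorem_of_calculus)
          (auto intro: has_vector_derivative_within_subset[of _ _ _ "{0..L}"])
      then have gxy: "integral {x..y} g1 = g y - g x" by (rule integral_unique)
      note s = integral_split[OF ihg xy(1-3)] integral_split[OF iFg xy(1-3)] integral_split[OF ih(1) xy(1-3)]
        integral_split[OF ih(2) xy(1-3)] integral_split[OF ig xy(1-3)]
      have ig1: "g1 integrable_on {x..y}"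
        by (intro integrable_continuous_interval continuous_on_subset[OF g1 sub])
      have eq1: "integral {x..y} (\<lambda>t. h t * (g x - g t)) = (F y - F x) * g x - integral {x..y} (\<lambda>t. h t * g t)"
        using s(2) integrable_on_mult_left[OF s(6), of "g x"] by (simp add: right_diff_distrib integral_diff fxy)
      have eq2: "integral {x..y} (\<lambda>t. (F y - F t) * g1 t) = F y * (g y - g x) - integral {x..y} (\<lambda>t. F t * g1 t)"
        using s(4) integrable_on_mult_right[OF ig1, of "F y"] by (simp add: left_diff_distrib integral_diff gxy)
      \<comment> \<open>Freezing \<open>g\<close> at the left end and \<open>F\<close> at the right
        end makes the two pieces add up to the increment exactly. Each contains an oscillation,
        which is below \<open>e\<close> by uniform continuity.\<close>
      have "P y - P x = integral {x..y} (\<lambda>t. h t * (g x - g t)) + integral {x..y} (\<lambda>t. (F y - F t) * g1 t)"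
        unfolding eq1 eq2 P_def s(1)[symmetric] s(3)[symmetric] by (simp add: left_diff_distrib right_diff_distrib)
      also have "norm \<dots> \<le> norm (integral {x..y} (\<lambda>t. h t * (g x - g t))) + norm (integral {x..y} (\<lambda>t. (F y - F t) * g1 t))"
        by (rule norm_triangle_ineq)
      also have "norm (integral {x..y} (\<lambda>t. h t * (g x - g t))) \<le> integral {x..y} (\<lambda>t. norm (h t) * e)"
      proof (rule integral_norm_bound_integral)
        show "(\<lambda>t. h t * (g x - g t)) integrable_on {x..y}"
          using s(2) integrable_on_mult_left[OF s(6), of "g x"] by (simp add: right_diff_distrib integrable_diff)
        show "(\<lambda>t. norm (h t) * e) integrable_on {x..y}" by (rule integrable_on_mult_left[OF s(8)])
        fix t assume t: "t \<in> {x..y}"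
        have "dist (g x) (g t) < e" using t xy by (intro d2(2)) (auto simp: dist_real_def)
        then show "norm (h t * (g x - g t)) \<le> norm (h t) * e"
          by (auto simp: norm_mult dist_norm intro!: mult_left_mono)
      qed
      also have "norm (integral {x..y} (\<lambda>t. (F y - F t) * g1 t)) \<le> integral {x..y} (\<lambda>t. e * norm (g1 t))"
      proof (rule integral_norm_bound_integral)
        show "(\<lambda>t. (F y - F t) * g1 t) integrable_on {x..y}"
          using s(4) integrable_on_mult_right[OF ig1, of "F y"] by (simp add: left_diff_distrib integrable_diff)
        show "(\<lambda>t. e * norm (g1 t)) integrable_on {x..y}" by (rule integrable_on_mult_right[OF s(10)])
        fix t assume t: "t \<in> {x..y}"
        have "dist (F y) (F t) < e" using t xy by (intro d1(2)) (auto simp: dist_real_def)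
        then show "norm ((F y - F t) * g1 t) \<le> e * norm (g1 t)"
          by (auto simp: norm_mult dist_norm intro!: mult_right_mono)
      qed
      also have "integral {x..y} (\<lambda>t. norm (h t) * e) + integral {x..y} (\<lambda>t. e * norm (g1 t)) = e * (m y - m x)"
      proof -
        have "m y - m x = integral {x..y} (\<lambda>t. norm (h t)) + integral {x..y} (\<lambda>t. norm (g1 t))"
          unfolding m_def s(7)[symmetric] s(9)[symmetric] by simp
        then show ?thesis by (simp add: distrib_left mult.commute)
      qed
      finally show "norm (P y - P x) \<le> e * (m y - m x)" by simp
    qed
  qed
  then have "integral {0..L} (\<lambda>t. h t * g t) = F L * g L - F 0 * g 0 - integral {0..L} (\<lambda>t. F t * g1 t)"
    by (simp add: P_def algebra_simps)
  then show ?thesis using integrable_integral[OF ihg] by simp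
qed

text \<open>With u the squared norm of \<open>f\<close>, integrate the derivative of t u(t) over
  [0, x] and that of -(L - t) u(t) over [x, L]. The boundary terms add up to L u(x), and the
  integrand is at most u + L |u'|; Young's inequality with weight \<open>e\<close> splits |u'|. As
  \<open>e\<close> is free, the derivative can be given an arbitrarily small factor.\<close>

lemma sup_bound_C1:
  fixes f f1 :: "real \<Rightarrow> complex"
  assumes L: "0 < L" and e: "0 < e"
    and f: "\<And>x. x \<in> {0..L} \<Longrightarrow> (f has_vector_derivative f1 x) (at x within {0..L})"
    and f1: "continuous_on {0..L} f1" and x: "x \<in> {0..L}"
  shows "(norm (f x))\<^sup>2 \<le> (1 / L + 1 / e) * integral {0..L} (\<lambda>t. (norm (f t))\<^sup>2) + e * integral {0..L} (\<lambda>t. (norm (f1 t))\<^sup>2)"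
proof -
  have cf: "continuous_on {0..L} f"
    unfolding continuous_on_eq_continuous_within using f has_vector_derivative_continuous by blast
  define u where "u = (\<lambda>t. (norm (f t))\<^sup>2)"
  define u1 where "u1 = (\<lambda>t. 2 * (f t \<bullet> f1 t))"
  have u: "(u has_vector_derivative u1 t) (at t within {0..L})" if "t \<in> {0..L}" for t
  proof -
    have "((\<lambda>t. f t \<bullet> f t) has_derivative (\<lambda>h. f t \<bullet> (h *\<^sub>R f1 t) + (h *\<^sub>R f1 t) \<bullet> f t)) (at t within {0..L})"
      using f[OF that] unfolding has_vector_derivative_def by (intro has_derivative_inner)
    then show ?thesis
      unfolding has_vector_derivative_def u_def u1_def power2_norm_eq_inner
      by (rule has_derivative_eq_rhs) (auto simp: inner_commute algebra_simps)
  qed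
  have cu: "continuous_on {0..L} u" "continuous_on {0..L} u1"
    unfolding u_def u1_def by (intro continuous_intros cf f1)+
  define w where "w = (\<lambda>t. u t + L * ((norm (f t))\<^sup>2 / e + e * (norm (f1 t))\<^sup>2))"
  have cw: "continuous_on {0..L} w" unfolding w_def using e by (intro continuous_intros cf f1 cu) auto
  have u1: "\<bar>u1 t\<bar> \<le> (norm (f t))\<^sup>2 / e + e * (norm (f1 t))\<^sup>2" for t
  proof -
    have "\<bar>u1 t\<bar> \<le> 2 * (norm (f t) * norm (f1 t))"
      using Cauchy_Schwarz_ineq2[of "f t" "f1 t"] by (simp add: u1_def)
    moreover have "2 * (norm (f t) * norm (f1 t)) \<le> (norm (f t))\<^sup>2 / e + e * (norm (f1 t))\<^sup>2"
    proof -
      have "0 \<le> (norm (f t) - e * norm (f1 t))\<^sup>2" by simp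
      then have "2 * (norm (f t) * norm (f1 t)) * e \<le> (norm (f t))\<^sup>2 + e * e * (norm (f1 t))\<^sup>2"
        by (simp add: power2_diff power_mult_distrib power2_eq_square[of e] mult_ac)
      then have "2 * (norm (f t) * norm (f1 t)) \<le> ((norm (f t))\<^sup>2 + e * e * (norm (f1 t))\<^sup>2) / e"
        using e by (simp add: pos_le_divide_eq)
      also have "\<dots> = (norm (f t))\<^sup>2 / e + e * (norm (f1 t))\<^sup>2"
        using e by (simp add: add_divide_distrib)
      finally show ?thesis .
    qed
    ultimately show ?thesis by linarith
  qed
  have sub: "{0..x} \<subseteq> {0..L}" "{x..L} \<subseteq> {0..L}" using x by auto
  have a: "((\<lambda>t. u t + t * u1 t) has_integral (x * u x - 0 * u 0)) {0..x}"
  proof (rule fundamental_theorem_of_calculus)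
    fix t assume t: "t \<in> {0..x}"
    then have "t \<in> {0..L}" using sub by blast
    from has_vector_derivative_mult[OF has_vector_derivative_id has_vector_derivative_within_subset[OF u[OF this] sub(1)]]
    show "((\<lambda>t. t * u t) has_vector_derivative u t + t * u1 t) (at t within {0..x})"
      by (simp add: add.commute)
  qed (use x in auto)
  have b: "((\<lambda>t. u t - (L - t) * u1 t) has_integral (- (L - L) * u L - (- (L - x) * u x))) {x..L}"
  proof (rule fundamental_theorem_of_calculus)
    fix t assume t: "t \<in> {x..L}"
    have "((\<lambda>t. - (L - t)) has_vector_derivative 1) (at t within {x..L})"
      by (auto intro!: derivative_eq_intros simp flip: has_real_derivative_iff_has_vector_derivative)
    moreover have "t \<in> {0..L}" using t sub by blast
    ultimately have "((\<lambda>t. - (L - t) * u t) has_vector_derivative - (L - t) * u1 t + 1 * u t) (at t within {x..L})"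
      by (intro has_vector_derivative_mult has_vector_derivative_within_subset[OF u sub(2)])
    moreover have "- (L - t) * u1 t + 1 * u t = u t - (L - t) * u1 t" by (simp add: algebra_simps)
    ultimately show "((\<lambda>t. - (L - t) * u t) has_vector_derivative u t - (L - t) * u1 t) (at t within {x..L})"
      by (simp only:)
  qed (use x in auto)
  have wi: "(w has_integral integral {0..x} w) {0..x}" "(w has_integral integral {x..L} w) {x..L}"
    by (intro integrable_integral integrable_continuous_interval continuous_on_subset[OF cw] sub)+
  have "x * u x \<le> integral {0..x} w"
  proof (rule has_integral_le[OF _ wi(1)])
    show "((\<lambda>t. u t + t * u1 t) has_integral x * u x) {0..x}" using a by simp
    fix t assume t: "t \<in> {0..x}"
    have "t * u1 t \<le> t * \<bar>u1 t\<bar>" using t by (intro mult_left_mono) auto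
    also have "\<dots> \<le> L * \<bar>u1 t\<bar>" using t x by (intro mult_right_mono) auto
    also have "\<dots> \<le> L * ((norm (f t))\<^sup>2 / e + e * (norm (f1 t))\<^sup>2)" using u1[of t] L by (intro mult_left_mono) auto
    finally show "u t + t * u1 t \<le> w t" by (simp add: w_def)
  qed
  moreover have "(L - x) * u x \<le> integral {x..L} w"
  proof (rule has_integral_le[OF _ wi(2)])
    show "((\<lambda>t. u t - (L - t) * u1 t) has_integral (L - x) * u x) {x..L}"
    proof -
      have "- (L - L) * u L - (- (L - x) * u x) = (L - x) * u x" by (simp add: left_diff_distrib)
      with b show ?thesis by (simp only:)
    qed
    fix t assume t: "t \<in> {x..L}"
    have "(L - t) * - u1 t \<le> (L - t) * \<bar>u1 t\<bar>" using t by (intro mult_left_mono) auto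
    also have "\<dots> \<le> L * \<bar>u1 t\<bar>" using t x by (intro mult_right_mono) auto
    also have "\<dots> \<le> L * ((norm (f t))\<^sup>2 / e + e * (norm (f1 t))\<^sup>2)" using u1[of t] L by (intro mult_left_mono) auto
    finally show "u t - (L - t) * u1 t \<le> w t" by (simp add: w_def)
  qed
  moreover have "integral {0..x} w + integral {x..L} w = integral {0..L} w"
    using x cw by (intro Henstock_Kurzweil_Integration.integral_combine integrable_continuous_interval) auto
  ultimately have "L * u x \<le> integral {0..L} w" by (simp add: algebra_simps)
  moreover have "integral {0..L} w = (1 + L / e) * integral {0..L} (\<lambda>t. (norm (f t))\<^sup>2) + L * e * integral {0..L} (\<lambda>t. (norm (f1 t))\<^sup>2)"
  proof -
    have w: "w = (\<lambda>t. (1 + L / e) * (norm (f t))\<^sup>2 + L * e * (norm (f1 t))\<^sup>2)"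
      by (auto simp: w_def u_def fun_eq_iff algebra_simps)
    show ?thesis unfolding w
      by (subst integral_add) (auto intro!: integrable_continuous_interval continuous_intros cf f1)
  qed
  ultimately have "u x \<le> ((1 + L / e) * integral {0..L} (\<lambda>t. (norm (f t))\<^sup>2) + L * e * integral {0..L} (\<lambda>t. (norm (f1 t))\<^sup>2)) / L"
    using L by (simp add: pos_le_divide_eq mult.commute)
  also have "\<dots> = (1 / L + 1 / e) * integral {0..L} (\<lambda>t. (norm (f t))\<^sup>2) + e * integral {0..L} (\<lambda>t. (norm (f1 t))\<^sup>2)"
  proof -
    have "((1 + L / e) * a + L * e * b) / L = (1 / L + 1 / e) * a + e * b" for a b :: real
      using L by (simp add: add_divide_distrib distrib_right)
    then show ?thesis .
  qed
  finally show ?thesis by (simp add: u_def)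
qed

section \<open>Square-integrable functions on a segment\<close>

lemma L2_on_square:
  assumes "L2_on L f"
  shows "(\<lambda>x. (norm (f x))\<^sup>2) integrable_on {0..L}"
    "(LINT x|lebesgue_on {0..L}. (norm (f x))\<^sup>2) = integral {0..L} (\<lambda>x. (norm (f x))\<^sup>2)"
  using assms unfolding L2_on_def by (auto intro: integrable_on_lebesgue_on lebesgue_integral_eq_integral)

lemma L2_on_absolutely_integrable:
  fixes f :: "real \<Rightarrow> 'a::euclidean_space"
  assumes "L2_on L f"
  shows "f absolutely_integrable_on {0..L}"
proof -
  have m: "f \<in> borel_measurable (lebesgue_on {0..L})"
    and i: "integrable (lebesgue_on {0..L}) (\<lambda>x. (norm (f x))\<^sup>2)"
    using assms by (auto simp: L2_on_def)
  \<comment> \<open>The segment has finite measure, and the norm is dominated by 1 plus its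
    square.\<close>
  have "integrable (lebesgue_on {0..L}) (\<lambda>x. 1 + (norm (f x))\<^sup>2)"
    using i by (intro Bochner_Integration.integrable_add) (auto intro: finite_measure.integrable_const finite_measure_lebesgue_on)
  then have "integrable (lebesgue_on {0..L}) (\<lambda>x. norm (f x))"
  proof (rule Bochner_Integration.integrable_bound)
    show "AE x in lebesgue_on {0..L}. norm (norm (f x)) \<le> norm (1 + (norm (f x))\<^sup>2)"
    proof (rule AE_I2)
      fix x
      have "0 \<le> (norm (f x) - 1)\<^sup>2" by simp
      then have "2 * norm (f x) \<le> 1 + (norm (f x))\<^sup>2" by (simp add: power2_diff)
      then have "norm (f x) \<le> 1 + (norm (f x))\<^sup>2" using norm_ge_zero[of "f x"] by linarith
      then show "norm (norm (f x)) \<le> norm (1 + (norm (f x))\<^sup>2)" by simp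
    qed
  qed (use m in measurable)
  then show ?thesis using m by (simp add: absolutely_integrable_measurable o_def)
qed

lemma L2_on_continuous:
  fixes f :: "real \<Rightarrow> complex"
  assumes "continuous_on {0..L} f"
  shows "L2_on L f"
  unfolding L2_on_def
proof
  show "f \<in> borel_measurable (lebesgue_on {0..L})"
    using assms by (intro continuous_imp_measurable_on_sets_lebesgue) auto
  have "(\<lambda>x. (norm (f x))\<^sup>2) absolutely_integrable_on {0..L}"
    by (intro absolutely_integrable_continuous_real continuous_intros assms)
  then show "integrable (lebesgue_on {0..L}) (\<lambda>x. (norm (f x))\<^sup>2)"
    by (rule absolutely_integrable_imp_integrable) auto
qed

lemma L2_on_add:
  fixes f g :: "real \<Rightarrow> complex"
  assumes "L2_on L f" "L2_on L g"
  shows "L2_on L (\<lambda>x. f x + g x)"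
proof -
  have m: "f \<in> borel_measurable (lebesgue_on {0..L})" "g \<in> borel_measurable (lebesgue_on {0..L})"
    and i: "integrable (lebesgue_on {0..L}) (\<lambda>x. (norm (f x))\<^sup>2)" "integrable (lebesgue_on {0..L}) (\<lambda>x. (norm (g x))\<^sup>2)"
    using assms by (auto simp: L2_on_def)
  have mm: "(\<lambda>x. f x + g x) \<in> borel_measurable (lebesgue_on {0..L})" using m by measurable
  have "integrable (lebesgue_on {0..L}) (\<lambda>x. 2 * (norm (f x))\<^sup>2 + 2 * (norm (g x))\<^sup>2)"
    by (intro Bochner_Integration.integrable_add Bochner_Integration.integrable_mult_right i)
  then have "integrable (lebesgue_on {0..L}) (\<lambda>x. (norm (f x + g x))\<^sup>2)"
  proof (rule Bochner_Integration.integrable_bound)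
    show "AE x in lebesgue_on {0..L}. norm ((norm (f x + g x))\<^sup>2) \<le> norm (2 * (norm (f x))\<^sup>2 + 2 * (norm (g x))\<^sup>2)"
    proof (rule AE_I2)
      fix x
      have "(norm (f x + g x))\<^sup>2 \<le> (norm (f x) + norm (g x))\<^sup>2"
        by (intro power_mono norm_triangle_ineq) auto
      also have "\<dots> \<le> 2 * (norm (f x))\<^sup>2 + 2 * (norm (g x))\<^sup>2"
        using sum_squares_bound[of "norm (f x)" "norm (g x)"] by (simp add: power2_sum)
      finally show "norm ((norm (f x + g x))\<^sup>2) \<le> norm (2 * (norm (f x))\<^sup>2 + 2 * (norm (g x))\<^sup>2)" by simp
    qed
  qed (use mm in measurable)
  then show ?thesis using mm by (simp add: L2_on_def)
qed

lemma L2_on_mult_continuous: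
  fixes f g :: "real \<Rightarrow> complex"
  assumes "L2_on L f" "continuous_on {0..L} g"
  shows "L2_on L (\<lambda>x. f x * g x)"
proof -
  obtain c where c: "\<And>x. x \<in> {0..L} \<Longrightarrow> norm (g x) \<le> c"
    using compact_imp_bounded[OF compact_continuous_image[OF assms(2) compact_Icc]] unfolding bounded_iff by blast
  have m: "f \<in> borel_measurable (lebesgue_on {0..L})" "g \<in> borel_measurable (lebesgue_on {0..L})"
    and i: "integrable (lebesgue_on {0..L}) (\<lambda>x. (norm (f x))\<^sup>2)"
    using assms L2_on_continuous[OF assms(2)] by (auto simp: L2_on_def)
  have mm: "(\<lambda>x. f x * g x) \<in> borel_measurable (lebesgue_on {0..L})" using m by measurable
  have "integrable (lebesgue_on {0..L}) (\<lambda>x. (norm (f x))\<^sup>2 * c\<^sup>2)"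
    by (intro Bochner_Integration.integrable_mult_left i)
  then have "integrable (lebesgue_on {0..L}) (\<lambda>x. (norm (f x * g x))\<^sup>2)"
  proof (rule Bochner_Integration.integrable_bound)
    show "AE x in lebesgue_on {0..L}. norm ((norm (f x * g x))\<^sup>2) \<le> norm ((norm (f x))\<^sup>2 * c\<^sup>2)"
      by (rule AE_I2) (auto simp: norm_mult power_mult_distrib intro!: mult_left_mono power_mono c)
  qed (use mm in measurable)
  then show ?thesis using mm by (simp add: L2_on_def)
qed

lemma L2_on_of_real:
  assumes "L2_on L (V :: real \<Rightarrow> real)"
  shows "L2_on L (\<lambda>x. complex_of_real (V x))"
  using assms by (auto simp: L2_on_def)

lemma L2_on_cmult:
  fixes f :: "real \<Rightarrow> complex"
  assumes "L2_on L f"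
  shows "L2_on L (\<lambda>x. c * f x)"
  using L2_on_mult_continuous[OF assms continuous_on_const[of _ c]] by (simp add: mult.commute)

lemma L2_on_AE_cong:
  fixes f g :: "real \<Rightarrow> complex"
  assumes "L2_on L f" "AE x in lebesgue_on {0..L}. g x = f x"
  shows "L2_on L g" "integral {0..L} (\<lambda>x. (norm (g x))\<^sup>2) = integral {0..L} (\<lambda>x. (norm (f x))\<^sup>2)"
proof -
  obtain N where N: "N \<in> null_sets (lebesgue_on {0..L})" and N': "{x \<in> {0..L}. g x \<noteq> f x} \<subseteq> N"
    using assms(2) unfolding eventually_ae_filter by (auto simp: space_restrict_space)
  have eq: "g x = f x" if "x \<in> {0..L} - N" for x using that N' by blast
  have neg: "negligible N" using N by (simp add: negligible_iff_null_sets null_sets_restrict_space)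
  have i: "(\<lambda>x. (norm (f x))\<^sup>2) absolutely_integrable_on {0..L}" and m: "f \<in> borel_measurable (lebesgue_on {0..L})"
    using assms(1) L2_on_square(1)[OF assms(1)] unfolding L2_on_def
    by (auto intro: nonnegative_absolutely_integrable_1)
  have "g \<in> borel_measurable (lebesgue_on {0..L})"
    using absolutely_integrable_spike[OF L2_on_absolutely_integrable[OF assms(1)] neg, of g] eq
    by (auto simp: absolutely_integrable_measurable)
  moreover have "integrable (lebesgue_on {0..L}) (\<lambda>x. (norm (g x))\<^sup>2)"
    using absolutely_integrable_spike[OF i neg, of "\<lambda>x. (norm (g x))\<^sup>2"] eq
    by (auto intro: absolutely_integrable_imp_integrable)
  ultimately show "L2_on L g" by (simp add: L2_on_def)
  show "integral {0..L} (\<lambda>x. (norm (g x))\<^sup>2) = integral {0..L} (\<lambda>x. (norm (f x))\<^sup>2)"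
    by (rule integral_spike[OF neg]) (use eq in auto)
qed

lemma L1_le_L2:
  fixes k :: "real \<Rightarrow> complex"
  assumes "L2_on L k" "0 < L"
  shows "integral {0..L} (\<lambda>t. norm (k t)) \<le> sqrt (L * integral {0..L} (\<lambda>t. (norm (k t))\<^sup>2))"
proof -
  define a where "a = integral {0..L} (\<lambda>t. norm (k t))"
  have i: "(\<lambda>t. norm (k t)) integrable_on {0..L}" "(\<lambda>t. (norm (k t))\<^sup>2) integrable_on {0..L}"
    using L2_on_absolutely_integrable[OF assms(1)] L2_on_square(1)[OF assms(1)] by (auto simp: absolutely_integrable_on_def)
  \<comment> \<open>\<open>c\<close> is the mean of \<open>norm (k t)\<close>. Non-negativity of the
    variance is the Cauchy-Schwarz inequality against the constant 1.\<close>
  define c where "c = a / L"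
  have 1: "(\<lambda>t. 2 * c * norm (k t)) integrable_on {0..L}" by (intro integrable_on_mult_right i)
  have 2: "(\<lambda>t. c\<^sup>2 - 2 * c * norm (k t)) integrable_on {0..L}" by (intro integrable_diff 1) auto
  have 3: "(norm (k t) - c)\<^sup>2 = (norm (k t))\<^sup>2 + (c\<^sup>2 - 2 * c * norm (k t))" for t
    unfolding power2_diff mult.commute[of "2 * norm (k t)"] by (simp only: mult.left_commute mult.assoc add_diff_eq)
  have "0 \<le> integral {0..L} (\<lambda>t. (norm (k t) - c)\<^sup>2)"
    unfolding 3 by (rule integral_nonneg[OF integrable_add[OF i(2) 2]]) (simp flip: 3)
  also have "\<dots> = integral {0..L} (\<lambda>t. (norm (k t))\<^sup>2) + (integral {0..L} (\<lambda>t. c\<^sup>2) - integral {0..L} (\<lambda>t. 2 * c * norm (k t)))"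
    unfolding 3 integral_add[OF i(2) 2] by (subst integral_diff[OF _ 1]) auto
  also have "integral {0..L} (\<lambda>t. 2 * c * norm (k t)) = 2 * (a\<^sup>2 / L)"
    by (simp add: c_def a_def power2_eq_square)
  also have "integral {0..L} (\<lambda>t. c\<^sup>2) = a\<^sup>2 / L" using assms(2) by (simp add: c_def power2_eq_square)
  finally have "a\<^sup>2 / L \<le> integral {0..L} (\<lambda>t. (norm (k t))\<^sup>2)" by simp
  then have "a\<^sup>2 \<le> L * integral {0..L} (\<lambda>t. (norm (k t))\<^sup>2)" using assms(2) by (simp add: pos_divide_le_eq mult.commute)
  then show ?thesis unfolding a_def by (rule real_le_rsqrt)
qed

text \<open>The resolvent equation \<open>(T - \<mu>) f = g\<close>, solved for the second
  derivative, gives \<open>(V - \<mu>) f - g\<close>; this is the origin of the inhomogeneity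
  \<open>- g\<close>. Integration removes the exceptional null set.\<close>

lemma H2_derivs_imp_solves:
  assumes H: "H2_derivs L f f1 f2"
    and ae: "AE x in lebesgue_on {0..L}. \<mu> * f x + g x = - f2 x + complex_of_real (V x) * f x"
  shows "solves (\<lambda>t. complex_of_real (V t) - \<mu>) (\<lambda>t. - g t) L f f1"
  unfolding solves_def
proof (intro ballI conjI)
  fix x assume x: "x \<in> {0..L}"
  show "(f has_vector_derivative f1 x) (at x within {0..L})" using H x by (simp add: H2_derivs_def)
  obtain N where N: "N \<in> null_sets (lebesgue_on {0..L})"
      and N': "{x \<in> {0..L}. \<mu> * f x + g x \<noteq> - f2 x + complex_of_real (V x) * f x} \<subseteq> N"
    using ae unfolding eventually_ae_filter by (auto simp: space_restrict_space)
  then have neg: "negligible N" by (simp add: negligible_iff_null_sets null_sets_restrict_space)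
  have "(f2 has_integral (f1 x - f1 0)) {0..x}" using H x by (simp add: H2_derivs_def)
  then show "((\<lambda>t. (complex_of_real (V t) - \<mu>) * f t + - g t) has_integral (f1 x - f1 0)) {0..x}"
  proof (rule has_integral_spike[OF neg, rotated])
    fix t assume "t \<in> {0..x} - N"
    then have eq: "\<mu> * f t + g t = - f2 t + complex_of_real (V t) * f t" using x N' by auto
    have "(complex_of_real (V t) - \<mu>) * f t + - g t = complex_of_real (V t) * f t - (\<mu> * f t + g t)"
      by (simp add: left_diff_distrib)
    also have "\<dots> = f2 t" unfolding eq by simp
    finally show "(complex_of_real (V t) - \<mu>) * f t + - g t = f2 t" .
  qed
qed

lemma solves_imp_H2_derivs:
  assumes "solves (\<lambda>t. complex_of_real (V t) - \<mu>) (\<lambda>t. - g t) L f f1" and V: "L2_on L V" and g: "L2_on L g"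
  shows "H2_derivs L f f1 (\<lambda>t. (complex_of_real (V t) - \<mu>) * f t + - g t)"
proof -
  have cf: "continuous_on {0..L} f" by (rule solves_continuous[OF assms(1)])
  have "L2_on L (\<lambda>t. complex_of_real (V t) + - \<mu>)"
    by (rule L2_on_add[OF L2_on_of_real[OF V] L2_on_continuous[OF continuous_on_const]])
  then have "L2_on L (\<lambda>t. (complex_of_real (V t) - \<mu>) * f t + - 1 * g t)"
    by (intro L2_on_add[OF L2_on_mult_continuous[OF _ cf] L2_on_cmult[OF g]]) simp
  then show ?thesis using assms(1) by (auto simp: H2_derivs_def solves_def)
qed

lemma potential_minus_absolutely_integrable:
  assumes "L2_on L V"
  shows "(\<lambda>t. complex_of_real (V t) - \<mu>) absolutely_integrable_on {0..L}"
  by (rule set_integral_diff(1)[OF L2_on_absolutely_integrable[OF L2_on_of_real[OF assms]]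
        absolutely_integrable_continuous_real[OF continuous_on_const]])

section \<open>Finite linear systems\<close>

text \<open>Gaussian elimination, one row at a time, produces preimages controlled by the image.
  \<open>K\<close> may be singular, so \<open>x'\<close> need not be \<open>x\<close>. It is applied
  to the possibly singular matrix \<open>B\<close> of a vertex condition, and to an injective
  matrix, for which \<open>x'\<close> is \<open>x\<close>.\<close>

lemma bounded_right_inverse:
  fixes K :: "'i \<Rightarrow> 'j \<Rightarrow> complex"
  assumes "finite I" "finite J"
  shows "\<exists>C\<ge>0. \<forall>x. \<exists>x'. (\<forall>i\<in>I. (\<Sum>j\<in>J. K i j * x' j) = (\<Sum>j\<in>J. K i j * x j)) \<and>
     (\<forall>j\<in>J. norm (x' j) \<le> C * (\<Sum>i\<in>I. norm (\<Sum>j\<in>J. K i j * x j)))"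
  using assms
proof (induction I arbitrary: J K rule: finite_induct)
  case empty
  show ?case by (intro exI[of _ 0] conjI allI exI[of _ "\<lambda>_. 0"]) auto
next
  case (insert r I)
  show ?case
  proof (cases "\<forall>j\<in>J. K r j = 0")
    case True
    obtain C where C: "C \<ge> 0" "\<forall>x. \<exists>x'. (\<forall>i\<in>I. (\<Sum>j\<in>J. K i j * x' j) = (\<Sum>j\<in>J. K i j * x j)) \<and>
     (\<forall>j\<in>J. norm (x' j) \<le> C * (\<Sum>i\<in>I. norm (\<Sum>j\<in>J. K i j * x j)))"
      using insert.IH[OF insert.prems, of K] by blast
    have z: "(\<Sum>j\<in>J. K r j * x j) = 0" for x using True by simp
    show ?thesis
      using C insert.hyps by (intro exI[of _ C]) (simp add: z)
  next
    case False
    then obtain p where p: "p \<in> J" "K r p \<noteq> 0" by blast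
    define J' where "J' = J - {p}"
    \<comment> \<open>The rows that remain after the unknown \<open>p\<close> is eliminated by means
      of row \<open>r\<close>. The induction hypothesis handles this smaller system, and the
      component at \<open>p\<close> is then recovered from row \<open>r\<close>.\<close>
    define K' where "K' = (\<lambda>i j. K i j - K i p * K r j / K r p)"
    have J': "finite J'" "J = insert p J'" "p \<notin> J'" using insert.prems p by (auto simp: J'_def)
    obtain C where C: "C \<ge> 0" "\<forall>x. \<exists>x'. (\<forall>i\<in>I. (\<Sum>j\<in>J'. K' i j * x' j) = (\<Sum>j\<in>J'. K' i j * x j)) \<and>
     (\<forall>j\<in>J'. norm (x' j) \<le> C * (\<Sum>i\<in>I. norm (\<Sum>j\<in>J'. K' i j * x j)))"
      using insert.IH[OF J'(1), of K'] by blast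
    define b where "b = (\<Sum>i\<in>I. norm (K i p / K r p))"
    define a where "a = (\<Sum>j\<in>J'. norm (K r j))"
    have ab: "0 \<le> a" "0 \<le> b" by (auto simp: a_def b_def intro: sum_nonneg)
    define C1 where "C1 = C * (1 + b)"
    define C2 where "C2 = (1 + a * C1) / norm (K r p)"
    have C1: "0 \<le> C1" "0 \<le> C2" using C ab by (auto simp: C1_def C2_def)
    have elim: "(\<Sum>j\<in>J'. K' i j * x j) = (\<Sum>j\<in>J. K i j * x j) - K i p / K r p * (\<Sum>j\<in>J. K r j * x j)" for i x
    proof -
      have "(\<Sum>j\<in>J'. K' i j * x j) = (\<Sum>j\<in>J'. K i j * x j) - K i p / K r p * (\<Sum>j\<in>J'. K r j * x j)"
        unfolding K'_def sum_distrib_left sum_subtractf[symmetric]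
        by (intro sum.cong refl) (simp add: left_diff_distrib)
      then show ?thesis using J' p(2) by (simp add: distrib_left)
    qed
    have "\<exists>x'. (\<forall>i\<in>insert r I. (\<Sum>j\<in>J. K i j * x' j) = (\<Sum>j\<in>J. K i j * x j)) \<and>
       (\<forall>j\<in>J. norm (x' j) \<le> max C1 C2 * (\<Sum>i\<in>insert r I. norm (\<Sum>j\<in>J. K i j * x j)))" for x
    proof -
      define y where "y = (\<lambda>i. \<Sum>j\<in>J. K i j * x j)"
      define S where "S = (\<Sum>i\<in>insert r I. norm (y i))"
      have S: "S = norm (y r) + (\<Sum>i\<in>I. norm (y i))" using insert.hyps by (simp add: S_def)
      have S0: "0 \<le> S" by (simp add: S_def sum_nonneg)
      obtain x' where x': "\<forall>i\<in>I. (\<Sum>j\<in>J'. K' i j * x' j) = (\<Sum>j\<in>J'. K' i j * x j)"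
        "\<forall>j\<in>J'. norm (x' j) \<le> C * (\<Sum>i\<in>I. norm (\<Sum>j\<in>J'. K' i j * x j))" using C by blast
      define w where "w = x'(p := (y r - (\<Sum>j\<in>J'. K r j * x' j)) / K r p)"
      have wJ: "(\<Sum>j\<in>J'. h j * w j) = (\<Sum>j\<in>J'. h j * x' j)" for h
        using J' by (intro sum.cong) (auto simp: w_def)
      have r: "(\<Sum>j\<in>J. K r j * w j) = y r"
        using J' p(2) by (simp add: wJ) (simp add: w_def)
      have eqs: "(\<Sum>j\<in>J. K i j * w j) = y i" if "i \<in> insert r I" for i
      proof (cases "i = r")
        case False
        then have i: "i \<in> I" using that by simp
        have "(\<Sum>j\<in>J. K i j * w j) - K i p / K r p * y r = (\<Sum>j\<in>J'. K' i j * w j)"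
          unfolding elim r ..
        also have "\<dots> = (\<Sum>j\<in>J'. K' i j * x j)" unfolding wJ using x'(1) i by blast
        also have "\<dots> = y i - K i p / K r p * y r" unfolding elim y_def ..
        finally show ?thesis by simp
      qed (simp add: r)
      have sb: "(\<Sum>i\<in>I. norm (\<Sum>j\<in>J'. K' i j * x j)) \<le> (1 + b) * S"
      proof -
        have "(\<Sum>i\<in>I. norm (\<Sum>j\<in>J'. K' i j * x j)) \<le> (\<Sum>i\<in>I. norm (y i) + norm (K i p / K r p) * norm (y r))"
          unfolding elim norm_mult[symmetric] y_def by (intro sum_mono norm_triangle_ineq4)
        also have "\<dots> = (\<Sum>i\<in>I. norm (y i)) + b * norm (y r)"
          by (simp add: sum.distrib b_def sum_distrib_right)
        also have "\<dots> \<le> S + b * S"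
          using ab S by (intro add_mono mult_left_mono) (auto simp: sum_nonneg)
        finally show ?thesis by (simp add: distrib_right)
      qed
      have x'b: "norm (x' j) \<le> C1 * S" if "j \<in> J'" for j
      proof -
        have "norm (x' j) \<le> C * (\<Sum>i\<in>I. norm (\<Sum>j\<in>J'. K' i j * x j))" using x'(2) that by blast
        also have "\<dots> \<le> C * ((1 + b) * S)" by (intro mult_left_mono sb C)
        finally show ?thesis by (simp add: C1_def mult.assoc)
      qed
      have wp: "norm (w p) \<le> C2 * S"
      proof -
        have "norm (\<Sum>j\<in>J'. K r j * x' j) \<le> (\<Sum>j\<in>J'. norm (K r j) * (C1 * S))"
          by (intro sum_norm_le) (auto simp: norm_mult intro!: mult_left_mono x'b)
        also have "\<dots> = a * (C1 * S)" by (simp add: a_def sum_distrib_right)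
        finally have "norm (y r - (\<Sum>j\<in>J'. K r j * x' j)) \<le> S + a * (C1 * S)"
          using norm_triangle_ineq4[of "y r" "\<Sum>j\<in>J'. K r j * x' j"] S sum_nonneg[of I "\<lambda>i. norm (y i)"] by simp
        then have "norm (y r - (\<Sum>j\<in>J'. K r j * x' j)) / norm (K r p) \<le> (S + a * (C1 * S)) / norm (K r p)"
          by (rule divide_right_mono) simp
        also have "\<dots> = C2 * S" by (simp add: C2_def distrib_right mult.assoc)
        finally show ?thesis by (simp add: w_def norm_divide)
      qed
      have "norm (w j) \<le> max C1 C2 * S" if "j \<in> J" for j
      proof (cases "j = p")
        case True
        have "C2 * S \<le> max C1 C2 * S" using S0 by (intro mult_right_mono) auto
        then show ?thesis using wp True by simp
      next
        case False
        have "C1 * S \<le> max C1 C2 * S" using S0 by (intro mult_right_mono) auto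
        then show ?thesis using x'b[of j] False that J' by (auto simp: w_def)
      qed
      then show ?thesis using eqs unfolding S_def y_def by blast
    qed
    then show ?thesis using C1 by (intro exI[of _ "max C1 C2"]) auto
  qed
qed

text \<open>The square system is singular exactly if its determinant vanishes, and expansion along
  row \<open>p\<close>, which holds the free row \<open>r\<close>, is linear in \<open>r\<close>
  with the cofactors as coefficients. The cofactors do not involve \<open>r\<close> and are
  polynomials in the remaining entries, hence entire. If the fixed equations are dependent, all
  cofactors vanish, in agreement with the equivalence.\<close>

lemma homogeneous_system_cofactors:
  fixes M :: "complex \<Rightarrow> 'i \<Rightarrow> 'i \<Rightarrow> complex"
  assumes fin: "finite I" and p: "p \<in> I"
    and hol: "\<And>i j. i \<in> I - {p} \<Longrightarrow> j \<in> I \<Longrightarrow> (\<lambda>\<mu>. M \<mu> i j) holomorphic_on UNIV"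
  shows "\<exists>c. (\<forall>j\<in>I. (\<lambda>\<mu>. c \<mu> j) holomorphic_on UNIV) \<and>
    (\<forall>\<mu> r. (\<exists>x. (\<exists>i\<in>I. x i \<noteq> 0) \<and> (\<forall>i\<in>I-{p}. (\<Sum>j\<in>I. M \<mu> i j * x j) = 0) \<and> (\<Sum>j\<in>I. r j * x j) = 0)
       \<longleftrightarrow> (\<Sum>j\<in>I. r j * c \<mu> j) = 0)"
proof -
  define n where "n = card I"
  obtain en where en: "bij_betw en {..<n} I"
    using ex_bij_betw_nat_finite[OF fin] by (auto simp: n_def atLeast0LessThan)
  define dn where "dn = the_inv_into {..<n} en"
  have en_I: "en k \<in> I" if "k < n" for k using en that bij_betwE by blast
  have dn: "dn i < n" "en (dn i) = i" if "i \<in> I" for i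
    using en that f_the_inv_into_f_bij_betw[of en "{..<n}" I i] bij_betw_the_inv_into[OF en]
    by (auto simp: dn_def dest: bij_betwE)
  have de: "dn (en k) = k" if "k < n" for k
    using en that by (simp add: dn_def the_inv_into_f_f bij_betw_def)
  define q where "q = dn p"
  have q: "q < n" "en q = p" using dn[OF p] by (auto simp: q_def)
  define A where "A = (\<lambda>\<mu> r. mat n n (\<lambda>(i, j). if i = q then r (en j) else M \<mu> (en i) (en j)))"
  have A: "A \<mu> r \<in> carrier_mat n n" for \<mu> r by (simp add: A_def)
  define c where "c = (\<lambda>\<mu> j. cofactor (A \<mu> (\<lambda>_. 0)) q (dn j))"
  have cof: "cofactor (A \<mu> r) q j = cofactor (A \<mu> (\<lambda>_. 0)) q j" if "j < n" for \<mu> r j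
  proof -
    have "mat_delete (A \<mu> r) q j = mat_delete (A \<mu> (\<lambda>_. 0)) q j"
      by (rule eq_matI) (auto simp: mat_delete_def A_def)
    then show ?thesis by (simp add: cofactor_def)
  qed
  have reix: "(\<Sum>k<n. g (en k)) = (\<Sum>j\<in>I. g j)" for g :: "'i \<Rightarrow> complex"
    using sum.reindex_bij_betw[OF en] .
  have detA: "Determinant.det (A \<mu> r) = (\<Sum>j\<in>I. r j * c \<mu> j)" for \<mu> r
  proof -
    have "Determinant.det (A \<mu> r) = (\<Sum>k<n. A \<mu> r $$ (q, k) * cofactor (A \<mu> r) q k)"
      by (rule laplace_expansion_row[OF A q(1)])
    also have "\<dots> = (\<Sum>k<n. r (en k) * c \<mu> (en k))"
    proof (intro sum.cong refl)
      fix k assume "k \<in> {..<n}"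
      then have k: "k < n" by simp
      have "A \<mu> r $$ (q, k) = r (en k)" using k q by (simp add: A_def)
      then show "A \<mu> r $$ (q, k) * cofactor (A \<mu> r) q k = r (en k) * c \<mu> (en k)"
        by (simp add: c_def cof[OF k, of \<mu> r] de[OF k])
    qed
    finally show ?thesis using reix[of "\<lambda>j. r j * c \<mu> j"] by simp
  qed
  have mv: "(A \<mu> r *\<^sub>v vec n (\<lambda>k. x (en k))) $ i = (\<Sum>j\<in>I. (if i = q then r j else M \<mu> (en i) j) * x j)"
    if "i < n" for \<mu> r x i
    using that reix[of "\<lambda>j. (if i = q then r j else M \<mu> (en i) j) * x j"]
    by (simp add: A_def scalar_prod_def atLeast0LessThan)
  show ?thesis
  proof (intro exI[of _ c] conjI ballI allI)
    fix j assume j: "j \<in> I"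
    define N where "N = (\<lambda>\<mu>. mat_delete (A \<mu> (\<lambda>_. 0)) q (dn j))"
    have N: "N \<mu> \<in> carrier_mat (n - 1) (n - 1)" for \<mu> using A unfolding N_def by (rule mat_delete_carrier)
    have ent: "(\<lambda>\<mu>. N \<mu> $$ (k, l)) holomorphic_on UNIV" if kl: "k < n - 1" "l < n - 1" for k l
    proof -
      have "N \<mu> $$ (k, l) = M \<mu> (en (if k < q then k else Suc k)) (en (if l < dn j then l else Suc l))" for \<mu>
        using kl by (auto simp: N_def mat_delete_def A_def)
      moreover have "en (if k < q then k else Suc k) \<in> I - {p}"
      proof -
        have "(if k < q then k else Suc k) < n" "(if k < q then k else Suc k) \<noteq> q" using kl by auto
        then show ?thesis using en_I de q by (metis DiffI empty_iff insert_iff)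
      qed
      moreover have "en (if l < dn j then l else Suc l) \<in> I" using kl by (intro en_I) auto
      ultimately show ?thesis using hol by simp
    qed
    have "(\<lambda>\<mu>. Determinant.det (N \<mu>)) holomorphic_on UNIV"
      unfolding det_def'[OF N]
    proof (intro holomorphic_intros)
      fix s i assume "s \<in> {s. s permutes {0..<n - 1}}" "i \<in> {0..<n - 1}"
      then show "(\<lambda>\<mu>. N \<mu> $$ (i, s i)) holomorphic_on UNIV"
        using permutes_in_image[of s "{0..<n - 1}" i] by (intro ent) auto
    qed
    then show "(\<lambda>\<mu>. c \<mu> j) holomorphic_on UNIV"
      unfolding c_def cofactor_def N_def by (intro holomorphic_intros)
  next
    fix \<mu> r
    have "(\<exists>x. (\<exists>i\<in>I. x i \<noteq> 0) \<and> (\<forall>i\<in>I-{p}. (\<Sum>j\<in>I. M \<mu> i j * x j) = 0) \<and> (\<Sum>j\<in>I. r j * x j) = 0)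
      \<longleftrightarrow> (\<exists>w. w \<in> carrier_vec n \<and> w \<noteq> 0\<^sub>v n \<and> A \<mu> r *\<^sub>v w = 0\<^sub>v n)"
    proof
      assume "\<exists>x. (\<exists>i\<in>I. x i \<noteq> 0) \<and> (\<forall>i\<in>I-{p}. (\<Sum>j\<in>I. M \<mu> i j * x j) = 0) \<and> (\<Sum>j\<in>I. r j * x j) = 0"
      then obtain x i0 where x: "i0 \<in> I" "x i0 \<noteq> 0" "\<forall>i\<in>I-{p}. (\<Sum>j\<in>I. M \<mu> i j * x j) = 0" "(\<Sum>j\<in>I. r j * x j) = 0"
        by blast
      define w where "w = vec n (\<lambda>k. x (en k))"
      have "w $ dn i0 \<noteq> 0" using x dn[OF x(1)] by (simp add: w_def)
      then have "w \<noteq> 0\<^sub>v n" using dn[OF x(1)] by auto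
      moreover have "A \<mu> r *\<^sub>v w = 0\<^sub>v n"
      proof (rule eq_vecI)
        fix i assume "i < dim_vec (0\<^sub>v n)"
        then have i: "i < n" by simp
        have "en i \<in> I - {p}" if "i \<noteq> q" using en_I[OF i] de[OF i] that q_def by auto
        then show "(A \<mu> r *\<^sub>v w) $ i = 0\<^sub>v n $ i" unfolding w_def mv[OF i] using x i by (cases "i = q") auto
      qed (simp add: A_def)
      ultimately show "\<exists>w. w \<in> carrier_vec n \<and> w \<noteq> 0\<^sub>v n \<and> A \<mu> r *\<^sub>v w = 0\<^sub>v n"
        by (intro exI[of _ w]) (simp add: w_def)
    next
      assume "\<exists>w. w \<in> carrier_vec n \<and> w \<noteq> 0\<^sub>v n \<and> A \<mu> r *\<^sub>v w = 0\<^sub>v n"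
      then obtain w where w: "w \<in> carrier_vec n" "w \<noteq> 0\<^sub>v n" "A \<mu> r *\<^sub>v w = 0\<^sub>v n" by blast
      define x where "x = (\<lambda>j. w $ dn j)"
      have wx: "w = vec n (\<lambda>k. x (en k))" using w(1) by (intro eq_vecI) (auto simp: x_def de)
      have z: "(\<Sum>j\<in>I. (if i = q then r j else M \<mu> (en i) j) * x j) = 0" if "i < n" for i
        using mv[OF that, of \<mu> r x] w(3) that unfolding wx[symmetric] by simp
      obtain k where k: "k < n" "w $ k \<noteq> 0"
        using w(1,2) by (metis carrier_vecD eq_vecI index_zero_vec)
      then have "x (en k) \<noteq> 0" by (simp add: x_def de)
      moreover have "(\<Sum>j\<in>I. M \<mu> i j * x j) = 0" if "i \<in> I - {p}" for i
      proof -
        have "dn i \<noteq> q" using that q dn[of i] by auto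
        then show ?thesis using z[of "dn i"] dn[of i] that by simp
      qed
      moreover have "(\<Sum>j\<in>I. r j * x j) = 0" using z[OF q(1)] by simp
      ultimately show "\<exists>x. (\<exists>i\<in>I. x i \<noteq> 0) \<and> (\<forall>i\<in>I-{p}. (\<Sum>j\<in>I. M \<mu> i j * x j) = 0) \<and> (\<Sum>j\<in>I. r j * x j) = 0"
        using en_I[OF k(1)] by blast
    qed
    also have "\<dots> \<longleftrightarrow> (\<Sum>j\<in>I. r j * c \<mu> j) = 0"
      using det_0_iff_vec_prod_zero_field[OF A] by (simp add: detA)
    finally show "(\<exists>x. (\<exists>i\<in>I. x i \<noteq> 0) \<and> (\<forall>i\<in>I-{p}. (\<Sum>j\<in>I. M \<mu> i j * x j) = 0) \<and> (\<Sum>j\<in>I. r j * x j) = 0)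
       \<longleftrightarrow> (\<Sum>j\<in>I. r j * c \<mu> j) = 0" .
  qed
qed

text \<open>With an additional unknown \<open>None\<close> whose column is \<open>- y\<close> there
  are more unknowns than equations, so a nontrivial solution exists. Injectivity forces its
  component at \<open>None\<close> to be nonzero, and dividing by it solves the system.\<close>

lemma square_system_solvable:
  fixes K :: "'i \<Rightarrow> 'i \<Rightarrow> complex"
  assumes fin: "finite I"
    and inj: "\<And>x. \<forall>i\<in>I. (\<Sum>j\<in>I. K i j * x j) = 0 \<Longrightarrow> \<forall>i\<in>I. x i = 0"
  shows "\<exists>x. \<forall>i\<in>I. (\<Sum>j\<in>I. K i j * x j) = y i"
proof -
  define J where "J = insert None (Some ` I)"
  define M where "M = (\<lambda>i j. case i of None \<Rightarrow> 0 | Some i' \<Rightarrow> (case j of None \<Rightarrow> - y i' | Some j' \<Rightarrow> K i' j'))"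
  have sJ: "(\<Sum>j\<in>J. g j) = g None + (\<Sum>j\<in>I. g (Some j))" for g :: "'i option \<Rightarrow> complex"
    using fin by (simp add: J_def sum.reindex)
  have JN: "J - {None} = Some ` I" by (auto simp: J_def)
  obtain c :: "complex \<Rightarrow> 'i option \<Rightarrow> complex" where
    c: "\<forall>\<mu> r. (\<exists>x. (\<exists>i\<in>J. x i \<noteq> 0) \<and> (\<forall>i\<in>J-{None}. (\<Sum>j\<in>J. M i j * x j) = 0) \<and> (\<Sum>j\<in>J. r j * x j) = 0)
       \<longleftrightarrow> (\<Sum>j\<in>J. r j * c \<mu> j) = 0"
  proof -
    have "finite J" "None \<in> J" using fin by (auto simp: J_def)
    from homogeneous_system_cofactors[OF this, of "\<lambda>_. M"] show ?thesis using that by auto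
  qed
  \<comment> \<open>The free row 0 meets the determinant criterion trivially; this is where the
    nontrivial solution comes from.\<close>
  obtain x where x: "\<exists>i\<in>J. x i \<noteq> 0" "\<forall>i\<in>J-{None}. (\<Sum>j\<in>J. M i j * x j) = 0"
    using c[rule_format, of "\<lambda>_. 0" 0] by auto
  have eq: "(\<Sum>j\<in>I. K i j * x (Some j)) = y i * x None" if "i \<in> I" for i
    using x(2) that by (auto simp: sJ JN M_def)
  have "x None \<noteq> 0"
  proof
    assume "x None = 0"
    then have "\<forall>i\<in>I. x (Some i) = 0" using inj[of "\<lambda>i. x (Some i)"] eq by simp
    then show False using x(1) \<open>x None = 0\<close> by (auto simp: J_def)
  qed
  then have "\<forall>i\<in>I. (\<Sum>j\<in>I. K i j * (x (Some j) / x None)) = y i"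
    using eq by (simp flip: sum_divide_distrib)
  then show ?thesis by (intro exI[of _ "\<lambda>j. x (Some j) / x None"])
qed

section \<open>Self-adjoint vertex conditions\<close>

text \<open>A maximal independent set of columns has \<open>d\<close> elements and forms an
  invertible matrix, which \<open>y\<close> already annihilates from the left. This turns the
  column-based rank of the vertex condition into independence of its rows.\<close>

lemma full_rank_annihilator:
  fixes M :: "complex mat"
  assumes M: "M \<in> carrier_mat d nc" and rank: "vec_space.rank d M = d"
    and ann: "\<And>j. j < nc \<Longrightarrow> (\<Sum>k<d. y k * M $$ (k, j)) = 0" and k: "k < d"
  shows "y k = 0"
proof -
  interpret vec_space "TYPE(complex)" d .
  obtain S where S: "finite S" "maximal S (\<lambda>T. T \<subseteq> set (cols M) \<and> lin_indpt T)"
    using maximal_exists_superset[of "set (cols M)" "\<lambda>T. T \<subseteq> set (cols M) \<and> lin_indpt T" "{}"]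
    by (auto simp: lin_dep_def)
  have Sc: "S \<subseteq> set (cols M)" "lin_indpt S" using S(2) by (auto simp: maximal_def)
  have card: "card S = d" using rank_card_indpt[OF M S(2)] rank by simp
  obtain l where l: "set l = S" "distinct l" using finite_distinct_list[OF S(1)] by blast
  have len: "length l = d" using distinct_card[OF l(2)] l(1) card by simp
  define N where "N = mat_of_cols d l"
  have N: "N \<in> carrier_mat d d" using mat_of_cols_carrier(1)[of d l] by (simp add: N_def len)
  have lc: "set l \<subseteq> carrier_vec d" using Sc(1) l(1) cols_dim[of M] M by auto
  have colsN: "cols N = l" unfolding N_def by (rule cols_mat_of_cols[OF lc])
  have "rank N = d" using lin_indpt_full_rank[OF N] colsN l Sc(2) by simp
  then have "Determinant.det N \<noteq> 0" using det_rank_iff[OF N] by simp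
  then have "Determinant.det (transpose_mat N) \<noteq> 0" using det_transpose[OF N] by simp
  moreover have "transpose_mat N *\<^sub>v vec d y = 0\<^sub>v d"
  proof (rule eq_vecI)
    fix i assume "i < dim_vec (0\<^sub>v d)"
    then have i: "i < d" by simp
    have "l ! i \<in> set (cols M)" using Sc(1) l(1) len i nth_mem by blast
    then obtain j where j: "j < nc" "l ! i = col M j" using M by (auto simp: cols_def)
    have "row (transpose_mat N) i = l ! i" using i N colsN len by (metis carrier_matD(2) cols_length cols_nth row_transpose)
    then have "(transpose_mat N *\<^sub>v vec d y) $ i = (\<Sum>k<d. M $$ (k, j) * y k)"
      using i N M j by (simp add: scalar_prod_def atLeast0LessThan)
    also have "\<dots> = 0" using ann[OF j(1)] by (simp add: mult.commute)
    finally show "(transpose_mat N *\<^sub>v vec d y) $ i = 0\<^sub>v d $ i" using i by simp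
  qed (use N in simp)
  ultimately have "vec d y = 0\<^sub>v d"
    using det_0_iff_vec_prod_zero_field[of "transpose_mat N" d] N by (meson transpose_carrier_mat vec_carrier)
  then show ?thesis using k by (metis index_vec index_zero_vec(1))
qed

text \<open>The admissible pairs form a Lagrangian subspace. Writing adj for the adjoint, every pair
  is a sum of (adj B x, - adj A x) and of an orthogonal pair (adj A u, adj B u). The matrix (A B)
  kills the first by self-adjointness, so the condition forces \<open>u = 0\<close>.\<close>

lemma selfadjoint_pair_param:
  fixes a b :: "nat \<Rightarrow> nat \<Rightarrow> complex"
  assumes rank: "\<forall>y. (\<forall>k<d. (\<Sum>i<d. a i k * y i) = 0) \<longrightarrow> (\<forall>k<d. (\<Sum>i<d. b i k * y i) = 0) \<longrightarrow> (\<forall>i<d. y i = 0)"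
    and herm: "\<forall>i<d. \<forall>j<d. (\<Sum>k<d. a i k * cnj (b j k)) = (\<Sum>k<d. b i k * cnj (a j k))"
    and cond: "\<forall>i<d. (\<Sum>k<d. a i k * F k) + (\<Sum>k<d. b i k * F' k) = 0"
  shows "\<exists>x. (\<forall>k<d. F k = (\<Sum>i<d. cnj (b i k) * x i)) \<and> (\<forall>k<d. F' k = - (\<Sum>i<d. cnj (a i k) * x i))"
proof -
  have rank': "\<forall>i<d. y i = 0" if "\<And>k. k < d \<Longrightarrow> (\<Sum>i<d. cnj (a i k) * y i) = 0" "\<And>k. k < d \<Longrightarrow> (\<Sum>i<d. cnj (b i k) * y i) = 0" for y
  proof -
    have "\<forall>i<d. cnj (y i) = 0"
    proof (rule rank[THEN spec, THEN mp, THEN mp])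
      show "\<forall>k<d. (\<Sum>i<d. a i k * cnj (y i)) = 0"
      proof (intro allI impI)
        fix k assume k: "k < d"
        show "(\<Sum>i<d. a i k * cnj (y i)) = 0" using arg_cong[OF that(1)[OF k], of cnj] by simp
      qed
      show "\<forall>k<d. (\<Sum>i<d. b i k * cnj (y i)) = 0"
      proof (intro allI impI)
        fix k assume k: "k < d"
        show "(\<Sum>i<d. b i k * cnj (y i)) = 0" using arg_cong[OF that(2)[OF k], of cnj] by simp
      qed
    qed
    then show ?thesis by simp
  qed
  have sq: "\<forall>k\<in>K. \<alpha> k = 0" if "(\<Sum>k\<in>K. \<alpha> k * cnj (\<alpha> k)) + (\<Sum>k\<in>K. \<beta> k * cnj (\<beta> k)) = 0" "finite K"
    for K and \<alpha> \<beta> :: "nat \<Rightarrow> complex"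
  proof -
    have "complex_of_real ((\<Sum>k\<in>K. (norm (\<alpha> k))\<^sup>2) + (\<Sum>k\<in>K. (norm (\<beta> k))\<^sup>2)) = 0"
      using that(1) unfolding of_real_add of_real_sum complex_norm_square .
    then have "(\<Sum>k\<in>K. (norm (\<alpha> k))\<^sup>2) + (\<Sum>k\<in>K. (norm (\<beta> k))\<^sup>2) = 0" by (simp only: of_real_eq_0_iff)
    then have "(\<Sum>k\<in>K. (norm (\<alpha> k))\<^sup>2) = 0"
      using sum_nonneg[of K "\<lambda>k. (norm (\<alpha> k))\<^sup>2"] sum_nonneg[of K "\<lambda>k. (norm (\<beta> k))\<^sup>2"] by simp
    then show ?thesis using that(2) by (simp add: sum_nonneg_eq_0_iff)
  qed
  \<comment> \<open>\<open>A (A\<^sup>* u + B\<^sup>* w) + B (B\<^sup>* u - A\<^sup>* w) = 0\<close> forces \<open>u = 0\<close>, since \<open>A B\<^sup>*\<close> is self-adjoint.\<close>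
  have u0: "\<forall>i<d. u i = 0"
    if c: "\<And>i. i < d \<Longrightarrow> (\<Sum>k<d. a i k * ((\<Sum>j<d. cnj (a j k) * u j) + (\<Sum>j<d. cnj (b j k) * w j)))
       + (\<Sum>k<d. b i k * ((\<Sum>j<d. cnj (b j k) * u j) - (\<Sum>j<d. cnj (a j k) * w j))) = 0" for u w
  proof -
    define \<alpha> where "\<alpha> = (\<lambda>k. \<Sum>j<d. cnj (a j k) * u j)"
    define \<beta> where "\<beta> = (\<lambda>k. \<Sum>j<d. cnj (b j k) * u j)"
    have cross: "(\<Sum>k<d. a i k * (\<Sum>j<d. cnj (b j k) * w j)) = (\<Sum>k<d. b i k * (\<Sum>j<d. cnj (a j k) * w j))" if "i < d" for i
    proof -
      have "(\<Sum>k<d. p i k * (\<Sum>j<d. cnj (q j k) * w j)) = (\<Sum>j<d. (\<Sum>k<d. p i k * cnj (q j k)) * w j)"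
        for p q :: "nat \<Rightarrow> nat \<Rightarrow> complex"
        unfolding sum_distrib_left sum_distrib_right mult.assoc by (rule sum.swap)
      then show ?thesis using herm that by simp
    qed
    have z: "(\<Sum>k<d. a i k * \<alpha> k) + (\<Sum>k<d. b i k * \<beta> k) = 0" if "i < d" for i
      using c[OF that] cross[OF that]
      by (simp add: distrib_left right_diff_distrib sum.distrib sum_subtractf \<alpha>_def \<beta>_def)
    have pair: "(\<Sum>i<d. cnj (u i) * (\<Sum>k<d. p i k * g k)) = (\<Sum>k<d. g k * cnj (\<Sum>i<d. cnj (p i k) * u i))"
      for p :: "nat \<Rightarrow> nat \<Rightarrow> complex" and g
    proof -
      have "(\<Sum>i<d. cnj (u i) * (\<Sum>k<d. p i k * g k)) = (\<Sum>i<d. \<Sum>k<d. g k * (p i k * cnj (u i)))"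
        unfolding sum_distrib_left by (intro sum.cong refl) (simp add: mult_ac)
      also have "\<dots> = (\<Sum>k<d. \<Sum>i<d. g k * (p i k * cnj (u i)))" by (rule sum.swap)
      finally show ?thesis by (simp add: sum_distrib_left)
    qed
    have pa: "(\<Sum>i<d. cnj (u i) * (\<Sum>k<d. a i k * \<alpha> k)) = (\<Sum>k<d. \<alpha> k * cnj (\<alpha> k))"
      by (rule trans[OF pair[of a \<alpha>]]) (simp only: \<alpha>_def)
    have pb: "(\<Sum>i<d. cnj (u i) * (\<Sum>k<d. b i k * \<beta> k)) = (\<Sum>k<d. \<beta> k * cnj (\<beta> k))"
      by (rule trans[OF pair[of b \<beta>]]) (simp only: \<beta>_def)
    have split: "(\<Sum>i<d. cnj (u i) * (X i + Y i)) = (\<Sum>i<d. cnj (u i) * X i) + (\<Sum>i<d. cnj (u i) * Y i)" for X Y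
      by (simp add: distrib_left sum.distrib)
    have "(\<Sum>i<d. cnj (u i) * ((\<Sum>k<d. a i k * \<alpha> k) + (\<Sum>k<d. b i k * \<beta> k))) = 0"
      by (rule sum.neutral) (simp add: z)
    then have z2: "(\<Sum>k<d. \<alpha> k * cnj (\<alpha> k)) + (\<Sum>k<d. \<beta> k * cnj (\<beta> k)) = 0"
      unfolding split pa pb .
    have "\<forall>k\<in>{..<d}. \<alpha> k = 0" by (rule sq[OF z2]) simp
    moreover have "\<forall>k\<in>{..<d}. \<beta> k = 0" by (rule sq[OF trans[OF add.commute z2]]) simp
    ultimately have "\<alpha> k = 0" "\<beta> k = 0" if "k < d" for k using that by auto
    then show ?thesis by (intro rank') (simp_all add: \<alpha>_def \<beta>_def)
  qed
  define J where "J = {..<d} \<times> (UNIV :: bool set)"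
  \<comment> \<open>The first index is a coordinate together with a flag for \<open>F\<close>
    (False) or \<open>F'\<close> (True). The second is a parameter together with a flag for the role
    of \<open>u\<close> (False) or of \<open>w\<close> (True) in \<open>u0\<close>.\<close>
  define K where "K = (\<lambda>p q. case p of (k, s) \<Rightarrow> case q of (j, t) \<Rightarrow>
    if s then (if t then - cnj (a j k) else cnj (b j k)) else (if t then cnj (b j k) else cnj (a j k)))"
  have sJ: "(\<Sum>q\<in>J. g q) = (\<Sum>j<d. g (j, False)) + (\<Sum>j<d. g (j, True))" for g :: "nat \<times> bool \<Rightarrow> complex"
  proof -
    have "(\<Sum>q\<in>J. g q) = (\<Sum>j<d. \<Sum>t\<in>UNIV. g (j, t))"
      unfolding J_def by (subst sum.cartesian_product) simp
    then show ?thesis by (simp add: UNIV_bool sum.distrib add.commute)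
  qed
  have Krow: "(\<Sum>q\<in>J. K (k, False) q * x q) = (\<Sum>j<d. cnj (a j k) * x (j, False)) + (\<Sum>j<d. cnj (b j k) * x (j, True))"
       "(\<Sum>q\<in>J. K (k, True) q * x q) = (\<Sum>j<d. cnj (b j k) * x (j, False)) - (\<Sum>j<d. cnj (a j k) * x (j, True))" for k x
    unfolding sJ by (simp_all add: K_def sum_negf)
  have "\<exists>x. \<forall>p\<in>J. (\<Sum>q\<in>J. K p q * x q) = (if snd p then F' (fst p) else F (fst p))"
  proof (rule square_system_solvable)
    show "finite J" by (simp add: J_def)
    fix x assume x: "\<forall>p\<in>J. (\<Sum>q\<in>J. K p q * x q) = 0"
    have e1: "(\<Sum>j<d. cnj (a j k) * x (j, False)) + (\<Sum>j<d. cnj (b j k) * x (j, True)) = 0"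
      and e2: "(\<Sum>j<d. cnj (b j k) * x (j, False)) - (\<Sum>j<d. cnj (a j k) * x (j, True)) = 0" if "k < d" for k
      using x that unfolding Krow[symmetric] by (auto simp: J_def)
    have f: "\<forall>i<d. x (i, False) = 0"
      by (rule u0[of "\<lambda>j. x (j, False)" "\<lambda>j. x (j, True)"]) (simp add: e1 e2)
    have t: "\<forall>i<d. x (i, True) = 0"
    proof (rule rank')
      fix k assume "k < d"
      then show "(\<Sum>j<d. cnj (a j k) * x (j, True)) = 0" "(\<Sum>j<d. cnj (b j k) * x (j, True)) = 0"
        using e1[of k] e2[of k] f by simp_all
    qed
    show "\<forall>i\<in>J. x i = 0"
    proof
      fix p assume "p \<in> J"
      then obtain i s where "p = (i, s)" "i < d" by (auto simp: J_def)
      then show "x p = 0" using f t by (cases s) auto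
    qed
  qed
  then obtain x where x: "\<forall>p\<in>J. (\<Sum>q\<in>J. K p q * x q) = (if snd p then F' (fst p) else F (fst p))" by blast
  have e1: "F k = (\<Sum>j<d. cnj (a j k) * x (j, False)) + (\<Sum>j<d. cnj (b j k) * x (j, True))"
      and e2: "F' k = (\<Sum>j<d. cnj (b j k) * x (j, False)) - (\<Sum>j<d. cnj (a j k) * x (j, True))" if "k < d" for k
    unfolding Krow[symmetric] using x that by (auto simp: J_def)
  have "\<forall>i<d. x (i, False) = 0"
  proof (rule u0[of "\<lambda>j. x (j, False)" "\<lambda>j. x (j, True)"])
    fix i assume "i < d"
    from cond[rule_format, OF this] show "(\<Sum>k<d. a i k * ((\<Sum>j<d. cnj (a j k) * x (j, False)) + (\<Sum>j<d. cnj (b j k) * x (j, True))))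
       + (\<Sum>k<d. b i k * ((\<Sum>j<d. cnj (b j k) * x (j, False)) - (\<Sum>j<d. cnj (a j k) * x (j, True)))) = 0"
      using e1 e2 by simp
  qed
  then show ?thesis using e1 e2 by (intro exI[of _ "\<lambda>j. x (j, True)"]) simp
qed

text \<open>At a vertex the boundary term of Green's formula is real and controlled by the values
  alone, although \<open>F\<close> need not determine \<open>F'\<close>. Reality comes from the
  parametrisation. For the bound, \<open>F'\<close> is replaced by some \<open>G\<close> with the
  same image under \<open>B\<close> and of size bounded by \<open>F\<close>; reality along a complex
  line of admissible derivatives shows that the boundary term is unchanged.\<close>

lemma selfadjoint_pair_form:
  fixes a b :: "nat \<Rightarrow> nat \<Rightarrow> complex"
  assumes rank: "\<forall>y. (\<forall>k<d. (\<Sum>i<d. a i k * y i) = 0) \<longrightarrow> (\<forall>k<d. (\<Sum>i<d. b i k * y i) = 0) \<longrightarrow> (\<forall>i<d. y i = 0)"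
    and herm: "\<forall>i<d. \<forall>j<d. (\<Sum>k<d. a i k * cnj (b j k)) = (\<Sum>k<d. b i k * cnj (a j k))"
  shows "\<exists>C\<ge>0. \<forall>F F'. (\<forall>i<d. (\<Sum>k<d. a i k * F k) + (\<Sum>k<d. b i k * F' k) = 0) \<longrightarrow>
    Im (\<Sum>k<d. F' k * cnj (F k)) = 0 \<and> norm (\<Sum>k<d. F' k * cnj (F k)) \<le> C * (\<Sum>k<d. (norm (F k))\<^sup>2)"
proof -
  have im: "Im (\<Sum>k<d. F' k * cnj (F k)) = 0"
    if c: "\<forall>i<d. (\<Sum>k<d. a i k * F k) + (\<Sum>k<d. b i k * F' k) = 0" for F F'
  proof -
    obtain x where x: "\<forall>k<d. F k = (\<Sum>i<d. cnj (b i k) * x i)" "\<forall>k<d. F' k = - (\<Sum>i<d. cnj (a i k) * x i)"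
      using selfadjoint_pair_param[OF rank herm c] by blast
    have pair: "(\<Sum>k<d. (\<Sum>i<d. cnj (p i k) * x i) * cnj (g k)) = (\<Sum>i<d. x i * cnj (\<Sum>k<d. p i k * g k))"
      for p :: "nat \<Rightarrow> nat \<Rightarrow> complex" and g
    proof -
      have "(\<Sum>k<d. (\<Sum>i<d. cnj (p i k) * x i) * cnj (g k)) = (\<Sum>k<d. \<Sum>i<d. x i * (cnj (p i k) * cnj (g k)))"
        unfolding sum_distrib_right by (intro sum.cong refl) (simp add: mult_ac)
      also have "\<dots> = (\<Sum>i<d. \<Sum>k<d. x i * (cnj (p i k) * cnj (g k)))" by (rule sum.swap)
      finally show ?thesis by (simp add: sum_distrib_left)
    qed
    have "(\<Sum>k<d. F' k * cnj (F k)) = - (\<Sum>i<d. x i * cnj (\<Sum>k<d. a i k * F k))"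
      unfolding pair[symmetric] using x(2) by (simp add: sum_negf)
    also have "\<dots> = (\<Sum>i<d. x i * cnj (\<Sum>k<d. b i k * F' k))"
    proof -
      have "(\<Sum>k<d. b i k * F' k) = - (\<Sum>k<d. a i k * F k)" if "i < d" for i
        using c that by (simp add: eq_neg_iff_add_eq_0 add.commute)
      then show ?thesis by (simp add: sum_negf)
    qed
    also have "\<dots> = (\<Sum>k<d. F k * cnj (F' k))"
      unfolding pair[symmetric] using x(1) by simp
    also have "\<dots> = cnj (\<Sum>k<d. F' k * cnj (F k))" by (simp add: mult.commute)
    finally have eq: "(\<Sum>k<d. F' k * cnj (F k)) = cnj (\<Sum>k<d. F' k * cnj (F k))" .
    have "Im (\<Sum>k<d. F' k * cnj (F k)) = - Im (\<Sum>k<d. F' k * cnj (F k))"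
      by (rule trans[OF arg_cong[OF eq, of Im]]) (rule cnj.simps(2))
    then show ?thesis by linarith
  qed
  obtain C where C: "C \<ge> 0" "\<forall>x. \<exists>x'. (\<forall>i\<in>{..<d}. (\<Sum>j<d. b i j * x' j) = (\<Sum>j<d. b i j * x j)) \<and>
     (\<forall>j\<in>{..<d}. norm (x' j) \<le> C * (\<Sum>i<d. norm (\<Sum>j<d. b i j * x j)))"
    using bounded_right_inverse[of "{..<d}" "{..<d}" b] by auto
  define m where "m = (\<Sum>i<d. \<Sum>k<d. norm (a i k))"
  have m0: "0 \<le> m" by (simp add: m_def sum_nonneg)
  have "norm (\<Sum>k<d. F' k * cnj (F k)) \<le> C * m * real d * (\<Sum>k<d. (norm (F k))\<^sup>2)"
    if c: "\<forall>i<d. (\<Sum>k<d. a i k * F k) + (\<Sum>k<d. b i k * F' k) = 0" for F F'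
  proof -
    define s where "s = (\<Sum>k<d. norm (F k))"
    have s0: "0 \<le> s" by (simp add: s_def sum_nonneg)
    obtain G where G: "\<forall>i<d. (\<Sum>j<d. b i j * G j) = (\<Sum>j<d. b i j * F' j)"
       "\<forall>j<d. norm (G j) \<le> C * (\<Sum>i<d. norm (\<Sum>j<d. b i j * F' j))" using spec[OF C(2), of F'] by auto
    have "(\<Sum>i<d. norm (\<Sum>j<d. b i j * F' j)) \<le> (\<Sum>i<d. \<Sum>k<d. norm (a i k) * s)"
    proof (rule sum_mono)
      fix i assume "i \<in> {..<d}"
      then have "(\<Sum>j<d. b i j * F' j) = - (\<Sum>k<d. a i k * F k)"
        using c by (simp add: eq_neg_iff_add_eq_0 add.commute)
      then have "norm (\<Sum>j<d. b i j * F' j) = norm (\<Sum>k<d. a i k * F k)" by simp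
      also have "\<dots> \<le> (\<Sum>k<d. norm (a i k) * s)"
      proof (rule sum_norm_le)
        fix k assume "k \<in> {..<d}"
        then have "norm (F k) \<le> s" unfolding s_def by (intro member_le_sum) auto
        then show "norm (a i k * F k) \<le> norm (a i k) * s" by (simp add: norm_mult mult_left_mono)
      qed
      finally show "norm (\<Sum>j<d. b i j * F' j) \<le> (\<Sum>k<d. norm (a i k) * s)" .
    qed
    also have "\<dots> = m * s" by (simp add: m_def sum_distrib_right)
    finally have "C * (\<Sum>i<d. norm (\<Sum>j<d. b i j * F' j)) \<le> C * (m * s)" using C(1) by (intro mult_left_mono)
    then have Gb: "norm (G j) \<le> C * m * s" if "j < d" for j
      using order_trans[OF G(2)[rule_format, OF that]] by (simp add: mult.assoc)
    note c = c[rule_format]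
    \<comment> \<open>\<open>G - F'\<close> lies in the kernel of \<open>B\<close>, so any complex
      multiple of it may be added to \<open>F'\<close> without violating the condition.\<close>
    have imc: "Im (\<Sum>k<d. (F' k + z * (G k - F' k)) * cnj (F k)) = 0" for z
    proof (rule im, intro allI impI)
      fix i assume i: "i < d"
      have "(\<Sum>k<d. b i k * (F' k + z * (G k - F' k))) = (\<Sum>k<d. b i k * F' k) + z * ((\<Sum>k<d. b i k * G k) - (\<Sum>k<d. b i k * F' k))"
        unfolding sum_subtractf[symmetric] sum_distrib_left sum.distrib[symmetric]
        by (intro sum.cong refl) (simp add: distrib_left right_diff_distrib mult.left_commute)
      then show "(\<Sum>k<d. a i k * F k) + (\<Sum>k<d. b i k * (F' k + z * (G k - F' k))) = 0" using G(1) c i by simp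
    qed
    define T where "T = (\<Sum>k<d. F' k * cnj (F k))"
    define T' where "T' = (\<Sum>k<d. G k * cnj (F k))"
    have "(\<Sum>k<d. (F' k + z * (G k - F' k)) * cnj (F k)) = T + z * (T' - T)" for z
      unfolding T_def T'_def sum_subtractf[symmetric] sum_distrib_left sum.distrib[symmetric]
      by (intro sum.cong refl) (simp add: distrib_right left_diff_distrib right_diff_distrib mult.assoc)
    then have imT: "Im (T + z * (T' - T)) = 0" for z using imc[of z] by simp
    \<comment> \<open>The values 0 and 1 of \<open>z\<close> make \<open>T\<close> and
      \<open>T'\<close> real; the value \<i> gives equality of their real parts.\<close>
    have "T' = T"
      using imT[of 0] imT[of 1] imT[of \<i>] by (simp add: complex_eq_iff)
    have "norm T' \<le> (\<Sum>k<d. C * m * s * norm (F k))"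
      unfolding T'_def by (intro sum_norm_le) (auto simp: norm_mult intro!: mult_right_mono Gb)
    also have "\<dots> = C * m * s\<^sup>2" by (simp add: s_def power2_eq_square mult.assoc flip: sum_distrib_left)
    also have "\<dots> \<le> C * m * (real d * (\<Sum>k<d. (norm (F k))\<^sup>2))"
    proof (rule mult_left_mono)
      show "s\<^sup>2 \<le> real d * (\<Sum>k<d. (norm (F k))\<^sup>2)"
        unfolding s_def using sum_squared_le_sum_of_squares[of "\<lambda>k. norm (F k)" "{..<d}"] by (simp add: mult.commute)
    qed (use C m0 in simp)
    finally show ?thesis using \<open>T' = T\<close> by (simp add: T_def mult.assoc)
  qed
  then show ?thesis using C(1) m0 im
    by (intro exI[of _ "C * m * real d"]) simp
qed

text \<open>The sums run over edge ends instead of list positions, so that the contributions of all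
  vertices can later be added up and regrouped by edges.\<close>

lemma selfadjoint_condition_form:
  assumes sc: "selfadjoint_condition G w ps A B"
  shows "\<exists>C\<ge>0. \<forall>F F'. A *\<^sub>v vec_of_list (map F ps) + B *\<^sub>v vec_of_list (map F' ps) = 0\<^sub>v (length ps) \<longrightarrow>
    Im (\<Sum>p\<in>ends_at G w. F' p * cnj (F p)) = 0 \<and>
    norm (\<Sum>p\<in>ends_at G w. F' p * cnj (F p)) \<le> C * (\<Sum>p\<in>ends_at G w. (norm (F p))\<^sup>2)"
proof -
  define d where "d = length ps"
  have ps: "distinct ps" "set ps = ends_at G w" and A: "A \<in> carrier_mat d d" and B: "B \<in> carrier_mat d d"
    and rank: "vec_space.rank d (mat_of_cols d (cols A @ cols B)) = d"
    and herm: "mat_adjoint (A * mat_adjoint B) = A * mat_adjoint B"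
    using sc by (auto simp: selfadjoint_condition_def Let_def d_def)
  define a where "a = (\<lambda>i k. A $$ (i, k))"
  define b where "b = (\<lambda>i k. B $$ (i, k))"
  have dims: "dim_row A = d" "dim_col A = d" "dim_row B = d" "dim_col B = d" using A B by auto
  have adj: "mat_adjoint M $$ (i, j) = cnj (M $$ (j, i))" "mat_adjoint M \<in> carrier_mat d d"
    if "M \<in> carrier_mat d d" "i < d" "j < d" for M :: "complex mat" and i j
    using that by (auto simp: mat_adjoint_def mat_of_rows_index conjugate_complex_def)
  have adjB: "mat_adjoint B \<in> carrier_mat d d" using B by (auto simp: mat_adjoint_def)
  have AB: "(A * mat_adjoint B) $$ (i, j) = (\<Sum>k<d. a i k * cnj (b j k))" if "i < d" "j < d" for i j
    using that A B adjB adj(1)[OF B] by (simp add: scalar_prod_def atLeast0LessThan a_def b_def)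
  have h: "\<forall>i<d. \<forall>j<d. (\<Sum>k<d. a i k * cnj (b j k)) = (\<Sum>k<d. b i k * cnj (a j k))"
  proof (intro allI impI)
    fix i j assume ij: "i < d" "j < d"
    have M: "A * mat_adjoint B \<in> carrier_mat d d" using A adjB by simp
    have "(\<Sum>k<d. a i k * cnj (b j k)) = mat_adjoint (A * mat_adjoint B) $$ (i, j)"
      unfolding herm AB[OF ij] ..
    also have "\<dots> = cnj (\<Sum>k<d. a j k * cnj (b i k))"
      unfolding adj(1)[OF M ij] AB[OF ij(2,1)] ..
    finally show "(\<Sum>k<d. a i k * cnj (b j k)) = (\<Sum>k<d. b i k * cnj (a j k))"
      by (simp add: mult.commute)
  qed
  have r: "\<forall>y. (\<forall>k<d. (\<Sum>i<d. a i k * y i) = 0) \<longrightarrow> (\<forall>k<d. (\<Sum>i<d. b i k * y i) = 0) \<longrightarrow> (\<forall>i<d. y i = 0)"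
  proof (intro allI impI)
    fix y i assume y: "\<forall>k<d. (\<Sum>i<d. a i k * y i) = 0" "\<forall>k<d. (\<Sum>i<d. b i k * y i) = 0" and i: "i < d"
    define M where "M = mat_of_cols d (cols A @ cols B)"
    have M: "M \<in> carrier_mat d (2 * d)"
      using mat_of_cols_carrier(1)[of d "cols A @ cols B"] dims unfolding M_def mult_2 by simp
    show "y i = 0"
    proof (rule full_rank_annihilator[OF M _ _ i])
      show "vec_space.rank d M = d" using rank by (simp add: M_def)
      fix j assume j: "j < 2 * d"
      have "M $$ (k, j) = (if j < d then a k j else b k (j - d))" if "k < d" for k
        using that j dims by (auto simp: M_def mat_of_cols_index nth_append a_def b_def)
      then have "(\<Sum>k<d. y k * M $$ (k, j)) = (\<Sum>k<d. (if j < d then a k j else b k (j - d)) * y k)"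
        by (intro sum.cong refl) (simp add: mult.commute)
      also have "\<dots> = 0" using y j by (cases "j < d") auto
      finally show "(\<Sum>k<d. y k * M $$ (k, j)) = 0" .
    qed
  qed
  obtain C where C: "C \<ge> 0" "\<forall>F F'. (\<forall>i<d. (\<Sum>k<d. a i k * F k) + (\<Sum>k<d. b i k * F' k) = 0) \<longrightarrow>
    Im (\<Sum>k<d. F' k * cnj (F k)) = 0 \<and> norm (\<Sum>k<d. F' k * cnj (F k)) \<le> C * (\<Sum>k<d. (norm (F k))\<^sup>2)"
    using selfadjoint_pair_form[OF r h] by blast
  have re: "(\<Sum>p\<in>ends_at G w. g p) = (\<Sum>k<d. g (ps ! k))" for g :: "_ \<Rightarrow> 'c::comm_monoid_add"
    unfolding d_def using sum.reindex_bij_betw[OF bij_betw_nth[OF ps(1) refl ps(2)[symmetric]], of g] by simp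
  show ?thesis
  proof (intro exI[of _ C] conjI C(1) allI impI)
    fix F F' assume c: "A *\<^sub>v vec_of_list (map F ps) + B *\<^sub>v vec_of_list (map F' ps) = 0\<^sub>v (length ps)"
    have "(\<Sum>k<d. a i k * F (ps ! k)) + (\<Sum>k<d. b i k * F' (ps ! k)) = 0" if i: "i < d" for i
    proof -
      have "(A *\<^sub>v vec_of_list (map F ps) + B *\<^sub>v vec_of_list (map F' ps)) $ i
          = (\<Sum>k<d. a i k * F (ps ! k)) + (\<Sum>k<d. b i k * F' (ps ! k))"
        using i dims by (simp add: scalar_prod_def atLeast0LessThan d_def a_def b_def vec_of_list_index)
      then show ?thesis unfolding c using i by (simp add: d_def)
    qed
    then have "Im (\<Sum>k<d. F' (ps ! k) * cnj (F (ps ! k))) = 0 \<and>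
       norm (\<Sum>k<d. F' (ps ! k) * cnj (F (ps ! k))) \<le> C * (\<Sum>k<d. (norm (F (ps ! k)))\<^sup>2)"
      using C(2)[rule_format, of "\<lambda>k. F (ps ! k)" "\<lambda>k. F' (ps ! k)"] by blast
    then show "Im (\<Sum>p\<in>ends_at G w. F' p * cnj (F p)) = 0"
      "norm (\<Sum>p\<in>ends_at G w. F' p * cnj (F p)) \<le> C * (\<Sum>p\<in>ends_at G w. (norm (F p))\<^sup>2)"
      unfolding re by auto
  qed
qed

section \<open>Herglotz functions\<close>

text \<open>Comparing the imaginary part with its first sine coefficient, \<open>\<bar>sin (n t)\<bar> \<le> n \<bar>sin t\<bar>\<close>,
  bounds all Taylor coefficients of a function that maps the upper and lower half planes to themselves.\<close>

lemma abs_sin_mult_le: "\<bar>sin (real n * t)\<bar> \<le> real n * \<bar>sin t\<bar>"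
proof (induction n)
  case (Suc n)
  have "real (Suc n) * t = real n * t + t" by (simp add: distrib_right)
  then have "\<bar>sin (real (Suc n) * t)\<bar> = \<bar>sin (real n * t) * cos t + cos (real n * t) * sin t\<bar>"
    by (simp only: sin_add)
  also have "\<dots> \<le> \<bar>sin (real n * t)\<bar> * \<bar>cos t\<bar> + \<bar>cos (real n * t)\<bar> * \<bar>sin t\<bar>"
    by (rule order_trans[OF abs_triangle_ineq]) (simp add: abs_mult)
  also have "\<dots> \<le> \<bar>sin (real n * t)\<bar> * 1 + 1 * \<bar>sin t\<bar>"
    by (intro add_mono mult_left_mono mult_right_mono) auto
  finally show ?case using Suc by (simp add: distrib_right)
qed simp

text \<open>On the circle of radius \<open>r\<close>, the Fourier coefficient of \<open>f\<close> of
  index \<open>n\<close> is the Taylor coefficient times \<open>r ^ n\<close>, and the one of index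
  \<open>- n\<close> vanishes by Cauchy's theorem. Combining both into a sine and taking imaginary
  parts leaves half of the real part of the coefficient.\<close>

lemma taylor_coeff_sine_integral:
  assumes f: "f holomorphic_on ball 0 R" and r: "0 < r" "r < R" and n: "0 < n"
  shows "((\<lambda>x. Im (f (of_real r * cis (2 * pi * x))) * sin (real n * (2 * pi * x))) has_integral
     (Re ((deriv ^^ n) f 0 / fact n) * r ^ n / 2)) {0..1}"
proof -
  define c where "c = (deriv ^^ n) f 0 / fact n"
  have sub: "cball 0 r \<subseteq> ball 0 R" using r by auto
  have fc: "continuous_on (cball 0 r) f" "f holomorphic_on ball 0 r"
    using holomorphic_on_imp_continuous_on[OF holomorphic_on_subset[OF f sub]]
      holomorphic_on_subset[OF f subset_ball[of r R 0]] r by auto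
  have gp: "of_real r * cis t \<noteq> 0" for t using r by simp
  have circ: "circlepath 0 r x = of_real r * cis (2 * pi * x)" for x
    by (simp add: circlepath cis_conv_exp mult_ac)
  have vd: "vector_derivative (circlepath 0 r) (at x within {0..1}) = 2 * pi * \<i> * (of_real r * cis (2 * pi * x))"
    if "x \<in> {0..1}" for x
    using vector_derivative_circlepath01[of x 0 r] that by (simp add: cis_conv_exp mult_ac)
  have I1: "((\<lambda>u. f u / u ^ Suc n) has_contour_integral (2 * pi * \<i> / fact n * (deriv ^^ n) f 0)) (circlepath 0 r)"
    using Cauchy_has_contour_integral_higher_derivative_circlepath[OF fc, of 0 n] r by simp
  have I2: "((\<lambda>u. f u * u ^ (n - 1)) has_contour_integral 0) (circlepath 0 r)"
  proof (rule Cauchy_theorem_convex_simple)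
    show "(\<lambda>u. f u * u ^ (n - 1)) holomorphic_on ball 0 R" by (intro holomorphic_intros f)
    show "path_image (circlepath 0 r) \<subseteq> ball 0 R" using r by auto
  qed auto
  have cancel1: "a / p * (F / (x * e * (a * b)) * (p * (x * e))) = F * inverse b"
    if "a \<noteq> 0" "b \<noteq> 0" "p \<noteq> 0" "x \<noteq> 0" "e \<noteq> 0" for a b p x e F :: complex
    using that by (simp add: field_simps)
  have cancel2: "1 / (x * a * p) * (F * (a * b) * (p * (x * e))) = F * (e * b)"
    if "a \<noteq> 0" "p \<noteq> 0" "x \<noteq> 0" for a b p x e F :: complex
    using that by (simp add: field_simps)
  have J1: "((\<lambda>x. f (of_real r * cis (2 * pi * x)) * cis (- (real n * (2 * pi * x)))) has_integral c * of_real (r ^ n)) {0..1}"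
  proof -
    have "((\<lambda>x. f (circlepath 0 r x) / circlepath 0 r x ^ Suc n * vector_derivative (circlepath 0 r) (at x within {0..1}))
        has_integral (2 * pi * \<i> * c)) {0..1}"
      using I1 unfolding has_contour_integral_def by (simp add: c_def)
    from has_integral_mult_right[OF this, of "of_real (r ^ n) / (2 * pi * \<i>)"]
    have "((\<lambda>x. of_real (r ^ n) / (2 * pi * \<i>) * (f (circlepath 0 r x) / circlepath 0 r x ^ Suc n * vector_derivative (circlepath 0 r) (at x within {0..1})))
        has_integral (c * of_real (r ^ n))) {0..1}"
      by (rule has_integral_eq_rhs) (simp add: complex_eq_iff)
    then show ?thesis
    proof (rule has_integral_eq[rotated])
      fix x :: real assume x: "x \<in> {0..1}"
      define e where "e = cis (2 * pi * x)"
      have e: "cis (- (real n * (2 * pi * x))) = inverse (e ^ n)" "e \<noteq> 0"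
        by (simp_all add: e_def Complex.DeMoivre flip: cis_inverse)
      show "of_real (r ^ n) / (2 * pi * \<i>) * (f (circlepath 0 r x) / circlepath 0 r x ^ Suc n * vector_derivative (circlepath 0 r) (at x within {0..1}))
        = f (of_real r * cis (2 * pi * x)) * cis (- (real n * (2 * pi * x)))"
        unfolding circ vd[OF x] e(1) e_def[symmetric] power_Suc power_mult_distrib of_real_power
        by (rule cancel1) (use r e(2) in auto)
    qed
  qed
  have J2: "((\<lambda>x. f (of_real r * cis (2 * pi * x)) * cis (real n * (2 * pi * x))) has_integral 0) {0..1}"
  proof -
    have "((\<lambda>x. f (circlepath 0 r x) * circlepath 0 r x ^ (n - 1) * vector_derivative (circlepath 0 r) (at x within {0..1}))
        has_integral 0) {0..1}"
      using I2 unfolding has_contour_integral_def .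
    from has_integral_mult_right[OF this, of "1 / (of_real (r ^ n) * (2 * pi * \<i>))"]
    have "((\<lambda>x. 1 / (of_real (r ^ n) * (2 * pi * \<i>)) * (f (circlepath 0 r x) * circlepath 0 r x ^ (n - 1) * vector_derivative (circlepath 0 r) (at x within {0..1})))
        has_integral 0) {0..1}" by simp
    then show ?thesis
    proof (rule has_integral_eq[rotated])
      fix x :: real assume x: "x \<in> {0..1}"
      define e where "e = cis (2 * pi * x)"
      have e: "cis (real n * (2 * pi * x)) = e ^ n" by (simp add: e_def Complex.DeMoivre)
      obtain m where m: "n = Suc m" using n gr0_implies_Suc by blast
      show "1 / (of_real (r ^ n) * (2 * pi * \<i>)) * (f (circlepath 0 r x) * circlepath 0 r x ^ (n - 1) * vector_derivative (circlepath 0 r) (at x within {0..1}))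
        = f (of_real r * cis (2 * pi * x)) * cis (real n * (2 * pi * x))"
        unfolding circ vd[OF x] e e_def[symmetric]
        unfolding m power_Suc power_mult_distrib of_real_power of_real_mult diff_Suc_1
        by (rule cancel2) (use r in auto)
    qed
  qed
  have "((\<lambda>x. Im (f (of_real r * cis (2 * pi * x))) * sin (real n * (2 * pi * x))) has_integral (Re c * r ^ n / 2)) {0..1}"
  proof -
    from has_integral_mult_right[OF has_integral_diff[OF J2 J1], of "1 / (2 * \<i>)"]
    have "((\<lambda>x. 1 / (2 * \<i>) * (f (of_real r * cis (2 * pi * x)) * cis (real n * (2 * pi * x))
         - f (of_real r * cis (2 * pi * x)) * cis (- (real n * (2 * pi * x))))) has_integral
       (1 / (2 * \<i>) * (0 - c * of_real (r ^ n)))) {0..1}" .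
    then have "((\<lambda>x. f (of_real r * cis (2 * pi * x)) * of_real (sin (real n * (2 * pi * x)))) has_integral
       (1 / (2 * \<i>) * (0 - c * of_real (r ^ n)))) {0..1}"
    proof (rule has_integral_eq[rotated])
      fix x :: real
      have d: "cis y - cis (- y) = 2 * \<i> * of_real (sin y)" for y by (simp add: complex_eq_iff)
      show "1 / (2 * \<i>) * (f (of_real r * cis (2 * pi * x)) * cis (real n * (2 * pi * x))
         - f (of_real r * cis (2 * pi * x)) * cis (- (real n * (2 * pi * x))))
         = f (of_real r * cis (2 * pi * x)) * of_real (sin (real n * (2 * pi * x)))"
        unfolding right_diff_distrib[symmetric] d by (simp add: complex_eq_iff)
    qed
    from has_integral_linear[OF this bounded_linear_Im]
    have "((\<lambda>x. Im (f (of_real r * cis (2 * pi * x)) * of_real (sin (real n * (2 * pi * x))))) has_integral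
       Im (1 / (2 * \<i>) * (0 - c * of_real (r ^ n)))) {0..1}" by (simp add: o_def)
    moreover have "Im (1 / (2 * \<i>) * (0 - c * of_real (r ^ n))) = Re c * r ^ n / 2"
    proof -
      have "1 / (2 * \<i>) * (0 - c * of_real (r ^ n)) = \<i> * (c * of_real (r ^ n / 2))" by (simp add: field_simps)
      then show ?thesis by (simp only:) simp
    qed
    moreover have "Im (z * of_real s) = Im z * s" for z s by simp
    ultimately show ?thesis by (simp only:)
  qed
  then show ?thesis by (simp add: c_def)
qed

lemma taylor_coeff_bound:
  assumes f: "f holomorphic_on ball 0 R" and r: "0 < r" "r < R" and n: "0 < n"
    and sgn: "\<And>z. z \<in> ball 0 R \<Longrightarrow> 0 \<le> Im (f z) * Im z"
  shows "\<bar>Re ((deriv ^^ n) f 0 / fact n)\<bar> * r ^ n \<le> real n * (Re (deriv f 0) * r)"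
proof -
  define g where "g = (\<lambda>x. Im (f (of_real r * cis (2 * pi * x))))"
  define c where "c = Re ((deriv ^^ n) f 0 / fact n) * r ^ n / 2"
  define c1 where "c1 = Re (deriv f 0) * r / 2"
  have gi: "((\<lambda>x. g x * sin (real n * (2 * pi * x))) has_integral c) {0..1}"
    unfolding g_def c_def by (rule taylor_coeff_sine_integral[OF f r n])
  have g1: "((\<lambda>x. real n * (g x * sin (2 * pi * x))) has_integral (real n * c1)) {0..1}"
    using has_integral_mult_right[OF taylor_coeff_sine_integral[OF f r, of 1], of "real n"]
    by (simp add: g_def c1_def)
  have pt: "\<bar>g x * sin (real n * (2 * pi * x))\<bar> \<le> real n * (g x * sin (2 * pi * x))" for x
  proof -
    have "of_real r * cis (2 * pi * x) \<in> ball 0 R" using r by (simp add: norm_mult)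
    from sgn[OF this] have "0 \<le> g x * (r * sin (2 * pi * x))" by (simp add: g_def)
    then have "0 \<le> r * (g x * sin (2 * pi * x))" by (simp add: mult.left_commute)
    then have nn: "0 \<le> g x * sin (2 * pi * x)" using r by (simp add: zero_le_mult_iff)
    have "\<bar>g x * sin (real n * (2 * pi * x))\<bar> \<le> \<bar>g x\<bar> * (real n * \<bar>sin (2 * pi * x)\<bar>)"
      unfolding abs_mult by (intro mult_left_mono abs_sin_mult_le) simp
    also have "\<dots> = real n * \<bar>g x * sin (2 * pi * x)\<bar>" by (simp add: abs_mult)
    finally show ?thesis using nn by simp
  qed
  have "c \<le> real n * c1"
    by (rule has_integral_le[OF gi g1]) (use pt abs_le_D1 in blast)
  moreover have "- c \<le> real n * c1"
    by (rule has_integral_le[OF has_integral_neg[OF gi] g1]) (use pt abs_le_D2 in blast)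
  ultimately have "\<bar>c\<bar> \<le> real n * c1" by simp
  then show ?thesis using r by (simp add: c_def c1_def abs_mult)
qed

text \<open>Up to a positive factor, \<open>Re (deriv f 0)\<close> is the mean of the imaginary part
  of \<open>f\<close> times the sine over a circle around 0, and this product is continuous and
  non-negative. Were the mean not positive, the product would vanish on the whole circle through
  \<open>w\<close>, contrary to its sign at \<open>w\<close>.\<close>

lemma herglotz_deriv_pos:
  assumes f: "f holomorphic_on ball 0 R"
    and sgn: "\<And>z. z \<in> ball 0 R \<Longrightarrow> 0 \<le> Im (f z) * Im z"
    and w: "w \<in> ball 0 R" "0 < Im (f w) * Im w"
  shows "0 < Re (deriv f 0)"
proof (rule ccontr)
  assume neg: "\<not> 0 < Re (deriv f 0)"
  define r where "r = norm w"
  have r: "0 < r" "r < R" using w by (auto simp: r_def)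
  define h where "h = (\<lambda>x. Im (f (of_real r * cis (2 * pi * x))) * sin (2 * pi * x))"
  have hi: "(h has_integral (Re (deriv f 0) * r / 2)) {0..1}"
    using taylor_coeff_sine_integral[OF f r, of 1] by (simp add: h_def)
  have inb: "of_real r * cis (2 * pi * x) \<in> ball 0 R" for x using r by (simp add: norm_mult)
  have h0: "0 \<le> h x" for x
  proof -
    from sgn[OF inb[of x]] have "0 \<le> r * h x" by (simp add: h_def mult.left_commute)
    then show ?thesis using r by (simp add: zero_le_mult_iff)
  qed
  have "0 \<le> Re (deriv f 0) * r / 2" using has_integral_nonneg[OF hi] h0 by blast
  then have "Re (deriv f 0) * r / 2 = 0" using neg r by (simp add: zero_le_mult_iff)
  with hi have hi0: "(h has_integral 0) (cbox 0 1)" by (simp only: cbox_interval)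
  have ch: "continuous_on (cbox 0 1) h"
    unfolding h_def
    by (intro continuous_intros continuous_on_compose2[OF holomorphic_on_imp_continuous_on[OF f]]) (use inb in auto)
  have z: "h x = 0" if "x \<in> {0..1}" for x
    using has_integral_0_cbox_imp_0[OF ch _ hi0 , of x] h0 that by (auto simp: box_real)
  \<comment> \<open>The parametrisation of the circle starts at angle 0, hence the shift of a
    negative \<open>Arg w\<close> by \<open>2 * pi\<close>.\<close>
  obtain t where t: "0 \<le> t" "t < 2 * pi" "w = of_real (norm w) * cis t"
  proof (cases "0 \<le> Arg w")
    case True
    then show ?thesis using that[of "Arg w"] Arg_bounded[of w] rcis_cmod_Arg[of w] pi_gt_zero by (auto simp: rcis_def)
  next
    case False
    have "cis (Arg w + 2 * pi) = cis (Arg w)" by (simp add: complex_eq_iff)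
    then show ?thesis using False that[of "Arg w + 2 * pi"] Arg_bounded[of w] rcis_cmod_Arg[of w] by (auto simp: rcis_def)
  qed
  have "h (t / (2 * pi)) = 0" using t by (intro z) auto
  moreover have "Im w = r * sin t" using arg_cong[OF t(3), of Im] by (simp add: r_def)
  moreover have "h (t / (2 * pi)) = Im (f w) * sin t" using t(3) by (simp add: h_def r_def)
  ultimately show False using w(2) by auto
qed

text \<open>The derivative can be computed along real increments, where every difference quotient is
  real.\<close>

lemma deriv_real_on_reals:
  assumes "f field_differentiable (at x)" "Im x = 0" "\<And>y. Im y = 0 \<Longrightarrow> Im (f y) = 0"
  shows "Im (deriv f x) = 0"
proof -
  have "((\<lambda>h. (f (x + h) - f x) / h) \<longlongrightarrow> deriv f x) (at 0)"
    using assms(1) by (simp flip: DERIV_deriv_iff_field_differentiable add: DERIV_def)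
  moreover have "filterlim (\<lambda>n. complex_of_real (1 / real (Suc n))) (at 0) sequentially"
    unfolding filterlim_at
    using tendsto_of_real[OF LIMSEQ_Suc[OF lim_1_over_n[where 'a = real]], where 'a = complex]
    by (auto simp del: of_nat_Suc)
  ultimately have "(\<lambda>n. (f (x + complex_of_real (1 / real (Suc n))) - f x) / complex_of_real (1 / real (Suc n))) \<longlonglongrightarrow> deriv f x"
    by (rule filterlim_compose)
  then have "(\<lambda>n. Im ((f (x + complex_of_real (1 / real (Suc n))) - f x) / complex_of_real (1 / real (Suc n)))) \<longlonglongrightarrow> Im (deriv f x)"
    by (rule tendsto_Im)
  moreover have "Im ((f (x + complex_of_real (1 / real (Suc n))) - f x) / complex_of_real (1 / real (Suc n))) = 0" for n
    using assms(2,3) by (simp only: Im_divide_of_real) simp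
  ultimately show ?thesis by (simp add: LIMSEQ_const_iff)
qed

text \<open>The coefficient bound compares \<open>r ^ n\<close> with a multiple of \<open>r\<close>.
  For an entire function \<open>r\<close> may tend to infinity, which kills the real parts of all
  coefficients from \<open>n = 2\<close> on. Their imaginary parts vanish because all derivatives
  are real on the real line.\<close>

lemma entire_herglotz_linear:
  assumes f: "f holomorphic_on UNIV" and sgn: "\<And>z. 0 \<le> Im (f z) * Im z"
    and real: "\<And>z. Im z = 0 \<Longrightarrow> Im (f z) = 0"
  shows "f z = f 0 + deriv f 0 * z"
proof -
  have fb: "f holomorphic_on ball 0 R" for R using f by (rule holomorphic_on_subset) simp
  have hd: "((deriv ^^ n) f) holomorphic_on UNIV" for n by (intro holomorphic_higher_deriv f) auto
  have re: "Im ((deriv ^^ n) f x) = 0" if "Im x = 0" for n x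
    using that
  proof (induction n arbitrary: x)
    case (Suc n)
    have "(deriv ^^ n) f field_differentiable (at x)"
      using hd[of n] by (simp add: holomorphic_on_imp_differentiable_at)
    then show ?case using deriv_real_on_reals[of "(deriv ^^ n) f" x] Suc by simp
  qed (simp add: real)
  have cz: "(deriv ^^ n) f 0 = 0" if n: "2 \<le> n" for n
  proof -
    define k where "k = \<bar>Re ((deriv ^^ n) f 0 / fact n)\<bar>"
    define d where "d = real n * Re (deriv f 0)"
    have b: "k * r ^ (n - 1) \<le> d" if r: "0 < r" for r
    proof -
      have "k * r ^ n \<le> real n * (Re (deriv f 0) * r)"
        unfolding k_def using n r by (intro taylor_coeff_bound[OF fb[of "r + 1"] _ _ _ sgn]) auto
      moreover have "r ^ n = r ^ (n - 1) * r" using n by (simp flip: power_Suc2)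
      ultimately have "k * r ^ (n - 1) * r \<le> d * r" by (simp add: d_def mult.assoc)
      then show ?thesis using r by simp
    qed
    have "k = 0"
    proof (rule ccontr)
      assume "k \<noteq> 0"
      then have k: "0 < k" by (simp add: k_def)
      \<comment> \<open>This makes \<open>r \<le> r ^ (n - 1)\<close> and \<open>k * r\<close>
        larger than \<open>d\<close>.\<close>
      define r where "r = max 1 (d / k + 1)"
      have "r ^ 1 \<le> r ^ (n - 1)" using n by (intro power_increasing) (auto simp: r_def)
      then have "k * r \<le> k * r ^ (n - 1)" using k by simp
      also have "\<dots> \<le> d" by (rule b) (simp add: r_def)
      finally have "k * r \<le> d" .
      moreover have "d < k * (d / k + 1)" using k by (simp add: distrib_left)
      moreover have "k * (d / k + 1) \<le> k * r" using k by (intro mult_left_mono) (auto simp: r_def)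
      ultimately show False by linarith
    qed
    moreover have "Re ((deriv ^^ n) f 0 / fact n) = Re ((deriv ^^ n) f 0) / fact n"
      by (metis Re_divide_of_real of_real_fact)
    ultimately have "Re ((deriv ^^ n) f 0) = 0" by (simp add: k_def)
    then show ?thesis using re[of 0 n] by (simp add: complex_eq_iff)
  qed
  have dc: "deriv f u = deriv f 0" for u
  proof (rule holomorphic_fun_eq_const_on_connected[of "deriv f" UNIV])
    show "deriv f holomorphic_on UNIV" using hd[of 1] by simp
    fix n :: nat assume "0 < n"
    then show "(deriv ^^ n) (deriv f) 0 = 0" using cz[of "Suc n"] by (simp add: funpow_swap1)
  qed auto
  have "((\<lambda>u. f u - deriv f 0 * u) has_field_derivative 0) (at u)" for u
    using holomorphic_derivI[OF f open_UNIV, of u] dc[of u]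
    by (auto intro!: derivative_eq_intros)
  then have "f z - deriv f 0 * z = f 0 - deriv f 0 * 0"
    using has_field_derivative_zero_constant[of UNIV "\<lambda>u. f u - deriv f 0 * u"] by (metis UNIV_I convex_UNIV)
  then show ?thesis by (simp add: diff_eq_eq)
qed

section \<open>Analytic continuation\<close>

text \<open>Changing the representative of a germ must count as a continuation, so that the set of
  all continuations contains every representative of its germs.\<close>

lemma continuation_const:
  assumes "z \<in> U" "f analytic_on {z}" "\<forall>\<^sub>F \<zeta> in nhds z. g \<zeta> = f \<zeta>"
  shows "analytic_continuation_in U z f z g"
  unfolding analytic_continuation_in_def
proof (intro exI conjI ballI)
  have g: "g analytic_on {z}" using assms analytic_at_cong by blast
  \<comment> \<open>The switch from \<open>f\<close> to \<open>g\<close> happens right after time 0.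
    It is invisible on germs, since both agree near \<open>z\<close>.\<close>
  let ?\<gamma> = "\<lambda>_::real. z" and ?F = "\<lambda>t::real. if t = 0 then f else g"
  show "path ?\<gamma>" by (simp add: path_def)
  show "path_image ?\<gamma> \<subseteq> U" using assms by (auto simp: path_image_def)
  show "pathstart ?\<gamma> = z" "pathfinish ?\<gamma> = z" by (simp_all add: pathstart_def pathfinish_def)
  show "?F 0 = f" "?F 1 = g" by simp_all
  show "?F t analytic_on {?\<gamma> t}" for t using assms g by simp
  have e: "\<forall>\<^sub>F \<zeta> in nhds z. ?F s \<zeta> = ?F t \<zeta>" for s t
    using assms(3) by (rule eventually_mono) auto
  show "\<forall>\<^sub>F s in at t within {0..1}. \<forall>\<^sub>F \<zeta> in nhds (?\<gamma> s). ?F s \<zeta> = ?F t \<zeta>" for t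
    by (rule always_eventually) (use e in blast)
qed

lemma continuation_in:
  assumes "analytic_continuation_in U z f w g"
  shows "z \<in> U" "w \<in> U" "f analytic_on {z}" "g analytic_on {w}"
proof -
  obtain \<gamma> F where *: "path \<gamma>" "path_image \<gamma> \<subseteq> U" "pathstart \<gamma> = z" "pathfinish \<gamma> = w"
    "F 0 = f" "F 1 = g" "\<forall>t\<in>{0..1}. F t analytic_on {\<gamma> t}"
    using assms unfolding analytic_continuation_in_def by blast
  show "z \<in> U" "w \<in> U" using *(2-4) pathstart_in_path_image pathfinish_in_path_image by blast+
  have "F 0 analytic_on {\<gamma> 0}" "F 1 analytic_on {\<gamma> 1}" using *(7) by auto
  then show "f analytic_on {z}" "g analytic_on {w}" using *(3-6) by (auto simp: pathstart_def pathfinish_def)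
qed

lemma continuation_sym:
  assumes "analytic_continuation_in U z f w g"
  shows "analytic_continuation_in U w g z f"
proof -
  obtain \<gamma> F where *: "path \<gamma>" "path_image \<gamma> \<subseteq> U" "pathstart \<gamma> = z" "pathfinish \<gamma> = w"
    "F 0 = f" "F 1 = g" "\<forall>t\<in>{0..1}. F t analytic_on {\<gamma> t}"
    and loc: "\<forall>t\<in>{0..1}. \<forall>\<^sub>F s in at t within {0..1}. \<forall>\<^sub>F \<zeta> in nhds (\<gamma> s). F s \<zeta> = F t \<zeta>"
    using assms unfolding analytic_continuation_in_def by blast
  have "\<forall>t\<in>{0..1}. \<forall>\<^sub>F s in at t within {0..1}. \<forall>\<^sub>F \<zeta> in nhds (reversepath \<gamma> s). F (1 - s) \<zeta> = F (1 - t) \<zeta>"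
  proof
    fix t :: real assume t: "t \<in> {0..1}"
    have fl: "filterlim (\<lambda>s. 1 - s) (at (1 - t) within {0..1}) (at t within {0..1})"
      unfolding filterlim_at
      by (auto simp: eventually_at_filter intro!: tendsto_eq_intros always_eventually)
    have "\<forall>\<^sub>F s in at (1 - t) within {0..1}. \<forall>\<^sub>F \<zeta> in nhds (\<gamma> s). F s \<zeta> = F (1 - t) \<zeta>"
      using loc t by auto
    from eventually_compose_filterlim[OF this fl]
    show "\<forall>\<^sub>F s in at t within {0..1}. \<forall>\<^sub>F \<zeta> in nhds (reversepath \<gamma> s). F (1 - s) \<zeta> = F (1 - t) \<zeta>"
      by (simp add: reversepath_def)
  qed
  then show ?thesis
    unfolding analytic_continuation_in_def using *
    by (intro exI[of _ "reversepath \<gamma>"] exI[of _ "\<lambda>t. F (1 - t)"]) (simp add: reversepath_def[of \<gamma>, symmetric], simp add: reversepath_def)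
qed

lemma continuation_trans:
  assumes "analytic_continuation_in U z f w g" "analytic_continuation_in U w g u h"
  shows "analytic_continuation_in U z f u h"
proof -
  obtain \<gamma>1 F1 where 1: "path \<gamma>1" "path_image \<gamma>1 \<subseteq> U" "pathstart \<gamma>1 = z" "pathfinish \<gamma>1 = w"
    "F1 0 = f" "F1 1 = g" "\<forall>t\<in>{0..1}. F1 t analytic_on {\<gamma>1 t}"
    "\<forall>t\<in>{0..1}. \<forall>\<^sub>F s in at t within {0..1}. \<forall>\<^sub>F \<zeta> in nhds (\<gamma>1 s). F1 s \<zeta> = F1 t \<zeta>"
    using assms(1) unfolding analytic_continuation_in_def by blast
  obtain \<gamma>2 F2 where 2: "path \<gamma>2" "path_image \<gamma>2 \<subseteq> U" "pathstart \<gamma>2 = w" "pathfinish \<gamma>2 = u"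
    "F2 0 = g" "F2 1 = h" "\<forall>t\<in>{0..1}. F2 t analytic_on {\<gamma>2 t}"
    "\<forall>t\<in>{0..1}. \<forall>\<^sub>F s in at t within {0..1}. \<forall>\<^sub>F \<zeta> in nhds (\<gamma>2 s). F2 s \<zeta> = F2 t \<zeta>"
    using assms(2) unfolding analytic_continuation_in_def by blast
  define F where "F = (\<lambda>t::real. if t \<le> 1/2 then F1 (2 * t) else F2 (2 * t - 1))"
  define \<gamma> where "\<gamma> = \<gamma>1 +++ \<gamma>2"
  have j: "pathfinish \<gamma>1 = pathstart \<gamma>2" using 1 2 by simp
  have left: "F t = F1 (2 * t)" "\<gamma> t = \<gamma>1 (2 * t)" if "t \<le> 1/2" for t
    using that by (auto simp: F_def \<gamma>_def joinpaths_def)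
  have mid: "F1 1 = F2 0" "\<gamma>1 1 = \<gamma>2 0" using 1(6) 2(5) j by (simp_all add: pathstart_def pathfinish_def)
  have right: "F t = F2 (2 * t - 1)" "\<gamma> t = \<gamma>2 (2 * t - 1)" if "1/2 \<le> t" for t
  proof -
    have "t = 1/2 \<or> \<not> t \<le> 1/2" using that by linarith
    then show "F t = F2 (2 * t - 1)" "\<gamma> t = \<gamma>2 (2 * t - 1)"
      using mid by (elim disjE; simp only: F_def \<gamma>_def joinpaths_def; simp)+
  qed
  have loc1: "\<forall>\<^sub>F s in at t within {0..1/2}. \<forall>\<^sub>F \<zeta> in nhds (\<gamma> s). F s \<zeta> = F t \<zeta>" if t: "t \<in> {0..1/2}" for t
  proof -
    have fl: "filterlim (\<lambda>s. 2 * s) (at (2 * t) within {0..1}) (at t within {0..1/2})"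
      unfolding filterlim_at
      by (auto simp: eventually_at_filter intro!: tendsto_eq_intros always_eventually)
    have "\<forall>\<^sub>F s in at (2 * t) within {0..1}. \<forall>\<^sub>F \<zeta> in nhds (\<gamma>1 s). F1 s \<zeta> = F1 (2 * t) \<zeta>"
      using 1(8) t by auto
    from eventually_compose_filterlim[OF this fl] have "\<forall>\<^sub>F s in at t within {0..1/2}. s \<in> {0..1/2} \<longrightarrow> (\<forall>\<^sub>F \<zeta> in nhds (\<gamma> s). F s \<zeta> = F t \<zeta>)"
      by (rule eventually_mono) (use left t in auto)
    then show ?thesis by (simp add: eventually_at_filter)
  qed
  have loc2: "\<forall>\<^sub>F s in at t within {1/2..1}. \<forall>\<^sub>F \<zeta> in nhds (\<gamma> s). F s \<zeta> = F t \<zeta>" if t: "t \<in> {1/2..1}" for t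
  proof -
    have fl: "filterlim (\<lambda>s. 2 * s - 1) (at (2 * t - 1) within {0..1}) (at t within {1/2..1})"
      unfolding filterlim_at
      by (auto simp: eventually_at_filter intro!: tendsto_eq_intros always_eventually)
    have "\<forall>\<^sub>F s in at (2 * t - 1) within {0..1}. \<forall>\<^sub>F \<zeta> in nhds (\<gamma>2 s). F2 s \<zeta> = F2 (2 * t - 1) \<zeta>"
      using 2(8) t by auto
    from eventually_compose_filterlim[OF this fl] have "\<forall>\<^sub>F s in at t within {1/2..1}. s \<in> {1/2..1} \<longrightarrow> (\<forall>\<^sub>F \<zeta> in nhds (\<gamma> s). F s \<zeta> = F t \<zeta>)"
      by (rule eventually_mono) (use right t in auto)
    then show ?thesis by (simp add: eventually_at_filter)
  qed
  have "\<forall>\<^sub>F s in at t within {0..1}. \<forall>\<^sub>F \<zeta> in nhds (\<gamma> s). F s \<zeta> = F t \<zeta>" if t: "t \<in> {0..1}" for t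
  proof -
    \<comment> \<open>At time 1/2 compatibility has to be checked from both sides; at any other time
      one of the two filters is trivial.\<close>
    have un: "at t within {0..1} = sup (at t within {0..1/2}) (at t within {1/2..1})"
      by (subst at_within_union[symmetric]) (simp add: ivl_disj_un_two_touch)
    have o: "at t within S = bot" if "\<not> t islimpt S" for S :: "real set" using that trivial_limit_within by blast
    have b1: "at t within {0..1/2::real} = bot" if "\<not> t \<le> 1/2"
      using that closed_limpt[of "{0..1/2::real}"] by (intro o) auto
    have b2: "at t within {1/2..1::real} = bot" if "\<not> 1/2 \<le> t"
      using that closed_limpt[of "{1/2..1::real}"] by (intro o) auto
    show ?thesis
      unfolding un eventually_sup using loc1[of t] loc2[of t] b1 b2 t
      by (cases "t \<le> 1/2"; cases "1/2 \<le> t") auto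
  qed
  moreover have "F t analytic_on {\<gamma> t}" if "t \<in> {0..1}" for t
    using 1(7) 2(7) left[of t] right[of t] that by (cases "t \<le> 1/2") auto
  moreover have "path \<gamma>" "path_image \<gamma> \<subseteq> U" "pathstart \<gamma> = z" "pathfinish \<gamma> = u"
    using 1 2 j by (auto simp: \<gamma>_def path_image_join)
  moreover have "F 0 = f" "F 1 = h" using 1 2 by (auto simp: F_def)
  ultimately show ?thesis unfolding analytic_continuation_in_def by blast
qed

text \<open>Along the segment to a nearby point, the representative \<open>g\<close> itself serves
  at all times.\<close>

lemma continuation_near:
  assumes "analytic_continuation_in U z f w g" "open U"
  shows "\<forall>\<^sub>F w' in nhds w. analytic_continuation_in U z f w' g"
proof -
  note w = continuation_in[OF assms(1)]
  obtain e1 where e1: "0 < e1" "ball w e1 \<subseteq> U" using assms(2) w by (meson open_contains_ball)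
  obtain e2 where e2: "0 < e2" "g holomorphic_on ball w e2" using w(4) unfolding analytic_at_ball by blast
  have "analytic_continuation_in U w g w' g" if w': "w' \<in> ball w (min e1 e2)" for w'
    unfolding analytic_continuation_in_def
  proof (intro exI[of _ "linepath w w'"] exI[of _ "\<lambda>_. g"] conjI ballI)
    have sub: "closed_segment w w' \<subseteq> ball w (min e1 e2)"
      using w' e1 e2 by (intro closed_segment_subset) auto
    moreover have "ball w (min e1 e2) \<subseteq> U" using e1(2) subset_ball[of "min e1 e2" e1 w] by simp
    ultimately show "path_image (linepath w w') \<subseteq> U" by simp
    fix t :: real assume t: "t \<in> {0..1}"
    have "linepath w w' t \<in> ball w e2" using sub t linepath_in_path[of t w w'] by auto
    then show "g analytic_on {linepath w w' t}" using e2 analytic_at open_ball by blast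
  qed auto
  then have "analytic_continuation_in U z f w' g" if "w' \<in> ball w (min e1 e2)" for w'
    using that continuation_trans[OF assms(1)] by blast
  moreover have "\<forall>\<^sub>F w' in nhds w. w' \<in> ball w (min e1 e2)"
    using e1 e2 by (intro eventually_nhds_in_open) auto
  ultimately show ?thesis by (simp add: eventually_mono)
qed

text \<open>Continuation within \<open>U\<close> is an equivalence relation on germs, so every
  member of a class generates the same class: a single class is irreducible by construction. What
  remains to be supplied is \<open>img\<close>, that each point of \<open>U\<close> carries a
  germ.\<close>

lemma mv_continuations:
  assumes U: "open U" and E: "E = {(w, g). analytic_continuation_in U z f w g}" and img: "U \<subseteq> fst ` E"
  shows "mv_analytic_on U E" "mv_irreducible_on U E"
proof -
  show "mv_analytic_on U E"
    unfolding mv_analytic_on_def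
  proof (intro conjI U)
    show "fst ` E = U" using img continuation_in(2) unfolding E by force
    show "\<forall>(w, g)\<in>E. g analytic_on {w} \<and> (\<forall>\<^sub>F w' in nhds w. (w', g) \<in> E) \<and>
       (\<forall>h. (\<forall>\<^sub>F \<zeta> in nhds w. h \<zeta> = g \<zeta>) \<longrightarrow> (w, h) \<in> E)"
    proof clarify
      fix w g assume "(w, g) \<in> E"
      then have ac: "analytic_continuation_in U z f w g" by (simp add: E)
      have "(w, h) \<in> E" if "\<forall>\<^sub>F \<zeta> in nhds w. h \<zeta> = g \<zeta>" for h
        using continuation_trans[OF ac continuation_const[OF continuation_in(2,4)[OF ac] that]] by (simp add: E)
      moreover have "\<forall>\<^sub>F w' in nhds w. (w', g) \<in> E" using continuation_near[OF ac U] by (simp add: E)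
      ultimately show "g analytic_on {w} \<and> (\<forall>\<^sub>F w' in nhds w. (w', g) \<in> E) \<and>
       (\<forall>h. (\<forall>\<^sub>F \<zeta> in nhds w. h \<zeta> = g \<zeta>) \<longrightarrow> (w, h) \<in> E)"
        using continuation_in(4)[OF ac] by blast
    qed
  qed
  show "mv_irreducible_on U E"
    unfolding mv_irreducible_on_def
  proof clarify
    fix w g assume "(w, g) \<in> E"
    then have ac: "analytic_continuation_in U z f w g" by (simp add: E)
    have "analytic_continuation_in U z f u h \<longleftrightarrow> analytic_continuation_in U w g u h" for u h
      using continuation_trans[OF ac] continuation_trans[OF continuation_sym[OF ac]] by blast
    then show "E = {(u, h). analytic_continuation_in U w g u h}" by (simp add: E)
  qed
qed

text \<open>Permanence of functional equations. \<open>P\<close> and \<open>Q\<close> are entire, so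
  the equation makes sense for every germ whatever its values, and the product form keeps zeros of
  \<open>Q\<close> harmless.\<close>

lemma continuation_functional_equation:
  assumes ac: "analytic_continuation_in U z f w g"
    and P: "P holomorphic_on UNIV" and Q: "Q holomorphic_on UNIV"
    and eq: "\<forall>\<^sub>F \<zeta> in nhds z. \<zeta> * Q (f \<zeta>) = P (f \<zeta>)"
  shows "\<forall>\<^sub>F \<zeta> in nhds w. \<zeta> * Q (g \<zeta>) = P (g \<zeta>)"
proof -
  obtain \<gamma> F where *: "path \<gamma>" "pathstart \<gamma> = z" "pathfinish \<gamma> = w"
    "F 0 = f" "F 1 = g" "\<forall>t\<in>{0..1}. F t analytic_on {\<gamma> t}"
    and loc: "\<forall>t\<in>{0..1}. \<forall>\<^sub>F s in at t within {0..1}. \<forall>\<^sub>F \<zeta> in nhds (\<gamma> s). F s \<zeta> = F t \<zeta>"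
    using ac unfolding analytic_continuation_in_def by blast
  define T where "T = (\<lambda>t. \<forall>\<^sub>F \<zeta> in nhds (\<gamma> t). \<zeta> * Q (F t \<zeta>) = P (F t \<zeta>))"
  have "T 1"
  proof (rule connected_induction_simple[of "{0..1::real}" 0 1 T])
    show "T 0" using eq * by (simp add: T_def pathstart_def)
    fix t :: real assume t: "t \<in> {0..1}"
    obtain e where e: "0 < e" "F t holomorphic_on ball (\<gamma> t) e" using *(6) t unfolding analytic_at_ball by blast
    define B where "B = ball (\<gamma> t) e"
    have hol: "(\<lambda>\<zeta>. \<zeta> * Q (F t \<zeta>) - P (F t \<zeta>)) holomorphic_on B"
      unfolding B_def by (intro holomorphic_intros holomorphic_on_compose_gen[OF e(2) P, unfolded o_def]
          holomorphic_on_compose_gen[OF e(2) Q, unfolded o_def]) auto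
    have "(\<gamma> \<longlongrightarrow> \<gamma> t) (at t within {0..1})" using *(1) t by (simp add: path_def continuous_on_def)
    then have "\<forall>\<^sub>F s in at t within {0..1}. \<gamma> s \<in> B"
      using e by (intro topological_tendstoD) (auto simp: B_def)
    with loc t have "\<forall>\<^sub>F s in at t within {0..1}. \<gamma> s \<in> B \<and> (\<forall>\<^sub>F \<zeta> in nhds (\<gamma> s). F s \<zeta> = F t \<zeta>)"
      by (intro eventually_conj) auto
    then obtain d where d: "0 < d" "\<forall>s\<in>{0..1}. s \<noteq> t \<and> dist s t < d \<longrightarrow> \<gamma> s \<in> B \<and> (\<forall>\<^sub>F \<zeta> in nhds (\<gamma> s). F s \<zeta> = F t \<zeta>)"
      unfolding eventually_at by auto
    have near: "\<gamma> s \<in> B \<and> (\<forall>\<^sub>F \<zeta> in nhds (\<gamma> s). F s \<zeta> = F t \<zeta>)" if "s \<in> {0..1}" "dist s t < d" for s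
      using d(2) that e by (cases "s = t") (auto simp: B_def)
    \<comment> \<open>At times near \<open>t\<close> the germ is that of \<open>F t\<close> at a
      point of the ball \<open>B\<close>. By the identity theorem, validity near one point of
      \<open>B\<close> is validity on all of \<open>B\<close>. Hence \<open>T\<close> is locally
      constant on a connected interval.\<close>
    have T_iff: "T s \<longleftrightarrow> (\<forall>\<zeta>\<in>B. \<zeta> * Q (F t \<zeta>) - P (F t \<zeta>) = 0)" if s: "s \<in> {0..1}" "dist s t < d" for s
    proof
      assume "T s"
      with near[OF s] have "\<forall>\<^sub>F \<zeta> in nhds (\<gamma> s). F s \<zeta> = F t \<zeta> \<and> \<zeta> * Q (F s \<zeta>) = P (F s \<zeta>)"
        unfolding T_def by (intro eventually_conj) auto
      then have "\<forall>\<^sub>F \<zeta> in nhds (\<gamma> s). \<zeta> * Q (F t \<zeta>) - P (F t \<zeta>) = 0"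
        by (rule eventually_mono) auto
      then obtain N where N: "open N" "\<gamma> s \<in> N" "\<forall>\<zeta>\<in>N. \<zeta> * Q (F t \<zeta>) - P (F t \<zeta>) = 0"
        unfolding eventually_nhds by blast
      show "\<forall>\<zeta>\<in>B. \<zeta> * Q (F t \<zeta>) - P (F t \<zeta>) = 0"
      proof
        fix \<zeta> assume z: "\<zeta> \<in> B"
        show "\<zeta> * Q (F t \<zeta>) - P (F t \<zeta>) = 0"
        proof (rule analytic_continuation_open[of "N \<inter> B" B _ "\<lambda>_. 0", OF _ _ _ _ _ hol _ _ z])
          show "open (N \<inter> B)" "N \<inter> B \<noteq> {}" using N near[OF s] by (auto simp: B_def)
        qed (use N in \<open>auto simp: B_def\<close>)
      qed
    next
      assume z: "\<forall>\<zeta>\<in>B. \<zeta> * Q (F t \<zeta>) - P (F t \<zeta>) = 0"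
      have "\<forall>\<^sub>F \<zeta> in nhds (\<gamma> s). \<zeta> \<in> B" using near[OF s] by (intro eventually_nhds_in_open) (auto simp: B_def)
      moreover have "\<forall>\<^sub>F \<zeta> in nhds (\<gamma> s). F s \<zeta> = F t \<zeta>" using near[OF s] by blast
      ultimately show "T s"
        unfolding T_def by eventually_elim (use z in auto)
    qed
    show "\<exists>S. openin (top_of_set {0..1}) S \<and> t \<in> S \<and> (\<forall>x\<in>S. \<forall>y\<in>S. T x \<longrightarrow> T y)"
    proof (intro exI[of _ "{0..1} \<inter> ball t d"] conjI ballI impI)
      show "openin (top_of_set {0..1}) ({0..1} \<inter> ball t d)" by (simp add: openin_open_Int)
      show "t \<in> {0..1} \<inter> ball t d" using t d by simp
      fix x y assume "x \<in> {0..1} \<inter> ball t d" "y \<in> {0..1} \<inter> ball t d" "T x"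
      then show "T y" using T_iff[of x] T_iff[of y] by (auto simp: dist_commute)
    qed
  qed auto
  then show ?thesis using * by (simp add: T_def pathfinish_def)
qed

section \<open>Inverting a Cayley transform\<close>

text \<open>Weierstrass factorisation of the meromorphic function \<open>S / C\<close> gives a
  numerator and a denominator without common zeros. The common factor is \<open>C / f2\<close> or
  \<open>S / S0\<close>, whichever has nonzero denominator; the two agree by cross-multiplication,
  and by coprimality their domains cover the plane.\<close>

lemma entire_pair_coprime:
  assumes S: "S holomorphic_on UNIV" and C: "C holomorphic_on UNIV" and nz: "C z0 \<noteq> 0"
  shows "\<exists>H S0 C0. H holomorphic_on UNIV \<and> S0 holomorphic_on UNIV \<and> C0 holomorphic_on UNIV \<and>
    (\<forall>z. S z = H z * S0 z) \<and> (\<forall>z. C z = H z * C0 z) \<and> (\<forall>z. \<not> (S0 z = 0 \<and> C0 z = 0))"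
proof -
  have an: "S analytic_on {z}" "C analytic_on {z}" for z
    using S C by (meson UNIV_I analytic_at open_UNIV)+
  define g where "g = remove_sings (\<lambda>z. S z / C z)"
  have "g nicely_meromorphic_on UNIV"
    unfolding g_def using an
    by (intro remove_sings_nicely_meromorphic meromorphic_intros analytic_on_imp_meromorphic_on)
      (auto simp: analytic_on_holomorphic S C)
  then obtain h f1 f2 where h: "h holomorphic_on UNIV" "f1 holomorphic_on UNIV" "f2 holomorphic_on UNIV"
    "\<forall>z. f1 z = 0 \<longleftrightarrow> \<not> is_pole g z \<and> g z = 0" "\<forall>z. f2 z = 0 \<longleftrightarrow> is_pole g z"
    "\<forall>z. h z \<noteq> 0" "\<forall>z. g z = h z * f1 z / f2 z"
    by (rule weierstrass_factorization_meromorphic_UNIV) blast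
  define S0 where "S0 = (\<lambda>z. h z * f1 z)"
  have S0: "S0 holomorphic_on UNIV" unfolding S0_def by (intro holomorphic_intros h)
  have cop: "\<not> (S0 z = 0 \<and> f2 z = 0)" for z using h(4-6) by (auto simp: S0_def)
  have loc: "C z * S0 z = S z * f2 z" if "C z \<noteq> 0" for z
  proof -
    have "(\<lambda>z. S z / C z) analytic_on {z}" using that by (intro analytic_intros an) auto
    then have a: "g analytic_on {z}" "g z = S z / C z"
      unfolding g_def by (auto intro: remove_sings_analytic_on)
    then have "f2 z \<noteq> 0" using h(5) analytic_at_imp_no_pole by blast
    moreover have "S z / C z = S0 z / f2 z" using a(2) h(7) by (simp add: S0_def)
    ultimately show ?thesis using that by (simp add: frac_eq_eq mult.commute)
  qed
  have cross: "C z * S0 z = S z * f2 z" for z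
  proof (rule analytic_continuation_open[of "{z. C z \<noteq> 0}" UNIV "\<lambda>z. C z * S0 z" "\<lambda>z. S z * f2 z"])
    have "continuous_on UNIV C" using C by (rule holomorphic_on_imp_continuous_on)
    then show "open {z. C z \<noteq> 0}" by (intro open_Collect_neq continuous_intros)
    show "{z. C z \<noteq> 0} \<noteq> {}" using nz by auto
  qed (auto intro!: holomorphic_intros C S S0 h(3) loc)
  define H where "H = (\<lambda>z. if f2 z \<noteq> 0 then C z / f2 z else S z / S0 z)"
  have H1: "H z = C z / f2 z" if "f2 z \<noteq> 0" for z using that by (simp add: H_def)
  have H2: "H z = S z / S0 z" if "S0 z \<noteq> 0" for z
    using that cross[of z] by (auto simp: H_def frac_eq_eq mult.commute)
  have CH: "C z = H z * f2 z" and SH: "S z = H z * S0 z" for z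
    using H1[of z] H2[of z] cross[of z] cop[of z] by (cases "f2 z = 0"; cases "S0 z = 0"; auto)+
  have op: "open {z. f2 z \<noteq> 0}" "open {z. S0 z \<noteq> 0}"
    using holomorphic_on_imp_continuous_on[OF h(3)] holomorphic_on_imp_continuous_on[OF S0]
    by (auto intro!: open_Collect_neq continuous_intros)
  have "H holomorphic_on {z. f2 z \<noteq> 0} \<union> {z. S0 z \<noteq> 0}"
  proof (rule holomorphic_on_Un[OF _ _ op])
    have "(\<lambda>z. C z / f2 z) holomorphic_on {z. f2 z \<noteq> 0}"
      by (intro holomorphic_intros holomorphic_on_subset[OF C] holomorphic_on_subset[OF h(3)]) auto
    then show "H holomorphic_on {z. f2 z \<noteq> 0}" by (rule holomorphic_transform) (use H1 in auto)
    have "(\<lambda>z. S z / S0 z) holomorphic_on {z. S0 z \<noteq> 0}"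
      by (intro holomorphic_intros holomorphic_on_subset[OF S] holomorphic_on_subset[OF S0]) auto
    then show "H holomorphic_on {z. S0 z \<noteq> 0}" by (rule holomorphic_transform) (use H2 in auto)
  qed
  moreover have "{z. f2 z \<noteq> 0} \<union> {z. S0 z \<noteq> 0} = UNIV" using cop by auto
  ultimately have "H holomorphic_on UNIV" by simp
  then show ?thesis using S0 h(3) CH SH cop by blast
qed

lemma Im_cayley:
  fixes a b :: complex
  assumes "a \<noteq> b"
  shows "Im (\<i> * (a + b) / (a - b)) = ((norm a)\<^sup>2 - (norm b)\<^sup>2) / (norm (a - b))\<^sup>2"
proof -
  have "\<i> * (a + b) / (a - b) = \<i> * ((a + b) * cnj (a - b)) / of_real ((norm (a - b))\<^sup>2)"
    by (subst complex_div_cnj) (simp add: mult.assoc)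
  then have "Im (\<i> * (a + b) / (a - b)) = Re ((a + b) * cnj (a - b)) / (norm (a - b))\<^sup>2"
    by (simp only: Im_divide_of_real) simp
  also have "Re ((a + b) * cnj (a - b)) = (norm a)\<^sup>2 - (norm b)\<^sup>2"
    unfolding cmod_power2 by (simp add: power2_eq_square algebra_simps)
  finally show ?thesis .
qed

text \<open>The inequalities say that \<open>P / Q\<close> maps the upper half plane into the unit
  disc and the lower one outside the closed disc. They are stated for \<open>P\<close> and
  \<open>Q\<close> separately because \<open>Q\<close> may vanish in the lower half plane.\<close>

locale unimodular_pair =
  fixes P Q :: "complex \<Rightarrow> complex"
  assumes P: "P holomorphic_on UNIV" and Q: "Q holomorphic_on UNIV"
    and coprime: "\<not> (P z = 0 \<and> Q z = 0)"
    and upper: "0 < Im z \<Longrightarrow> norm (P z) < norm (Q z)"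
    and lower: "Im z < 0 \<Longrightarrow> norm (Q z) < norm (P z)"
    and real: "Im z = 0 \<Longrightarrow> norm (P z) = norm (Q z)"
begin

definition "Z z = P z / Q z"

lemma norm_eq_iff: "norm (P z) = norm (Q z) \<longleftrightarrow> Im z = 0"
  using upper[of z] lower[of z] real[of z] by (cases "Im z" "0::real" rule: linorder_cases) auto

lemma Q_nonzero: "Im z = 0 \<Longrightarrow> Q z \<noteq> 0"
  using real[of z] coprime[of z] by auto

lemma norm_Z: "Im z = 0 \<Longrightarrow> norm (Z z) = 1"
  using real[of z] Q_nonzero[of z] by (simp add: Z_def norm_divide)

lemma open_Q_nonzero: "open {z. Q z \<noteq> 0}"
  using holomorphic_on_imp_continuous_on[OF Q] by (auto intro!: open_Collect_neq continuous_intros)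

lemma Z_holomorphic: "Z holomorphic_on {z. Q z \<noteq> 0}"
  unfolding Z_def by (intro holomorphic_intros holomorphic_on_subset[OF P] holomorphic_on_subset[OF Q]) auto

text \<open>The Moebius map sending \<open>u\<close> to infinity carries the unit disc to the upper
  half plane, so the transformed function is of Herglotz type. It is needed with
  \<open>- Z x\<close> for \<open>u\<close>, to differentiate at \<open>x\<close>, and with a value
  on the circle that \<open>Z\<close> omits.\<close>

lemma cayley_sign:
  assumes "norm u = 1" "u * Q z \<noteq> P z"
  shows "0 \<le> Im (\<i> * (u * Q z + P z) / (u * Q z - P z)) * Im z"
    "Im z \<noteq> 0 \<Longrightarrow> 0 < Im (\<i> * (u * Q z + P z) / (u * Q z - P z)) * Im z"
    "Im z = 0 \<Longrightarrow> Im (\<i> * (u * Q z + P z) / (u * Q z - P z)) = 0"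
proof -
  define d where "d = (norm (Q z))\<^sup>2 - (norm (P z))\<^sup>2"
  have eq: "Im (\<i> * (u * Q z + P z) / (u * Q z - P z)) = d / (norm (u * Q z - P z))\<^sup>2"
    unfolding Im_cayley[OF assms(2)] d_def by (simp add: norm_mult assms(1))
  have pos: "0 < (norm (u * Q z - P z))\<^sup>2" using assms(2) by simp
  have "0 < d" if "0 < Im z" using upper[OF that] by (simp add: d_def power_strict_mono)
  moreover have "d < 0" if "Im z < 0" using lower[OF that] by (simp add: d_def power_strict_mono)
  moreover have "d = 0" if "Im z = 0" using real[OF that] by (simp add: d_def)
  ultimately show "0 \<le> Im (\<i> * (u * Q z + P z) / (u * Q z - P z)) * Im z"
    "Im z \<noteq> 0 \<Longrightarrow> 0 < Im (\<i> * (u * Q z + P z) / (u * Q z - P z)) * Im z"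
    "Im z = 0 \<Longrightarrow> Im (\<i> * (u * Q z + P z) / (u * Q z - P z)) = 0"
    unfolding eq using pos
    by (cases "Im z" "0::real" rule: linorder_cases; simp add: zero_le_mult_iff zero_less_mult_iff zero_less_divide_iff divide_less_0_iff divide_le_0_iff zero_le_divide_iff)+
qed

text \<open>\<open>Z\<close> is unimodular on the real line, so \<open>Z' / Z\<close> is \<i> times
  the derivative of the argument, and the claim is that the argument strictly increases. With
  \<open>u\<close> opposite to \<open>Z x\<close> on the circle, the Herglotz function
  \<open>h\<close> is regular at 0, and \<open>deriv h 0\<close> is \<open>- \<i> / 2\<close> times
  \<open>Z' / Z\<close>.\<close>

lemma deriv_Z_sign:
  assumes x: "Im x = 0"
  shows "0 < Im (deriv Z x / Z x)"
proof -
  define u where "u = - Z x"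
  have u1: "norm u = 1" using norm_Z[OF x] by (simp add: u_def)
  define h where "h = (\<lambda>w. \<i> * (u * Q (x + w) + P (x + w)) / (u * Q (x + w) - P (x + w)))"
  have Qx: "Q x \<noteq> 0" by (rule Q_nonzero[OF x])
  have Zx: "Z x \<noteq> 0" using norm_Z[OF x] by auto
  have nz0: "u * Q x - P x \<noteq> 0" using Qx Zx by (auto simp: u_def Z_def)
  have sh: "(\<lambda>w. g (x + w)) holomorphic_on UNIV" if "g holomorphic_on UNIV" for g
    using holomorphic_on_compose_gen[OF _ that, of "\<lambda>w. x + w" UNIV] by (simp add: o_def holomorphic_intros)
  define N where "N = {w. u * Q (x + w) - P (x + w) \<noteq> 0}"
  have "open N" unfolding N_def
    by (intro open_Collect_neq continuous_intros holomorphic_on_imp_continuous_on[OF sh[OF P]] holomorphic_on_imp_continuous_on[OF sh[OF Q]])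
  moreover have "0 \<in> N" using nz0 by (simp add: N_def)
  ultimately obtain R where R: "0 < R" "ball 0 R \<subseteq> N" by (meson open_contains_ball)
  have hol: "h holomorphic_on N"
    unfolding h_def by (intro holomorphic_intros holomorphic_on_subset[OF sh[OF P]] holomorphic_on_subset[OF sh[OF Q]]) (auto simp: N_def)
  \<comment> \<open>One point with a strict sign is required; any nonreal point of the disc has
    it.\<close>
  define w0 where "w0 = \<i> * complex_of_real (R / 2)"
  have w0: "w0 \<in> ball 0 R" "Im w0 = R / 2" using R by (simp_all add: w0_def norm_mult)
  have "0 < Re (deriv h 0)"
  proof (rule herglotz_deriv_pos[where w = w0])
    show "h holomorphic_on ball 0 R" using holomorphic_on_subset[OF hol R(2)] .
    show "0 \<le> Im (h z) * Im z" if "z \<in> ball 0 R" for z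
      using cayley_sign(1)[OF u1, of "x + z"] that R(2) x by (auto simp: h_def N_def)
    show "w0 \<in> ball 0 R" by (rule w0)
    have ne: "u * Q (x + w0) \<noteq> P (x + w0)" using w0 R(2) by (auto simp: N_def)
    have im: "Im (x + w0) = Im w0" using x by simp
    have "Im (x + w0) \<noteq> 0" using im w0(2) R(1) by simp
    from cayley_sign(2)[OF u1 ne this] show "0 < Im (h w0) * Im w0" unfolding h_def im .
  qed
  moreover have "deriv h 0 = - \<i> * (deriv Z x / Z x) / 2"
  proof -
    have Zd: "(Z has_field_derivative deriv Z x) (at x)"
      using holomorphic_derivI[OF Z_holomorphic open_Q_nonzero] Qx by simp
    have heq: "\<forall>\<^sub>F w in nhds 0. h w = \<i> * (u + Z (x + w)) / (u - Z (x + w))"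
    proof -
      have "open {w. Q (x + w) \<noteq> 0}"
        by (intro open_Collect_neq continuous_intros holomorphic_on_imp_continuous_on[OF sh[OF Q]])
      then have "\<forall>\<^sub>F w in nhds 0. w \<in> {w. Q (x + w) \<noteq> 0}" using Qx by (intro eventually_nhds_in_open) auto
      then show ?thesis
      proof (rule eventually_mono)
        fix w assume "w \<in> {w. Q (x + w) \<noteq> 0}"
        then have q: "Q (x + w) \<noteq> 0" by simp
        have "u * Q (x + w) + P (x + w) = (u + Z (x + w)) * Q (x + w)"
          "u * Q (x + w) - P (x + w) = (u - Z (x + w)) * Q (x + w)"
          using q by (simp_all add: Z_def distrib_right left_diff_distrib)
        then show "h w = \<i> * (u + Z (x + w)) / (u - Z (x + w))" using q by (simp add: h_def)
      qed
    qed
    have Zd0: "((\<lambda>w. Z (x + w)) has_field_derivative deriv Z x) (at 0)"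
      using Zd by (simp add: DERIV_shift[of _ _ 0 x, symmetric] add.commute)
    have num: "((\<lambda>w. \<i> * (u + Z (x + w))) has_field_derivative \<i> * deriv Z x) (at 0)"
      by (auto intro!: derivative_eq_intros Zd0)
    have den: "((\<lambda>w. u - Z (x + w)) has_field_derivative - deriv Z x) (at 0)"
      by (auto intro!: derivative_eq_intros Zd0)
    have "u - Z (x + 0) \<noteq> 0" using Zx by (simp add: u_def)
    from DERIV_imp_deriv[OF DERIV_divide[OF num den this]]
    have "deriv h 0 = (\<i> * deriv Z x * (u - Z x) - \<i> * (u + Z x) * (- deriv Z x)) / ((u - Z x) * (u - Z x))"
      unfolding deriv_cong_ev[OF heq refl] by (simp only: add_0_right)
    also have "\<dots> = - \<i> * (deriv Z x / Z x) / 2"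
    proof -
      have "u - Z x = - (2 * Z x)" "u + Z x = 0" by (simp_all add: u_def)
      then show ?thesis unfolding \<open>u - Z x = - (2 * Z x)\<close> \<open>u + Z x = 0\<close> using Zx by simp
    qed
    finally show ?thesis .
  qed
  ultimately have "0 < Re (- \<i> * (deriv Z x / Z x) / 2)" by (simp only:)
  moreover have "Re (- \<i> * q / 2) = Im q / 2" for q by simp
  ultimately show ?thesis by (simp only:)
qed

text \<open>Off the real line \<open>Z\<close> may have critical points; \<open>W\<close> avoids them.\<close>

definition W where "W = connected_component_set {z. Q z \<noteq> 0 \<and> deriv Z z \<noteq> 0} 0"

lemma open_regular: "open {z. Q z \<noteq> 0 \<and> deriv Z z \<noteq> 0}"
proof -
  have "continuous_on {z. Q z \<noteq> 0} (deriv Z)"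
    by (intro holomorphic_on_imp_continuous_on holomorphic_deriv Z_holomorphic open_Q_nonzero)
  then have "open ({z. Q z \<noteq> 0} \<inter> deriv Z -` (- {0}))"
    by (intro continuous_open_preimage open_Q_nonzero) auto
  moreover have "{z. Q z \<noteq> 0} \<inter> deriv Z -` (- {0}) = {z. Q z \<noteq> 0 \<and> deriv Z z \<noteq> 0}" by auto
  ultimately show ?thesis by simp
qed

lemma open_W: "open W"
  unfolding W_def by (rule open_connected_component[OF open_regular])

lemma W_regular: "z \<in> W \<Longrightarrow> Q z \<noteq> 0" "z \<in> W \<Longrightarrow> deriv Z z \<noteq> 0"
  unfolding W_def using connected_component_subset[of "{z. Q z \<noteq> 0 \<and> deriv Z z \<noteq> 0}" 0] by auto

lemma deriv_Z_nonzero: "Im z = 0 \<Longrightarrow> deriv Z z \<noteq> 0"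
  using deriv_Z_sign[of z] by auto

lemma real_in_W: "Im z = 0 \<Longrightarrow> z \<in> W"
proof -
  have "connected {z. Im z = 0}"
    by (intro convex_connected) (simp add: convex_def)
  moreover have "{z. Im z = 0} \<subseteq> {z. Q z \<noteq> 0 \<and> deriv Z z \<noteq> 0}"
    using Q_nonzero deriv_Z_nonzero by auto
  ultimately have "{z. Im z = 0} \<subseteq> W" unfolding W_def by (intro connected_component_maximal) auto
  then show "Im z = 0 \<Longrightarrow> z \<in> W" by auto
qed

lemma path_connected_W: "path_connected W"
  using connected_open_path_connected[OF open_W] by (simp add: W_def)

lemma Z_holomorphic_W: "Z holomorphic_on W"
  using holomorphic_on_subset[OF Z_holomorphic] W_regular by auto

text \<open>Germs of the inverse are indexed by the point \<open>a\<close> and not by the value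
  \<open>Z a\<close>: several points with the same value give the several branches over it.\<close>

definition local_inverse :: "complex \<Rightarrow> (complex \<Rightarrow> complex) \<Rightarrow> bool" where
  "local_inverse a g \<longleftrightarrow> (\<exists>B. open B \<and> a \<in> B \<and> B \<subseteq> W \<and> open (Z ` B) \<and> g holomorphic_on Z ` B \<and> (\<forall>b\<in>B. g (Z b) = b))"

lemma local_inverse_exists:
  assumes a: "a \<in> W"
  shows "\<exists>g. local_inverse a g"
proof -
  obtain r where r: "0 < r" "ball a r \<subseteq> W" "inj_on Z (ball a r)"
    by (rule has_complex_derivative_locally_injective[OF Z_holomorphic_W a open_W W_regular(2)[OF a]])
  have hol: "Z holomorphic_on ball a r" using holomorphic_on_subset[OF Z_holomorphic_W r(2)] .
  obtain g where g: "g holomorphic_on Z ` ball a r" "\<And>b. b \<in> ball a r \<Longrightarrow> g (Z b) = b"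
    by (rule holomorphic_has_inverse[OF hol open_ball r(3)]) blast
  have "open (Z ` ball a r)" by (rule open_mapping_thm3[OF hol open_ball r(3)])
  then have "local_inverse a g"
    unfolding local_inverse_def using r g by (intro exI[of _ "ball a r"]) auto
  then show ?thesis by (intro exI[of _ g])
qed

definition G where "G a = (SOME g. local_inverse a g)"

lemma G: "a \<in> W \<Longrightarrow> local_inverse a (G a)"
  unfolding G_def using local_inverse_exists by (rule someI_ex)

lemma G_Z: "a \<in> W \<Longrightarrow> G a (Z a) = a"
  using G[of a] by (auto simp: local_inverse_def)

lemma G_analytic:
  assumes "a \<in> W"
  shows "G a analytic_on {Z a}"
proof -
  from assms obtain B where "a \<in> B" "open (Z ` B)" "G a holomorphic_on Z ` B"
    using G[of a] unfolding local_inverse_def by blast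
  then show ?thesis unfolding analytic_at by blast
qed

text \<open>No path has to be lifted: the path in the base is the image of a given path in
  \<open>W\<close>, and the germs \<open>G (p t)\<close> continue one another because neighbouring
  ones invert the same local restriction of \<open>Z\<close>.\<close>

lemma lift_continuation:
  assumes p: "path p" "path_image p \<subseteq> W"
  shows "analytic_continuation_in (Z ` W) (Z (pathstart p)) (G (pathstart p)) (Z (pathfinish p)) (G (pathfinish p))"
  unfolding analytic_continuation_in_def
proof (intro exI[of _ "Z \<circ> p"] exI[of _ "\<lambda>t. G (p t)"] conjI ballI)
  have pW: "p t \<in> W" if "t \<in> {0..1}" for t using p(2) that by (auto simp: path_image_def)
  have cZ: "continuous_on W Z" by (rule holomorphic_on_imp_continuous_on[OF Z_holomorphic_W])
  show "path (Z \<circ> p)" by (rule path_continuous_image[OF p(1) continuous_on_subset[OF cZ p(2)]])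
  show "path_image (Z \<circ> p) \<subseteq> Z ` W" using p(2) by (auto simp: path_image_def)
  show "pathstart (Z \<circ> p) = Z (pathstart p)" "pathfinish (Z \<circ> p) = Z (pathfinish p)"
    by (simp_all add: pathstart_def pathfinish_def)
  show "G (p 0) = G (pathstart p)" "G (p 1) = G (pathfinish p)" by (simp_all add: pathstart_def pathfinish_def)
  fix t :: real assume t: "t \<in> {0..1}"
  show "G (p t) analytic_on {(Z \<circ> p) t}" using G_analytic[OF pW[OF t]] by simp
  obtain B where B: "open B" "p t \<in> B" "B \<subseteq> W" "\<forall>b\<in>B. G (p t) (Z b) = b"
    using G[OF pW[OF t]] unfolding local_inverse_def by blast
  have "(p \<longlongrightarrow> p t) (at t within {0..1})" using p(1) t by (simp add: path_def continuous_on_def)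
  then have "\<forall>\<^sub>F s in at t within {0..1}. p s \<in> B" using B by (intro topological_tendstoD) auto
  moreover have "\<forall>\<^sub>F s in at t within {0..1}. s \<in> {0..1}" by (simp add: eventually_at_filter)
  ultimately show "\<forall>\<^sub>F s in at t within {0..1}. \<forall>\<^sub>F \<zeta> in nhds ((Z \<circ> p) s). G (p s) \<zeta> = G (p t) \<zeta>"
  proof eventually_elim
    case (elim s)
    obtain D where D: "open D" "p s \<in> D" "D \<subseteq> W" "open (Z ` D)" "G (p s) holomorphic_on Z ` D" "\<forall>b\<in>D. G (p s) (Z b) = b"
      using G[OF pW[OF elim(2)]] unfolding local_inverse_def by blast
    \<comment> \<open>By continuity, \<open>G (p s)\<close> takes values in \<open>B\<close> near
      \<open>Z (p s)\<close>. There \<open>\<zeta> = Z b\<close> with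
      \<open>b = G (p s) \<zeta>\<close> in \<open>B\<close>, so \<open>G (p t)\<close> returns the
      same \<open>b\<close>.\<close>
    have "continuous_on (Z ` D) (G (p s))" by (rule holomorphic_on_imp_continuous_on[OF D(5)])
    then have "open (Z ` D \<inter> G (p s) -` B)" by (rule continuous_open_preimage[OF _ D(4) B(1)])
    moreover have "(Z \<circ> p) s \<in> Z ` D \<inter> G (p s) -` B" using D elim by auto
    ultimately have "\<forall>\<^sub>F \<zeta> in nhds ((Z \<circ> p) s). \<zeta> \<in> Z ` D \<inter> G (p s) -` B"
      by (rule eventually_nhds_in_open)
    then show ?case
    proof (rule eventually_mono)
      fix \<zeta> assume "\<zeta> \<in> Z ` D \<inter> G (p s) -` B"
      then obtain b where "b \<in> D" "\<zeta> = Z b" "G (p s) \<zeta> \<in> B" by auto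
      then show "G (p s) \<zeta> = G (p t) \<zeta>" using D(6) B(4) by auto
    qed
  qed
qed

definition U where "U = Z ` W"

text \<open>The base point 0 stands for any point of \<open>W\<close>; the germs at the others are
  reached because \<open>W\<close> is path-connected.\<close>

definition E :: mvfun where "E = {(w, g). analytic_continuation_in U (Z 0) (G 0) w g}"

lemma germ_in_E:
  assumes a: "a \<in> W"
  shows "(Z a, G a) \<in> E"
proof -
  have "0 \<in> W" by (simp add: real_in_W)
  then obtain p where "path p" "path_image p \<subseteq> W" "pathstart p = 0" "pathfinish p = a"
    using path_connected_W a unfolding path_connected_def by blast
  then show ?thesis using lift_continuation[of p] by (simp add: E_def U_def)
qed

text \<open>Germs of \<open>E\<close> arise along arbitrary paths in \<open>U\<close>, not only
  along images of paths in \<open>W\<close>. The functional equation holds for all of them, and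
  every later statement about \<open>E\<close> on the circle is derived from it.\<close>

lemma E_equation:
  assumes "(w, g) \<in> E"
  shows "\<forall>\<^sub>F \<zeta> in nhds w. \<zeta> * Q (g \<zeta>) = P (g \<zeta>)"
proof -
  from assms have ac: "analytic_continuation_in U (Z 0) (G 0) w g" by (simp add: E_def)
  have "0 \<in> W" by (simp add: real_in_W)
  then obtain B where B: "0 \<in> B" "B \<subseteq> W" "open (Z ` B)" "\<forall>b\<in>B. G 0 (Z b) = b"
    using G[of 0] unfolding local_inverse_def by blast
  have "\<forall>\<^sub>F \<zeta> in nhds (Z 0). \<zeta> \<in> Z ` B" using B by (intro eventually_nhds_in_open) auto
  then have "\<forall>\<^sub>F \<zeta> in nhds (Z 0). \<zeta> * Q (G 0 \<zeta>) = P (G 0 \<zeta>)"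
  proof (rule eventually_mono)
    fix \<zeta> assume "\<zeta> \<in> Z ` B"
    then obtain b where "b \<in> B" "\<zeta> = Z b" by auto
    moreover have "Q b \<noteq> 0" using B(2) \<open>b \<in> B\<close> W_regular(1) by blast
    ultimately show "\<zeta> * Q (G 0 \<zeta>) = P (G 0 \<zeta>)" using B(4) by (simp add: Z_def)
  qed
  from continuation_functional_equation[OF ac P Q this] show ?thesis .
qed

lemma E_on_circle:
  assumes "(w, g) \<in> E" "norm w = 1"
  shows "Im (g w) = 0" "w * Q (g w) = P (g w)"
proof -
  show eq: "w * Q (g w) = P (g w)" using E_equation[OF assms(1)] eventually_nhds_x_imp_x by fast
  then have "norm (P (g w)) = norm (Q (g w))" using assms(2) by (metis mult_1 norm_mult)
  then show "Im (g w) = 0" using norm_eq_iff by blast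
qed

text \<open>On the circle a solution of \<open>w * Q \<mu> = P \<mu>\<close> is real, hence lies in
  \<open>W\<close>, and the germ \<open>G \<mu>\<close> attains it. The other inclusion is the
  functional equation at the point \<open>w\<close> itself.\<close>

lemma E_values:
  assumes w: "norm w = 1"
  shows "mv_values E w = {\<mu>. w * Q \<mu> = P \<mu>}"
proof (intro Set.set_eqI iffI)
  fix \<mu> assume "\<mu> \<in> mv_values E w"
  then show "\<mu> \<in> {\<mu>. w * Q \<mu> = P \<mu>}" using w E_on_circle(2) by (auto simp: mv_values_def)
next
  fix \<mu> assume "\<mu> \<in> {\<mu>. w * Q \<mu> = P \<mu>}"
  then have eq: "w * Q \<mu> = P \<mu>" by simp
  then have "norm (P \<mu>) = norm (Q \<mu>)" using w by (metis mult_1 norm_mult)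
  then have im: "Im \<mu> = 0" using norm_eq_iff by blast
  have "Z \<mu> = w" using eq Q_nonzero[OF im] by (simp add: Z_def flip: eq)
  then show "\<mu> \<in> mv_values E w"
    using germ_in_E[OF real_in_W[OF im]] G_Z[OF real_in_W[OF im]]
    unfolding mv_values_def by (intro CollectI exI[of _ "G \<mu>"]) simp
qed

lemma E_mv: "mv_analytic_on U E" "mv_irreducible_on U E"
proof -
  have oU: "open U" unfolding U_def
  proof (subst open_subopen, intro ballI)
    fix w assume "w \<in> Z ` W"
    then obtain a where a: "a \<in> W" "w = Z a" by auto
    then obtain B where "a \<in> B" "B \<subseteq> W" "open (Z ` B)" using G[of a] unfolding local_inverse_def by blast
    then show "\<exists>T. open T \<and> w \<in> T \<and> T \<subseteq> Z ` W" using a by (intro exI[of _ "Z ` B"]) auto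
  qed
  have "U \<subseteq> fst ` E"
  proof
    fix w assume "w \<in> U"
    then obtain a where "a \<in> W" "w = Z a" by (auto simp: U_def)
    then show "w \<in> fst ` E" using germ_in_E[of a] by (intro rev_image_eqI[of "(Z a, G a)"]) auto
  qed
  from mv_continuations[OF oU E_def this] show "mv_analytic_on U E" "mv_irreducible_on U E" .
qed

text \<open>Differentiating \<open>Z (f \<zeta>) = \<zeta>\<close> gives \<open>Z' * f' = 1\<close>.
  The derivative of the branch in the angle is therefore \<open>\<i> / q\<close> with
  \<open>q = Z' / Z\<close>, and its real part is \<open>Im q\<close> divided by the squared norm of
  \<open>q\<close>, positive by \<open>deriv_Z_sign\<close>.\<close>

lemma branch_strict_mono:
  assumes br: "circle_branch E a b \<phi>"
  shows "strict_mono_on {a<..<b} (\<lambda>\<theta>. Re (\<phi> \<theta>))"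
proof -
  have der: "\<exists>d. ((\<lambda>\<theta>. Re (\<phi> \<theta>)) has_real_derivative d) (at \<theta>) \<and> 0 < d" if \<theta>: "\<theta> \<in> {a<..<b}" for \<theta>
  proof -
    obtain f where f: "(cis \<theta>, f) \<in> E" "\<forall>\<^sub>F t in nhds \<theta>. \<phi> t = f (cis t)"
      using br \<theta> unfolding circle_branch_def by blast
    define x where "x = f (cis \<theta>)"
    have x: "Im x = 0" and eqx: "cis \<theta> * Q x = P x" using E_on_circle[OF f(1)] by (simp_all add: x_def)
    have Qx: "Q x \<noteq> 0" by (rule Q_nonzero[OF x])
    have Zx: "Z x = cis \<theta>" using Qx by (simp add: Z_def flip: eqx)
    have "f analytic_on {cis \<theta>}" using f(1) continuation_in(4) by (auto simp: E_def)
    then have fd: "(f has_field_derivative deriv f (cis \<theta>)) (at (cis \<theta>))"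
      by (simp add: DERIV_deriv_iff_field_differentiable analytic_on_imp_differentiable_at)
    have Zd: "(Z has_field_derivative deriv Z x) (at x)"
      using holomorphic_derivI[OF Z_holomorphic open_Q_nonzero] Qx by simp
    have d: "((\<lambda>\<zeta>. Z (f \<zeta>)) has_field_derivative deriv Z x * deriv f (cis \<theta>)) (at (cis \<theta>))"
      using DERIV_chain2[OF Zd[unfolded x_def] fd] by (simp add: x_def)
    \<comment> \<open>\<open>Q\<close> is nonzero at the real point \<open>x\<close>, hence along
      \<open>f\<close> near \<open>cis \<theta>\<close>, so the product form of the equation may be
      divided.\<close>
    have ev: "\<forall>\<^sub>F \<zeta> in nhds (cis \<theta>). Z (f \<zeta>) = \<zeta>"
    proof -
      have "isCont f (cis \<theta>)" using fd by (rule DERIV_isCont)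
      then have "(f \<longlongrightarrow> x) (nhds (cis \<theta>))" by (simp add: x_def isCont_def tendsto_nhds_iff)
      then have "\<forall>\<^sub>F \<zeta> in nhds (cis \<theta>). f \<zeta> \<in> {z. Q z \<noteq> 0}"
        using Qx by (intro topological_tendstoD open_Q_nonzero) auto
      with E_equation[OF f(1)] show ?thesis
        by eventually_elim (simp add: Z_def divide_eq_eq)
    qed
    have "((\<lambda>\<zeta>. \<zeta>) has_field_derivative deriv Z x * deriv f (cis \<theta>)) (at (cis \<theta>))"
      by (rule iffD1[OF DERIV_cong_ev[OF refl ev refl] d])
    then have prod: "deriv Z x * deriv f (cis \<theta>) = 1" by (rule DERIV_unique[OF _ DERIV_ident])
    have "(cis has_vector_derivative (\<i> * cis \<theta>)) (at \<theta>)"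
      unfolding has_vector_derivative_def by (rule has_derivative_cis[OF has_derivative_ident])
    from field_vector_diff_chain_at[OF this fd]
    have "((\<lambda>t. f (cis t)) has_vector_derivative (\<i> * cis \<theta> * deriv f (cis \<theta>))) (at \<theta>)" by (simp add: o_def)
    then have "(\<phi> has_vector_derivative (\<i> * cis \<theta> * deriv f (cis \<theta>))) (at \<theta>)"
      by (subst has_vector_derivative_cong_ev[where g = "\<lambda>t. f (cis t)"])
        (use f(2) eventually_nhds_x_imp_x[OF f(2)] in \<open>auto elim: eventually_mono\<close>)
    then have "((\<lambda>t. Re (\<phi> t)) has_real_derivative Re (\<i> * cis \<theta> * deriv f (cis \<theta>))) (at \<theta>)"
      unfolding has_real_derivative_iff_has_vector_derivative
      by (rule bounded_linear.has_vector_derivative[OF bounded_linear_Re])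
    moreover have "0 < Re (\<i> * cis \<theta> * deriv f (cis \<theta>))"
    proof -
      define q where "q = deriv Z x / Z x"
      have q: "0 < Im q" unfolding q_def by (rule deriv_Z_sign[OF x])
      have "cis \<theta> * deriv f (cis \<theta>) * q = 1" using prod by (simp add: q_def Zx mult_ac)
      moreover have "q \<noteq> 0" using q by auto
      ultimately have "\<i> * cis \<theta> * deriv f (cis \<theta>) = \<i> / q"
        by (simp add: eq_divide_eq mult.assoc)
      moreover have "Re (\<i> / q) = Im q / (norm q)\<^sup>2" by (simp add: Re_divide cmod_power2)
      ultimately show ?thesis using q \<open>q \<noteq> 0\<close> by simp
    qed
    ultimately show ?thesis by blast
  qed
  show ?thesis
  proof (rule strict_mono_onI)
    fix r s assume rs: "r \<in> {a<..<b}" "s \<in> {a<..<b}" "r < s"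
    show "Re (\<phi> r) < Re (\<phi> s)"
    proof (rule DERIV_pos_imp_increasing[OF rs(3)])
      fix t assume "r \<le> t" "t \<le> s"
      then have "t \<in> {a<..<b}" using rs by auto
      from der[OF this] show "\<exists>y. ((\<lambda>\<theta>. Re (\<phi> \<theta>)) has_real_derivative y) (at t) \<and> 0 < y" .
    qed
  qed
qed

end

text \<open>An omitted value \<open>w\<close> would turn the Cayley transform in the assumption into an entire Herglotz function,
  hence a linear one, contrary to its growth.\<close>

lemma (in unimodular_pair) circle_covered:
  assumes w: "norm w = 1"
    and growth: "\<And>d. 0 < d \<Longrightarrow> (\<And>z. w * Q z \<noteq> P z) \<Longrightarrow> \<exists>K. \<forall>\<^sub>F x in at_bot.
      norm (\<i> * (w * Q (of_real x) + P (of_real x)) / (w * Q (of_real x) - P (of_real x))) \<le> d * \<bar>x\<bar> + K"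
  shows "w \<in> U"
proof -
  have "\<exists>\<mu>. w * Q \<mu> = P \<mu>"
  proof (rule ccontr)
    assume "\<nexists>\<mu>. w * Q \<mu> = P \<mu>"
    then have ne: "w * Q z \<noteq> P z" for z by blast
    define h where "h = (\<lambda>z. \<i> * (w * Q z + P z) / (w * Q z - P z))"
    have hol: "h holomorphic_on UNIV" unfolding h_def by (intro holomorphic_intros P Q) (use ne in auto)
    have sgn: "0 \<le> Im (h z) * Im z" "Im z \<noteq> 0 \<Longrightarrow> 0 < Im (h z) * Im z" "Im z = 0 \<Longrightarrow> Im (h z) = 0" for z
      unfolding h_def by (fact cayley_sign[OF w ne])+
    have lin: "h z = h 0 + deriv h 0 * z" for z
      by (rule entire_herglotz_linear[OF hol]) (use sgn in auto)
    define d where "d = deriv h 0"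
    have "0 < Im (h \<i>)" using sgn(2)[of \<i>] by simp
    moreover have "Im (h 0) = 0" using sgn(3)[of 0] by simp
    ultimately have d: "d \<noteq> 0" using lin[of \<i>] by (auto simp: d_def)
    \<comment> \<open>Half of the slope suffices for the contradiction: the linear function exceeds
      this bound far enough to the left.\<close>
    obtain K where K: "\<forall>\<^sub>F x in at_bot. norm (h (of_real x)) \<le> norm d / 2 * \<bar>x\<bar> + K"
      using growth[of "norm d / 2"] d ne unfolding h_def by auto
    then obtain b where b: "\<And>x. x \<le> b \<Longrightarrow> norm (h (of_real x)) \<le> norm d / 2 * \<bar>x\<bar> + K"
      unfolding eventually_at_bot_linorder by blast
    define x where "x = min b (- (2 * (\<bar>K\<bar> + norm (h 0)) / norm d + 1))"
    have "norm d * \<bar>x\<bar> - norm (h 0) \<le> norm (h (of_real x))"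
      using norm_triangle_ineq2[of "d * of_real x" "- h 0"] lin[of "of_real x"] by (simp add: d_def norm_mult add.commute)
    also have "\<dots> \<le> norm d / 2 * \<bar>x\<bar> + K" by (rule b) (simp add: x_def)
    finally have "norm d * \<bar>x\<bar> \<le> 2 * (\<bar>K\<bar> + norm (h 0))" by simp
    then have "\<bar>x\<bar> \<le> 2 * (\<bar>K\<bar> + norm (h 0)) / norm d" using d by (simp add: pos_le_divide_eq mult.commute)
    moreover have "0 \<le> 2 * (\<bar>K\<bar> + norm (h 0)) / norm d" by simp
    ultimately show False by (simp add: x_def min_def split: if_splits)
  qed
  then obtain \<mu> where \<mu>: "w * Q \<mu> = P \<mu>" ..
  then have "norm (P \<mu>) = norm (Q \<mu>)" using w by (metis mult_1 norm_mult)
  then have im: "Im \<mu> = 0" using norm_eq_iff by blast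
  have "Z \<mu> = w" using Q_nonzero[OF im] by (simp add: Z_def flip: \<mu>)
  then show ?thesis using real_in_W[OF im] by (auto simp: U_def)
qed

text \<open>The conditions at -infinity have different tasks. \<open>nz\<close> bounds the common
  zeros from below and makes the quotient meaningful; \<open>sublin\<close> treats the omitted value
  -1, where the Cayley transform is \<open>S / C\<close> itself; \<open>inf\<close> treats all other
  values, where the transform stays bounded.\<close>

lemma dispersion_relation_of_pair:
  fixes S C :: "complex \<Rightarrow> complex"
  assumes S: "S holomorphic_on UNIV" and C: "C holomorphic_on UNIV"
    and upper: "\<And>z. 0 < Im z \<Longrightarrow> 0 < Im (S z * cnj (C z))"
    and lower: "\<And>z. Im z < 0 \<Longrightarrow> Im (S z * cnj (C z)) < 0"
    and nz: "\<forall>\<^sub>F x in at_bot. C (of_real x) \<noteq> 0"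
    and inf: "\<And>M. \<forall>\<^sub>F x in at_bot. M \<le> norm (S (of_real x) / C (of_real x))"
    and sublin: "\<And>d. 0 < d \<Longrightarrow> \<forall>\<^sub>F x in at_bot. norm (S (of_real x) / C (of_real x)) \<le> d * \<bar>x\<bar>"
  shows "\<exists>(\<Delta> :: real set) (U :: complex set) (\<Lambda> :: mvfun).
      bdd_below \<Delta> \<and> (\<forall>x. \<not> x islimpt \<Delta>) \<and>
      sphere 0 1 \<subseteq> U \<and> mv_analytic_on U \<Lambda> \<and>
      (\<forall>z\<in>sphere 0 1. mv_values \<Lambda> z \<subseteq> \<real>) \<and>
      (\<forall>z\<in>sphere 0 1. {\<mu>. (z + 1) * S \<mu> + \<i> * (z - 1) * C \<mu> = 0} = mv_values \<Lambda> z \<union> complex_of_real ` \<Delta>) \<and>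
      mv_irreducible_on U \<Lambda> \<and>
      (\<forall>a b \<phi>. circle_branch \<Lambda> a b \<phi> \<longrightarrow> strict_mono_on {a<..<b} (\<lambda>\<theta>. Re (\<phi> \<theta>)))"
proof -
  have "C \<i> \<noteq> 0" using upper[of \<i>] by auto
  then obtain H S0 C0 where H: "H holomorphic_on UNIV" and S0: "S0 holomorphic_on UNIV" and C0: "C0 holomorphic_on UNIV"
    and SH: "\<forall>z. S z = H z * S0 z" and CH: "\<forall>z. C z = H z * C0 z" and cop: "\<forall>z. \<not> (S0 z = 0 \<and> C0 z = 0)"
    using entire_pair_coprime[OF S C] by blast
  have Hnr: "H z \<noteq> 0" if "Im z \<noteq> 0" for z
  proof
    assume "H z = 0"
    then have "S z * cnj (C z) = 0" using SH by simp
    then show False using upper[of z] lower[of z] that by (cases "Im z" "0::real" rule: linorder_cases) auto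
  qed
  define v where "v = (\<lambda>z. Im (S0 z * cnj (C0 z)))"
  have vS: "Im (S z * cnj (C z)) = (norm (H z))\<^sup>2 * v z" for z
  proof -
    have "S z * cnj (C z) = of_real ((norm (H z))\<^sup>2) * (S0 z * cnj (C0 z))"
      unfolding complex_norm_square using SH CH by (simp add: mult_ac)
    then show ?thesis unfolding v_def by (simp only: Im_complex_of_real Re_complex_of_real times_complex.sel)
  qed
  have vup: "0 < v z" if "0 < Im z" for z
    using upper[OF that] Hnr[of z] that unfolding vS by (simp add: zero_less_mult_iff)
  have vlo: "v z < 0" if "Im z < 0" for z
    using lower[OF that] Hnr[of z] that unfolding vS by (simp add: mult_less_0_iff)
  \<comment> \<open>On the real line \<open>H\<close> may vanish, and then \<open>S * cnj C\<close>
    carries no information. The sign of \<open>v\<close> is inherited from both half planes by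
    continuity, which leaves only 0.\<close>
  have vre: "v z = 0" if "Im z = 0" for z
  proof -
    have "continuous_on UNIV v" unfolding v_def
      by (intro continuous_intros holomorphic_on_imp_continuous_on S0 C0)
    then have iso: "isCont v z" by (simp add: continuous_on_eq_continuous_at)
    have lim: "(\<lambda>n. z + \<i> * of_real (c * inverse (real (Suc n)))) \<longlonglongrightarrow> z" for c
    proof -
      have "(\<lambda>n. z + \<i> * of_real (c * inverse (real (Suc n)))) \<longlonglongrightarrow> z + \<i> * of_real (c * 0)"
        by (intro tendsto_intros LIMSEQ_inverse_real_of_nat)
      then show ?thesis by simp
    qed
    have l: "(\<lambda>n. v (z + \<i> * of_real (c * inverse (real (Suc n))))) \<longlonglongrightarrow> v z" for c
      by (rule isCont_tendsto_compose[OF iso lim])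
    have "0 \<le> v z"
      by (rule LIMSEQ_le_const[OF l[of 1]]) (auto intro!: less_imp_le[OF vup] simp: that simp del: of_nat_Suc)
    moreover have "v z \<le> 0"
      by (rule LIMSEQ_le_const2[OF l[of "-1"]]) (auto intro!: less_imp_le[OF vlo] simp: that simp del: of_nat_Suc)
    ultimately show ?thesis by simp
  qed
  define P where "P = (\<lambda>z. \<i> * C0 z - S0 z)"
  define Q where "Q = (\<lambda>z. \<i> * C0 z + S0 z)"
  have nQP: "(norm (Q z))\<^sup>2 - (norm (P z))\<^sup>2 = 4 * v z" for z
    unfolding Q_def P_def v_def cmod_power2 by (simp add: power2_eq_square algebra_simps)
  have nlt: "norm a < norm b" if "0 < (norm b)\<^sup>2 - (norm a)\<^sup>2" for a b :: complex
    using that by (simp add: power_less_imp_less_base[of _ 2])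
  interpret unimodular_pair P Q
  proof
    show "P holomorphic_on UNIV" "Q holomorphic_on UNIV"
      unfolding P_def Q_def by (intro holomorphic_intros S0 C0)+
    show "\<not> (P z = 0 \<and> Q z = 0)" for z
    proof
      assume "P z = 0 \<and> Q z = 0"
      then have "\<i> * C0 z - S0 z = 0" "\<i> * C0 z + S0 z = 0" by (auto simp: P_def Q_def)
      then have "S0 z = 0" by (simp add: complex_eq_iff)
      then show False using cop \<open>\<i> * C0 z + S0 z = 0\<close> by simp
    qed
    show "norm (P z) < norm (Q z)" if "0 < Im z" for z
      by (rule nlt) (use vup[OF that] nQP in simp)
    show "norm (Q z) < norm (P z)" if "Im z < 0" for z
      by (rule nlt) (use vlo[OF that] nQP[of z] in simp)
    show "norm (P z) = norm (Q z)" if "Im z = 0" for z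
      using vre[OF that] nQP[of z] by (simp add: power2_eq_iff_nonneg)
  qed
  have D: "(z + 1) * S \<mu> + \<i> * (z - 1) * C \<mu> = H \<mu> * (z * Q \<mu> - P \<mu>)" for z \<mu>
    unfolding SH[rule_format] CH[rule_format] P_def Q_def by (simp add: algebra_simps)
  define \<Delta> where "\<Delta> = {x::real. H (of_real x) = 0}"
  have zeros: "{\<mu>. H \<mu> = 0} = complex_of_real ` \<Delta>"
  proof (intro Set.set_eqI iffI)
    fix \<mu> assume "\<mu> \<in> {\<mu>. H \<mu> = 0}"
    then have "Im \<mu> = 0" "H \<mu> = 0" using Hnr by auto
    then have "\<mu> = of_real (Re \<mu>)" by (simp add: complex_eq_iff)
    then show "\<mu> \<in> complex_of_real ` \<Delta>" using \<open>H \<mu> = 0\<close> by (auto simp: \<Delta>_def intro!: image_eqI[of _ _ "Re \<mu>"])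
  qed (auto simp: \<Delta>_def)
  have bdd: "bdd_below \<Delta>"
  proof -
    obtain b where b: "\<And>x. x \<le> b \<Longrightarrow> C (of_real x) \<noteq> 0" using nz unfolding eventually_at_bot_linorder by blast
    have "b \<le> x" if "x \<in> \<Delta>" for x
    proof (rule ccontr)
      assume "\<not> b \<le> x"
      then show False using b[of x] that CH by (simp add: \<Delta>_def)
    qed
    then show ?thesis by (rule bdd_belowI)
  qed
  \<comment> \<open>An accumulation point of zeros would make \<open>H\<close> vanish identically,
    but \<open>H\<close> has no nonreal zeros.\<close>
  have disc: "\<not> x islimpt \<Delta>" for x
  proof
    assume x: "x islimpt \<Delta>"
    have "of_real x islimpt complex_of_real ` \<Delta>"
      unfolding islimpt_approachable
    proof (intro allI impI)
      fix e :: real assume "0 < e"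
      then obtain y where "y \<in> \<Delta>" "y \<noteq> x" "dist y x < e" using x unfolding islimpt_approachable by blast
      then show "\<exists>x'\<in>complex_of_real ` \<Delta>. x' \<noteq> of_real x \<and> dist x' (of_real x) < e" by (intro bexI[of _ "of_real y"]) auto
    qed
    then have "H \<i> = 0"
    proof (rule analytic_continuation[OF H open_UNIV connected_UNIV subset_UNIV UNIV_I _ _ UNIV_I])
      fix z assume "z \<in> complex_of_real ` \<Delta>"
      then show "H z = 0" by (auto simp: \<Delta>_def)
    qed
    then show False using Hnr[of \<i>] by simp
  qed
  have cov: "w \<in> U" if w: "norm w = 1" for w
  proof (rule circle_covered[OF w])
    fix d :: real assume d: "0 < d" and ne: "\<And>z. w * Q z \<noteq> P z"
    define N where "N = (\<lambda>x. S (complex_of_real x) / C (of_real x))"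
    define h where "h = (\<lambda>x. \<i> * (w * Q (of_real x) + P (of_real x)) / (w * Q (of_real x) - P (of_real x)))"
    have hN: "\<forall>\<^sub>F x in at_bot. h x = \<i> * ((w + 1) * \<i> + (w - 1) * N x) / ((w - 1) * \<i> + (w + 1) * N x)"
      using nz
    proof eventually_elim
      case (elim x)
      then have c: "C0 (of_real x) \<noteq> 0" "H (of_real x) \<noteq> 0" using CH by auto
      then have S0N: "S0 (of_real x) = N x * C0 (of_real x)" unfolding N_def using SH CH by simp
      have "w * Q (of_real x) + P (of_real x) = ((w + 1) * \<i> + (w - 1) * N x) * C0 (of_real x)"
        "w * Q (of_real x) - P (of_real x) = ((w - 1) * \<i> + (w + 1) * N x) * C0 (of_real x)"
        unfolding P_def Q_def S0N by (simp_all add: algebra_simps)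
      then show ?case using c by (simp add: h_def)
    qed
    have "\<exists>K. \<forall>\<^sub>F x in at_bot. norm (h x) \<le> d * \<bar>x\<bar> + K"
    proof (cases "w = -1")
      case True
      have "\<forall>\<^sub>F x in at_bot. norm (h x) \<le> d * \<bar>x\<bar> + 0"
        using hN sublin[OF d]
      proof eventually_elim
        case (elim x)
        have "h x = N x" unfolding elim(1) True by (simp add: field_simps)
        then show ?case using elim(2) by (simp add: N_def)
      qed
      then show "\<exists>K. \<forall>\<^sub>F x in at_bot. norm (h x) \<le> d * \<bar>x\<bar> + K" by blast
    next
      case False
      define k where "k = norm (w + 1)"
      have k: "0 < k" using False by (simp add: k_def add_eq_0_iff2)
      have w2: "norm (w + 1) \<le> 2" "norm (w - 1) \<le> 2"
        using norm_triangle_ineq[of w 1] norm_triangle_ineq4[of w 1] w by auto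
      have "\<forall>\<^sub>F x in at_bot. norm (h x) \<le> d * \<bar>x\<bar> + 8 / k"
        using hN inf[of "max 1 (4 / k)"]
      proof eventually_elim
        case (elim x)
        \<comment> \<open>Once \<open>1 \<le> n\<close> and \<open>4 \<le> k * n\<close>, the
          numerator is at most \<open>4 * n\<close> and the denominator at least
          \<open>k * n / 2\<close>; this is the source of \<open>8 / k\<close>.\<close>
        define n where "n = norm (N x)"
        have n: "1 \<le> n" "4 / k \<le> n" using elim(2) by (auto simp: n_def N_def)
        have "norm ((w + 1) * \<i> + (w - 1) * N x) \<le> norm (w + 1) * 1 + norm (w - 1) * n"
          by (rule order_trans[OF norm_triangle_ineq]) (simp add: norm_mult n_def)
        also have "\<dots> \<le> 2 * n + 2 * n" using w2 n by (intro add_mono mult_mono) auto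
        finally have num: "norm ((w + 1) * \<i> + (w - 1) * N x) \<le> 4 * n" by simp
        have "k * n - 2 \<le> norm ((w + 1) * N x) - norm (- ((w - 1) * \<i>))"
          using w2 by (simp add: norm_mult k_def n_def)
        also have "\<dots> \<le> norm ((w - 1) * \<i> + (w + 1) * N x)"
          using norm_triangle_ineq2[of "(w + 1) * N x" "- ((w - 1) * \<i>)"] by (simp add: add.commute)
        finally have "k * n - 2 \<le> norm ((w - 1) * \<i> + (w + 1) * N x)" .
        moreover have "4 \<le> k * n" using n(2) k by (simp add: pos_divide_le_eq mult.commute)
        ultimately have den: "k * n / 2 \<le> norm ((w - 1) * \<i> + (w + 1) * N x)" by simp
        have "norm (h x) \<le> 4 * n / (k * n / 2)"
          unfolding elim(1) norm_divide using num den k n by (intro frac_le) (auto simp: norm_mult)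
        also have "\<dots> = 8 / k" using n k by simp
        also have "\<dots> \<le> d * \<bar>x\<bar> + 8 / k" using d by simp
        finally show ?case .
      qed
      then show "\<exists>K. \<forall>\<^sub>F x in at_bot. norm (h x) \<le> d * \<bar>x\<bar> + K" by blast
    qed
    then show "\<exists>K. \<forall>\<^sub>F x in at_bot. norm (\<i> * (w * Q (of_real x) + P (of_real x)) / (w * Q (of_real x) - P (of_real x))) \<le> d * \<bar>x\<bar> + K"
      by (simp only: h_def)
  qed
  have vals: "{\<mu>. (z + 1) * S \<mu> + \<i> * (z - 1) * C \<mu> = 0} = mv_values E z \<union> complex_of_real ` \<Delta>"
    if "norm z = 1" for z
    unfolding D E_values[OF that] zeros[symmetric] by auto
  have "mv_values E z \<subseteq> \<real>" if "norm z = 1" for z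
    using E_on_circle(1) that by (auto simp: mv_values_def complex_is_Real_iff)
  then show ?thesis
    using bdd disc cov E_mv vals branch_strict_mono
    by (intro exI[of _ \<Delta>] exI[of _ U] exI[of _ E]) auto
qed

section \<open>The characteristic equation of a quantum graph\<close>

lemma continuous_AE_zero:
  fixes f :: "real \<Rightarrow> complex"
  assumes f: "continuous_on {0..L} f" and ae: "AE x in lebesgue_on {0..L}. f x = 0" and x: "x \<in> {0..L}" and L: "0 < L"
  shows "f x = 0"
proof -
  have z: "L2_on L (\<lambda>_. 0 :: complex)" by (rule L2_on_continuous) auto
  have "integral {0..L} (\<lambda>x. (norm (f x))\<^sup>2) = integral {0..L} (\<lambda>x. (norm (0 :: complex))\<^sup>2)"
    by (rule L2_on_AE_cong(2)[OF z]) (use ae in simp)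
  then have i0: "integral {0..L} (\<lambda>x. (norm (f x))\<^sup>2) = 0" by simp
  have c: "continuous_on {0..L} (\<lambda>x. (norm (f x))\<^sup>2)" by (intro continuous_intros f)
  have "((\<lambda>x. (norm (f x))\<^sup>2) has_integral 0) {0..L}"
    using integrable_integral[OF integrable_continuous_interval[OF c]] i0 by simp
  then have "((\<lambda>x. (norm (f x))\<^sup>2) has_integral 0) (cbox 0 L)" by (simp only: cbox_interval)
  from has_integral_0_cbox_imp_0[OF _ _ this, of x] c x L
  have "(norm (f x))\<^sup>2 = 0" by auto
  then show ?thesis by simp
qed

lemma solves_zero_deriv:
  assumes s: "solves q k L f f1" and L: "0 < L" and z: "\<And>x. x \<in> {0..L} \<Longrightarrow> f x = 0"
  shows "f1 0 = 0"
proof -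
  have "(f has_vector_derivative f1 0) (at 0 within {0..L})" using s L by (simp add: solves_def)
  moreover have "(f has_vector_derivative 0) (at 0 within {0..L})"
    by (rule has_vector_derivative_transform[where f = "\<lambda>_. 0"]) (use L z in auto)
  ultimately show ?thesis
    using vector_derivative_unique_within_closed_interval[of 0 L 0 f "f1 0" 0] L by (simp add: cbox_interval)
qed

text \<open>\<open>p0\<close> is an arbitrary end at \<open>v\<close>. Its value represents f(v) in
  the continuity conditions, and its row of the linear system is the one left over for the condition
  on the derivatives: degree d at \<open>v\<close> means d - 1 continuity conditions and one
  derivative condition.\<close>

locale quantum_graph =
  fixes G :: "('v, 'e) pre_digraph" and len :: "'e \<Rightarrow> real" and V :: "'e \<Rightarrow> real \<Rightarrow> real"
    and inc :: "'v \<Rightarrow> ('e \<times> bool) list" and A B :: "'v \<Rightarrow> complex mat" and v :: 'v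
    and p0 :: "'e \<times> bool"
  assumes graph: "compact_metric_graph G len"
    and p0: "p0 \<in> ends_at G v"
    and V: "e \<in> arcs G \<Longrightarrow> L2_on (len e) (V e)"
    and sa: "w \<in> verts G - {v} \<Longrightarrow> selfadjoint_condition G w (inc w) (A w) (B w)"
begin

lemma finite_arcs: "finite (arcs G)" and finite_verts: "finite (verts G)"
  and len_pos: "e \<in> arcs G \<Longrightarrow> 0 < len e"
  using graph fin_digraph.finite_arcs fin_digraph.finite_verts by (auto simp: compact_metric_graph_def)

definition ends :: "('e \<times> bool) set" where "ends = arcs G \<times> UNIV"

definition vert :: "'e \<times> bool \<Rightarrow> 'v" where "vert p = (if snd p then head G (fst p) else tail G (fst p))"

lemma finite_ends: "finite ends" by (simp add: ends_def finite_arcs)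

lemma vert_in: "p \<in> ends \<Longrightarrow> vert p \<in> verts G"
proof -
  assume p: "p \<in> ends"
  have wf: "wf_digraph G" using graph fin_digraph.axioms(1) by (auto simp: compact_metric_graph_def)
  show "vert p \<in> verts G"
    using p wf_digraph.head_in_verts[OF wf] wf_digraph.tail_in_verts[OF wf] by (auto simp: ends_def vert_def)
qed

lemma ends_at_eq: "ends_at G w = {p \<in> ends. vert p = w}"
  by (auto simp: ends_at_def ends_def vert_def)

lemma p0_in: "p0 \<in> ends" "vert p0 = v" using p0 by (auto simp: ends_at_eq)

lemma sum_ends: "(\<Sum>p\<in>ends. g p) = (\<Sum>w\<in>verts G. \<Sum>p\<in>ends_at G w. g p)"
  unfolding ends_at_eq using vert_in by (intro sum.group[symmetric] finite_ends finite_verts) auto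

lemma sum_ends_arcs: "(\<Sum>p\<in>ends. g p) = (\<Sum>e\<in>arcs G. g (e, False) + g (e, True))"
proof -
  have "(\<Sum>p\<in>ends. g p) = (\<Sum>e\<in>arcs G. \<Sum>b\<in>UNIV. g (e, b))"
    unfolding ends_def by (subst sum.cartesian_product) simp
  then show ?thesis by (simp add: UNIV_bool add.commute)
qed

text \<open>The conditions at all edge ends as one square linear system in the values \<open>F\<close> and derivatives
  \<open>F'\<close>; the row of \<open>p0\<close> carries the derivative condition at \<open>v\<close>, with coefficients \<open>\<alpha>\<close>, \<open>\<beta>\<close>.\<close>

definition pos :: "'e \<times> bool \<Rightarrow> nat" where
  "pos p = (SOME i. i < length (inc (vert p)) \<and> inc (vert p) ! i = p)"

definition row :: "complex \<Rightarrow> complex \<Rightarrow> 'e \<times> bool \<Rightarrow> ('e \<times> bool \<Rightarrow> complex) \<Rightarrow> ('e \<times> bool \<Rightarrow> complex) \<Rightarrow> complex" where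
  "row \<alpha> \<beta> p F F' =
    (if vert p = v then (if p = p0 then \<alpha> * (\<Sum>q\<in>ends_at G v. F' q) + \<beta> * F p0 else F p - F p0)
     else (\<Sum>k<length (inc (vert p)). A (vert p) $$ (pos p, k) * F (inc (vert p) ! k)) +
       (\<Sum>k<length (inc (vert p)). B (vert p) $$ (pos p, k) * F' (inc (vert p) ! k)))"

lemma row_zero [simp]: "row \<alpha> \<beta> p (\<lambda>_. 0) (\<lambda>_. 0) = 0"
  by (simp add: row_def)

lemma row_add: "row \<alpha> \<beta> p (\<lambda>q. F q + H q) (\<lambda>q. F' q + H' q) = row \<alpha> \<beta> p F F' + row \<alpha> \<beta> p H H'"
  by (simp add: row_def distrib_left sum.distrib)

lemma row_scale: "row \<alpha> \<beta> p (\<lambda>q. c * F q) (\<lambda>q. c * F' q) = c * row \<alpha> \<beta> p F F'"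
  by (simp add: row_def distrib_left right_diff_distrib sum_distrib_left mult.left_commute)

lemma row_sum:
  assumes "finite J"
  shows "row \<alpha> \<beta> p (\<lambda>q. \<Sum>j\<in>J. x j * F j q) (\<lambda>q. \<Sum>j\<in>J. x j * F' j q) = (\<Sum>j\<in>J. x j * row \<alpha> \<beta> p (F j) (F' j))"
  using assms by (induction J rule: finite_induct) (simp_all add: row_add row_scale)

lemma inc_props:
  assumes "w \<in> verts G - {v}"
  shows "distinct (inc w)" "set (inc w) = ends_at G w"
    "A w \<in> carrier_mat (length (inc w)) (length (inc w))" "B w \<in> carrier_mat (length (inc w)) (length (inc w))"
  using sa[OF assms] by (auto simp: selfadjoint_condition_def Let_def)

lemma pos: "p \<in> ends \<Longrightarrow> vert p \<noteq> v \<Longrightarrow> pos p < length (inc (vert p)) \<and> inc (vert p) ! pos p = p"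
proof -
  assume p: "p \<in> ends" "vert p \<noteq> v"
  then have "p \<in> set (inc (vert p))" using inc_props(2)[of "vert p"] vert_in[of p] by (auto simp: ends_at_eq)
  then have "\<exists>i. i < length (inc (vert p)) \<and> inc (vert p) ! i = p" by (auto simp: in_set_conv_nth)
  then show "pos p < length (inc (vert p)) \<and> inc (vert p) ! pos p = p" unfolding pos_def by (rule someI_ex)
qed

text \<open>Rows away from \<open>v\<close> do not involve \<open>\<alpha>\<close> and
  \<open>\<beta>\<close>, so these are arbitrary here. The equivalence serves the operator as well
  as the system with both coefficients 0.\<close>

lemma matrix_condition_iff:
  assumes w: "w \<in> verts G - {v}"
  shows "A w *\<^sub>v vec_of_list (map F (inc w)) + B w *\<^sub>v vec_of_list (map F' (inc w)) = 0\<^sub>v (length (inc w))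
    \<longleftrightarrow> (\<forall>p\<in>ends_at G w. row \<alpha> \<beta> p F F' = 0)"
proof -
  define d where "d = length (inc w)"
  have dims: "dim_row (A w) = d" "dim_col (A w) = d" "dim_row (B w) = d" "dim_col (B w) = d"
    using inc_props(3,4)[OF w] by (auto simp: d_def)
  define r where "r = (\<lambda>i. (\<Sum>k<d. A w $$ (i, k) * F (inc w ! k)) + (\<Sum>k<d. B w $$ (i, k) * F' (inc w ! k)))"
  have ent: "(A w *\<^sub>v vec_of_list (map F (inc w)) + B w *\<^sub>v vec_of_list (map F' (inc w))) $ i = r i" if "i < d" for i
    using that dims by (simp add: scalar_prod_def atLeast0LessThan d_def r_def vec_of_list_index)
  have "A w *\<^sub>v vec_of_list (map F (inc w)) + B w *\<^sub>v vec_of_list (map F' (inc w)) = 0\<^sub>v (length (inc w)) \<longleftrightarrow> (\<forall>i<d. r i = 0)"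
  proof
    assume eq: "A w *\<^sub>v vec_of_list (map F (inc w)) + B w *\<^sub>v vec_of_list (map F' (inc w)) = 0\<^sub>v (length (inc w))"
    show "\<forall>i<d. r i = 0"
    proof (intro allI impI)
      fix i assume i: "i < d"
      show "r i = 0" using ent[OF i] i unfolding eq by (simp add: d_def)
    qed
  next
    assume z: "\<forall>i<d. r i = 0"
    show "A w *\<^sub>v vec_of_list (map F (inc w)) + B w *\<^sub>v vec_of_list (map F' (inc w)) = 0\<^sub>v (length (inc w))"
    proof (rule eq_vecI)
      fix i assume "i < dim_vec (0\<^sub>v (length (inc w)))"
      then have i: "i < d" by (simp add: d_def)
      show "(A w *\<^sub>v vec_of_list (map F (inc w)) + B w *\<^sub>v vec_of_list (map F' (inc w))) $ i = 0\<^sub>v (length (inc w)) $ i"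
        unfolding ent[OF i] using z i by (simp add: d_def)
    qed (simp add: dims d_def[symmetric])
  qed
  also have "\<dots> \<longleftrightarrow> (\<forall>p\<in>ends_at G w. row \<alpha> \<beta> p F F' = 0)"
  proof -
    have rp: "row \<alpha> \<beta> p F F' = r (pos p)" if "p \<in> ends_at G w" for p
      using that w by (simp add: ends_at_eq row_def r_def d_def)
    have posw: "pos p < d" "inc w ! pos p = p" if "p \<in> ends_at G w" for p
    proof -
      have p: "p \<in> ends" "vert p = w" using that by (simp_all add: ends_at_eq)
      then have "vert p \<noteq> v" using w by simp
      from pos[OF p(1) this] show "pos p < d" "inc w ! pos p = p" unfolding p(2) d_def by blast+
    qed
    have ex: "\<exists>p\<in>ends_at G w. pos p = i" if i: "i < d" for i
    proof (intro bexI[of _ "inc w ! i"])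
      have "inc w ! i \<in> set (inc w)" using i by (simp add: d_def)
      then show m: "inc w ! i \<in> ends_at G w" unfolding inc_props(2)[OF w] .
      from posw[OF m] have "pos (inc w ! i) < length (inc w) \<and> inc w ! pos (inc w ! i) = inc w ! i"
        unfolding d_def by blast
      then show "pos (inc w ! i) = i" using nth_eq_iff_index_eq[OF inc_props(1)[OF w], of "pos (inc w ! i)" i] i by (simp add: d_def)
    qed
    show ?thesis
    proof
      assume "\<forall>i<d. r i = 0"
      then show "\<forall>p\<in>ends_at G w. row \<alpha> \<beta> p F F' = 0" by (auto simp: rp intro: posw(1))
    next
      assume z: "\<forall>p\<in>ends_at G w. row \<alpha> \<beta> p F F' = 0"
      show "\<forall>i<d. r i = 0"
      proof (intro allI impI)
        fix i assume "i < d"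
        then obtain p where p: "p \<in> ends_at G w" "pos p = i" using ex by blast
        show "r i = 0" using z p rp[OF p(1)] by simp
      qed
    qed
  qed
  finally show ?thesis .
qed

text \<open>The existentially quantified common value at \<open>v\<close> is replaced by the value
  at \<open>p0\<close>; all conditions thereby become linear equations, one for each edge
  end.\<close>

lemma boundary_condition_iff:
  "delta_condition G len v z f \<and> (\<forall>w\<in>verts G - {v}. matrix_condition len (inc w) (A w) (B w) f)
    \<longleftrightarrow> (\<forall>p\<in>ends. row (z + 1) (\<i> * (z - 1)) p (end_value len f) (end_deriv len f) = 0)"
proof -
  let ?r = "\<lambda>p. row (z + 1) (\<i> * (z - 1)) p (end_value len f) (end_deriv len f)"
  have v: "delta_condition G len v z f \<longleftrightarrow> (\<forall>p\<in>ends_at G v. ?r p = 0)"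
  proof
    assume "delta_condition G len v z f"
    then obtain c where c: "\<forall>p\<in>ends_at G v. end_value len f p = c"
      "(z + 1) * (\<Sum>p\<in>ends_at G v. end_deriv len f p) = - \<i> * (z - 1) * c" unfolding delta_condition_def by blast
    show "\<forall>p\<in>ends_at G v. ?r p = 0"
    proof
      fix p assume p: "p \<in> ends_at G v"
      then have vp: "vert p = v" by (simp add: ends_at_eq)
      have "end_value len f p = c" "end_value len f p0 = c" using c(1) p p0 by blast+
      then show "?r p = 0" by (simp add: row_def vp c(2))
    qed
  next
    assume r: "\<forall>p\<in>ends_at G v. ?r p = 0"
    have "end_value len f p = end_value len f p0" if "p \<in> ends_at G v" for p
      using r[rule_format, OF that] that by (cases "p = p0") (auto simp: row_def ends_at_eq)
    moreover have "(z + 1) * (\<Sum>p\<in>ends_at G v. end_deriv len f p) + \<i> * (z - 1) * end_value len f p0 = 0"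
      using r[rule_format, OF p0] p0_in by (simp add: row_def)
    then have "(z + 1) * (\<Sum>p\<in>ends_at G v. end_deriv len f p) = - \<i> * (z - 1) * end_value len f p0"
      by (simp add: eq_neg_iff_add_eq_0)
    ultimately show "delta_condition G len v z f" unfolding delta_condition_def by blast
  qed
  have w: "matrix_condition len (inc w) (A w) (B w) f \<longleftrightarrow> (\<forall>p\<in>ends_at G w. ?r p = 0)" if "w \<in> verts G - {v}" for w
    unfolding matrix_condition_def by (rule matrix_condition_iff[OF that])
  have "v \<in> verts G" using vert_in[OF p0_in(1)] p0_in(2) by simp
  then have "(\<forall>p\<in>ends. ?r p = 0) \<longleftrightarrow> (\<forall>p\<in>ends_at G v. ?r p = 0) \<and> (\<forall>w\<in>verts G - {v}. \<forall>p\<in>ends_at G w. ?r p = 0)"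
  proof (intro iffI conjI ballI)
    fix p assume a: "(\<forall>p\<in>ends_at G v. ?r p = 0) \<and> (\<forall>w\<in>verts G - {v}. \<forall>p\<in>ends_at G w. ?r p = 0)" and p: "p \<in> ends"
    show "?r p = 0"
    proof (cases "vert p = v")
      case True
      then have "p \<in> ends_at G v" using p by (simp add: ends_at_eq)
      then show ?thesis using a by blast
    next
      case False
      then have "vert p \<in> verts G - {v}" "p \<in> ends_at G (vert p)" using p vert_in by (simp_all add: ends_at_eq)
      then show ?thesis using a by blast
    qed
  qed (simp_all add: ends_at_eq)
  then show ?thesis using v w by simp
qed

text \<open>The index \<open>(e, False)\<close> stands for the initial data \<open>f 0 = 1\<close>, \<open>f' 0 = 0\<close> on \<open>e\<close>, and \<open>(e, True)\<close> for
  \<open>f 0 = 0\<close>, \<open>f' 0 = 1\<close>; both refer to the coordinate \<open>0\<close>, not to an end of \<open>e\<close>.\<close>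

definition fund :: "complex \<Rightarrow> 'e \<times> bool \<Rightarrow> (real \<Rightarrow> complex) \<times> (real \<Rightarrow> complex)" where
  "fund \<mu> j = (SOME h. solves (\<lambda>t. complex_of_real (V (fst j) t) - \<mu>) (\<lambda>_. 0) (len (fst j)) (fst h) (snd h) \<and>
     fst h 0 = (if snd j then 0 else 1) \<and> snd h 0 = (if snd j then 1 else 0))"

definition "phi \<mu> j = fst (fund \<mu> j)"
definition "phi1 \<mu> j = snd (fund \<mu> j)"

lemma fund:
  assumes "j \<in> ends"
  shows "solves (\<lambda>t. complex_of_real (V (fst j) t) - \<mu>) (\<lambda>_. 0) (len (fst j)) (phi \<mu> j) (phi1 \<mu> j)"
    "phi \<mu> j 0 = (if snd j then 0 else 1)" "phi1 \<mu> j 0 = (if snd j then 1 else 0)"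
proof -
  have e: "fst j \<in> arcs G" using assms by (auto simp: ends_def)
  have z: "(\<lambda>_. 0 :: complex) absolutely_integrable_on {0..len (fst j)}" by simp
  obtain f f1 where "solves (\<lambda>t. complex_of_real (V (fst j) t) - \<mu>) (\<lambda>_. 0) (len (fst j)) f f1"
    "f 0 = (if snd j then 0 else 1)" "f1 0 = (if snd j then 1 else 0)"
    by (rule solves_exists[OF potential_minus_absolutely_integrable[OF V[OF e]] z less_imp_le[OF len_pos[OF e]]])
  then have "\<exists>h. solves (\<lambda>t. complex_of_real (V (fst j) t) - \<mu>) (\<lambda>_. 0) (len (fst j)) (fst h) (snd h) \<and>
     fst h 0 = (if snd j then 0 else 1) \<and> snd h 0 = (if snd j then 1 else 0)"
    by (intro exI[of _ "(f, f1)"]) simp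
  from someI_ex[OF this]
  show "solves (\<lambda>t. complex_of_real (V (fst j) t) - \<mu>) (\<lambda>_. 0) (len (fst j)) (phi \<mu> j) (phi1 \<mu> j)"
    "phi \<mu> j 0 = (if snd j then 0 else 1)" "phi1 \<mu> j 0 = (if snd j then 1 else 0)"
    unfolding phi_def phi1_def fund_def by auto
qed

definition val :: "complex \<Rightarrow> 'e \<times> bool \<Rightarrow> 'e \<times> bool \<Rightarrow> complex" where
  "val \<mu> p j = (if fst p = fst j then phi \<mu> j (if snd p then len (fst p) else 0) else 0)"

text \<open>The minus sign at the head turns the derivative into the edge. The derivatives come from
  \<open>phi1\<close>, for which holomorphy in \<open>\<mu>\<close> is known.\<close>

definition dval :: "complex \<Rightarrow> 'e \<times> bool \<Rightarrow> 'e \<times> bool \<Rightarrow> complex" where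
  "dval \<mu> p j = (if fst p = fst j then (if snd p then - phi1 \<mu> j (len (fst p)) else phi1 \<mu> j 0) else 0)"

lemma val_holomorphic:
  assumes "j \<in> ends"
  shows "(\<lambda>\<mu>. val \<mu> p j) holomorphic_on UNIV" "(\<lambda>\<mu>. dval \<mu> p j) holomorphic_on UNIV"
proof -
  have e: "fst j \<in> arcs G" using assms by (auto simp: ends_def)
  note h = solves_holomorphic[OF L2_on_absolutely_integrable[OF L2_on_of_real[OF V[OF e]]] less_imp_le[OF len_pos[OF e]],
      of "\<lambda>\<mu>. phi \<mu> j" "\<lambda>\<mu>. phi1 \<mu> j", OF fund(1,2,3)[OF assms]]
  have l: "len (fst j) \<in> {0..len (fst j)}" "0 \<in> {0..len (fst j)}" using len_pos[OF e] by auto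
  show "(\<lambda>\<mu>. val \<mu> p j) holomorphic_on UNIV"
    using h(1)[OF l(1)] h(1)[OF l(2)] by (cases "fst p = fst j"; cases "snd p") (simp_all add: val_def)
  show "(\<lambda>\<mu>. dval \<mu> p j) holomorphic_on UNIV"
    using h(2)[OF l(1)] h(2)[OF l(2)]
    by (cases "fst p = fst j"; cases "snd p") (simp_all add: dval_def holomorphic_on_minus)
qed

definition comb :: "complex \<Rightarrow> ('e \<times> bool \<Rightarrow> complex) \<Rightarrow> 'e \<Rightarrow> real \<Rightarrow> complex" where
  "comb \<mu> x e t = x (e, False) * phi \<mu> (e, False) t + x (e, True) * phi \<mu> (e, True) t"

definition comb1 :: "complex \<Rightarrow> ('e \<times> bool \<Rightarrow> complex) \<Rightarrow> 'e \<Rightarrow> real \<Rightarrow> complex" where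
  "comb1 \<mu> x e t = x (e, False) * phi1 \<mu> (e, False) t + x (e, True) * phi1 \<mu> (e, True) t"

lemma comb:
  assumes e: "e \<in> arcs G"
  shows "solves (\<lambda>t. complex_of_real (V e t) - \<mu>) (\<lambda>_. 0) (len e) (comb \<mu> x e) (comb1 \<mu> x e)"
    "comb \<mu> x e 0 = x (e, False)" "comb1 \<mu> x e 0 = x (e, True)"
proof -
  have j: "(e, b) \<in> ends" for b using e by (simp add: ends_def)
  show "solves (\<lambda>t. complex_of_real (V e t) - \<mu>) (\<lambda>_. 0) (len e) (comb \<mu> x e) (comb1 \<mu> x e)"
    using solves_linear[OF fund(1)[OF j[of False], of \<mu>, simplified] fund(1)[OF j[of True], of \<mu>, simplified], of "x (e, False)" "x (e, True)"]
    unfolding comb_def[abs_def] comb1_def[abs_def] by simp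
  show "comb \<mu> x e 0 = x (e, False)" "comb1 \<mu> x e 0 = x (e, True)"
    using fund(2,3)[OF j[of False], of \<mu>] fund(2,3)[OF j[of True], of \<mu>] by (simp_all add: comb_def comb1_def)
qed

lemma end_deriv_solves:
  assumes "p \<in> ends" "solves q k (len (fst p)) (f (fst p)) f1"
  shows "end_deriv len f p = (if snd p then - f1 (len (fst p)) else f1 0)"
proof -
  have e: "0 < len (fst p)" using assms(1) len_pos by (auto simp: ends_def)
  have "vector_derivative (f (fst p)) (at x within {0..len (fst p)}) = f1 x" if "x \<in> {0..len (fst p)}" for x
    using assms(2) that e unfolding solves_def
    by (intro vector_derivative_within_closed_interval) auto
  then show ?thesis using e by (cases p) (auto simp: end_deriv_def)
qed

lemma sum_over_ends_diag:
  assumes "p \<in> ends" "\<And>j. fst p \<noteq> fst j \<Longrightarrow> g j = 0"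
  shows "(\<Sum>j\<in>ends. g j) = g (fst p, False) + g (fst p, True)"
proof -
  have "(\<Sum>j\<in>ends. g j) = (\<Sum>e\<in>arcs G. if e = fst p then g (e, False) + g (e, True) else 0)"
    unfolding sum_ends_arcs using assms(2) by (intro sum.cong) auto
  also have "\<dots> = g (fst p, False) + g (fst p, True)"
    using assms(1) finite_arcs by (auto simp: ends_def)
  finally show ?thesis .
qed

lemma comb_ends:
  assumes "p \<in> ends"
  shows "end_value len (comb \<mu> x) p = (\<Sum>j\<in>ends. x j * val \<mu> p j)"
    "end_deriv len (comb \<mu> x) p = (\<Sum>j\<in>ends. x j * dval \<mu> p j)"
proof -
  have e: "fst p \<in> arcs G" using assms by (auto simp: ends_def)
  show "end_value len (comb \<mu> x) p = (\<Sum>j\<in>ends. x j * val \<mu> p j)"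
    by (subst sum_over_ends_diag[OF assms])
      (auto simp: val_def end_value_def comb_def split: prod.splits)
  show "end_deriv len (comb \<mu> x) p = (\<Sum>j\<in>ends. x j * dval \<mu> p j)"
  proof -
    have "end_deriv len (comb \<mu> x) p = (if snd p then - comb1 \<mu> x (fst p) (len (fst p)) else comb1 \<mu> x (fst p) 0)"
      by (rule end_deriv_solves[OF assms]) (rule comb(1)[OF e])
    then show ?thesis by (subst sum_over_ends_diag[OF assms]) (auto simp: dval_def comb1_def)
  qed
qed

lemma row_cong:
  assumes "p \<in> ends" "\<And>q. q \<in> ends \<Longrightarrow> F q = H q" "\<And>q. q \<in> ends \<Longrightarrow> F' q = H' q"
  shows "row \<alpha> \<beta> p F F' = row \<alpha> \<beta> p H H'"
proof (cases "vert p = v")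
  case True
  then show ?thesis unfolding row_def using assms p0_in by (auto simp: ends_at_eq intro!: sum.cong)
next
  case False
  then have w: "vert p \<in> verts G - {v}" using vert_in assms(1) by auto
  have "inc (vert p) ! k \<in> ends" if "k < length (inc (vert p))" for k
    using inc_props(2)[OF w] that nth_mem by (fastforce simp: ends_at_eq)
  then show ?thesis unfolding row_def using False assms by (auto intro!: sum.cong)
qed

definition K :: "complex \<Rightarrow> complex \<Rightarrow> complex \<Rightarrow> 'e \<times> bool \<Rightarrow> 'e \<times> bool \<Rightarrow> complex" where
  "K \<mu> \<alpha> \<beta> p j = row \<alpha> \<beta> p (\<lambda>q. val \<mu> q j) (\<lambda>q. dval \<mu> q j)"

lemma row_comb:
  assumes "p \<in> ends"
  shows "row \<alpha> \<beta> p (end_value len (comb \<mu> x)) (end_deriv len (comb \<mu> x)) = (\<Sum>j\<in>ends. K \<mu> \<alpha> \<beta> p j * x j)"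
proof -
  have "row \<alpha> \<beta> p (end_value len (comb \<mu> x)) (end_deriv len (comb \<mu> x))
      = row \<alpha> \<beta> p (\<lambda>q. \<Sum>j\<in>ends. x j * val \<mu> q j) (\<lambda>q. \<Sum>j\<in>ends. x j * dval \<mu> q j)"
    by (rule row_cong[OF assms]) (simp_all add: comb_ends)
  then show ?thesis unfolding row_sum[OF finite_ends] K_def by (simp add: mult.commute)
qed

lemma K_off: "p \<noteq> p0 \<Longrightarrow> K \<mu> \<alpha> \<beta> p j = K \<mu> 0 0 p j"
  by (simp add: K_def row_def)

lemma K_p0: "K \<mu> \<alpha> \<beta> p0 j = \<alpha> * (\<Sum>q\<in>ends_at G v. dval \<mu> q j) + \<beta> * val \<mu> p0 j"
  by (simp add: K_def row_def p0_in)

lemma K_holomorphic: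
  assumes "j \<in> ends"
  shows "(\<lambda>\<mu>. K \<mu> \<alpha> \<beta> p j) holomorphic_on UNIV"
  unfolding K_def row_def
  by (cases "vert p = v"; cases "p = p0") (auto intro!: holomorphic_intros val_holomorphic[OF assms])

text \<open>\<open>\<alpha>\<close> and \<open>\<beta>\<close> are free instead of being tied to
  \<open>z\<close>: the choices (0, 0), (0, 1) and (1, - flux) later recover \<open>S / C\<close>
  from the mere vanishing of \<open>\<alpha> * S \<mu> + \<beta> * C \<mu>\<close>.\<close>

definition singular :: "complex \<Rightarrow> complex \<Rightarrow> complex \<Rightarrow> bool" where
  "singular \<mu> \<alpha> \<beta> \<longleftrightarrow> (\<exists>x. (\<exists>i\<in>ends. x i \<noteq> 0) \<and> (\<forall>p\<in>ends. (\<Sum>j\<in>ends. K \<mu> \<alpha> \<beta> p j * x j) = 0))"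

text \<open>Only the row of \<open>p0\<close> contains \<open>\<alpha>\<close> and
  \<open>\<beta>\<close>, and linearly. Expansion along it collects the derivative sums in
  \<open>S\<close> and the values in \<open>C\<close>. The equivalence includes those
  \<open>\<mu>\<close> at which both vanish.\<close>

lemma characteristic_pair:
  "\<exists>S C. S holomorphic_on UNIV \<and> C holomorphic_on UNIV \<and> (\<forall>\<mu> \<alpha> \<beta>. singular \<mu> \<alpha> \<beta> \<longleftrightarrow> \<alpha> * S \<mu> + \<beta> * C \<mu> = 0)"
proof -
  have "\<exists>c. (\<forall>j\<in>ends. (\<lambda>\<mu>. c \<mu> j) holomorphic_on UNIV) \<and>
    (\<forall>\<mu> r. (\<exists>x. (\<exists>i\<in>ends. x i \<noteq> 0) \<and> (\<forall>i\<in>ends-{p0}. (\<Sum>j\<in>ends. K \<mu> 0 0 i j * x j) = 0) \<and> (\<Sum>j\<in>ends. r j * x j) = 0)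
       \<longleftrightarrow> (\<Sum>j\<in>ends. r j * c \<mu> j) = 0)"
    by (rule homogeneous_system_cofactors[OF finite_ends p0_in(1)]) (rule K_holomorphic)
  then obtain c where hol: "\<forall>j\<in>ends. (\<lambda>\<mu>. c \<mu> j) holomorphic_on UNIV" and
    c: "\<forall>\<mu> r. (\<exists>x. (\<exists>i\<in>ends. x i \<noteq> 0) \<and> (\<forall>i\<in>ends-{p0}. (\<Sum>j\<in>ends. K \<mu> 0 0 i j * x j) = 0) \<and> (\<Sum>j\<in>ends. r j * x j) = 0)
       \<longleftrightarrow> (\<Sum>j\<in>ends. r j * c \<mu> j) = 0" by blast
  define S where "S = (\<lambda>\<mu>. \<Sum>j\<in>ends. (\<Sum>q\<in>ends_at G v. dval \<mu> q j) * c \<mu> j)"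
  define C where "C = (\<lambda>\<mu>. \<Sum>j\<in>ends. val \<mu> p0 j * c \<mu> j)"
  have "S holomorphic_on UNIV" "C holomorphic_on UNIV"
    unfolding S_def C_def using hol by (auto intro!: holomorphic_intros val_holomorphic)
  moreover have "singular \<mu> \<alpha> \<beta> \<longleftrightarrow> \<alpha> * S \<mu> + \<beta> * C \<mu> = 0" for \<mu> \<alpha> \<beta>
  proof -
    have split: "(\<forall>p\<in>ends. Pr p) \<longleftrightarrow> (\<forall>p\<in>ends-{p0}. Pr p) \<and> Pr p0" for Pr using p0_in by auto
    have "singular \<mu> \<alpha> \<beta> \<longleftrightarrow> (\<exists>x. (\<exists>i\<in>ends. x i \<noteq> 0) \<and> (\<forall>i\<in>ends-{p0}. (\<Sum>j\<in>ends. K \<mu> 0 0 i j * x j) = 0) \<and> (\<Sum>j\<in>ends. K \<mu> \<alpha> \<beta> p0 j * x j) = 0)"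
    proof -
      have "(\<Sum>j\<in>ends. K \<mu> \<alpha> \<beta> p j * x j) = (\<Sum>j\<in>ends. K \<mu> 0 0 p j * x j)" if "p \<in> ends - {p0}" for p x
        using that by (intro sum.cong refl) (subst K_off, auto)
      then have "(\<forall>p\<in>ends-{p0}. (\<Sum>j\<in>ends. K \<mu> \<alpha> \<beta> p j * x j) = 0) \<longleftrightarrow> (\<forall>p\<in>ends-{p0}. (\<Sum>j\<in>ends. K \<mu> 0 0 p j * x j) = 0)" for x
        by (intro ball_cong refl) simp
      then show ?thesis unfolding singular_def split by simp
    qed
    also have "\<dots> \<longleftrightarrow> (\<Sum>j\<in>ends. K \<mu> \<alpha> \<beta> p0 j * c \<mu> j) = 0"
      by (rule c[THEN spec, THEN spec])
    also have "(\<Sum>j\<in>ends. K \<mu> \<alpha> \<beta> p0 j * c \<mu> j) = \<alpha> * S \<mu> + \<beta> * C \<mu>"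
      unfolding S_def C_def sum_distrib_left sum.distrib[symmetric]
      unfolding K_p0 by (intro sum.cong refl) (simp add: distrib_right mult.assoc)
    finally show ?thesis .
  qed
  ultimately show ?thesis by blast
qed

end

section \<open>The spectrum as the set of parameters with a singular linear system\<close>

context quantum_graph
begin

abbreviation "pot \<mu> e \<equiv> (\<lambda>t. complex_of_real (V e t) - \<mu>)"

lemma hamiltonian_iff:
  "(f, u) \<in> hamiltonian G len V inc A B v z \<longleftrightarrow>
    (\<forall>p\<in>ends. row (z + 1) (\<i> * (z - 1)) p (end_value len f) (end_deriv len f) = 0) \<and>
    (\<forall>e\<in>arcs G. \<exists>f1 f2. H2_derivs (len e) (f e) f1 f2 \<and>
        (AE x in lebesgue_on {0..len e}. u e x = - f2 x + complex_of_real (V e x) * f e x))"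
  unfolding hamiltonian_def schroedinger_def boundary_condition_iff by simp

lemma pot_integrable: "e \<in> arcs G \<Longrightarrow> pot \<mu> e absolutely_integrable_on {0..len e}"
  by (rule potential_minus_absolutely_integrable[OF V])

lemma hamiltonian_solves:
  assumes "(f, u) \<in> hamiltonian G len V inc A B v z" "e \<in> arcs G"
  shows "\<exists>f1. solves (pot \<mu> e) (\<lambda>t. - (u e t - \<mu> * f e t)) (len e) (f e) f1" "L2_on (len e) (\<lambda>t. u e t - \<mu> * f e t)"
proof -
  obtain f1 f2 where f: "H2_derivs (len e) (f e) f1 f2"
    "AE x in lebesgue_on {0..len e}. u e x = - f2 x + complex_of_real (V e x) * f e x"
    using assms unfolding hamiltonian_iff by blast
  have "AE x in lebesgue_on {0..len e}. \<mu> * f e x + (u e x - \<mu> * f e x) = - f2 x + complex_of_real (V e x) * f e x"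
    using f(2) by eventually_elim simp
  from H2_derivs_imp_solves[OF f(1) this] have s: "solves (pot \<mu> e) (\<lambda>t. - (u e t - \<mu> * f e t)) (len e) (f e) f1" .
  then show "\<exists>f1. solves (pot \<mu> e) (\<lambda>t. - (u e t - \<mu> * f e t)) (len e) (f e) f1" by blast
  have cf: "continuous_on {0..len e} (f e)" by (rule solves_continuous[OF s])
  have "L2_on (len e) (\<lambda>t. -1 * f2 t + (complex_of_real (V e t) * f e t + - \<mu> * f e t))"
    using f(1) by (intro L2_on_add[OF L2_on_cmult L2_on_add[OF L2_on_mult_continuous[OF L2_on_of_real[OF V[OF assms(2)]] cf]
          L2_on_cmult[OF L2_on_continuous[OF cf]]]]) (simp add: H2_derivs_def)
  then show "L2_on (len e) (\<lambda>t. u e t - \<mu> * f e t)"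
    by (rule L2_on_AE_cong(1)) (use f(2) in \<open>eventually_elim, simp\<close>)
qed

lemma solves_hamiltonian:
  assumes "\<forall>p\<in>ends. row (z + 1) (\<i> * (z - 1)) p (end_value len f) (end_deriv len f) = 0"
    and "\<And>e. e \<in> arcs G \<Longrightarrow> solves (pot \<mu> e) (\<lambda>t. - g e t) (len e) (f e) (f1 e)"
    and "\<And>e. e \<in> arcs G \<Longrightarrow> L2_on (len e) (g e)"
  shows "(f, \<lambda>e x. \<mu> * f e x + g e x) \<in> hamiltonian G len V inc A B v z"
  unfolding hamiltonian_iff
proof (intro conjI ballI)
  fix e assume e: "e \<in> arcs G"
  have "H2_derivs (len e) (f e) (f1 e) (\<lambda>t. pot \<mu> e t * f e t + - g e t)"
    by (rule solves_imp_H2_derivs[OF assms(2)[OF e] V[OF e] assms(3)[OF e]])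
  moreover have "\<mu> * f e x + g e x = - (pot \<mu> e x * f e x + - g e x) + complex_of_real (V e x) * f e x" for x
    by (simp add: left_diff_distrib)
  ultimately show "\<exists>f1 f2. H2_derivs (len e) (f e) f1 f2 \<and>
      (AE x in lebesgue_on {0..len e}. \<mu> * f e x + g e x = - f2 x + complex_of_real (V e x) * f e x)"
    by (intro exI[of _ "f1 e"] exI[of _ "\<lambda>t. pot \<mu> e t * f e t + - g e t"]) simp
qed (use assms(1) in blast)

lemma comb_zero:
  assumes "e \<in> arcs G" "\<And>t. t \<in> {0..len e} \<Longrightarrow> comb \<mu> x e t = 0"
  shows "x (e, b) = 0"
proof -
  have "comb \<mu> x e 0 = 0" using assms(2)[of 0] len_pos[OF assms(1)] by simp
  moreover have "comb1 \<mu> x e 0 = 0"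
    by (rule solves_zero_deriv[OF comb(1)[OF assms(1)] len_pos[OF assms(1)] assms(2)])
  ultimately show ?thesis using comb(2,3)[OF assms(1), of \<mu> x] by (cases b) auto
qed

text \<open>A null vector of the system gives an eigenfunction. Membership in the resolvent set
  makes it vanish only almost everywhere; continuity makes it vanish at every point, and then its
  initial data, which are the coefficients, are zero.\<close>

lemma singular_spectrum:
  assumes "singular \<mu> (z + 1) (\<i> * (z - 1))"
  shows "\<mu> \<in> op_spectrum G len (hamiltonian G len V inc A B v z)"
proof -
  obtain x i where x: "i \<in> ends" "x i \<noteq> 0" "\<forall>p\<in>ends. (\<Sum>j\<in>ends. K \<mu> (z + 1) (\<i> * (z - 1)) p j * x j) = 0"
    using assms unfolding singular_def by blast
  obtain e b where i: "i = (e, b)" "e \<in> arcs G" using x(1) by (auto simp: ends_def)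
  have "(comb \<mu> x, \<lambda>e t. \<mu> * comb \<mu> x e t + 0) \<in> hamiltonian G len V inc A B v z"
    by (rule solves_hamiltonian[where ?f1.0 = "comb1 \<mu> x"])
      (use x(3) in \<open>auto simp: row_comb comb(1) intro!: L2_on_continuous\<close>)
  then have T: "(comb \<mu> x, \<lambda>e t. \<mu> * comb \<mu> x e t) \<in> hamiltonian G len V inc A B v z" by simp
  show ?thesis
  proof (rule ccontr)
    assume "\<mu> \<notin> op_spectrum G len (hamiltonian G len V inc A B v z)"
    then have "AE t in lebesgue_on {0..len e}. comb \<mu> x e t = 0"
      using T i(2) unfolding op_spectrum_def resolvent_set_def by blast
    then have "comb \<mu> x e t = 0" if "t \<in> {0..len e}" for t
      using continuous_AE_zero[OF solves_continuous[OF comb(1)[OF i(2)]] _ that len_pos[OF i(2)]] by blast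
    then show False using comb_zero[OF i(2), of \<mu> x b] x(2) i(1) by blast
  qed
qed

text \<open>By uniqueness: the particular solution has zero initial data, so the coefficients of the
  basis solutions are just the initial data of \<open>f\<close>.\<close>

lemma solves_comb:
  assumes e: "e \<in> arcs G" and f: "solves (pot \<mu> e) k (len e) (f e) f1" and p: "solves (pot \<mu> e) k (len e) (pf e) pf1"
    and k: "k absolutely_integrable_on {0..len e}"
    and p0: "pf e 0 = 0" "pf1 0 = 0" and x: "x (e, False) = f e 0" "x (e, True) = f1 0" and t: "t \<in> {0..len e}"
  shows "f e t = comb \<mu> x e t + pf e t" "f1 t = comb1 \<mu> x e t + pf1 t"
proof -
  have "solves (pot \<mu> e) k (len e) (\<lambda>t. comb \<mu> x e t + pf e t) (\<lambda>t. comb1 \<mu> x e t + pf1 t)"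
    using solves_linear[OF comb(1)[OF e, of \<mu> x] p, of 1 1] by simp
  from solves_unique[OF pot_integrable[OF e] k less_imp_le[OF len_pos[OF e]] f this _ _ t]
  show "f e t = comb \<mu> x e t + pf e t" "f1 t = comb1 \<mu> x e t + pf1 t"
    using comb(2,3)[OF e, of \<mu> x] p0 x by auto
qed

text \<open>A row is a linear functional of finitely many numbers; \<open>R\<close> adds up the
  norms of its values on unit vectors.\<close>

lemma row_bound:
  "\<exists>R\<ge>0. \<forall>p\<in>ends. \<forall>F F' b. (\<forall>q\<in>ends. norm (F q) \<le> b \<and> norm (F' q) \<le> b) \<longrightarrow> norm (row \<alpha> \<beta> p F F') \<le> R * b"
proof -
  define d where "d = (\<lambda>(j :: 'e \<times> bool) q. if q = j then 1 else 0 :: complex)"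
  define r where "r = (\<lambda>p j. norm (row \<alpha> \<beta> p (d j) (\<lambda>_. 0)) + norm (row \<alpha> \<beta> p (\<lambda>_. 0) (d j)))"
  define R where "R = (\<Sum>p\<in>ends. \<Sum>j\<in>ends. r p j)"
  have r0: "0 \<le> r p j" for p j by (simp add: r_def)
  have "norm (row \<alpha> \<beta> p F F') \<le> R * b"
    if p: "p \<in> ends" and b: "\<forall>q\<in>ends. norm (F q) \<le> b \<and> norm (F' q) \<le> b" for p F F' b
  proof -
    have b0: "0 \<le> b" using b p norm_ge_zero order_trans by blast
    have delta: "(\<Sum>j\<in>ends. H j * d j q) = H q" if "q \<in> ends" for H q
    proof -
      have "(\<Sum>j\<in>ends. H j * d j q) = (\<Sum>j\<in>ends. if q = j then H j else 0)"
        by (intro sum.cong refl) (simp add: d_def)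
      then show ?thesis using that finite_ends by simp
    qed
    have "row \<alpha> \<beta> p F F' = row \<alpha> \<beta> p (\<lambda>q. (\<Sum>j\<in>ends. F j * d j q) + (\<Sum>j\<in>ends. F' j * 0))
       (\<lambda>q. (\<Sum>j\<in>ends. F j * 0) + (\<Sum>j\<in>ends. F' j * d j q))"
      by (rule row_cong[OF p]) (simp_all add: delta)
    also have "\<dots> = (\<Sum>j\<in>ends. F j * row \<alpha> \<beta> p (d j) (\<lambda>_. 0)) + (\<Sum>j\<in>ends. F' j * row \<alpha> \<beta> p (\<lambda>_. 0) (d j))"
      unfolding row_add row_sum[OF finite_ends] ..
    finally have eq: "row \<alpha> \<beta> p F F' = (\<Sum>j\<in>ends. F j * row \<alpha> \<beta> p (d j) (\<lambda>_. 0) + F' j * row \<alpha> \<beta> p (\<lambda>_. 0) (d j))"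
      by (simp add: sum.distrib)
    have "norm (row \<alpha> \<beta> p F F') \<le> (\<Sum>j\<in>ends. r p j * b)"
      unfolding eq
    proof (rule sum_norm_le)
      fix j assume j: "j \<in> ends"
      have "norm (F j * row \<alpha> \<beta> p (d j) (\<lambda>_. 0) + F' j * row \<alpha> \<beta> p (\<lambda>_. 0) (d j))
        \<le> norm (F j) * norm (row \<alpha> \<beta> p (d j) (\<lambda>_. 0)) + norm (F' j) * norm (row \<alpha> \<beta> p (\<lambda>_. 0) (d j))"
        by (rule order_trans[OF norm_triangle_ineq]) (simp add: norm_mult)
      also have "\<dots> \<le> b * norm (row \<alpha> \<beta> p (d j) (\<lambda>_. 0)) + b * norm (row \<alpha> \<beta> p (\<lambda>_. 0) (d j))"
        using b j by (intro add_mono mult_right_mono) auto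
      finally show "norm (F j * row \<alpha> \<beta> p (d j) (\<lambda>_. 0) + F' j * row \<alpha> \<beta> p (\<lambda>_. 0) (d j)) \<le> r p j * b"
        by (simp add: r_def distrib_left mult.commute)
    qed
    also have "\<dots> = (\<Sum>j\<in>ends. r p j) * b" by (simp add: sum_distrib_right)
    also have "\<dots> \<le> R * b"
      unfolding R_def using p finite_ends r0 b0
      by (intro mult_right_mono member_le_sum[of p ends "\<lambda>p. \<Sum>j\<in>ends. r p j"]) (auto intro: sum_nonneg)
    finally show ?thesis .
  qed
  moreover have "0 \<le> R" unfolding R_def by (intro sum_nonneg r0)
  ultimately show ?thesis by blast
qed

text \<open>A solution is a particular solution with zero initial data plus a combination of basis
  solutions, and the vertex conditions are a linear system with injective matrix \<open>M\<close>
  for the coefficients. Solvability of this system gives surjectivity, its bounded inversion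
  together with the edge estimates gives the norm bound, and that bound for zero right-hand side
  gives injectivity.\<close>

lemma not_singular_resolvent:
  assumes ns: "\<not> singular \<mu> (z + 1) (\<i> * (z - 1))"
  shows "\<mu> \<notin> op_spectrum G len (hamiltonian G len V inc A B v z)"
proof -
  define \<alpha> where "\<alpha> = z + 1"
  define \<beta> where "\<beta> = \<i> * (z - 1)"
  define M where "M = K \<mu> \<alpha> \<beta>"
  have inj: "\<forall>i\<in>ends. x i = 0" if "\<forall>p\<in>ends. (\<Sum>j\<in>ends. M p j * x j) = 0" for x
    using ns that unfolding singular_def M_def \<alpha>_def \<beta>_def by blast
  obtain C0 where C0: "C0 \<ge> 0" "\<forall>x. \<exists>x'. (\<forall>i\<in>ends. (\<Sum>j\<in>ends. M i j * x' j) = (\<Sum>j\<in>ends. M i j * x j)) \<and>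
     (\<forall>j\<in>ends. norm (x' j) \<le> C0 * (\<Sum>i\<in>ends. norm (\<Sum>j\<in>ends. M i j * x j)))"
    using bounded_right_inverse[OF finite_ends finite_ends, of M] by blast
  \<comment> \<open>\<open>M\<close> is injective, so the controlled preimage is \<open>x\<close>
    itself.\<close>
  have xb: "norm (x j) \<le> C0 * (\<Sum>i\<in>ends. norm (\<Sum>j\<in>ends. M i j * x j))" if "j \<in> ends" for x j
  proof -
    obtain x' where x': "\<forall>i\<in>ends. (\<Sum>j\<in>ends. M i j * x' j) = (\<Sum>j\<in>ends. M i j * x j)"
      "\<forall>j\<in>ends. norm (x' j) \<le> C0 * (\<Sum>i\<in>ends. norm (\<Sum>j\<in>ends. M i j * x j))" using spec[OF C0(2), of x] by blast
    have "\<forall>i\<in>ends. x' i - x i = 0"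
      by (rule inj) (use x'(1) in \<open>simp add: right_diff_distrib sum_subtractf\<close>)
    then show ?thesis using x'(2) that by simp
  qed
  obtain Ke where Ke: "\<forall>e\<in>arcs G. 0 \<le> Ke e \<and> (\<forall>k f f1 x. k absolutely_integrable_on {0..len e} \<longrightarrow> solves (pot \<mu> e) k (len e) f f1 \<longrightarrow> x \<in> {0..len e} \<longrightarrow>
       norm (f x) \<le> Ke e * (norm (f 0) + norm (f1 0) + integral {0..len e} (\<lambda>t. norm (k t))) \<and>
       norm (f1 x) \<le> Ke e * (norm (f 0) + norm (f1 0) + integral {0..len e} (\<lambda>t. norm (k t))))"
    using bchoice[of "arcs G" "\<lambda>e K. 0 \<le> K \<and> (\<forall>k f f1 x. k absolutely_integrable_on {0..len e} \<longrightarrow> solves (pot \<mu> e) k (len e) f f1 \<longrightarrow> x \<in> {0..len e} \<longrightarrow>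
       norm (f x) \<le> K * (norm (f 0) + norm (f1 0) + integral {0..len e} (\<lambda>t. norm (k t))) \<and>
       norm (f1 x) \<le> K * (norm (f 0) + norm (f1 0) + integral {0..len e} (\<lambda>t. norm (k t))))"]
      solves_bound[OF pot_integrable less_imp_le[OF len_pos]] by blast
  define K0 where "K0 = (\<Sum>e\<in>arcs G. Ke e)"
  have K0: "Ke e \<le> K0" if "e \<in> arcs G" for e
    unfolding K0_def using that Ke finite_arcs by (intro member_le_sum) auto
  have K00: "0 \<le> K0" unfolding K0_def using Ke by (intro sum_nonneg) auto
  have bd: "norm (f x) \<le> K0 * (norm (f 0) + norm (f1 0) + integral {0..len e} (\<lambda>t. norm (k t)))"
     "norm (f1 x) \<le> K0 * (norm (f 0) + norm (f1 0) + integral {0..len e} (\<lambda>t. norm (k t)))"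
    if "e \<in> arcs G" "k absolutely_integrable_on {0..len e}" "solves (pot \<mu> e) k (len e) f f1" "x \<in> {0..len e}" for e k f f1 x
  proof -
    have "0 \<le> integral {0..len e} (\<lambda>t. norm (k t))"
      using that(2) by (intro integral_nonneg) (auto simp: absolutely_integrable_on_def)
    then have "Ke e * (norm (f 0) + norm (f1 0) + integral {0..len e} (\<lambda>t. norm (k t)))
       \<le> K0 * (norm (f 0) + norm (f1 0) + integral {0..len e} (\<lambda>t. norm (k t)))"
      by (intro mult_right_mono K0 that) auto
    moreover have "norm (f x) \<le> Ke e * (norm (f 0) + norm (f1 0) + integral {0..len e} (\<lambda>t. norm (k t))) \<and>
      norm (f1 x) \<le> Ke e * (norm (f 0) + norm (f1 0) + integral {0..len e} (\<lambda>t. norm (k t)))"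
      using Ke that by blast
    ultimately show "norm (f x) \<le> K0 * (norm (f 0) + norm (f1 0) + integral {0..len e} (\<lambda>t. norm (k t)))"
     "norm (f1 x) \<le> K0 * (norm (f 0) + norm (f1 0) + integral {0..len e} (\<lambda>t. norm (k t)))" by auto
  qed
  define part where "part = (\<lambda>g e. SOME h. solves (pot \<mu> e) (\<lambda>t. - g e t) (len e) (fst h) (snd h) \<and> fst h 0 = 0 \<and> snd h 0 = (0::complex))"
  have part: "solves (pot \<mu> e) (\<lambda>t. - g e t) (len e) (fst (part g e)) (snd (part g e)) \<and> fst (part g e) 0 = 0 \<and> snd (part g e) 0 = 0"
    if e: "e \<in> arcs G" and g: "L2_on (len e) (g e)" for g e
  proof -
    have k: "(\<lambda>t. - g e t) absolutely_integrable_on {0..len e}"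
      using L2_on_absolutely_integrable[OF L2_on_cmult[OF g, of "-1"]] by simp
    obtain f f1 where "solves (pot \<mu> e) (\<lambda>t. - g e t) (len e) f f1" "f 0 = 0" "f1 0 = 0"
      by (rule solves_exists[OF pot_integrable[OF e] k less_imp_le[OF len_pos[OF e]]])
    then have "\<exists>h. solves (pot \<mu> e) (\<lambda>t. - g e t) (len e) (fst h) (snd h) \<and> fst h 0 = 0 \<and> snd h 0 = (0::complex)"
      by (intro exI[of _ "(f, f1)"]) simp
    from someI_ex[OF this] show ?thesis unfolding part_def .
  qed
  have row_split: "row \<alpha> \<beta> p (end_value len f) (end_deriv len f)
      = (\<Sum>j\<in>ends. M p j * x j) + row \<alpha> \<beta> p (end_value len pf) (end_deriv len pf)"
    if p: "p \<in> ends" and f: "\<And>e t. e \<in> arcs G \<Longrightarrow> t \<in> {0..len e} \<Longrightarrow> f e t = comb \<mu> x e t + pf e t"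
      and s: "\<And>e. e \<in> arcs G \<Longrightarrow> solves (pot \<mu> e) (k e) (len e) (f e) (\<lambda>t. comb1 \<mu> x e t + pf1 e t)"
      and ps: "\<And>e. e \<in> arcs G \<Longrightarrow> solves (pot \<mu> e) (k e) (len e) (pf e) (pf1 e)" for p f x pf k pf1
  proof -
    have "row \<alpha> \<beta> p (end_value len f) (end_deriv len f)
        = row \<alpha> \<beta> p (\<lambda>q. end_value len (comb \<mu> x) q + end_value len pf q) (\<lambda>q. end_deriv len (comb \<mu> x) q + end_deriv len pf q)"
    proof (rule row_cong[OF p])
      fix q assume q: "q \<in> ends"
      then have e: "fst q \<in> arcs G" by (auto simp: ends_def)
      show "end_value len f q = end_value len (comb \<mu> x) q + end_value len pf q"
        using f[OF e] len_pos[OF e] by (cases q) (simp add: end_value_def)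
      show "end_deriv len f q = end_deriv len (comb \<mu> x) q + end_deriv len pf q"
        unfolding end_deriv_solves[of q _ _ f, OF q s[OF e]] end_deriv_solves[of q _ _ pf, OF q ps[OF e]]
          end_deriv_solves[of q _ _ "comb \<mu> x", OF q comb(1)[OF e]] by simp
    qed
    then show ?thesis unfolding row_add row_comb[OF p] M_def .
  qed
  obtain R where R: "0 \<le> R" "\<forall>p\<in>ends. \<forall>F F' b. (\<forall>q\<in>ends. norm (F q) \<le> b \<and> norm (F' q) \<le> b) \<longrightarrow> norm (row \<alpha> \<beta> p F F') \<le> R * b"
    using row_bound[of \<alpha> \<beta>] by blast
  \<comment> \<open>\<open>X\<close> bounds the coefficients: particular solutions are at most
    \<open>K0 * N\<close>, their rows at most \<open>R * (K0 * N)\<close>; these are summed over the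
    ends and inverted with \<open>C0\<close>. \<open>Y\<close> feeds the two initial data, each at
    most \<open>X * N\<close>, back into the edge estimate.\<close>
  define X where "X = C0 * (real (card ends) * (R * K0))"
  define Y where "Y = K0 * (2 * X + 1)"
  have X0: "0 \<le> X" "0 \<le> Y" using C0(1) R(1) K00 by (simp_all add: X_def Y_def)
  \<comment> \<open>A supremum bound by the L1 norm of the right-hand side, which is what the
    initial value problems provide. Cauchy-Schwarz converts it to L2 at the end.\<close>
  have est: "norm (f e t) \<le> Y * (\<Sum>e\<in>arcs G. integral {0..len e} (\<lambda>t. norm (u e t - \<mu> * f e t)))"
    if T: "(f, u) \<in> hamiltonian G len V inc A B v z" and e: "e \<in> arcs G" and t: "t \<in> {0..len e}" for f u e t
  proof -
    define g where "g = (\<lambda>e t. u e t - \<mu> * f e t)"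
    have gL: "L2_on (len e) (g e)" if "e \<in> arcs G" for e
      unfolding g_def by (rule hamiltonian_solves(2)[OF T that])
    have gi: "(\<lambda>t. - g e t) absolutely_integrable_on {0..len e}" if "e \<in> arcs G" for e
      using L2_on_absolutely_integrable[OF L2_on_cmult[OF gL[OF that], of "-1"]] by simp
    define n where "n = (\<lambda>e. integral {0..len e} (\<lambda>t. norm (g e t)))"
    define N where "N = (\<Sum>e\<in>arcs G. n e)"
    have n0: "0 \<le> n e" if "e \<in> arcs G" for e
      using L2_on_absolutely_integrable[OF gL[OF that]] unfolding n_def
      by (intro integral_nonneg) (auto simp: absolutely_integrable_on_def)
    have nN: "n e \<le> N" if "e \<in> arcs G" for e
      unfolding N_def using that finite_arcs n0 by (intro member_le_sum) auto
    have "\<forall>e\<in>arcs G. \<exists>f1. solves (pot \<mu> e) (\<lambda>t. - g e t) (len e) (f e) f1"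
      unfolding g_def using hamiltonian_solves(1)[OF T] by blast
    from bchoice[OF this] obtain f1 where f1: "\<forall>e\<in>arcs G. solves (pot \<mu> e) (\<lambda>t. - g e t) (len e) (f e) (f1 e)" ..
    define x where "x = (\<lambda>(e, b). if b then f1 e 0 else f e 0)"
    define pf where "pf = (\<lambda>e. fst (part g e))"
    define pf1 where "pf1 = (\<lambda>e. snd (part g e))"
    have ps: "solves (pot \<mu> e) (\<lambda>t. - g e t) (len e) (pf e) (pf1 e)" "pf e 0 = 0" "pf1 e 0 = 0" if "e \<in> arcs G" for e
      using part[where g = g and e = e, OF that gL[OF that]] unfolding pf_def pf1_def by blast+
    have pfb: "norm (pf e t) \<le> K0 * N" "norm (pf1 e t) \<le> K0 * N" if e: "e \<in> arcs G" and t: "t \<in> {0..len e}" for e t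
    proof -
      have le: "K0 * (norm (pf e 0) + norm (pf1 e 0) + integral {0..len e} (\<lambda>t. norm (- g e t))) \<le> K0 * N"
        using nN[OF e] K00 by (intro mult_left_mono) (simp_all add: ps(2,3)[OF e] n_def)
      show "norm (pf e t) \<le> K0 * N" by (rule order_trans[OF bd(1)[OF e gi[OF e] ps(1)[OF e] t] le])
      show "norm (pf1 e t) \<le> K0 * N" by (rule order_trans[OF bd(2)[OF e gi[OF e] ps(1)[OF e] t] le])
    qed
    have dec: "f e t = comb \<mu> x e t + pf e t" "f1 e t = comb1 \<mu> x e t + pf1 e t" if e: "e \<in> arcs G" and t: "t \<in> {0..len e}" for e t
    proof -
      have x: "x (e, False) = f e 0" "x (e, True) = f1 e 0" by (simp_all add: x_def)
      note sc = solves_comb[where f = f and pf = pf and ?f1.0 = "f1 e" and ?pf1.0 = "pf1 e" and k = "\<lambda>t. - g e t" and x = x and t = t,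
        OF e f1[rule_format, OF e] ps(1)[OF e] gi[OF e] ps(2,3)[OF e] x t]
      show "f e t = comb \<mu> x e t + pf e t" by (rule sc(1))
      show "f1 e t = comb1 \<mu> x e t + pf1 e t" by (rule sc(2))
    qed
    have fs: "solves (pot \<mu> e) (\<lambda>t. - g e t) (len e) (f e) (\<lambda>t. comb1 \<mu> x e t + pf1 e t)" if e: "e \<in> arcs G" for e
      by (rule solves_deriv_cong[OF f1[rule_format, OF e] less_imp_le[OF len_pos[OF e]] dec(2)[OF e]])
    have Mx: "(\<Sum>j\<in>ends. M p j * x j) = - row \<alpha> \<beta> p (end_value len pf) (end_deriv len pf)" if p: "p \<in> ends" for p
    proof -
      have "row \<alpha> \<beta> p (end_value len f) (end_deriv len f) = 0"
        using T p unfolding hamiltonian_iff \<alpha>_def \<beta>_def by blast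
      moreover have "row \<alpha> \<beta> p (end_value len f) (end_deriv len f)
          = (\<Sum>j\<in>ends. M p j * x j) + row \<alpha> \<beta> p (end_value len pf) (end_deriv len pf)"
        by (rule row_split[OF p dec(1) fs ps(1)])
      ultimately show ?thesis by (simp add: eq_neg_iff_add_eq_0)
    qed
    have N0: "0 \<le> N" unfolding N_def using n0 by (intro sum_nonneg) auto
    have "norm (\<Sum>j\<in>ends. M p j * x j) \<le> R * (K0 * N)" if p: "p \<in> ends" for p
    proof -
      have "norm (end_value len pf q) \<le> K0 * N \<and> norm (end_deriv len pf q) \<le> K0 * N" if q: "q \<in> ends" for q
      proof -
        have e: "fst q \<in> arcs G" using q by (auto simp: ends_def)
        have l: "0 \<in> {0..len (fst q)}" "len (fst q) \<in> {0..len (fst q)}" using len_pos[OF e] by auto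
        show ?thesis
          unfolding end_deriv_solves[of q _ _ pf, OF q ps(1)[OF e]] end_value_def case_prod_beta
          using pfb(1)[OF e l(1)] pfb(1)[OF e l(2)] pfb(2)[OF e l(1)] pfb(2)[OF e l(2)]
          by (auto simp: norm_minus_cancel)
      qed
      then show ?thesis unfolding Mx[OF p] norm_minus_cancel using R(2)[rule_format, OF p, of "end_value len pf" "K0 * N" "end_deriv len pf"] by blast
    qed
    then have "(\<Sum>p\<in>ends. norm (\<Sum>j\<in>ends. M p j * x j)) \<le> real (card ends) * (R * (K0 * N))"
      by (rule sum_bounded_above)
    then have "C0 * (\<Sum>p\<in>ends. norm (\<Sum>j\<in>ends. M p j * x j)) \<le> C0 * (real (card ends) * (R * (K0 * N)))"
      by (rule mult_left_mono[OF _ C0(1)])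
    also have "\<dots> = X * N" by (simp add: X_def mult.assoc)
    finally have xX: "norm (x j) \<le> X * N" if "j \<in> ends" for j
      by (rule order_trans[OF xb[OF that]])
    have "norm (f e t) \<le> K0 * (norm (f e 0) + norm (f1 e 0) + integral {0..len e} (\<lambda>t. norm (- g e t)))"
      by (rule bd(1)[OF e gi[OF e] f1[rule_format, OF e] t])
    also have "\<dots> \<le> K0 * (X * N + X * N + N)"
      using xX[of "(e, False)"] xX[of "(e, True)"] e nN[OF e] K00
      by (intro mult_left_mono add_mono) (simp_all add: x_def ends_def n_def)
    also have "\<dots> = Y * N" by (simp add: Y_def distrib_right distrib_left mult.assoc)
    finally show ?thesis by (simp add: N_def n_def g_def)
  qed
  have "\<mu> \<in> resolvent_set G len (hamiltonian G len V inc A B v z)"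
    unfolding resolvent_set_def
  proof (intro CollectI conjI allI impI ballI)
    fix f e assume T: "(f, \<lambda>e x. \<mu> * f e x) \<in> hamiltonian G len V inc A B v z" and e: "e \<in> arcs G"
    have "f e t = 0" if "t \<in> {0..len e}" for t
      using est[OF T e that] by simp
    then show "AE x in lebesgue_on {0..len e}. f e x = 0" by (intro AE_I2) (simp add: space_restrict_space)
  next
    fix g assume "g \<in> graph_L2 G len"
    then have g: "\<And>e. e \<in> arcs G \<Longrightarrow> L2_on (len e) (g e)" by (simp add: graph_L2_def)
    define pf where "pf = (\<lambda>e. fst (part g e))"
    define pf1 where "pf1 = (\<lambda>e. snd (part g e))"
    have ps: "solves (pot \<mu> e) (\<lambda>t. - g e t) (len e) (pf e) (pf1 e)" if "e \<in> arcs G" for e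
      using part[where g = g and e = e, OF that g[OF that]] unfolding pf_def pf1_def by blast
    obtain x where x: "\<forall>p\<in>ends. (\<Sum>j\<in>ends. M p j * x j) = - row \<alpha> \<beta> p (end_value len pf) (end_deriv len pf)"
      using square_system_solvable[where K = M and y = "\<lambda>p. - row \<alpha> \<beta> p (end_value len pf) (end_deriv len pf)", OF finite_ends inj] by blast
    define f where "f = (\<lambda>e t. comb \<mu> x e t + pf e t)"
    have fs: "solves (pot \<mu> e) (\<lambda>t. - g e t) (len e) (f e) (\<lambda>t. comb1 \<mu> x e t + pf1 e t)" if "e \<in> arcs G" for e
      using solves_linear[OF comb(1)[OF that, of \<mu> x] ps[OF that], of 1 1] by (simp add: f_def)
    have "(f, \<lambda>e x. \<mu> * f e x + g e x) \<in> hamiltonian G len V inc A B v z"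
    proof (rule solves_hamiltonian[OF _ fs g])
      show "\<forall>p\<in>ends. row (z + 1) (\<i> * (z - 1)) p (end_value len f) (end_deriv len f) = 0"
      proof
        fix p assume p: "p \<in> ends"
        have "row \<alpha> \<beta> p (end_value len f) (end_deriv len f)
          = (\<Sum>j\<in>ends. M p j * x j) + row \<alpha> \<beta> p (end_value len pf) (end_deriv len pf)"
          by (rule row_split[OF p _ fs ps]) (simp_all add: f_def)
        then show "row (z + 1) (\<i> * (z - 1)) p (end_value len f) (end_deriv len f) = 0"
          using x p by (simp add: \<alpha>_def \<beta>_def)
      qed
    qed
    then show "\<exists>f. (f, \<lambda>e x. \<mu> * f e x + g e x) \<in> hamiltonian G len V inc A B v z" by blast
  next
    show "\<exists>C. \<forall>(f, u)\<in>hamiltonian G len V inc A B v z.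
       graph_L2_norm G len f \<le> C * graph_L2_norm G len (\<lambda>e x. u e x - \<mu> * f e x)"
    \<comment> \<open>The witness for the constant stays schematic and is fixed by the final
      estimate; it depends neither on \<open>f\<close> nor on \<open>u\<close>.\<close>
    proof (intro exI ballI, clarify)
      fix f u assume T: "(f, u) \<in> hamiltonian G len V inc A B v z"
      define g where "g = (\<lambda>e t. u e t - \<mu> * f e t)"
      have gL: "L2_on (len e) (g e)" if "e \<in> arcs G" for e
        unfolding g_def by (rule hamiltonian_solves(2)[OF T that])
      have fc: "continuous_on {0..len e} (f e)" if "e \<in> arcs G" for e
        using hamiltonian_solves(1)[OF T that] solves_continuous by blast
      have fL: "L2_on (len e) (f e)" if "e \<in> arcs G" for e
        by (rule L2_on_continuous[OF fc[OF that]])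
      define N where "N = (\<Sum>e\<in>arcs G. integral {0..len e} (\<lambda>t. norm (g e t)))"
      define ng where "ng = graph_L2_norm G len g"
      have ng: "ng = sqrt (\<Sum>e\<in>arcs G. integral {0..len e} (\<lambda>x. (norm (g e x))\<^sup>2))"
        unfolding ng_def graph_L2_norm_def using L2_on_square(2)[OF gL] by (intro arg_cong[of _ _ sqrt] sum.cong) auto
      have Nng: "N \<le> (\<Sum>e\<in>arcs G. sqrt (len e)) * ng"
        unfolding N_def sum_distrib_right
      proof (rule sum_mono)
        fix e assume e: "e \<in> arcs G"
        have "integral {0..len e} (\<lambda>t. norm (g e t)) \<le> sqrt (len e * integral {0..len e} (\<lambda>t. (norm (g e t))\<^sup>2))"
          by (rule L1_le_L2[OF gL[OF e] len_pos[OF e]])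
        also have "\<dots> = sqrt (len e) * sqrt (integral {0..len e} (\<lambda>t. (norm (g e t))\<^sup>2))" by (rule real_sqrt_mult)
        also have "\<dots> \<le> sqrt (len e) * ng"
          unfolding ng using e finite_arcs len_pos[OF e] L2_on_square(1)[OF gL]
          by (intro mult_left_mono real_sqrt_le_mono member_le_sum) (auto intro!: integral_nonneg)
        finally show "integral {0..len e} (\<lambda>t. norm (g e t)) \<le> sqrt (len e) * ng" .
      qed
      have N0: "0 \<le> N" unfolding N_def using L2_on_absolutely_integrable[OF gL]
        by (intro sum_nonneg integral_nonneg) (auto simp: absolutely_integrable_on_def)
      have "graph_L2_norm G len f = sqrt (\<Sum>e\<in>arcs G. integral {0..len e} (\<lambda>x. (norm (f e x))\<^sup>2))"
        unfolding graph_L2_norm_def using L2_on_square(2)[OF fL] by (intro arg_cong[of _ _ sqrt] sum.cong) auto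
      also have "\<dots> \<le> sqrt (\<Sum>e\<in>arcs G. len e * (Y * N)\<^sup>2)"
      proof (intro real_sqrt_le_mono sum_mono)
        fix e assume e: "e \<in> arcs G"
        have "integral {0..len e} (\<lambda>x. (norm (f e x))\<^sup>2) \<le> integral {0..len e} (\<lambda>x. (Y * N)\<^sup>2)"
          using est[OF T e] L2_on_square(1)[OF fL[OF e]] by (intro integral_le power_mono) (auto simp: N_def g_def)
        then show "integral {0..len e} (\<lambda>x. (norm (f e x))\<^sup>2) \<le> len e * (Y * N)\<^sup>2"
          using len_pos[OF e] by simp
      qed
      also have "\<dots> = sqrt (\<Sum>e\<in>arcs G. len e) * (Y * N)"
        using X0(2) N0 by (simp add: sum_distrib_right[symmetric] real_sqrt_mult)
      also have "\<dots> \<le> sqrt (\<Sum>e\<in>arcs G. len e) * (Y * ((\<Sum>e\<in>arcs G. sqrt (len e)) * ng))"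
        using X0(2) Nng len_pos by (intro mult_left_mono real_sqrt_ge_zero sum_nonneg) (auto intro: less_imp_le)
      finally show "graph_L2_norm G len f \<le> sqrt (\<Sum>e\<in>arcs G. len e) * (Y * (\<Sum>e\<in>arcs G. sqrt (len e))) * graph_L2_norm G len (\<lambda>e x. u e x - \<mu> * f e x)"
        by (simp add: ng_def g_def mult.assoc)
    qed
  qed
  then show ?thesis by (simp add: op_spectrum_def)
qed

end

section \<open>The Dirichlet-to-Neumann function at the vertex\<close>

lemma absolutely_integrable_potential_mult:
  assumes V: "L2_on L (V :: real \<Rightarrow> real)" and g: "continuous_on {0..L} (g :: real \<Rightarrow> real)"
  shows "(\<lambda>t. V t * g t) absolutely_integrable_on {0..L}"
proof -
  have "(\<lambda>t. complex_of_real (V t) * complex_of_real (g t)) absolutely_integrable_on {0..L}"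
    by (rule absolutely_integrable_mult_continuous[OF L2_on_absolutely_integrable[OF L2_on_of_real[OF V]]])
      (intro continuous_intros g)
  from absolutely_integrable_linear[OF this bounded_linear_Re] show ?thesis by (simp add: o_def)
qed

lemma potential_integral_bound:
  assumes V: "L2_on L (V :: real \<Rightarrow> real)" and g: "continuous_on {0..L} (g :: real \<Rightarrow> real)"
    and m: "\<And>t. t \<in> {0..L} \<Longrightarrow> \<bar>g t\<bar> \<le> m"
  shows "\<bar>integral {0..L} (\<lambda>t. V t * g t)\<bar> \<le> integral {0..L} (\<lambda>t. \<bar>V t\<bar>) * m"
proof -
  have i: "(\<lambda>t. \<bar>V t\<bar>) integrable_on {0..L}"
    using L2_on_absolutely_integrable[OF V] by (simp add: absolutely_integrable_on_def)
  have "norm (integral {0..L} (\<lambda>t. V t * g t)) \<le> integral {0..L} (\<lambda>t. \<bar>V t\<bar> * m)"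
    using absolutely_integrable_potential_mult[OF V g] has_integral_integrable[OF has_integral_mult_left[OF integrable_integral[OF i]]] m
    by (intro integral_norm_bound_integral) (auto simp: absolutely_integrable_on_def abs_mult intro: mult_left_mono)
  then show ?thesis by simp
qed

text \<open>The equation is multiplied by \<open>cnj (f t)\<close> and integrated by parts once. The
  boundary terms have the signs of derivatives into the edge, so over all edges they add up to the
  sums at the vertices.\<close>

lemma green_edge:
  assumes s: "solves (\<lambda>t. complex_of_real (V t) - \<mu>) (\<lambda>_. 0) L f f1" and V: "L2_on L V" and L: "0 < L"
  shows "f1 0 * cnj (f 0) - f1 L * cnj (f L) =
    \<mu> * complex_of_real (integral {0..L} (\<lambda>t. (norm (f t))\<^sup>2)) -
    complex_of_real (integral {0..L} (\<lambda>t. (norm (f1 t))\<^sup>2) + integral {0..L} (\<lambda>t. V t * (norm (f t))\<^sup>2))"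
proof -
  have cf: "continuous_on {0..L} f" and cf1: "continuous_on {0..L} f1"
    using solves_continuous[OF s] solves_continuous_deriv[OF s less_imp_le[OF L]] by auto
  have "(\<lambda>t. (complex_of_real (V t) - \<mu>) * f t) absolutely_integrable_on {0..L}"
    by (rule absolutely_integrable_mult_continuous[OF potential_minus_absolutely_integrable[OF V] cf])
  then have ibp: "((\<lambda>t. (complex_of_real (V t) - \<mu>) * f t * cnj (f t)) has_integral
     (f1 L * cnj (f L) - f1 0 * cnj (f 0) - integral {0..L} (\<lambda>t. f1 t * cnj (f1 t)))) {0..L}"
  proof (rule has_integral_by_parts[OF less_imp_le[OF L]])
    show "((\<lambda>t. (complex_of_real (V t) - \<mu>) * f t) has_integral (f1 x - f1 0)) {0..x}" if "x \<in> {0..L}" for x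
      using s that by (simp add: solves_def)
    show "((\<lambda>t. cnj (f t)) has_vector_derivative cnj (f1 x)) (at x within {0..L})" if "x \<in> {0..L}" for x
      using s that by (intro has_vector_derivative_cnj) (simp add: solves_def)
    show "continuous_on {0..L} (\<lambda>t. cnj (f1 t))" by (intro continuous_intros cf1)
  qed
  have i1: "((\<lambda>t. f1 t * cnj (f1 t)) has_integral complex_of_real (integral {0..L} (\<lambda>t. (norm (f1 t))\<^sup>2))) {0..L}"
    unfolding complex_norm_square[symmetric]
    by (intro has_integral_of_real integrable_integral integrable_continuous_interval continuous_intros cf1)
  have i0: "((\<lambda>t. (norm (f t))\<^sup>2) has_integral (integral {0..L} (\<lambda>t. (norm (f t))\<^sup>2))) {0..L}"
    by (intro integrable_integral integrable_continuous_interval continuous_intros cf)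
  have iw: "((\<lambda>t. V t * (norm (f t))\<^sup>2) has_integral (integral {0..L} (\<lambda>t. V t * (norm (f t))\<^sup>2))) {0..L}"
    by (intro integrable_integral set_lebesgue_integral_eq_integral(1) absolutely_integrable_potential_mult[OF V] continuous_intros cf)
  have "((\<lambda>t. complex_of_real (V t * (norm (f t))\<^sup>2) - \<mu> * complex_of_real ((norm (f t))\<^sup>2)) has_integral
    (complex_of_real (integral {0..L} (\<lambda>t. V t * (norm (f t))\<^sup>2)) - \<mu> * complex_of_real (integral {0..L} (\<lambda>t. (norm (f t))\<^sup>2)))) {0..L}"
    by (intro has_integral_diff has_integral_mult_right has_integral_of_real iw i0)
  moreover have fe: "(\<lambda>t. (complex_of_real (V t) - \<mu>) * f t * cnj (f t))
      = (\<lambda>t. complex_of_real (V t * (norm (f t))\<^sup>2) - \<mu> * complex_of_real ((norm (f t))\<^sup>2))"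
    by (rule ext) (simp only: of_real_mult complex_norm_square left_diff_distrib mult.assoc)
  ultimately have eq: "f1 L * cnj (f L) - f1 0 * cnj (f 0) - integral {0..L} (\<lambda>t. f1 t * cnj (f1 t))
      = complex_of_real (integral {0..L} (\<lambda>t. V t * (norm (f t))\<^sup>2)) - \<mu> * complex_of_real (integral {0..L} (\<lambda>t. (norm (f t))\<^sup>2))"
    by (intro has_integral_unique[OF ibp[unfolded fe]])
  have "f1 0 * cnj (f 0) - f1 L * cnj (f L) =
    - (f1 L * cnj (f L) - f1 0 * cnj (f 0) - integral {0..L} (\<lambda>t. f1 t * cnj (f1 t))) - integral {0..L} (\<lambda>t. f1 t * cnj (f1 t))"
    by simp
  then show ?thesis unfolding eq unfolding integral_unique[OF i1] by simp
qed

lemma integral_affine_power: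
  fixes \<alpha> \<beta> L :: real
  assumes "\<beta> \<noteq> 0" "0 \<le> L"
  shows "integral {0..L} (\<lambda>t. (\<alpha> + \<beta> * t) ^ m) = ((\<alpha> + \<beta> * L) ^ Suc m - \<alpha> ^ Suc m) / (\<beta> * (1 + real m))"
proof (rule integral_unique)
  have "((\<lambda>t. (\<alpha> + \<beta> * t) ^ m) has_integral ((\<alpha> + \<beta> * L) ^ Suc m / (\<beta> * (1 + real m)) - (\<alpha> + \<beta> * 0) ^ Suc m / (\<beta> * (1 + real m)))) {0..L}"
  proof (rule fundamental_theorem_of_calculus[OF assms(2)])
    fix x
    have "((\<lambda>t. (\<alpha> + \<beta> * t) ^ Suc m) has_field_derivative (1 + real m) * ((\<alpha> + \<beta> * x) ^ m * \<beta>)) (at x within {0..L})"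
      by (rule derivative_eq_intros refl | simp)+
    then have "((\<lambda>t. (\<alpha> + \<beta> * t) ^ Suc m / (\<beta> * (1 + real m))) has_field_derivative (1 + real m) * ((\<alpha> + \<beta> * x) ^ m * \<beta>) / (\<beta> * (1 + real m))) (at x within {0..L})"
      by (rule DERIV_cdivide)
    moreover have "(1 + real m) * ((\<alpha> + \<beta> * x) ^ m * \<beta>) / (\<beta> * (1 + real m)) = (\<alpha> + \<beta> * x) ^ m" using assms(1) by simp
    ultimately show "((\<lambda>t. (\<alpha> + \<beta> * t) ^ Suc m / (\<beta> * (1 + real m))) has_vector_derivative (\<alpha> + \<beta> * x) ^ m) (at x within {0..L})"
      by (simp add: has_real_derivative_iff_has_vector_derivative)
  qed
  then show "((\<lambda>t. (\<alpha> + \<beta> * t) ^ m) has_integral (((\<alpha> + \<beta> * L) ^ Suc m - \<alpha> ^ Suc m) / (\<beta> * (1 + real m)))) {0..L}"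
    by (simp only: mult_zero_right add_0_right diff_divide_distrib)
qed

lemma mult_le_eta:
  fixes a b \<eta> :: real
  assumes "0 < \<eta>"
  shows "a * b \<le> \<eta> * a\<^sup>2 + b\<^sup>2 / (4 * \<eta>)"
proof -
  have "0 \<le> (2 * \<eta> * a - b)\<^sup>2 / (4 * \<eta>)" using assms by simp
  also have "\<dots> = \<eta> * a\<^sup>2 + b\<^sup>2 / (4 * \<eta>) - a * b" using assms by (simp add: field_simps power2_eq_square)
  finally show ?thesis by simp
qed

text \<open>The equation is tested against \<open>(t / L)\<^sup>n\<close> or \<open>(1 - t / L)\<^sup>n\<close>: for large \<open>n\<close> these have small \<open>L\<^sub>2\<close> norm, which
  produces the factor \<open>\<eta>\<close> in front of \<open>y\<close>.\<close>

lemma end_derivative_bound: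
  fixes \<alpha> \<beta> \<eta> L :: real
  assumes V: "L2_on L V" and L: "0 < L" and eta: "0 < \<eta>"
    and ab: "(\<alpha>, \<beta>) = (0, 1 / L) \<or> (\<alpha>, \<beta>) = (1, - 1 / L)"
  shows "\<exists>K\<ge>0. \<forall>y\<ge>0. \<forall>f f1 \<sigma>. solves (\<lambda>t. complex_of_real (V t) - complex_of_real (- y)) (\<lambda>_. 0) L f f1 \<longrightarrow>
     (\<forall>t\<in>{0..L}. (norm (f t))\<^sup>2 \<le> \<sigma>) \<longrightarrow>
     norm (if \<alpha> = 0 then f1 L else f1 0) \<le> \<eta> * (y + y * integral {0..L} (\<lambda>t. (norm (f t))\<^sup>2) + integral {0..L} (\<lambda>t. (norm (f1 t))\<^sup>2) + \<sigma>) + K"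
proof -
  \<comment> \<open>The integral of the squared test function is
    \<open>L / (1 + 2 * real n)\<close>. This \<open>n\<close> brings it below
    \<open>4 * \<eta>\<^sup>2\<close>, so that Young's inequality leaves at most
    \<open>y * \<eta>\<close>.\<close>
  obtain n where n: "L / (4 * \<eta>\<^sup>2) < real n" using reals_Archimedean2 by blast
  then have n0: "0 < n" using L eta by (intro Nat.gr0I) (auto simp: divide_less_0_iff)
  define g where "g = (\<lambda>t. (\<alpha> + \<beta> * t) ^ n)"
  define g1 where "g1 = (\<lambda>t. real n * ((\<alpha> + \<beta> * t) ^ (n - 1) * \<beta>))"
  define vv where "vv = integral {0..L} (\<lambda>t. \<bar>V t\<bar>)"
  have vv0: "0 \<le> vv" unfolding vv_def
    using L2_on_absolutely_integrable[OF V] by (intro integral_nonneg) (auto simp: absolutely_integrable_on_def)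
  \<comment> \<open>The potential term carries the factor \<open>vv\<close>, so Young's inequality
    is applied there with a smaller weight; the summand 1 avoids division by zero.\<close>
  define \<eta>' where "\<eta>' = \<eta> / (vv + 1)"
  have eta': "0 < \<eta>'" "vv * \<eta>' \<le> \<eta>" using eta vv0 by (simp_all add: \<eta>'_def field_simps)
  define K where "K = vv * (1 / (4 * \<eta>')) + integral {0..L} (\<lambda>t. (g1 t)\<^sup>2 / (4 * \<eta>))"
  have cg: "continuous_on S g" "continuous_on S g1" for S unfolding g_def g1_def by (intro continuous_intros)+
  have K0: "0 \<le> K" unfolding K_def using vv0 eta eta' cg(2)
    by (intro add_nonneg_nonneg integral_nonneg integrable_continuous_interval continuous_intros) auto
  have dg: "(g has_field_derivative g1 x) (at x within X)" for x X
    unfolding g_def g1_def by (rule derivative_eq_intros refl | simp)+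
  have g01: "\<bar>g t\<bar> \<le> 1" if "t \<in> {0..L}" for t
  proof -
    have "0 \<le> t / L" "t / L \<le> 1" using that L by auto
    moreover have "\<alpha> + \<beta> * t = t / L \<or> \<alpha> + \<beta> * t = 1 - t / L" using ab by auto
    ultimately have "\<bar>\<alpha> + \<beta> * t\<bar> \<le> 1" by linarith
    then show ?thesis unfolding g_def power_abs by (intro power_le_one) auto
  qed
  \<comment> \<open>The first choice of \<open>(\<alpha>, \<beta>)\<close> is the power of t / L and
    picks out the derivative at \<open>L\<close>; the second is the power of 1 - t / L and picks out
    the one at 0.\<close>
  have ends: "g 0 = (if \<alpha> = 0 then 0 else 1)" "g L = (if \<alpha> = 0 then 1 else 0)" using ab n0 L by (auto simp: g_def)
  have ig: "integral {0..L} (\<lambda>t. (g t)\<^sup>2) \<le> 4 * \<eta>\<^sup>2"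
  proof -
    have "integral {0..L} (\<lambda>t. (g t)\<^sup>2) = integral {0..L} (\<lambda>t. (\<alpha> + \<beta> * t) ^ (n * 2))"
      by (simp add: g_def power_mult)
    also have "\<dots> = ((\<alpha> + \<beta> * L) ^ Suc (n * 2) - \<alpha> ^ Suc (n * 2)) / (\<beta> * (1 + real (n * 2)))"
      by (rule integral_affine_power) (use ab L in auto)
    also have "\<dots> = L / (1 + 2 * real n)"
    proof -
      have "(1 / L * L) ^ Suc (n * 2) - 0 ^ Suc (n * 2) = 1" "(1 + - 1 / L * L) ^ Suc (n * 2) - 1 ^ Suc (n * 2) = - 1"
        using L by simp_all
      then show ?thesis using ab by (auto simp: add.commute mult.commute)
    qed
    also have "\<dots> \<le> L / real n" using n0 L by (intro divide_left_mono) auto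
    also have "\<dots> \<le> 4 * \<eta>\<^sup>2" using n n0 eta by (simp add: field_simps)
    finally show ?thesis .
  qed
  have "norm (if \<alpha> = 0 then f1 L else f1 0) \<le> \<eta> * (y + y * integral {0..L} (\<lambda>t. (norm (f t))\<^sup>2) + integral {0..L} (\<lambda>t. (norm (f1 t))\<^sup>2) + \<sigma>) + K"
    if y: "0 \<le> y" and s: "solves (\<lambda>t. complex_of_real (V t) - complex_of_real (- y)) (\<lambda>_. 0) L f f1"
      and sg: "\<forall>t\<in>{0..L}. (norm (f t))\<^sup>2 \<le> \<sigma>" for y f f1 \<sigma>
  proof -
    let ?h = "\<lambda>t. (complex_of_real (V t) - complex_of_real (- y)) * f t"
    have cf: "continuous_on {0..L} f" and cf1: "continuous_on {0..L} f1"
      using solves_continuous[OF s] solves_continuous_deriv[OF s less_imp_le[OF L]] by auto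
    have "?h absolutely_integrable_on {0..L}"
      by (rule absolutely_integrable_mult_continuous[OF potential_minus_absolutely_integrable[OF V] cf])
    then have ibp: "((\<lambda>t. ?h t * complex_of_real (g t)) has_integral
       (f1 L * complex_of_real (g L) - f1 0 * complex_of_real (g 0) - integral {0..L} (\<lambda>t. f1 t * complex_of_real (g1 t)))) {0..L}"
    proof (rule has_integral_by_parts[OF less_imp_le[OF L]])
      show "(?h has_integral (f1 x - f1 0)) {0..x}" if "x \<in> {0..L}" for x
        using s that by (simp add: solves_def)
      show "((\<lambda>t. complex_of_real (g t)) has_vector_derivative complex_of_real (g1 x)) (at x within {0..L})" for x
        by (intro has_vector_derivative_of_real dg)
      show "continuous_on {0..L} (\<lambda>t. complex_of_real (g1 t))" by (intro continuous_intros cg)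
    qed
    have i1: "(\<lambda>t. f1 t * complex_of_real (g1 t)) integrable_on {0..L}"
      by (intro integrable_continuous_interval continuous_intros cg cf1)
    have "((\<lambda>t. ?h t * complex_of_real (g t) + f1 t * complex_of_real (g1 t)) has_integral
       (f1 L * complex_of_real (g L) - f1 0 * complex_of_real (g 0))) {0..L}"
      using has_integral_add[OF ibp integrable_integral[OF i1]] by simp
    moreover define I where "I = (\<lambda>t. \<bar>V t\<bar> * (\<eta>' * \<sigma> + 1 / (4 * \<eta>')) + y * (\<eta> * (norm (f t))\<^sup>2 + (g t)\<^sup>2 / (4 * \<eta>)) + (\<eta> * (norm (f1 t))\<^sup>2 + (g1 t)\<^sup>2 / (4 * \<eta>)))"
    have ptw: "norm (?h t * complex_of_real (g t) + f1 t * complex_of_real (g1 t)) \<le> I t" if t: "t \<in> {0..L}" for t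
    proof -
      have 1: "\<bar>V t\<bar> * (norm (f t) * \<bar>g t\<bar>) \<le> \<bar>V t\<bar> * (\<eta>' * \<sigma> + 1 / (4 * \<eta>'))"
      proof (rule mult_left_mono)
        have "norm (f t) * \<bar>g t\<bar> \<le> norm (f t) * 1" using g01[OF t] by (intro mult_left_mono) auto
        also have "\<dots> \<le> \<eta>' * (norm (f t))\<^sup>2 + 1\<^sup>2 / (4 * \<eta>')" by (rule mult_le_eta[OF eta'(1)])
        also have "\<dots> \<le> \<eta>' * \<sigma> + 1 / (4 * \<eta>')" using sg t eta'(1) by auto
        finally show "norm (f t) * \<bar>g t\<bar> \<le> \<eta>' * \<sigma> + 1 / (4 * \<eta>')" .
      qed simp
      have 2: "y * (norm (f t) * \<bar>g t\<bar>) \<le> y * (\<eta> * (norm (f t))\<^sup>2 + (g t)\<^sup>2 / (4 * \<eta>))"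
        using mult_le_eta[OF eta, of "norm (f t)" "\<bar>g t\<bar>"] y by (intro mult_left_mono) auto
      have 3: "norm (f1 t) * \<bar>g1 t\<bar> \<le> \<eta> * (norm (f1 t))\<^sup>2 + (g1 t)\<^sup>2 / (4 * \<eta>)"
        using mult_le_eta[OF eta, of "norm (f1 t)" "\<bar>g1 t\<bar>"] by simp
      have "norm (complex_of_real (V t) - complex_of_real (- y)) \<le> \<bar>V t\<bar> + y"
        using norm_triangle_ineq[of "complex_of_real (V t)" "complex_of_real y"] y by simp
      then have "norm (complex_of_real (V t) - complex_of_real (- y)) * (norm (f t) * \<bar>g t\<bar>) \<le> (\<bar>V t\<bar> + y) * (norm (f t) * \<bar>g t\<bar>)"
        by (rule mult_right_mono) simp
      then have 4: "norm (?h t * complex_of_real (g t)) \<le> \<bar>V t\<bar> * (norm (f t) * \<bar>g t\<bar>) + y * (norm (f t) * \<bar>g t\<bar>)"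
        unfolding norm_mult by (simp add: distrib_right mult.assoc)
      have 5: "norm (f1 t * complex_of_real (g1 t)) = norm (f1 t) * \<bar>g1 t\<bar>" by (simp add: norm_mult)
      show ?thesis unfolding I_def using norm_triangle_ineq[of "?h t * complex_of_real (g t)" "f1 t * complex_of_real (g1 t)"] 1 2 3 4 5 by linarith
    qed
    have iV: "((\<lambda>t. \<bar>V t\<bar>) has_integral vv) {0..L}" unfolding vv_def
      using L2_on_absolutely_integrable[OF V] by (intro integrable_integral) (simp add: absolutely_integrable_on_def)
    have iI: "(I has_integral (vv * (\<eta>' * \<sigma> + 1 / (4 * \<eta>')) +
       y * (\<eta> * integral {0..L} (\<lambda>t. (norm (f t))\<^sup>2) + integral {0..L} (\<lambda>t. (g t)\<^sup>2) / (4 * \<eta>)) +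
       (\<eta> * integral {0..L} (\<lambda>t. (norm (f1 t))\<^sup>2) + integral {0..L} (\<lambda>t. (g1 t)\<^sup>2 / (4 * \<eta>))))) {0..L}"
      unfolding I_def using eta
      by (intro has_integral_add has_integral_mult_left has_integral_mult_right has_integral_divide iV integrable_integral
          integrable_continuous_interval continuous_intros cg cf cf1) auto
    have "norm (f1 L * complex_of_real (g L) - f1 0 * complex_of_real (g 0)) \<le> vv * (\<eta>' * \<sigma> + 1 / (4 * \<eta>')) +
       y * (\<eta> * integral {0..L} (\<lambda>t. (norm (f t))\<^sup>2) + integral {0..L} (\<lambda>t. (g t)\<^sup>2) / (4 * \<eta>)) +
       (\<eta> * integral {0..L} (\<lambda>t. (norm (f1 t))\<^sup>2) + integral {0..L} (\<lambda>t. (g1 t)\<^sup>2 / (4 * \<eta>)))"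
      using integral_norm_bound_integral[OF has_integral_integrable[OF calculation] has_integral_integrable[OF iI] ptw]
      unfolding integral_unique[OF calculation] integral_unique[OF iI] .
    moreover have "norm (f1 L * complex_of_real (g L) - f1 0 * complex_of_real (g 0)) = norm (if \<alpha> = 0 then f1 L else f1 0)"
      unfolding ends by simp
    moreover have "vv * (\<eta>' * \<sigma>) \<le> \<eta> * \<sigma>"
    proof -
      have "0 \<le> \<sigma>" using sg L by (intro order_trans[OF zero_le_power2, of "norm (f 0)"]) auto
      then show ?thesis unfolding mult.assoc[symmetric] by (rule mult_right_mono[OF eta'(2)])
    qed
    moreover have "y * (integral {0..L} (\<lambda>t. (g t)\<^sup>2) / (4 * \<eta>)) \<le> y * \<eta>"
      using ig eta y by (intro mult_left_mono) (simp_all add: field_simps power2_eq_square)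
    moreover have "vv * (\<eta>' * \<sigma> + 1 / (4 * \<eta>')) = vv * (\<eta>' * \<sigma>) + vv * (1 / (4 * \<eta>'))"
      "y * (\<eta> * integral {0..L} (\<lambda>t. (norm (f t))\<^sup>2) + integral {0..L} (\<lambda>t. (g t)\<^sup>2) / (4 * \<eta>))
        = y * (\<eta> * integral {0..L} (\<lambda>t. (norm (f t))\<^sup>2)) + y * (integral {0..L} (\<lambda>t. (g t)\<^sup>2) / (4 * \<eta>))"
      by (rule distrib_left)+
    moreover have "\<eta> * (y + y * integral {0..L} (\<lambda>t. (norm (f t))\<^sup>2) + integral {0..L} (\<lambda>t. (norm (f1 t))\<^sup>2) + \<sigma>)
       = y * \<eta> + y * (\<eta> * integral {0..L} (\<lambda>t. (norm (f t))\<^sup>2)) + \<eta> * integral {0..L} (\<lambda>t. (norm (f1 t))\<^sup>2) + \<eta> * \<sigma>"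
      by (simp only: distrib_left mult.left_commute[of \<eta> y] mult.commute[of \<eta> y])
    ultimately show ?thesis unfolding K_def by linarith
  qed
  with K0 show ?thesis by blast
qed

section \<open>Energy identity for solutions without the derivative condition at
  \<open>v\<close>\<close>

context quantum_graph
begin

definition mass :: "('e \<Rightarrow> real \<Rightarrow> complex) \<Rightarrow> real" where
  "mass h = (\<Sum>e\<in>arcs G. integral {0..len e} (\<lambda>t. (norm (h e t))\<^sup>2))"

text \<open>With both coefficients 0 the row of \<open>p0\<close> is empty. These are thus the
  nonzero solutions subject to everything except the derivative condition at \<open>v\<close>, from
  which the Dirichlet-to-Neumann function is formed.\<close>

definition kernel :: "complex \<Rightarrow> ('e \<times> bool \<Rightarrow> complex) \<Rightarrow> bool" where
  "kernel \<mu> x \<longleftrightarrow> (\<exists>i\<in>ends. x i \<noteq> 0) \<and> (\<forall>p\<in>ends. (\<Sum>j\<in>ends. K \<mu> 0 0 p j * x j) = 0)"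

definition flux :: "complex \<Rightarrow> ('e \<times> bool \<Rightarrow> complex) \<Rightarrow> complex" where
  "flux \<mu> x = (\<Sum>p\<in>ends_at G v. end_deriv len (comb \<mu> x) p)"

definition vertex_value :: "complex \<Rightarrow> ('e \<times> bool \<Rightarrow> complex) \<Rightarrow> complex" where
  "vertex_value \<mu> x = end_value len (comb \<mu> x) p0"

text \<open>A common bound for all \<open>1 / len e\<close>, so that one trace inequality serves
  every edge.\<close>

definition \<kappa> :: real where "\<kappa> = (\<Sum>e\<in>arcs G. 1 / len e)"

lemma comb_continuous:
  assumes "e \<in> arcs G"
  shows "continuous_on {0..len e} (comb \<mu> x e)" "continuous_on {0..len e} (comb1 \<mu> x e)"
  using solves_continuous[OF comb(1)[OF assms]] solves_continuous_deriv[OF comb(1)[OF assms] less_imp_le[OF len_pos[OF assms]]] by auto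

lemma mass_edge:
  assumes "\<And>e. e \<in> arcs G \<Longrightarrow> continuous_on {0..len e} (h e)"
  shows "0 \<le> mass h" "e \<in> arcs G \<Longrightarrow> integral {0..len e} (\<lambda>t. (norm (h e t))\<^sup>2) \<le> mass h"
proof -
  have n: "0 \<le> integral {0..len e} (\<lambda>t. (norm (h e t))\<^sup>2)" if "e \<in> arcs G" for e
    by (intro integral_nonneg integrable_continuous_interval continuous_intros assms that) simp
  then show "0 \<le> mass h" unfolding mass_def by (intro sum_nonneg)
  show "integral {0..len e} (\<lambda>t. (norm (h e t))\<^sup>2) \<le> mass h" if "e \<in> arcs G"
    unfolding mass_def by (rule member_le_sum[OF that _ finite_arcs]) (use n in auto)
qed

lemma comb_sup_bound:
  assumes e: "e \<in> arcs G" and \<epsilon>: "0 < \<epsilon>" and t: "t \<in> {0..len e}"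
  shows "(norm (comb \<mu> x e t))\<^sup>2 \<le> (\<kappa> + 1 / \<epsilon>) * integral {0..len e} (\<lambda>t. (norm (comb \<mu> x e t))\<^sup>2) +
    \<epsilon> * integral {0..len e} (\<lambda>t. (norm (comb1 \<mu> x e t))\<^sup>2)"
proof -
  have "(norm (comb \<mu> x e t))\<^sup>2 \<le> (1 / len e + 1 / \<epsilon>) * integral {0..len e} (\<lambda>t. (norm (comb \<mu> x e t))\<^sup>2) +
    \<epsilon> * integral {0..len e} (\<lambda>t. (norm (comb1 \<mu> x e t))\<^sup>2)"
    by (rule sup_bound_C1[OF len_pos[OF e] \<epsilon> _ comb_continuous(2)[OF e] t])
      (use comb(1)[OF e, of \<mu> x] in \<open>auto simp: solves_def\<close>)
  also have "\<dots> \<le> (\<kappa> + 1 / \<epsilon>) * integral {0..len e} (\<lambda>t. (norm (comb \<mu> x e t))\<^sup>2) +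
    \<epsilon> * integral {0..len e} (\<lambda>t. (norm (comb1 \<mu> x e t))\<^sup>2)"
  proof (intro add_right_mono mult_right_mono)
    show "1 / len e \<le> \<kappa>"
      unfolding \<kappa>_def by (rule member_le_sum[OF e _ finite_arcs]) (use len_pos less_imp_le in auto)
    show "0 \<le> integral {0..len e} (\<lambda>t. (norm (comb \<mu> x e t))\<^sup>2)"
      by (intro integral_nonneg integrable_continuous_interval continuous_intros comb_continuous e) simp
  qed
  finally show ?thesis .
qed

lemma \<kappa>_nonneg: "0 \<le> \<kappa>"
  unfolding \<kappa>_def by (intro sum_nonneg) (use len_pos less_imp_le in auto)

lemma comb_mass_bound:
  assumes e: "e \<in> arcs G" and \<epsilon>: "0 < \<epsilon>" and t: "t \<in> {0..len e}"
  shows "(norm (comb \<mu> x e t))\<^sup>2 \<le> (\<kappa> + 1 / \<epsilon>) * mass (comb \<mu> x) + \<epsilon> * mass (comb1 \<mu> x)"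
proof -
  note comb_sup_bound[OF e \<epsilon> t, of \<mu> x]
  also have "(\<kappa> + 1 / \<epsilon>) * integral {0..len e} (\<lambda>t. (norm (comb \<mu> x e t))\<^sup>2) +
    \<epsilon> * integral {0..len e} (\<lambda>t. (norm (comb1 \<mu> x e t))\<^sup>2) \<le> (\<kappa> + 1 / \<epsilon>) * mass (comb \<mu> x) + \<epsilon> * mass (comb1 \<mu> x)"
    using \<kappa>_nonneg \<epsilon> by (intro add_mono mult_left_mono mass_edge(2) comb_continuous e) auto
  finally show ?thesis .
qed

text \<open>The trace inequality is used with \<epsilon> tending to 0: zero mass makes every value
  arbitrarily small, however large the derivative.\<close>

lemma kernel_mass_pos:
  assumes "kernel \<mu> x"
  shows "0 < mass (comb \<mu> x)"
proof (rule ccontr)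
  assume "\<not> 0 < mass (comb \<mu> x)"
  then have z: "mass (comb \<mu> x) = 0" using mass_edge(1)[of "comb \<mu> x", OF comb_continuous(1)] by simp
  obtain e b where e: "e \<in> arcs G" "x (e, b) \<noteq> 0" using assms by (auto simp: kernel_def ends_def)
  have "0 \<le> mass (comb1 \<mu> x)" by (rule mass_edge(1)[OF comb_continuous(2)])
  have "(norm (comb \<mu> x e t))\<^sup>2 \<le> 0" if t: "t \<in> {0..len e}" for t
  proof (rule field_le_epsilon)
    fix d :: real assume d: "0 < d"
    define \<epsilon> where "\<epsilon> = d / (mass (comb1 \<mu> x) + 1)"
    have \<epsilon>: "0 < \<epsilon>" "\<epsilon> * mass (comb1 \<mu> x) \<le> d"
      using d \<open>0 \<le> mass (comb1 \<mu> x)\<close> by (simp_all add: \<epsilon>_def field_simps)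
    show "(norm (comb \<mu> x e t))\<^sup>2 \<le> 0 + d"
      using comb_mass_bound[OF e(1) \<epsilon>(1) t, of \<mu> x] \<epsilon>(2) z by simp
  qed
  then have "comb \<mu> x e t = 0" if "t \<in> {0..len e}" for t using that by simp
  then show False using comb_zero[OF e(1), of \<mu> x b] e(2) by blast
qed

lemma kernel_vertex_value:
  assumes k: "kernel \<mu> x" and p: "p \<in> ends_at G v"
  shows "end_value len (comb \<mu> x) p = vertex_value \<mu> x"
proof -
  have p': "p \<in> ends" "vert p = v" using p by (auto simp: ends_at_eq)
  have "row 0 0 p (end_value len (comb \<mu> x)) (end_deriv len (comb \<mu> x)) = 0"
    unfolding row_comb[OF p'(1)] using k p'(1) by (simp add: kernel_def)
  then show ?thesis using p' by (cases "p = p0") (simp_all add: row_def vertex_value_def)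
qed

lemma comb_end_values:
  assumes "e \<in> arcs G"
  shows "end_value len (comb \<mu> x) (e, False) = comb \<mu> x e 0" "end_value len (comb \<mu> x) (e, True) = comb \<mu> x e (len e)"
    "end_deriv len (comb \<mu> x) (e, False) = comb1 \<mu> x e 0" "end_deriv len (comb \<mu> x) (e, True) = - comb1 \<mu> x e (len e)"
proof -
  have "(e, b) \<in> ends" for b using assms by (simp add: ends_def)
  note d = end_deriv_solves[where f = "comb \<mu> x", OF this, unfolded fst_conv, OF comb(1)[OF assms]]
  show "end_deriv len (comb \<mu> x) (e, False) = comb1 \<mu> x e 0" "end_deriv len (comb \<mu> x) (e, True) = - comb1 \<mu> x e (len e)"
    using d[of False] d[of True] by auto
qed (simp_all add: end_value_def)

text \<open>Green's formula on all edges; \<open>\<rho>\<close> collects the potential and the vertices other than \<open>v\<close>.\<close>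

lemma energy_identity:
  "\<exists>M>0. \<forall>\<mu> x. kernel \<mu> x \<longrightarrow> (\<exists>\<rho>. flux \<mu> x * cnj (vertex_value \<mu> x) =
       \<mu> * complex_of_real (mass (comb \<mu> x)) - complex_of_real (mass (comb1 \<mu> x) + \<rho>) \<and>
     (\<forall>\<epsilon>>0. \<bar>\<rho>\<bar> \<le> M * ((\<kappa> + 1 / \<epsilon>) * mass (comb \<mu> x) + \<epsilon> * mass (comb1 \<mu> x))))"
proof -
  have "\<forall>w\<in>verts G - {v}. \<exists>C\<ge>0. \<forall>F F'. A w *\<^sub>v vec_of_list (map F (inc w)) + B w *\<^sub>v vec_of_list (map F' (inc w)) = 0\<^sub>v (length (inc w)) \<longrightarrow>
    Im (\<Sum>p\<in>ends_at G w. F' p * cnj (F p)) = 0 \<and>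
    norm (\<Sum>p\<in>ends_at G w. F' p * cnj (F p)) \<le> C * (\<Sum>p\<in>ends_at G w. (norm (F p))\<^sup>2)"
    by (intro ballI selfadjoint_condition_form sa)
  from bchoice[OF this] obtain Cw where Cw: "\<forall>w\<in>verts G - {v}. 0 \<le> Cw w \<and> (\<forall>F F'. A w *\<^sub>v vec_of_list (map F (inc w)) + B w *\<^sub>v vec_of_list (map F' (inc w)) = 0\<^sub>v (length (inc w)) \<longrightarrow>
    Im (\<Sum>p\<in>ends_at G w. F' p * cnj (F p)) = 0 \<and>
    norm (\<Sum>p\<in>ends_at G w. F' p * cnj (F p)) \<le> Cw w * (\<Sum>p\<in>ends_at G w. (norm (F p))\<^sup>2))" ..
  define Cm where "Cm = (\<Sum>w\<in>verts G - {v}. Cw w)"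
  have Cm: "Cw w \<le> Cm" if "w \<in> verts G - {v}" for w
    unfolding Cm_def by (rule member_le_sum[OF that]) (use Cw finite_verts in auto)
  have Cm0: "0 \<le> Cm" unfolding Cm_def using Cw by (intro sum_nonneg) auto
  define vv where "vv = (\<lambda>e. integral {0..len e} (\<lambda>t. \<bar>V e t\<bar>))"
  have vv0: "0 \<le> vv e" if "e \<in> arcs G" for e
    unfolding vv_def using L2_on_absolutely_integrable[OF V[OF that]]
    by (intro integral_nonneg) (auto simp: absolutely_integrable_on_def)
  define vm where "vm = (\<Sum>e\<in>arcs G. vv e)"
  have vm: "vv e \<le> vm" if "e \<in> arcs G" for e
    unfolding vm_def by (rule member_le_sum[OF that _ finite_arcs]) (use vv0 in auto)
  have vm0: "0 \<le> vm" unfolding vm_def using vv0 by (intro sum_nonneg)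
  \<comment> \<open>\<open>vm\<close> accounts for the potential, \<open>2 * Cm\<close> for the
    vertex terms at the two ends of each edge, and 1 for positivity.\<close>
  define M where "M = vm + 2 * Cm + 1"
  have "\<exists>\<rho>. flux \<mu> x * cnj (vertex_value \<mu> x) =
       \<mu> * complex_of_real (mass (comb \<mu> x)) - complex_of_real (mass (comb1 \<mu> x) + \<rho>) \<and>
     (\<forall>\<epsilon>>0. \<bar>\<rho>\<bar> \<le> M * ((\<kappa> + 1 / \<epsilon>) * mass (comb \<mu> x) + \<epsilon> * mass (comb1 \<mu> x)))"
    if k: "kernel \<mu> x" for \<mu> x
  proof -
    let ?F = "end_value len (comb \<mu> x)" and ?D = "end_deriv len (comb \<mu> x)"
    define a where "a = (\<lambda>e. integral {0..len e} (\<lambda>t. (norm (comb \<mu> x e t))\<^sup>2))"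
    define b where "b = (\<lambda>e. integral {0..len e} (\<lambda>t. (norm (comb1 \<mu> x e t))\<^sup>2))"
    define W where "W = (\<lambda>e. integral {0..len e} (\<lambda>t. V e t * (norm (comb \<mu> x e t))\<^sup>2))"
    define q where "q = (\<lambda>w. \<Sum>p\<in>ends_at G w. ?D p * cnj (?F p))"
    define r where "r = (\<Sum>w\<in>verts G - {v}. q w)"
    have cond: "Im (q w) = 0 \<and> norm (q w) \<le> Cw w * (\<Sum>p\<in>ends_at G w. (norm (?F p))\<^sup>2)" if w: "w \<in> verts G - {v}" for w
    proof -
      have "\<forall>p\<in>ends_at G w. row 0 0 p ?F ?D = 0"
        using k row_comb[of _ 0 0 \<mu> x] by (auto simp: kernel_def ends_at_eq)
      then have "A w *\<^sub>v vec_of_list (map ?F (inc w)) + B w *\<^sub>v vec_of_list (map ?D (inc w)) = 0\<^sub>v (length (inc w))"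
        using matrix_condition_iff[OF w] by blast
      then show ?thesis unfolding q_def using Cw w by blast
    qed
    \<comment> \<open>Self-adjointness at the other vertices makes their total contribution real, so
      \<open>\<mu>\<close> is the only source of an imaginary part.\<close>
    have rr: "r = complex_of_real (Re r)"
    proof (rule complex_eqI)
      have "Im r = (\<Sum>w\<in>verts G - {v}. Im (q w))" by (simp add: r_def)
      also have "\<dots> = 0" using cond by (intro sum.neutral) auto
      finally show "Im r = Im (complex_of_real (Re r))" by simp
    qed simp
    have vv: "v \<in> verts G" using vert_in[OF p0_in(1)] p0_in(2) by simp
    have qv: "q v = flux \<mu> x * cnj (vertex_value \<mu> x)"
      unfolding q_def flux_def sum_distrib_right
      by (rule sum.cong[OF refl]) (simp add: kernel_vertex_value[OF k])
    \<comment> \<open>The boundary terms are regrouped from vertices to edges, where Green's formula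
      applies.\<close>
    have "q v + r = (\<Sum>p\<in>ends. ?D p * cnj (?F p))"
      unfolding sum_ends r_def q_def by (rule sum.remove[OF finite_verts vv, symmetric])
    also have "\<dots> = (\<Sum>e\<in>arcs G. comb1 \<mu> x e 0 * cnj (comb \<mu> x e 0) - comb1 \<mu> x e (len e) * cnj (comb \<mu> x e (len e)))"
      unfolding sum_ends_arcs by (rule sum.cong[OF refl]) (simp add: comb_end_values)
    also have "\<dots> = (\<Sum>e\<in>arcs G. \<mu> * complex_of_real (a e) - complex_of_real (b e + W e))"
      unfolding a_def b_def W_def by (intro sum.cong refl green_edge comb V len_pos)
    also have "\<dots> = \<mu> * complex_of_real (sum a (arcs G)) - complex_of_real (sum b (arcs G) + sum W (arcs G))"
      by (simp add: sum_subtractf sum_distrib_left sum.distrib)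
    finally have eq: "q v + r = \<mu> * complex_of_real (sum a (arcs G)) - complex_of_real (sum b (arcs G) + sum W (arcs G))" .
    define \<rho> where "\<rho> = sum W (arcs G) + Re r"
    have "q v = \<mu> * complex_of_real (sum a (arcs G)) - complex_of_real (sum b (arcs G) + sum W (arcs G)) - complex_of_real (Re r)"
      using eq rr by (metis add_diff_cancel_right')
    then have I: "flux \<mu> x * cnj (vertex_value \<mu> x) = \<mu> * complex_of_real (mass (comb \<mu> x)) - complex_of_real (mass (comb1 \<mu> x) + \<rho>)"
      unfolding qv by (simp add: mass_def a_def b_def \<rho>_def)
    have "\<bar>\<rho>\<bar> \<le> M * ((\<kappa> + 1 / \<epsilon>) * mass (comb \<mu> x) + \<epsilon> * mass (comb1 \<mu> x))" if \<epsilon>: "0 < \<epsilon>" for \<epsilon>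
    proof -
      define m where "m = (\<lambda>e. (\<kappa> + 1 / \<epsilon>) * a e + \<epsilon> * b e)"
      have m: "(norm (comb \<mu> x e t))\<^sup>2 \<le> m e" if "e \<in> arcs G" "t \<in> {0..len e}" for e t
        unfolding m_def a_def b_def by (rule comb_sup_bound[OF that(1) \<epsilon> that(2)])
      have m0: "0 \<le> m e" if "e \<in> arcs G" for e
        using m[OF that, of 0] len_pos[OF that] by (auto intro: order_trans[OF zero_le_power2])
      have ms: "sum m (arcs G) = (\<kappa> + 1 / \<epsilon>) * mass (comb \<mu> x) + \<epsilon> * mass (comb1 \<mu> x)"
        by (simp add: m_def sum.distrib sum_distrib_left[symmetric] mass_def a_def b_def)
      have ms0: "0 \<le> sum m (arcs G)" using m0 by (intro sum_nonneg)
      have "\<bar>sum W (arcs G)\<bar> \<le> (\<Sum>e\<in>arcs G. vm * m e)"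
      proof (rule order_trans[OF sum_abs], rule sum_mono)
        fix e assume e: "e \<in> arcs G"
        have "\<bar>W e\<bar> \<le> vv e * m e" unfolding W_def vv_def
          by (rule potential_integral_bound[OF V[OF e]])
            (use m[OF e] in \<open>auto intro!: continuous_intros comb_continuous[OF e]\<close>)
        also have "\<dots> \<le> vm * m e" by (rule mult_right_mono[OF vm[OF e] m0[OF e]])
        finally show "\<bar>W e\<bar> \<le> vm * m e" .
      qed
      then have w: "\<bar>sum W (arcs G)\<bar> \<le> vm * sum m (arcs G)" by (simp only: sum_distrib_left)
      have "\<bar>Re r\<bar> \<le> norm r" by (rule abs_Re_le_cmod)
      also have "\<dots> \<le> (\<Sum>w\<in>verts G - {v}. norm (q w))" unfolding r_def by (rule norm_sum)
      also have "\<dots> \<le> (\<Sum>w\<in>verts G - {v}. Cm * (\<Sum>p\<in>ends_at G w. (norm (?F p))\<^sup>2))"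
      proof (rule sum_mono)
        fix w assume w: "w \<in> verts G - {v}"
        have "Cw w * (\<Sum>p\<in>ends_at G w. (norm (?F p))\<^sup>2) \<le> Cm * (\<Sum>p\<in>ends_at G w. (norm (?F p))\<^sup>2)"
          by (intro mult_right_mono Cm[OF w] sum_nonneg) simp
        then show "norm (q w) \<le> Cm * (\<Sum>p\<in>ends_at G w. (norm (?F p))\<^sup>2)" using cond[OF w] by linarith
      qed
      also have "\<dots> \<le> (\<Sum>w\<in>verts G. Cm * (\<Sum>p\<in>ends_at G w. (norm (?F p))\<^sup>2))"
        by (intro sum_mono2 finite_verts mult_nonneg_nonneg Cm0 sum_nonneg) auto
      also have "\<dots> = Cm * (\<Sum>e\<in>arcs G. (norm (?F (e, False)))\<^sup>2 + (norm (?F (e, True)))\<^sup>2)"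
        by (simp only: sum_distrib_left[symmetric] sum_ends[symmetric] sum_ends_arcs)
      also have "\<dots> \<le> Cm * (\<Sum>e\<in>arcs G. 2 * m e)"
      proof (intro mult_left_mono Cm0 sum_mono)
        fix e assume e: "e \<in> arcs G"
        show "(norm (?F (e, False)))\<^sup>2 + (norm (?F (e, True)))\<^sup>2 \<le> 2 * m e"
          unfolding comb_end_values[OF e] using m[OF e, of 0] m[OF e, of "len e"] len_pos[OF e] by simp
      qed
      also have "\<dots> = 2 * Cm * sum m (arcs G)" by (simp add: sum_distrib_left[symmetric])
      finally have "\<bar>\<rho>\<bar> \<le> vm * sum m (arcs G) + 2 * Cm * sum m (arcs G)" using w unfolding \<rho>_def by linarith
      also have "\<dots> \<le> M * sum m (arcs G)" using ms0 by (simp add: M_def distrib_right)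
      finally show ?thesis unfolding ms .
    qed
    then show ?thesis using I by blast
  qed
  moreover have "0 < M" using vm0 Cm0 by (simp add: M_def)
  ultimately show ?thesis by blast
qed

text \<open>The two matrices differ only in the row of \<open>p0\<close>, and on that row the system
  is the linear relation between flux and vertex value.\<close>

lemma singular_iff: "singular \<mu> \<alpha> \<beta> \<longleftrightarrow> (\<exists>x. kernel \<mu> x \<and> \<alpha> * flux \<mu> x + \<beta> * vertex_value \<mu> x = 0)"
proof -
  have "(\<forall>p\<in>ends. (\<Sum>j\<in>ends. K \<mu> \<alpha> \<beta> p j * x j) = 0) \<longleftrightarrow>
    (\<forall>p\<in>ends. (\<Sum>j\<in>ends. K \<mu> 0 0 p j * x j) = 0) \<and> \<alpha> * flux \<mu> x + \<beta> * vertex_value \<mu> x = 0" for x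
  proof -
    have 0: "(\<Sum>j\<in>ends. K \<mu> 0 0 p0 j * x j) = 0" by (simp add: K_p0)
    have 1: "(\<Sum>j\<in>ends. K \<mu> \<alpha> \<beta> p0 j * x j) = \<alpha> * flux \<mu> x + \<beta> * vertex_value \<mu> x"
      unfolding row_comb[OF p0_in(1), symmetric] by (simp add: row_def p0_in flux_def vertex_value_def)
    have 2: "(\<Sum>j\<in>ends. K \<mu> \<alpha> \<beta> p j * x j) = (\<Sum>j\<in>ends. K \<mu> 0 0 p j * x j)" if "p \<noteq> p0" for p
      by (rule sum.cong[OF refl]) (subst K_off[OF that, of \<mu> \<alpha> \<beta>], rule refl)
    show ?thesis
    proof (intro iffI conjI ballI)
      fix p assume "\<forall>p\<in>ends. (\<Sum>j\<in>ends. K \<mu> \<alpha> \<beta> p j * x j) = 0" "p \<in> ends"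
      then show "(\<Sum>j\<in>ends. K \<mu> 0 0 p j * x j) = 0" using 0 2[of p] by (cases "p = p0") auto
    next
      assume "\<forall>p\<in>ends. (\<Sum>j\<in>ends. K \<mu> \<alpha> \<beta> p j * x j) = 0"
      then show "\<alpha> * flux \<mu> x + \<beta> * vertex_value \<mu> x = 0" using 1 p0_in(1) by auto
    next
      fix p assume "(\<forall>p\<in>ends. (\<Sum>j\<in>ends. K \<mu> 0 0 p j * x j) = 0) \<and> \<alpha> * flux \<mu> x + \<beta> * vertex_value \<mu> x = 0" "p \<in> ends"
      then show "(\<Sum>j\<in>ends. K \<mu> \<alpha> \<beta> p j * x j) = 0" using 1 2[of p] by (cases "p = p0") auto
    qed
  qed
  note iff = this
  show ?thesis unfolding singular_def kernel_def iff by (simp only: conj_assoc)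
qed

lemma kernel_scale:
  assumes "kernel \<mu> x" "c \<noteq> 0"
  shows "kernel \<mu> (\<lambda>j. c * x j)"
proof -
  have "(\<Sum>j\<in>ends. K \<mu> 0 0 p j * (c * x j)) = c * (\<Sum>j\<in>ends. K \<mu> 0 0 p j * x j)" for p
    by (simp add: sum_distrib_left mult.left_commute)
  then show ?thesis using assms by (simp add: kernel_def)
qed

lemma vertex_value_scale: "vertex_value \<mu> (\<lambda>j. c * x j) = c * vertex_value \<mu> x"
  unfolding vertex_value_def comb_ends(1)[OF p0_in(1)] by (simp add: sum_distrib_left mult.assoc)

text \<open>\<open>S \<mu>\<close> and \<open>C \<mu>\<close> are accessible only through the pairs
  for which \<open>\<alpha> * S \<mu> + \<beta> * C \<mu>\<close> vanishes. If no kernel element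
  vanishes at \<open>v\<close>, the pair (0, 1) shows that \<open>C \<mu>\<close> is nonzero, (0, 0)
  provides a kernel element, and (1, - flux) for the normalised element identifies the
  quotient.\<close>

lemma pair_quotient:
  assumes SC: "\<And>\<mu> \<alpha> \<beta>. singular \<mu> \<alpha> \<beta> \<longleftrightarrow> \<alpha> * S \<mu> + \<beta> * C \<mu> = 0"
    and nz: "\<And>x. kernel \<mu> x \<Longrightarrow> vertex_value \<mu> x \<noteq> 0"
  shows "C \<mu> \<noteq> 0" "\<exists>x. kernel \<mu> x \<and> vertex_value \<mu> x = 1 \<and> flux \<mu> x = S \<mu> / C \<mu>"
proof -
  show C: "C \<mu> \<noteq> 0"
  proof
    assume "C \<mu> = 0"
    then have "singular \<mu> 0 1" by (simp add: SC)
    then show False using nz unfolding singular_iff by auto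
  qed
  have "singular \<mu> 0 0" by (simp add: SC)
  then obtain x0 where x0: "kernel \<mu> x0" unfolding singular_iff by blast
  define x where "x = (\<lambda>j. (1 / vertex_value \<mu> x0) * x0 j)"
  have k: "kernel \<mu> x" unfolding x_def by (rule kernel_scale[OF x0]) (use nz[OF x0] in simp)
  have c: "vertex_value \<mu> x = 1" unfolding x_def vertex_value_scale using nz[OF x0] by simp
  have "singular \<mu> 1 (- flux \<mu> x)" unfolding singular_iff by (rule exI[of _ x]) (simp add: k c)
  then have "flux \<mu> x = S \<mu> / C \<mu>" using C by (simp add: SC eq_divide_eq)
  then show "\<exists>x. kernel \<mu> x \<and> vertex_value \<mu> x = 1 \<and> flux \<mu> x = S \<mu> / C \<mu>" using k c by blast
qed

end

section \<open>The Dirichlet-to-Neumann function off the real line and at minus infinity\<close>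

context quantum_graph
begin

lemma mass_comb_nonneg: "0 \<le> mass (comb \<mu> x)" "0 \<le> mass (comb1 \<mu> x)"
  by (rule mass_edge(1), rule comb_continuous, assumption)+

text \<open>The correction in the energy identity is real and drops out. With positivity of the mass
  this is the Herglotz property, and it excludes kernel elements that vanish at \<open>v\<close> for
  nonreal \<open>\<mu>\<close>.\<close>

lemma energy_nonreal:
  assumes k: "kernel \<mu> x"
  shows "Im (flux \<mu> x * cnj (vertex_value \<mu> x)) = Im \<mu> * mass (comb \<mu> x)"
proof -
  obtain \<rho> where "flux \<mu> x * cnj (vertex_value \<mu> x) =
       \<mu> * complex_of_real (mass (comb \<mu> x)) - complex_of_real (mass (comb1 \<mu> x) + \<rho>)"
    using energy_identity k by blast
  then show ?thesis by simp
qed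

lemma energy_negative:
  "\<exists>Y>0. \<forall>y\<ge>Y. \<forall>x. kernel (complex_of_real (- y)) x \<longrightarrow>
     y * mass (comb (complex_of_real (- y)) x) + mass (comb1 (complex_of_real (- y)) x)
       \<le> 2 * norm (flux (complex_of_real (- y)) x * cnj (vertex_value (complex_of_real (- y)) x))"
proof -
  obtain M where M: "0 < M" "\<forall>\<mu> x. kernel \<mu> x \<longrightarrow> (\<exists>\<rho>. flux \<mu> x * cnj (vertex_value \<mu> x) =
       \<mu> * complex_of_real (mass (comb \<mu> x)) - complex_of_real (mass (comb1 \<mu> x) + \<rho>) \<and>
     (\<forall>\<epsilon>>0. \<bar>\<rho>\<bar> \<le> M * ((\<kappa> + 1 / \<epsilon>) * mass (comb \<mu> x) + \<epsilon> * mass (comb1 \<mu> x))))"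
    using energy_identity by blast
  \<comment> \<open>With \<epsilon> equal to \<open>1 / (2 * M)\<close> the correction takes at most
    half of \<open>b\<close>; this \<open>Y\<close> limits the rest of it to half of
    \<open>y * a\<close>.\<close>
  define Y where "Y = 2 * (M * (\<kappa> + 2 * M)) + 1"
  have Y: "0 < Y" using M(1) \<kappa>_nonneg by (simp add: Y_def add_nonneg_pos)
  have "y * mass (comb (complex_of_real (- y)) x) + mass (comb1 (complex_of_real (- y)) x)
       \<le> 2 * norm (flux (complex_of_real (- y)) x * cnj (vertex_value (complex_of_real (- y)) x))"
    if y: "Y \<le> y" and k: "kernel (complex_of_real (- y)) x" for y x
  proof -
    define a where "a = mass (comb (complex_of_real (- y)) x)"
    define b where "b = mass (comb1 (complex_of_real (- y)) x)"
    have a0: "0 \<le> a" unfolding a_def by (rule mass_comb_nonneg)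
    obtain \<rho> where \<rho>: "flux (complex_of_real (- y)) x * cnj (vertex_value (complex_of_real (- y)) x) =
        complex_of_real (- y) * complex_of_real a - complex_of_real (b + \<rho>)"
      "\<forall>\<epsilon>>0. \<bar>\<rho>\<bar> \<le> M * ((\<kappa> + 1 / \<epsilon>) * a + \<epsilon> * b)"
      using M(2) k unfolding a_def b_def by blast
    have "\<bar>\<rho>\<bar> \<le> M * ((\<kappa> + 1 / (1 / (2 * M))) * a + 1 / (2 * M) * b)" by (rule \<rho>(2)[rule_format]) (use M(1) in simp)
    also have "\<dots> = M * (\<kappa> + 2 * M) * a + b / 2" using M(1) by (simp add: field_simps)
    also have "M * (\<kappa> + 2 * M) * a \<le> y / 2 * a" using y a0 by (intro mult_right_mono) (simp_all add: Y_def)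
    finally have "\<bar>\<rho>\<bar> \<le> y * a / 2 + b / 2" by simp
    moreover have "flux (complex_of_real (- y)) x * cnj (vertex_value (complex_of_real (- y)) x) = complex_of_real (- (y * a + b + \<rho>))"
      unfolding \<rho>(1) by simp
    then have "norm (flux (complex_of_real (- y)) x * cnj (vertex_value (complex_of_real (- y)) x)) = \<bar>y * a + b + \<rho>\<bar>"
      by (simp only: norm_of_real abs_minus_cancel)
    ultimately show ?thesis unfolding a_def[symmetric] b_def[symmetric] by linarith
  qed
  then show ?thesis using Y by blast
qed

text \<open>The single-end bound is summed over the ends at \<open>v\<close>, with the test function
  that equals 1 at the respective end. The factor \<open>\<eta>\<close> is arbitrary, at the expense
  of \<open>K\<close>.\<close>

lemma flux_bound:
  assumes eta: "0 < \<eta>"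
  shows "\<exists>K\<ge>0. \<forall>y\<ge>0. \<forall>x \<sigma>. (\<forall>e\<in>arcs G. \<forall>t\<in>{0..len e}. (norm (comb (complex_of_real (- y)) x e t))\<^sup>2 \<le> \<sigma>) \<longrightarrow>
     norm (flux (complex_of_real (- y)) x) \<le> real (card (ends_at G v)) *
       (\<eta> * (y + y * mass (comb (complex_of_real (- y)) x) + mass (comb1 (complex_of_real (- y)) x) + \<sigma>)) + K"
proof -
  define P where "P = (\<lambda>p K. 0 \<le> K \<and> (\<forall>y\<ge>0. \<forall>f f1 \<sigma>. solves (\<lambda>t. complex_of_real (V (fst p) t) - complex_of_real (- y)) (\<lambda>_. 0) (len (fst p)) f f1 \<longrightarrow>
     (\<forall>t\<in>{0..len (fst p)}. (norm (f t))\<^sup>2 \<le> \<sigma>) \<longrightarrow>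
     norm (if snd p then f1 (len (fst p)) else f1 0) \<le> \<eta> * (y + y * integral {0..len (fst p)} (\<lambda>t. (norm (f t))\<^sup>2) + integral {0..len (fst p)} (\<lambda>t. (norm (f1 t))\<^sup>2) + \<sigma>) + K))"
  have "\<exists>K. P p K" if p: "p \<in> ends_at G v" for p
  proof -
    have e: "fst p \<in> arcs G" using p by (auto simp: ends_at_def)
    obtain \<alpha> \<beta> :: real where ab: "(\<alpha>, \<beta>) = (0, 1 / len (fst p)) \<or> (\<alpha>, \<beta>) = (1, - 1 / len (fst p))" "\<alpha> = 0 \<longleftrightarrow> snd p"
      by (cases "snd p") auto
    show ?thesis using end_derivative_bound[OF V[OF e] len_pos[OF e] eta ab(1)] unfolding P_def ab(2) by blast
  qed
  then have "\<forall>p\<in>ends_at G v. \<exists>K. P p K" by blast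
  from bchoice[OF this] obtain Kp where Kp: "\<forall>p\<in>ends_at G v. P p (Kp p)" ..
  define K0 where "K0 = sum Kp (ends_at G v)"
  have "0 \<le> K0" unfolding K0_def using Kp by (intro sum_nonneg) (auto simp: P_def)
  moreover have "norm (flux (complex_of_real (- y)) x) \<le> real (card (ends_at G v)) *
       (\<eta> * (y + y * mass (comb (complex_of_real (- y)) x) + mass (comb1 (complex_of_real (- y)) x) + \<sigma>)) + K0"
    if y: "0 \<le> y" and sg: "\<forall>e\<in>arcs G. \<forall>t\<in>{0..len e}. (norm (comb (complex_of_real (- y)) x e t))\<^sup>2 \<le> \<sigma>" for y x \<sigma>
  proof -
    let ?\<mu> = "complex_of_real (- y)"
    let ?E = "\<eta> * (y + y * mass (comb ?\<mu> x) + mass (comb1 ?\<mu> x) + \<sigma>)"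
    have "norm (flux ?\<mu> x) \<le> (\<Sum>p\<in>ends_at G v. ?E + Kp p)"
      unfolding flux_def
    proof (rule sum_norm_le)
      fix p assume p: "p \<in> ends_at G v"
      have e: "fst p \<in> arcs G" and pe: "p \<in> ends" using p by (auto simp: ends_at_def ends_def)
      have "norm (end_deriv len (comb ?\<mu> x) p) = norm (if snd p then comb1 ?\<mu> x (fst p) (len (fst p)) else comb1 ?\<mu> x (fst p) 0)"
        unfolding end_deriv_solves[where f = "comb ?\<mu> x", OF pe comb(1)[OF e]] by simp
      also have "\<dots> \<le> \<eta> * (y + y * integral {0..len (fst p)} (\<lambda>t. (norm (comb ?\<mu> x (fst p) t))\<^sup>2) + integral {0..len (fst p)} (\<lambda>t. (norm (comb1 ?\<mu> x (fst p) t))\<^sup>2) + \<sigma>) + Kp p"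
      proof -
        have "P p (Kp p)" using Kp p by blast
        then show ?thesis unfolding P_def using y comb(1)[OF e, of ?\<mu> x] sg e by blast
      qed
      also have "\<dots> \<le> ?E + Kp p"
        using eta y by (intro add_mono mult_left_mono order_refl mass_edge(2) comb_continuous e) auto
      finally show "norm (end_deriv len (comb ?\<mu> x) p) \<le> ?E + Kp p" .
    qed
    then show ?thesis by (simp add: sum.distrib K0_def)
  qed
  ultimately show ?thesis by blast
qed

lemma vertex_value_bound:
  assumes "0 < \<epsilon>"
  shows "(norm (vertex_value \<mu> x))\<^sup>2 \<le> (\<kappa> + 1 / \<epsilon>) * mass (comb \<mu> x) + \<epsilon> * mass (comb1 \<mu> x)"
proof -
  have e: "fst p0 \<in> arcs G" using p0_in by (auto simp: ends_def)
  have v: "vertex_value \<mu> x = comb \<mu> x (fst p0) (if snd p0 then len (fst p0) else 0)"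
    by (simp add: vertex_value_def end_value_def case_prod_beta)
  have t: "(if snd p0 then len (fst p0) else 0) \<in> {0..len (fst p0)}" using len_pos[OF e] by auto
  show ?thesis unfolding v by (rule comb_mass_bound[OF e assms t])
qed

lemma dispersion_relation:
  "\<exists>(\<Delta> :: real set) (U :: complex set) (\<Lambda> :: mvfun).
      bdd_below \<Delta> \<and> (\<forall>x. \<not> x islimpt \<Delta>) \<and>
      sphere 0 1 \<subseteq> U \<and> mv_analytic_on U \<Lambda> \<and>
      (\<forall>z\<in>sphere 0 1. mv_values \<Lambda> z \<subseteq> \<real>) \<and>
      (\<forall>z\<in>sphere 0 1.
         op_spectrum G len (hamiltonian G len V inc A B v z) = mv_values \<Lambda> z \<union> complex_of_real ` \<Delta>) \<and>
      mv_irreducible_on U \<Lambda> \<and>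
      (\<forall>a b \<phi>. circle_branch \<Lambda> a b \<phi> \<longrightarrow> strict_mono_on {a<..<b} (\<lambda>\<theta>. Re (\<phi> \<theta>)))"
proof -
  obtain S C where hol: "S holomorphic_on UNIV" "C holomorphic_on UNIV"
    and SC: "\<And>\<mu> \<alpha> \<beta>. singular \<mu> \<alpha> \<beta> \<longleftrightarrow> \<alpha> * S \<mu> + \<beta> * C \<mu> = 0"
    using characteristic_pair by blast
  have spec: "op_spectrum G len (hamiltonian G len V inc A B v z) = {\<mu>. (z + 1) * S \<mu> + \<i> * (z - 1) * C \<mu> = 0}" for z
    using singular_spectrum not_singular_resolvent unfolding SC by blast
  have Im: "\<exists>a>0. Im (S \<mu> * cnj (C \<mu>)) = Im \<mu> * a" if \<mu>: "Im \<mu> \<noteq> 0" for \<mu>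
  proof -
    have nz: "vertex_value \<mu> x \<noteq> 0" if k: "kernel \<mu> x" for x
    proof
      assume "vertex_value \<mu> x = 0"
      then show False using energy_nonreal[OF k] kernel_mass_pos[OF k] \<mu> by simp
    qed
    note pq = pair_quotient[of S C \<mu>, OF SC nz]
    obtain x where x: "kernel \<mu> x" "vertex_value \<mu> x = 1" "flux \<mu> x = S \<mu> / C \<mu>" using pq(2) by blast
    have "S \<mu> * cnj (C \<mu>) = (S \<mu> / C \<mu>) * complex_of_real ((norm (C \<mu>))\<^sup>2)"
      unfolding complex_norm_square using pq(1) by simp
    then have "Im (S \<mu> * cnj (C \<mu>)) = Im (S \<mu> / C \<mu>) * (norm (C \<mu>))\<^sup>2" by (simp only: times_complex.sel Re_complex_of_real Im_complex_of_real mult_zero_right add_0_left)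
    moreover have "Im (S \<mu> / C \<mu>) = Im \<mu> * mass (comb \<mu> x)" using energy_nonreal[OF x(1)] x(2,3) by simp
    ultimately show ?thesis using kernel_mass_pos[OF x(1)] pq(1)
      by (intro exI[of _ "mass (comb \<mu> x) * (norm (C \<mu>))\<^sup>2"]) simp
  qed
  obtain Y where Y: "0 < Y" "\<forall>y\<ge>Y. \<forall>x. kernel (complex_of_real (- y)) x \<longrightarrow>
     y * mass (comb (complex_of_real (- y)) x) + mass (comb1 (complex_of_real (- y)) x)
       \<le> 2 * norm (flux (complex_of_real (- y)) x * cnj (vertex_value (complex_of_real (- y)) x))"
    using energy_negative by blast
  have nzr: "vertex_value (complex_of_real (- y)) x \<noteq> 0" if y: "Y \<le> y" and k: "kernel (complex_of_real (- y)) x" for y x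
  proof
    assume "vertex_value (complex_of_real (- y)) x = 0"
    then have "y * mass (comb (complex_of_real (- y)) x) + mass (comb1 (complex_of_real (- y)) x) \<le> 0"
      using Y(2)[rule_format, OF y k] by simp
    moreover have "0 < y * mass (comb (complex_of_real (- y)) x)" using y Y(1) kernel_mass_pos[OF k] by simp
    ultimately show False using mass_comb_nonneg(2)[of "complex_of_real (- y)" x] by linarith
  qed
  have C: "C (complex_of_real (- y)) \<noteq> 0" if "Y \<le> y" for y
    using pair_quotient(1)[of S C "complex_of_real (- y)", OF SC nzr[OF that]] .
  have ex: "\<exists>x. vertex_value (complex_of_real (- y)) x = 1 \<and> flux (complex_of_real (- y)) x = S (complex_of_real (- y)) / C (complex_of_real (- y)) \<and>
     y * mass (comb (complex_of_real (- y)) x) + mass (comb1 (complex_of_real (- y)) x) \<le> 2 * norm (S (complex_of_real (- y)) / C (complex_of_real (- y)))"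
    if y: "Y \<le> y" for y
  proof -
    obtain x where x: "kernel (complex_of_real (- y)) x" "vertex_value (complex_of_real (- y)) x = 1"
      "flux (complex_of_real (- y)) x = S (complex_of_real (- y)) / C (complex_of_real (- y))"
      using pair_quotient(2)[of S C "complex_of_real (- y)", OF SC nzr[OF y]] by blast
    show ?thesis using Y(2)[rule_format, OF y x(1)] unfolding x(2,3) by (intro exI[of _ x] conjI x(2,3)) simp
  qed
  \<comment> \<open>Value 1 at \<open>v\<close> forces energy at least \<open>2 * M'\<close> for
    large \<open>y\<close>, by the trace inequality with \<epsilon> equal to
    \<open>1 / (2 * M')\<close>; and the energy is at most twice the norm of the quotient.\<close>
  have grow: "\<exists>N. \<forall>y\<ge>N. M \<le> norm (S (complex_of_real (- y)) / C (complex_of_real (- y)))" for M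
  proof -
    define M' where "M' = max 1 M"
    have M': "1 \<le> M'" "M \<le> M'" by (simp_all add: M'_def)
    have "M \<le> norm (S (complex_of_real (- y)) / C (complex_of_real (- y)))" if y: "max Y (2 * M' * (\<kappa> + 2 * M')) \<le> y" for y
    proof -
      let ?\<mu> = "complex_of_real (- y)"
      obtain x where x: "vertex_value ?\<mu> x = 1" "y * mass (comb ?\<mu> x) + mass (comb1 ?\<mu> x) \<le> 2 * norm (S ?\<mu> / C ?\<mu>)"
        using ex[of y] y by auto
      have "1 \<le> (\<kappa> + 1 / (1 / (2 * M'))) * mass (comb ?\<mu> x) + 1 / (2 * M') * mass (comb1 ?\<mu> x)"
        using vertex_value_bound[of "1 / (2 * M')" ?\<mu> x] x(1) M'(1) by simp
      then have "2 * M' * 1 \<le> 2 * M' * ((\<kappa> + 2 * M') * mass (comb ?\<mu> x) + 1 / (2 * M') * mass (comb1 ?\<mu> x))"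
        using M'(1) by (intro mult_left_mono) simp_all
      also have "\<dots> = 2 * M' * (\<kappa> + 2 * M') * mass (comb ?\<mu> x) + mass (comb1 ?\<mu> x)" using M'(1) by (simp add: field_simps)
      also have "\<dots> \<le> y * mass (comb ?\<mu> x) + mass (comb1 ?\<mu> x)"
        using y by (intro add_right_mono mult_right_mono mass_comb_nonneg) simp
      also note x(2)
      finally have "M' \<le> norm (S ?\<mu> / C ?\<mu>)" by (simp only: mult_1_right mult_le_cancel_left_pos zero_less_numeral)
      with M'(2) show ?thesis by (rule order_trans)
    qed
    note le = this
    show ?thesis by (intro exI[of _ "max Y (2 * M' * (\<kappa> + 2 * M'))"] allI impI le)
  qed
  have sub: "\<exists>N. \<forall>y\<ge>N. norm (S (complex_of_real (- y)) / C (complex_of_real (- y))) \<le> d * \<bar>- y\<bar>" if d: "0 < d" for d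
  proof -
    define D where "D = real (card (ends_at G v))"
    have D0: "0 \<le> D" by (simp add: D_def)
    \<comment> \<open>The estimate to come is \<open>s \<le> D * \<eta> * (y + 4 * s) + K0\<close>.
      The bound 1/8 on \<open>D * \<eta>\<close> absorbs half of \<open>s\<close>, the bound
      \<open>d / 4\<close> leaves a quarter of \<open>d * y\<close>, and the threshold for
      \<open>y\<close> makes \<open>K0\<close> at most another quarter.\<close>
    define \<eta> where "\<eta> = min (1 / 8) (d / 4) / (D + 1)"
    have eta: "0 < \<eta>" using d D0 by (simp add: \<eta>_def)
    have "D * \<eta> \<le> (D + 1) * \<eta>" using eta by (intro mult_right_mono) auto
    also have "\<dots> = min (1 / 8) (d / 4)" using D0 by (simp add: \<eta>_def)
    finally have De: "D * \<eta> \<le> 1 / 8" "D * \<eta> \<le> d / 4" by simp_all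
    have De0: "0 \<le> D * \<eta>" using D0 eta by simp
    obtain K0 where K0: "0 \<le> K0" "\<forall>y\<ge>0. \<forall>x \<sigma>. (\<forall>e\<in>arcs G. \<forall>t\<in>{0..len e}. (norm (comb (complex_of_real (- y)) x e t))\<^sup>2 \<le> \<sigma>) \<longrightarrow>
     norm (flux (complex_of_real (- y)) x) \<le> D *
       (\<eta> * (y + y * mass (comb (complex_of_real (- y)) x) + mass (comb1 (complex_of_real (- y)) x) + \<sigma>)) + K0"
      using flux_bound[OF eta] unfolding D_def by blast
    have "norm (S (complex_of_real (- y)) / C (complex_of_real (- y))) \<le> d * \<bar>- y\<bar>"
      if y: "max Y (max (\<kappa> + 1) (4 * K0 / d)) \<le> y" for y
    proof -
      let ?\<mu> = "complex_of_real (- y)"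
      define s where "s = norm (S ?\<mu> / C ?\<mu>)"
      have y0: "0 < y" using y Y(1) by simp
      obtain x where x: "flux ?\<mu> x = S ?\<mu> / C ?\<mu>" "y * mass (comb ?\<mu> x) + mass (comb1 ?\<mu> x) \<le> 2 * s"
        using ex[of y] y unfolding s_def by auto
      \<comment> \<open>The trace bound with \<epsilon> = 1. As soon as
        \<open>\<kappa> + 1 \<le> y\<close>, it is dominated by the energy.\<close>
      define \<sigma> where "\<sigma> = (\<kappa> + 1 / 1) * mass (comb ?\<mu> x) + 1 * mass (comb1 ?\<mu> x)"
      have "(\<kappa> + 1) * mass (comb ?\<mu> x) \<le> y * mass (comb ?\<mu> x)" using y by (intro mult_right_mono mass_comb_nonneg) simp
      then have sg: "\<sigma> \<le> 2 * s" using x(2) by (simp add: \<sigma>_def)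
      have "\<forall>e\<in>arcs G. \<forall>t\<in>{0..len e}. (norm (comb ?\<mu> x e t))\<^sup>2 \<le> \<sigma>"
        unfolding \<sigma>_def by (intro ballI comb_mass_bound) simp_all
      then have "norm (flux ?\<mu> x) \<le> D * (\<eta> * (y + y * mass (comb ?\<mu> x) + mass (comb1 ?\<mu> x) + \<sigma>)) + K0"
        using K0(2) less_imp_le[OF y0] by blast
      then have "s \<le> (D * \<eta>) * (y + y * mass (comb ?\<mu> x) + mass (comb1 ?\<mu> x) + \<sigma>) + K0"
        unfolding x(1) s_def by (simp only: mult.assoc)
      also have "\<dots> \<le> (D * \<eta>) * (y + 4 * s) + K0"
        using sg x(2) by (intro add_right_mono mult_left_mono De0) linarith
      also have "\<dots> = (D * \<eta>) * y + 4 * ((D * \<eta>) * s) + K0" by (simp add: distrib_left)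
      finally have "s \<le> (D * \<eta>) * y + 4 * ((D * \<eta>) * s) + K0" .
      moreover have "(D * \<eta>) * y \<le> d / 4 * y" by (rule mult_right_mono[OF De(2)]) (use y0 in simp)
      moreover have "(D * \<eta>) * s \<le> 1 / 8 * s" by (rule mult_right_mono[OF De(1)]) (simp add: s_def)
      moreover have "4 * K0 / d \<le> y" using y by simp
      then have "4 * K0 \<le> d * y" using d by (simp add: pos_divide_le_eq mult.commute)
      ultimately have "s \<le> d * y" by simp
      then show ?thesis using y0 by (simp add: s_def)
    qed
    note le = this
    show ?thesis by (intro exI[of _ "max Y (max (\<kappa> + 1) (4 * K0 / d))"] allI impI le)
  qed
  have bot: "\<forall>\<^sub>F x in at_bot. P x" if ev: "\<exists>N. \<forall>y\<ge>N. P (- y)" for P :: "real \<Rightarrow> bool"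
  proof -
    obtain N where N: "\<forall>y\<ge>N. P (- y)" using ev by blast
    have "P x" if "x \<le> - N" for x using N[rule_format, of "- x"] that by simp
    then show ?thesis unfolding eventually_at_bot_linorder by blast
  qed
  show ?thesis unfolding spec
  proof (rule dispersion_relation_of_pair[OF hol])
    fix z :: complex
    show "0 < Im (S z * cnj (C z))" if z: "0 < Im z"
    proof -
      obtain a where "0 < a" "Im (S z * cnj (C z)) = Im z * a" using Im[of z] z by auto
      then show ?thesis using z by (simp only: mult_pos_pos)
    qed
    show "Im (S z * cnj (C z)) < 0" if z: "Im z < 0"
    proof -
      obtain a where "0 < a" "Im (S z * cnj (C z)) = Im z * a" using Im[of z] z by auto
      then show ?thesis using z by (simp only: mult_neg_pos)
    qed
  next
    show "\<forall>\<^sub>F x in at_bot. C (complex_of_real x) \<noteq> 0" by (rule bot) (use C in blast)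
    show "\<forall>\<^sub>F x in at_bot. M \<le> norm (S (complex_of_real x) / C (complex_of_real x))" for M by (rule bot[OF grow])
    show "\<forall>\<^sub>F x in at_bot. norm (S (complex_of_real x) / C (complex_of_real x)) \<le> d * \<bar>x\<bar>" if "0 < d" for d
      by (rule bot[OF sub[OF that]])
  qed
qed

end

theorem theorem6p1:
  fixes G :: "('v, 'e) pre_digraph" and len :: "'e \<Rightarrow> real" and V :: "'e \<Rightarrow> real \<Rightarrow> real"
    and inc :: "'v \<Rightarrow> ('e \<times> bool) list" and A B :: "'v \<Rightarrow> complex mat" and v :: 'v
  assumes "compact_metric_graph G len"
    and "v \<in> verts G" and "ends_at G v \<noteq> {}"
    and "\<And>e. e \<in> arcs G \<Longrightarrow> L2_on (len e) (V e)"
    and "\<And>w. w \<in> verts G - {v} \<Longrightarrow> selfadjoint_condition G w (inc w) (A w) (B w)"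
  shows "\<exists>(\<Delta> :: real set) (U :: complex set) (\<Lambda> :: mvfun).
      bdd_below \<Delta> \<and> (\<forall>x. \<not> x islimpt \<Delta>) \<and>
      sphere 0 1 \<subseteq> U \<and> mv_analytic_on U \<Lambda> \<and>
      (\<forall>z\<in>sphere 0 1. mv_values \<Lambda> z \<subseteq> \<real>) \<and>
      (\<forall>z\<in>sphere 0 1.
         op_spectrum G len (hamiltonian G len V inc A B v z) = mv_values \<Lambda> z \<union> complex_of_real ` \<Delta>) \<and>
      mv_irreducible_on U \<Lambda> \<and>
      (\<forall>a b \<phi>. circle_branch \<Lambda> a b \<phi> \<longrightarrow> strict_mono_on {a<..<b} (\<lambda>\<theta>. Re (\<phi> \<theta>)))"
proof -
  obtain p0 where "p0 \<in> ends_at G v" using assms(3) by blast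
  then interpret quantum_graph G len V inc A B v p0
    using assms(1,4,5) by unfold_locales
  show ?thesis by (rule dispersion_relation)
qed

end
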